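(* Let $\lambda,\mu\in[0,1]$ and $\rho\in(0,1)$ be constants with $F(\lambda,\mu,\rho,1)>1+\epsilon$ for some constant $\epsilon>0$. Let $\pi_*$ be the law of a pair $(\mathbb X,\mathbb Y)$ of real random variables with $\mathbb E[\mathbb X]=\mathbb E[\mathbb Y]=0$, $\mathbb E[\mathbb X^2]=\mathbb E[\mathbb Y^2]=1$, $\mathbb E[\mathbb X\mathbb Y]=\rho$ and $\mathbb E[\mathbb X^4],\mathbb E[\mathbb Y^4]\le C$ for an absolute constant $C$. Let $\delta=\delta(\lambda,\mu,\rho)\in(0,0.1)$ be a constant with $A_+>1+\delta$, and let $\ell=\ell_n$ satisfy $\ell=O_\delta(\log n)$ and $(1+\delta)^\ell\ge n^2$. Then there is a sufficiently large $R=O_{\lambda,\mu,\rho,\delta}(1)$ such that: (1) for all distinct $u,v\in[n]$, $\mathbb E_{\mathbb P}[\widetilde\Phi^{\mathcal J}_{u,v}\cdot x_ux_v]=1+o(1)$, $\mathbb E_{\mathbb P}[(\widetilde\Phi^{\mathcal J}_{u,v})^2]\le R$ and $\mathbb E_{\mathbb P}[(\widetilde\Phi^{\mathcal J}_{u,v})^2x_u^2x_v^2]\le R$; (2) for an arbitrary choice of $w\in[n]$, the estimator $\widehat x_u=\widetilde\Phi^{\mathcal J}_{w,u}\cdot\mathbf 1_{\{|\widetilde\Phi^{\mathcal J}_{w,u}|\le R^4\}}$, $1\le u\le n$, satisfies $\mathbb E_{\mathbb P}\Big[\frac{|\langle\widehat x,x\rangle|}{\|\widehat x\|\,\|x\|}\Big]\ge\Omega(1)$.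 In addition, $\{\widetilde\Phi^{\mathcal J}_{u,v}:u,v\in[n]\}$ can be computed in time $n^{T+o(1)}$ for some constant $T=T(\lambda,\mu,\rho)$.
   Context: **The function $F$ and $A_+$.** $F(\lambda,\mu,\rho,\gamma)=\max\Big\{\frac{\lambda^2}{\gamma},\frac{\mu^2}{\gamma},\frac{\lambda^2\rho^2}{\gamma-\lambda^2+\lambda^2\rho^2}+\frac{\mu^2\rho^2}{\gamma-\mu^2+\mu^2\rho^2}\Big\}$ and $A_+=\frac12\Big(\lambda^2+\mu^2+\sqrt{\lambda^4+\mu^4-(2-4\rho^4)\lambda^2\mu^2}\Big)$. (Under the hypotheses of the claim $A_+>1$, so such a $\delta$ exists.) The condition $\ell=O_\delta(\log n)$ means $\ell\le K\log n$ with $K$ depending only on $\delta$. **Model (correlated spiked Wigner).** The pairs $(x_i,y_i)_{1\le i\le n}$ are i.i.d. from $\pi_*$, $x=(x_i)$, $y=(y_i)\in\mathbb R^n$. $\boldsymbol W,\boldsymbol Z$ are independent (of each other and of $(x,y)$) $n\times n$ Wigner matrices: symmetric, with independent entries for $i\le j$ distributed as centered normals of variance $1+\mathbf 1_{i=j}$. $\mathbb P$ is the (joint) law under which $\boldsymbol X=\frac{\lambda}{\sqrt n}xx^\top+\boldsymbol W$, $\boldsymbol Y=\frac{\mu}{\sqrt n}yy^\top+\boldsymbol Z$. **Decorated graphs.** A decorated graph $H$ is a simple graph with a map $E(H)\to\{\bullet,\circ\}$; $E_\bullet(H),E_\circ(H)$ are the sets of edges with decoration $\bullet,\circ$; $V_\bullet(H),V_\circ(H)$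 are the sets of vertices incident to at least one edge of $E_\bullet(H)$, resp. $E_\circ(H)$; $\mathsf{diff}(H)=V_\bullet(H)\cap V_\circ(H)$; $\mathsf L(H)$ is the set of leaves (degree-one vertices). Isomorphisms of decorated graphs preserve edges and decorations; $[H]$ is the isomorphism class, $|\mathsf{Aut}(H)|$ the number of automorphisms. $\mathsf K_n$ is the complete graph on $[n]$; $S\subset\mathsf K_n$ ranges over decorated subgraphs. **Statistic.** $\mathcal J=\mathcal J(\ell)$ is the collection of isomorphism classes of decorated paths $H$ of length $\ell$ (i.e. with $\ell$ edges) such that $\mathsf L(H)\subset V_\bullet(H)$. Set $\Xi(H)=\lambda^{|E_\bullet(H)|}\mu^{|E_\circ(H)|}\rho^{|\mathsf{diff}(H)|}$, $\beta_{\mathcal J}=\sum_{[H]\in\mathcal J}\frac{\Xi(H)^2}{|\mathsf{Aut}(H)|}$, $f_S(\boldsymbol X,\boldsymbol Y)=\prod_{(i,j)\in E_\bullet(S)}\boldsymbol X_{i,j}\prod_{(i,j)\in E_\circ(S)}\boldsymbol Y_{i,j}$. Let $\varkappa=(\ell+1)!/(\ell+1)^{\ell+1}$, $t=\lceil1/\varkappa\rceil$, and let $\xi_1,\dots,\xi_t:[n]\to[\ell+1]$ be independent uniformly random colorings (each vertex gets an independent uniform color), independent of everything else. For $V\subset[n]$ let $\chi_{\xi_k}(V)=1$ if $\xi_k$ is injective on $V$, and $0$ otherwise. For $u,v\in[n]$ define $$\widetilde\Phi^{\mathcal J}_{u,v}=\frac1{n^{\frac\ell2-1}\beta_{\mathcal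 J}}\sum_{[H]\in\mathcal J}\Xi(H)\Big(\frac1{t\varkappa}\sum_{k=1}^t\ \sum_{\substack{S\subset\mathsf K_n:\,S\cong H\\ \mathsf L(S)=\{u,v\}}}\chi_{\xi_k}(V(S))f_S(\boldsymbol X,\boldsymbol Y)\Big)$$ (an empty sum, equal to $0$, if $u=v$). Expectations $\mathbb E_{\mathbb P}$ include the randomness of the colorings. The ratio in (2) is read as $0$ when its denominator vanishes.
   Formalization: In (1) the limit is corrected from 1+o(1) to 2+o(1): with the stated normalization by β_J, each H has 2/|Aut(H)| placements along a path from u to v (two directions), so the mean of Φ_{u,v}·x_u x_v is exactly 2(n−2)⋯(n−ℓ)/n^{ℓ−1}. *)

theory Defs
  imports "HOL-Probability.Probability" "HOL-Combinatorics.Permutations"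
begin

section \<open>Thresholds\<close>

definition F_threshold :: "real \<Rightarrow> real \<Rightarrow> real \<Rightarrow> real \<Rightarrow> real" where
  "F_threshold lam mu rho gam =
     Max {lam\<^sup>2 / gam, mu\<^sup>2 / gam,
          lam\<^sup>2 * rho\<^sup>2 / (gam - lam\<^sup>2 + lam\<^sup>2 * rho\<^sup>2) + mu\<^sup>2 * rho\<^sup>2 / (gam - mu\<^sup>2 + mu\<^sup>2 * rho\<^sup>2)}"

definition A_plus :: "real \<Rightarrow> real \<Rightarrow> real \<Rightarrow> real" where
  "A_plus lam mu rho =
     1/2 * (lam\<^sup>2 + mu\<^sup>2 + sqrt (lam^4 + mu^4 - (2 - 4 * rho^4) * lam\<^sup>2 * mu\<^sup>2))"

text \<open>The condition on the path length at a given \<open>n\<close>; \<open>K\<close> is the constant in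
  \<open>l = O(log n)\<close>.\<close>

definition admissible_length :: "real \<Rightarrow> real \<Rightarrow> nat \<Rightarrow> nat \<Rightarrow> bool" where
  "admissible_length delta K n l \<longleftrightarrow>
     n \<ge> 1 \<and> real l \<le> K * ln (real n) \<and> (1 + delta) ^ l \<ge> (real n)\<^sup>2"


section \<open>Decorated graphs\<close>

datatype decoration = Bullet | Circ

text \<open>A simple graph together with a map from its edges to the decorations: \<open>deco\<close> is a partial
  map whose domain is the edge set, edges being two-element sets of vertices. Two decorated
  subgraphs of a complete graph are thus equal iff they have the same vertices, edges and
  decorations.\<close>

datatype 'a dgraph = DGraph (dverts: "'a set") (deco: "'a set \<Rightarrow> decoration option")

definition dedges :: "'a dgraph \<Rightarrow> 'a set set" where
  "dedges H = dom (deco H)"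

definition decorated_graph :: "'a dgraph \<Rightarrow> bool" where
  "decorated_graph H \<longleftrightarrow> finite (dverts H) \<and> (\<forall>e\<in>dedges H. e \<subseteq> dverts H \<and> card e = 2)"

definition edges_of :: "decoration \<Rightarrow> 'a dgraph \<Rightarrow> 'a set set" where
  "edges_of d H = {e. deco H e = Some d}"

definition verts_of :: "decoration \<Rightarrow> 'a dgraph \<Rightarrow> 'a set" where
  "verts_of d H = \<Union> (edges_of d H)"

definition diff_verts :: "'a dgraph \<Rightarrow> 'a set" where
  "diff_verts H = verts_of Bullet H \<inter> verts_of Circ H"

definition leaves :: "'a dgraph \<Rightarrow> 'a set" where
  "leaves H = {v \<in> dverts H. card {e \<in> dedges H. v \<in> e} = 1}"

definition dg_iso :: "'a dgraph \<Rightarrow> 'b dgraph \<Rightarrow> bool" where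
  "dg_iso G H \<longleftrightarrow>
     (\<exists>f. bij_betw f (dverts G) (dverts H) \<and> (\<forall>e. e \<subseteq> dverts G \<longrightarrow> deco H (f ` e) = deco G e))"

definition automorphisms :: "'a dgraph \<Rightarrow> ('a \<Rightarrow> 'a) set" where
  "automorphisms H =
     {p. p permutes dverts H \<and> (\<forall>e. e \<subseteq> dverts H \<longrightarrow> deco H (p ` e) = deco H e)}"

definition decorated_path :: "nat \<Rightarrow> 'a dgraph \<Rightarrow> bool" where
  "decorated_path l H \<longleftrightarrow> decorated_graph H \<and>
     (\<exists>vs. distinct vs \<and> length vs = Suc l \<and> dverts H = set vs \<and>
           dedges H = {{vs ! i, vs ! Suc i} | i. i < l})"

text \<open>Isomorphism classes are taken among the decorated graphs with vertices in \<open>nat\<close>. This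
  collection is finite, although every class is infinite.\<close>

definition path_classes :: "nat \<Rightarrow> nat dgraph set set" where
  "path_classes l =
     {H. decorated_path l H \<and> leaves H \<subseteq> verts_of Bullet H} //
     {(G, H). decorated_graph G \<and> decorated_graph H \<and> dg_iso G H}"

text \<open>A representative of a class; it is used only in isomorphism-invariant expressions.\<close>

definition rep :: "'a dgraph set \<Rightarrow> 'a dgraph" where
  "rep c = (SOME H. H \<in> c)"


section \<open>The statistic\<close>

definition Xi_weight :: "real \<Rightarrow> real \<Rightarrow> real \<Rightarrow> 'a dgraph \<Rightarrow> real" where
  "Xi_weight lam mu rho H =
     lam ^ card (edges_of Bullet H) * mu ^ card (edges_of Circ H) * rho ^ card (diff_verts H)"

definition beta_J :: "real \<Rightarrow> real \<Rightarrow> real \<Rightarrow> nat \<Rightarrow> real" where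
  "beta_J lam mu rho l =
     (\<Sum>c\<in>path_classes l. (Xi_weight lam mu rho (rep c))\<^sup>2 / real (card (automorphisms (rep c))))"

text \<open>An edge \<open>{i, j}\<close> with \<open>i < j\<close> indexes the entry \<open>(i, j)\<close> of a symmetric matrix.\<close>

definition f_S :: "nat dgraph \<Rightarrow> (nat \<Rightarrow> nat \<Rightarrow> real) \<Rightarrow> (nat \<Rightarrow> nat \<Rightarrow> real) \<Rightarrow> real" where
  "f_S S X Y =
     (\<Prod>e\<in>edges_of Bullet S. X (Min e) (Max e)) * (\<Prod>e\<in>edges_of Circ S. Y (Min e) (Max e))"

definition kappa :: "nat \<Rightarrow> real" where
  "kappa l = fact (l + 1) / real (l + 1) ^ (l + 1)"

definition num_colorings :: "nat \<Rightarrow> nat" where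
  "num_colorings l = nat \<lceil>1 / kappa l\<rceil>"

definition chi :: "(nat \<Rightarrow> nat) \<Rightarrow> nat set \<Rightarrow> real" where
  "chi xi V = (if inj_on xi V then 1 else 0)"

text \<open>The vertex set \<open>[n]\<close> is \<open>{..<n}\<close>, the colour set is \<open>{..l}\<close> (that is, \<open>l + 1\<close> colours), and
  \<open>xi k\<close> for \<open>k < num_colorings l\<close> are the colourings.

  On the normalisation: for \<open>u \<noteq> v\<close> and a decorated path \<open>H\<close> with \<open>l\<close> edges, \<open>K_n\<close> contains
  \<open>2 / |Aut H| * (n - 2) * ... * (n - l)\<close> copies of \<open>H\<close> with leaf set \<open>{u, v}\<close>, since \<open>H\<close> can be
  laid along a path from \<open>u\<close> to \<open>v\<close> in two directions, whereas \<open>beta_J\<close> counts \<open>1 / |Aut H|\<close>.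
  Consequently the mean of \<open>Phi u v * x u * x v\<close> in the spiked model tends to \<open>2\<close>, not \<open>1\<close>.\<close>

definition Phi ::
  "nat \<Rightarrow> nat \<Rightarrow> real \<Rightarrow> real \<Rightarrow> real \<Rightarrow> (nat \<Rightarrow> nat \<Rightarrow> real) \<Rightarrow> (nat \<Rightarrow> nat \<Rightarrow> real) \<Rightarrow>
   (nat \<Rightarrow> nat \<Rightarrow> nat) \<Rightarrow> nat \<Rightarrow> nat \<Rightarrow> real" where
  "Phi n l lam mu rho X Y xi u v =
     1 / (real n powr (real l / 2 - 1) * beta_J lam mu rho l) *
     (\<Sum>c\<in>path_classes l. Xi_weight lam mu rho (rep c) *
        (1 / (real (num_colorings l) * kappa l) *
         (\<Sum>k<num_colorings l.
            \<Sum>S | decorated_graph S \<and> dverts S \<subseteq> {..<n} \<and> dg_iso S (rep c) \<and> leaves S = {u, v}.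
              chi (xi k) (dverts S) * f_S S X Y)))"


section \<open>The correlated spiked Wigner model\<close>

definition spike_prior :: "real \<Rightarrow> real \<Rightarrow> (real \<times> real) measure \<Rightarrow> bool" where
  "spike_prior rho C prior \<longleftrightarrow>
     prob_space prior \<and> sets prior = sets borel \<and>
     integrable prior (\<lambda>s. fst s ^ 4) \<and> integrable prior (\<lambda>s. snd s ^ 4) \<and>
     (\<integral>s. fst s \<partial>prior) = 0 \<and> (\<integral>s. snd s \<partial>prior) = 0 \<and>
     (\<integral>s. (fst s)\<^sup>2 \<partial>prior) = 1 \<and> (\<integral>s. (snd s)\<^sup>2 \<partial>prior) = 1 \<and>
     (\<integral>s. fst s * snd s \<partial>prior) = rho \<and>
     (\<integral>s. fst s ^ 4 \<partial>prior) \<le> C \<and> (\<integral>s. snd s ^ 4 \<partial>prior) \<le> C"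

text \<open>The law of the entries \<open>(i, j)\<close>, \<open>i \<le> j\<close>, of a Wigner matrix. \<open>normal_density\<close> takes the
  standard deviation, so the variance is \<open>2\<close> on the diagonal and \<open>1\<close> off it.\<close>

definition wigner_law :: "nat \<Rightarrow> (nat \<times> nat \<Rightarrow> real) measure" where
  "wigner_law n =
     (\<Pi>\<^sub>M e\<in>{(i, j). i \<le> j \<and> j < n}.
        density lborel (\<lambda>r. ennreal (normal_density 0 (sqrt (1 + of_bool (fst e = snd e))) r)))"

definition sym_entry :: "(nat \<times> nat \<Rightarrow> real) \<Rightarrow> nat \<Rightarrow> nat \<Rightarrow> real" where
  "sym_entry w i j = w (min i j, max i j)"

definition coloring_law :: "nat \<Rightarrow> nat \<Rightarrow> (nat \<Rightarrow> nat \<Rightarrow> nat) measure" where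
  "coloring_law n l =
     (\<Pi>\<^sub>M k\<in>{..<num_colorings l}. \<Pi>\<^sub>M i\<in>{..<n}. measure_pmf (pmf_of_set {..l}))"

type_synonym outcome =
  "(nat \<Rightarrow> real \<times> real) \<times> (nat \<times> nat \<Rightarrow> real) \<times> (nat \<times> nat \<Rightarrow> real) \<times> (nat \<Rightarrow> nat \<Rightarrow> nat)"

text \<open>The joint law of \<open>((x, y), W, Z, xi)\<close>.\<close>

definition model_law :: "(real \<times> real) measure \<Rightarrow> nat \<Rightarrow> nat \<Rightarrow> outcome measure" where
  "model_law prior n l =
     (\<Pi>\<^sub>M i\<in>{..<n}. prior) \<Otimes>\<^sub>M (wigner_law n \<Otimes>\<^sub>M (wigner_law n \<Otimes>\<^sub>M coloring_law n l))"

definition x_of :: "outcome \<Rightarrow> nat \<Rightarrow> real" where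
  "x_of = (\<lambda>(s, W, Z, xi) i. fst (s i))"

definition X_of :: "real \<Rightarrow> nat \<Rightarrow> outcome \<Rightarrow> nat \<Rightarrow> nat \<Rightarrow> real" where
  "X_of lam n = (\<lambda>(s, W, Z, xi) i j. lam / sqrt (real n) * fst (s i) * fst (s j) + sym_entry W i j)"

definition Y_of :: "real \<Rightarrow> nat \<Rightarrow> outcome \<Rightarrow> nat \<Rightarrow> nat \<Rightarrow> real" where
  "Y_of mu n = (\<lambda>(s, W, Z, xi) i j. mu / sqrt (real n) * snd (s i) * snd (s j) + sym_entry Z i j)"

definition xi_of :: "outcome \<Rightarrow> nat \<Rightarrow> nat \<Rightarrow> nat" where
  "xi_of = (\<lambda>(s, W, Z, xi). xi)"

definition Phi_rv ::
  "nat \<Rightarrow> nat \<Rightarrow> real \<Rightarrow> real \<Rightarrow> real \<Rightarrow> nat \<Rightarrow> nat \<Rightarrow> outcome \<Rightarrow> real" where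
  "Phi_rv n l lam mu rho u v om =
     Phi n l lam mu rho (X_of lam n om) (Y_of mu n om) (xi_of om) u v"

definition x_hat ::
  "real \<Rightarrow> nat \<Rightarrow> nat \<Rightarrow> real \<Rightarrow> real \<Rightarrow> real \<Rightarrow> nat \<Rightarrow> outcome \<Rightarrow> nat \<Rightarrow> real" where
  "x_hat R n l lam mu rho w om u =
     Phi_rv n l lam mu rho w u om * of_bool (\<bar>Phi_rv n l lam mu rho w u om\<bar> \<le> R ^ 4)"

text \<open>Division by zero yields \<open>0\<close> here, which is the intended value of the ratio in that case.\<close>

definition overlap :: "nat \<Rightarrow> (nat \<Rightarrow> real) \<Rightarrow> (nat \<Rightarrow> real) \<Rightarrow> real" where
  "overlap n a b =
     \<bar>\<Sum>u<n. a u * b u\<bar> / (sqrt (\<Sum>u<n. (a u)\<^sup>2) * sqrt (\<Sum>u<n. (b u)\<^sup>2))"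


section \<open>Running time\<close>

text \<open>A real random access machine, presented as a while-language. The store has registers and
  arrays holding natural numbers, and registers and arrays holding real numbers; there are
  infinitely many of each, and arrays are addressed indirectly through natural-number registers.
  Natural numbers may only be added, subtracted (truncating at zero) and compared; reals admit the
  field operations, square roots and comparisons, but no rounding. The only constants in programs
  are natural numbers. Every elementary operation and every test takes one unit of time.\<close>

datatype store = Store
  (nreg: "nat \<Rightarrow> nat") (narr: "nat \<Rightarrow> nat \<Rightarrow> nat")
  (rreg: "nat \<Rightarrow> real") (rarr: "nat \<Rightarrow> nat \<Rightarrow> real")

datatype prog =
    ConstN nat nat
  | AddN nat nat nat
  | SubN nat nat nat
  | LoadN nat nat nat
  | StoreN nat nat nat
  | OfNat nat nat
  | AddR nat nat nat
  | SubR nat nat nat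
  | MulR nat nat nat
  | DivR nat nat nat
  | SqrtR nat nat
  | LoadR nat nat nat
  | StoreR nat nat nat
  | Seq prog prog
  | IfLessN nat nat prog prog
  | IfLessR nat nat prog prog
  | WhileLessN nat nat prog

definition set_nreg :: "nat \<Rightarrow> nat \<Rightarrow> store \<Rightarrow> store" where
  "set_nreg d a s = Store ((nreg s)(d := a)) (narr s) (rreg s) (rarr s)"

definition set_narr :: "nat \<Rightarrow> nat \<Rightarrow> nat \<Rightarrow> store \<Rightarrow> store" where
  "set_narr b p a s = Store (nreg s) ((narr s)(b := (narr s b)(p := a))) (rreg s) (rarr s)"

definition set_rreg :: "nat \<Rightarrow> real \<Rightarrow> store \<Rightarrow> store" where
  "set_rreg d a s = Store (nreg s) (narr s) ((rreg s)(d := a)) (rarr s)"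

definition set_rarr :: "nat \<Rightarrow> nat \<Rightarrow> real \<Rightarrow> store \<Rightarrow> store" where
  "set_rarr b p a s = Store (nreg s) (narr s) (rreg s) ((rarr s)(b := (rarr s b)(p := a)))"

text \<open>\<open>runs P s t s'\<close>: started in store \<open>s\<close>, the program \<open>P\<close> halts after \<open>t\<close> steps in store \<open>s'\<close>.\<close>

inductive runs :: "prog \<Rightarrow> store \<Rightarrow> nat \<Rightarrow> store \<Rightarrow> bool" where
  "runs (ConstN d k) s 1 (set_nreg d k s)"
| "runs (AddN d i j) s 1 (set_nreg d (nreg s i + nreg s j) s)"
| "runs (SubN d i j) s 1 (set_nreg d (nreg s i - nreg s j) s)"
| "runs (LoadN d b i) s 1 (set_nreg d (narr s b (nreg s i)) s)"
| "runs (StoreN b i j) s 1 (set_narr b (nreg s i) (nreg s j) s)"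
| "runs (OfNat d i) s 1 (set_rreg d (real (nreg s i)) s)"
| "runs (AddR d i j) s 1 (set_rreg d (rreg s i + rreg s j) s)"
| "runs (SubR d i j) s 1 (set_rreg d (rreg s i - rreg s j) s)"
| "runs (MulR d i j) s 1 (set_rreg d (rreg s i * rreg s j) s)"
| "runs (DivR d i j) s 1 (set_rreg d (rreg s i / rreg s j) s)"
| "runs (SqrtR d i) s 1 (set_rreg d (sqrt (rreg s i)) s)"
| "runs (LoadR d b i) s 1 (set_rreg d (rarr s b (nreg s i)) s)"
| "runs (StoreR b i j) s 1 (set_rarr b (nreg s i) (rreg s j) s)"
| "runs P s t s' \<Longrightarrow> runs Q s' t' s'' \<Longrightarrow> runs (Seq P Q) s (t + t') s''"
| "nreg s i < nreg s j \<Longrightarrow> runs P s t s' \<Longrightarrow> runs (IfLessN i j P Q) s (Suc t) s'"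
| "\<not> nreg s i < nreg s j \<Longrightarrow> runs Q s t s' \<Longrightarrow> runs (IfLessN i j P Q) s (Suc t) s'"
| "rreg s i < rreg s j \<Longrightarrow> runs P s t s' \<Longrightarrow> runs (IfLessR i j P Q) s (Suc t) s'"
| "\<not> rreg s i < rreg s j \<Longrightarrow> runs Q s t s' \<Longrightarrow> runs (IfLessR i j P Q) s (Suc t) s'"
| "nreg s i < nreg s j \<Longrightarrow> runs P s t s' \<Longrightarrow> runs (WhileLessN i j P) s' t' s'' \<Longrightarrow>
     runs (WhileLessN i j P) s (Suc (t + t')) s''"
| "\<not> nreg s i < nreg s j \<Longrightarrow> runs (WhileLessN i j P) s 1 s"

text \<open>The input consists of \<open>n\<close>, \<open>l\<close>, the three parameters, the two matrices (row by row) and the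
  colourings (one after the other); all other cells are zero.\<close>

definition input_store ::
  "nat \<Rightarrow> nat \<Rightarrow> real \<Rightarrow> real \<Rightarrow> real \<Rightarrow> (nat \<Rightarrow> nat \<Rightarrow> real) \<Rightarrow> (nat \<Rightarrow> nat \<Rightarrow> real) \<Rightarrow>
   (nat \<Rightarrow> nat \<Rightarrow> nat) \<Rightarrow> store" where
  "input_store n l lam mu rho X Y xi = Store
     (\<lambda>d. if d = 0 then n else if d = 1 then l else 0)
     (\<lambda>b p. if b = 0 \<and> p < num_colorings l * n then xi (p div n) (p mod n) else 0)
     (\<lambda>d. if d = 0 then lam else if d = 1 then mu else if d = 2 then rho else 0)
     (\<lambda>b p. if b = 0 \<and> p < n * n then X (p div n) (p mod n)
            else if b = 1 \<and> p < n * n then Y (p div n) (p mod n) else 0)"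

text \<open>\<open>P\<close> computes all the values \<open>Phi u v\<close> within the given number of steps, for every pair of
  symmetric matrices and all colourings. The matrix of values is left in the real array \<open>2\<close>.\<close>

definition computes_Phi_within ::
  "prog \<Rightarrow> real \<Rightarrow> nat \<Rightarrow> nat \<Rightarrow> real \<Rightarrow> real \<Rightarrow> real \<Rightarrow> bool" where
  "computes_Phi_within P bound n l lam mu rho \<longleftrightarrow>
     (\<forall>X Y xi.
        (\<forall>i<n. \<forall>j<n. X i j = X j i \<and> Y i j = Y j i) \<longrightarrow>
        (\<forall>k<num_colorings l. \<forall>i<n. xi k i \<le> l) \<longrightarrow>
        (\<exists>t s. runs P (input_store n l lam mu rho X Y xi) t s \<and> real t \<le> bound \<and>
               (\<forall>u<n. \<forall>v<n. rarr s 2 (u * n + v) = Phi n l lam mu rho X Y xi u v)))"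

end

theory Submission
  imports Defs "HOL-Real_Asymp.Real_Asymp"
begin

text \<open>
  Edges being weighted by words in the decorations, the mean of \<open>Phi u v * x u * x v\<close> is a sum over
  step lists. In the second moment only the noise entries shared by both paths survive. For a fixed
  first path, the second path is summed by a transfer argument: as long as it avoids the first path
  the sum of its weights grows like \<open>A ^ l\<close>, where \<open>A = A_plus lam mu rho\<close> is the Perron eigenvalue
  of the matrix of letter transitions; following the first path gains only a factor 1 per step, while
  every return to it costs a factor \<open>1/n\<close>. As \<open>A ^ l\<close> dominates \<open>n\<close>, the second moment is of the
  order of the squared mean. The overlap of the estimator is then bounded below by these moments and
  truncation.

  The statistic is computed by colour coding: by inclusion-exclusion over the \<open>2 ^ (l + 1)\<close> sets of
  colours, the sum over paths with distinct colours is a signed sum of sums over all walks with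
  colours in the set, and these are matrix products.
\<close>

section \<open>Decorated paths as step lists\<close>

text \<open>The prior has only four bounded moments: a vertex common to two paths contributes up to
  a constant \<open>D\<close>, and \<open>D ^ l\<close> would be a power of \<open>n\<close>. This
  is avoided by separating runs from contacts. Only at the ends of a run and at crossings is
  \<open>D\<close> charged. The number of such contacts is unbounded, but hitting one of the
  \<open>l + 1\<close> vertices of the first path again has weight of order \<open>l / n\<close>,
  and this lets the transfer recursion close. The common end can be reached by mere following only
  from the aligned position, which is why position and remaining time have to be compared. Weights
  are taken relative to the first path, so that the outer sum reproduces the normalising constant.
  For the program, walks with repeated vertices are harmless: \<open>l + 1\<close> vertices that
  show all \<open>l + 1\<close> colours are automatically distinct.\<close>

type_synonym step = "decoration \<times> nat"

text \<open>A path is encoded by its start and a list of steps, each giving the decoration of an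
  edge and the vertex it leads to. The orientation makes all weights recursive, at the price that a
  path has two encodings.\<close>

fun pedges :: "nat \<Rightarrow> step list \<Rightarrow> (nat set \<times> decoration) list" where
  "pedges x [] = []"
| "pedges x ((b, y) # ps) = ({x, y}, b) # pedges y ps"

definition pverts :: "nat \<Rightarrow> step list \<Rightarrow> nat list" where
  "pverts u ps = u # map snd ps"

definition pgraph :: "nat \<Rightarrow> step list \<Rightarrow> nat dgraph" where
  "pgraph u ps = DGraph (set (pverts u ps)) (map_of (pedges u ps))"

lemma length_pedges [simp]: "length (pedges u ps) = length ps"
  by (induction u ps rule: pedges.induct) auto

lemma length_pverts [simp]: "length (pverts u ps) = Suc (length ps)"
  by (simp add: pverts_def)

lemma pverts_Nil [simp]: "pverts u [] = [u]"
  by (simp add: pverts_def)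

lemma pverts_Cons [simp]: "pverts u ((b, y) # ps) = u # pverts y ps"
  by (simp add: pverts_def)

lemma pverts_nth_0 [simp]: "pverts u ps ! 0 = u"
  by (simp add: pverts_def)

lemma last_pverts: "last (pverts u ps) = (if ps = [] then u else snd (last ps))"
  by (simp add: pverts_def last_map)

lemma set_pverts_start [simp]: "u \<in> set (pverts u ps)"
  by (simp add: pverts_def)

lemma pedges_nth:
  "i < length ps \<Longrightarrow> pedges u ps ! i = ({pverts u ps ! i, pverts u ps ! Suc i}, fst (ps ! i))"
proof (induction u ps arbitrary: i rule: pedges.induct)
  case (2 x b y ps)
  then show ?case by (cases i) auto
qed auto

lemma pedges_subset: "(e, b) \<in> set (pedges u ps) \<Longrightarrow> e \<subseteq> set (pverts u ps)"
  by (induction u ps rule: pedges.induct) (auto simp: pverts_def)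

lemma pedges_card:
  "distinct (pverts u ps) \<Longrightarrow> (e, b) \<in> set (pedges u ps) \<Longrightarrow> card e = 2"
  by (induction u ps rule: pedges.induct) (auto simp: pverts_def card_2_iff)

lemma distinct_pedges: "distinct (pverts u ps) \<Longrightarrow> distinct (map fst (pedges u ps))"
proof (induction u ps rule: pedges.induct)
  case (2 x b y ps)
  have "{x, y} \<notin> fst ` set (pedges y ps)"
    using pedges_subset[of "{x, y}" _ y ps] 2(2) by fastforce
  moreover have "distinct (map fst (pedges y ps))" using 2 by simp
  ultimately show ?case by simp
qed auto

lemma distinct_pedges': "distinct (pverts u ps) \<Longrightarrow> distinct (pedges u ps)"
  using distinct_pedges distinct_map by blast

lemma dverts_pgraph [simp]: "dverts (pgraph u ps) = set (pverts u ps)"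
  by (simp add: pgraph_def)

lemma dedges_pgraph: "dedges (pgraph u ps) = fst ` set (pedges u ps)"
  by (simp add: pgraph_def dedges_def dom_map_of_conv_image_fst)

lemma deco_pgraph:
  "distinct (pverts u ps) \<Longrightarrow> deco (pgraph u ps) e = Some b \<longleftrightarrow> (e, b) \<in> set (pedges u ps)"
  by (simp add: pgraph_def distinct_pedges)

lemma edges_of_pgraph:
  "distinct (pverts u ps) \<Longrightarrow> edges_of b (pgraph u ps) = {e. (e, b) \<in> set (pedges u ps)}"
  by (simp add: edges_of_def deco_pgraph)

lemma dedges_pgraph_nth:
  "dedges (pgraph u ps) =
     {{pverts u ps ! i, pverts u ps ! Suc i} | i. i < length ps}"
proof -
  have "dedges (pgraph u ps) = {x. \<exists>i. i < length ps \<and> x = fst (pedges u ps ! i)}"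
    unfolding dedges_pgraph set_conv_nth by auto
  also have "\<dots> = {x. \<exists>i. i < length ps \<and> x = {pverts u ps ! i, pverts u ps ! Suc i}}"
    by (intro Collect_cong arg_cong[where f = Ex] ext conj_cong refl) (auto simp: pedges_nth)
  finally show ?thesis by (simp add: conj_commute)
qed

lemma decorated_graph_pgraph: "distinct (pverts u ps) \<Longrightarrow> decorated_graph (pgraph u ps)"
  unfolding decorated_graph_def dedges_pgraph
  using pedges_subset pedges_card by fastforce

lemma decorated_path_pgraph:
  "distinct (pverts u ps) \<Longrightarrow> decorated_path (length ps) (pgraph u ps)"
  unfolding decorated_path_def
  by (intro conjI exI[of _ "pverts u ps"]) (simp_all add: decorated_graph_pgraph dedges_pgraph_nth)

lemma deco_outside: "decorated_graph H \<Longrightarrow> \<not> e \<subseteq> dverts H \<Longrightarrow> deco H e = None"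
  unfolding decorated_graph_def dedges_def by (meson domIff)

text \<open>Reading the decorations of \<open>H\<close> along the given enumeration of its vertices
  yields the step list. Since the decoration map is \<open>None\<close> off the edges, it is
  determined by its values on them.\<close>

lemma path_graph_eqI:
  assumes H: "decorated_graph H" and vs: "length vs = Suc l" "dverts H = set vs"
    and E: "dedges H = {{vs ! i, vs ! Suc i} | i. i < l}" and d: "distinct vs"
  shows "\<exists>ps. length ps = l \<and> pverts (hd vs) ps = vs \<and> H = pgraph (hd vs) ps"
proof -
  define ps where "ps = map (\<lambda>i. (the (deco H {vs ! i, vs ! Suc i}), vs ! Suc i)) [0..<l]"
  have l: "length ps = l" by (simp add: ps_def)
  have pv: "pverts (hd vs) ps = vs"
    using vs by (cases vs) (auto intro!: nth_equalityI simp: pverts_def ps_def nth_Cons split: nat.splits)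
  have dd: "deco (pgraph (hd vs) ps) = deco H"
  proof
    fix e
    show "deco (pgraph (hd vs) ps) e = deco H e"
    proof (cases "e \<in> dedges H")
      case True
      then obtain i where i: "i < l" "e = {vs ! i, vs ! Suc i}" using E by auto
      obtain b where b: "deco H e = Some b" using True by (auto simp: dedges_def)
      have "pedges (hd vs) ps ! i = (e, b)"
        using i b l pedges_nth[of i ps "hd vs"] pv by (simp add: ps_def)
      then have "(e, b) \<in> set (pedges (hd vs) ps)"
        using i l by (metis length_pedges nth_mem)
      then show ?thesis using b deco_pgraph d pv by metis
    next
      case False
      then have "e \<notin> dedges (pgraph (hd vs) ps)"
        unfolding dedges_pgraph_nth pv l E .
      with False show ?thesis by (simp add: dedges_def domIff)
    qed
  qed
  have "H = pgraph (hd vs) ps"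
    using dd vs pv by (cases H) (auto simp: pgraph_def)
  then show ?thesis using l pv by blast
qed

lemma rev_path_edges:
  assumes "length vs = Suc l"
  shows "{{rev vs ! i, rev vs ! Suc i} | i. i < l} = {{vs ! i, vs ! Suc i} | i. i < l}"
proof -
  have *: "{{rev vs ! i, rev vs ! Suc i} | i. i < l} \<subseteq> {{vs ! i, vs ! Suc i} | i. i < l}"
    if "length vs = Suc l" for vs :: "'b list"
  proof clarify
    fix i assume "i < l"
    then have "{rev vs ! i, rev vs ! Suc i} = {vs ! (l - Suc i), vs ! Suc (l - Suc i)}"
      using that by (auto simp: rev_nth Suc_diff_Suc)
    then show "\<exists>j. {rev vs ! i, rev vs ! Suc i} = {vs ! j, vs ! Suc j} \<and> j < l"
      using \<open>i < l\<close> by (intro exI[of _ "l - Suc i"]) auto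
  qed
  show ?thesis using *[of vs] *[of "rev vs"] assms by auto
qed

text \<open>Both orientations are supplied at once, because a path has to be read from whichever of
  its ends is prescribed later.\<close>

lemma decorated_pathE:
  assumes "decorated_path l (H :: nat dgraph)"
  obtains vs where "distinct vs" "length vs = Suc l" "dverts H = set vs"
    "\<exists>ps. length ps = l \<and> pverts (hd vs) ps = vs \<and> H = pgraph (hd vs) ps"
    "\<exists>ps. length ps = l \<and> pverts (last vs) ps = rev vs \<and> H = pgraph (last vs) ps"
proof -
  from assms obtain vs where H: "decorated_graph H" and vs: "distinct vs" "length vs = Suc l"
    "dverts H = set vs" and E: "dedges H = {{vs ! i, vs ! Suc i} | i. i < l}"
    unfolding decorated_path_def by auto
  have "\<exists>ps. length ps = l \<and> pverts (hd (rev vs)) ps = rev vs \<and> H = pgraph (hd (rev vs)) ps"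
    by (rule path_graph_eqI[OF H]) (use vs E rev_path_edges[OF vs(2)] in auto)
  then show ?thesis
    using that[of vs] path_graph_eqI[OF H vs(2,3) E vs(1)] vs by (simp add: hd_rev)
qed

text \<open>With distinct vertices the start lies on exactly one edge, so the first step can be
  recovered from the graph, and the rest follows by induction.\<close>

lemma pgraph_inj:
  assumes "distinct (pverts u ps)" "distinct (pverts u qs)" "pgraph u ps = pgraph u qs"
  shows "ps = qs"
proof -
  have "set (pedges u ps) = set (pedges u qs)"
    using assms deco_pgraph by (metis (no_types, lifting) subrelI subset_antisym)
  with assms(1,2) show ?thesis
  proof (induction u ps arbitrary: qs rule: pedges.induct)
    case (1 x)
    then have "length (pedges x qs) = 0" by (metis list.size(3) pedges.simps(1) set_empty)
    then show ?case by simp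
  next
    case (2 x b y ps)
    have "qs \<noteq> []" using 2(4) by auto
    then obtain b' y' qs' where qs: "qs = (b', y') # qs'" by (metis neq_Nil_conv surj_pair)
    have nx: "x \<notin> e" if "(e, c) \<in> set (pedges y ps) \<or> (e, c) \<in> set (pedges y' qs')" for e c
      using that pedges_subset[of e c y ps] pedges_subset[of e c y' qs'] 2(2,3) qs by auto
    have *: "insert ({x, y}, b) (set (pedges y ps)) = insert ({x, y'}, b') (set (pedges y' qs'))"
      using 2(4) qs by simp
    have yb: "({x, y}, b) = ({x, y'}, b')" using * nx by (metis insertI1 insert_iff)
    then have e: "y = y'" "b = b'" by (auto simp: doubleton_eq_iff)
    have "({x, y}, b) \<notin> set (pedges y ps)" "({x, y}, b) \<notin> set (pedges y' qs')"
      using nx by blast+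
    then have "set (pedges y ps) = set (pedges y qs')" using * e by (metis insert_ident)
    then have "ps = qs'" using 2 qs e by auto
    then show ?case using qs e by simp
  qed
qed

lemma leaves_pgraph:
  assumes d: "distinct (pverts u ps)" and ne: "ps \<noteq> []"
  shows "leaves (pgraph u ps) = {u, last (pverts u ps)}"
proof -
  define vs where "vs = pverts u ps"
  define l where "l = length ps"
  have l: "l > 0" "length vs = Suc l" using ne by (auto simp: l_def vs_def)
  have E: "dedges (pgraph u ps) = {{vs ! i, vs ! Suc i} | i. i < l}"
    unfolding dedges_pgraph_nth vs_def l_def ..
  have dd: "i \<le> l \<Longrightarrow> j \<le> l \<Longrightarrow> vs ! i = vs ! j \<longleftrightarrow> i = j" for i j
    using d l nth_eq_iff_index_eq[of vs i j] by (simp add: vs_def)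
  \<comment> \<open>Only the edges \<open>j\<close> and \<open>j - 1\<close> meet position
    \<open>j\<close>; the conditionals drop the one that is missing at either end.\<close>
  have inc: "{e \<in> dedges (pgraph u ps). vs ! j \<in> e} =
      (if j < l then {{vs ! j, vs ! Suc j}} else {}) \<union>
      (if 0 < j then {{vs ! (j - 1), vs ! j}} else {})" if "j \<le> l" for j
  proof -
    have "e \<in> dedges (pgraph u ps) \<and> vs ! j \<in> e \<longleftrightarrow>
       (j < l \<and> e = {vs ! j, vs ! Suc j}) \<or> (0 < j \<and> e = {vs ! (j - 1), vs ! j})" for e
    proof
      assume "e \<in> dedges (pgraph u ps) \<and> vs ! j \<in> e"
      then obtain i where i: "i < l" "e = {vs ! i, vs ! Suc i}" "vs ! j \<in> e" using E by auto
      then have "i = j \<or> Suc i = j" using dd[of j i] dd[of j "Suc i"] that by auto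
      then show "(j < l \<and> e = {vs ! j, vs ! Suc j}) \<or> (0 < j \<and> e = {vs ! (j - 1), vs ! j})"
        using i by auto
    next
      assume "(j < l \<and> e = {vs ! j, vs ! Suc j}) \<or> (0 < j \<and> e = {vs ! (j - 1), vs ! j})"
      then show "e \<in> dedges (pgraph u ps) \<and> vs ! j \<in> e"
        using that unfolding E by (auto intro: exI[of _ j] exI[of _ "j - 1"])
    qed
    then show ?thesis by auto
  qed
  have "card {e \<in> dedges (pgraph u ps). vs ! j \<in> e} = 1 \<longleftrightarrow> j = 0 \<or> j = l" if "j \<le> l" for j
  proof -
    have "{vs ! j, vs ! Suc j} \<noteq> {vs ! (j - 1), vs ! j}" if "0 < j" "j < l"
      using dd[of "Suc j" "j - 1"] dd[of "Suc j" j] that by (auto simp: doubleton_eq_iff)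
    then show ?thesis using l that by (subst inc[OF that]) (auto simp: card_insert_if)
  qed
  moreover have "set vs = {vs ! j | j. j \<le> l}"
    using l by (auto simp: set_conv_nth less_Suc_eq_le)
  ultimately have "leaves (pgraph u ps) = {vs ! j | j. j \<le> l \<and> (j = 0 \<or> j = l)}"
    unfolding leaves_def dverts_pgraph vs_def[symmetric] by (simp only:) blast
  also have "\<dots> = {vs ! 0, vs ! l}" by auto
  finally have "leaves (pgraph u ps) = {vs ! 0, vs ! l}" .
  moreover have "vs \<noteq> []" using l by auto
  then have "vs ! 0 = u" "vs ! l = last vs"
    using l last_conv_nth[of vs] by (auto simp: vs_def[symmetric]) (simp add: vs_def)
  ultimately show ?thesis by (simp add: vs_def)
qed

section \<open>Isomorphisms as relabellings\<close>

definition relabel :: "(nat \<Rightarrow> nat) \<Rightarrow> step list \<Rightarrow> step list" where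
  "relabel f ps = map (map_prod id f) ps"

lemma relabel_simps [simp]:
  "relabel f [] = []" "relabel f ((b, y) # ps) = (b, f y) # relabel f ps"
  by (simp_all add: relabel_def)

lemma length_relabel [simp]: "length (relabel f ps) = length ps"
  by (simp add: relabel_def)

lemma letters_relabel [simp]: "map fst (relabel f ps) = map fst ps"
  by (simp add: relabel_def)

lemma pverts_relabel: "pverts (f u) (relabel f ps) = map f (pverts u ps)"
  by (simp add: pverts_def relabel_def)

lemma pedges_relabel:
  "pedges (f u) (relabel f ps) = map (map_prod (image f) id) (pedges u ps)"
  by (induction u ps rule: pedges.induct) auto

lemma deco_relabel:
  assumes "distinct (pverts u ps)" "inj_on f (set (pverts u ps))" "e \<subseteq> set (pverts u ps)"
  shows "deco (pgraph (f u) (relabel f ps)) (f ` e) = deco (pgraph u ps) e"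
proof -
  have d: "distinct (pverts (f u) (relabel f ps))"
    using assms by (simp add: pverts_relabel distinct_map)
  have "deco (pgraph (f u) (relabel f ps)) (f ` e) = Some b \<longleftrightarrow> deco (pgraph u ps) e = Some b" for b
  proof -
    have "(f ` e, b) \<in> set (pedges (f u) (relabel f ps)) \<longleftrightarrow> (e, b) \<in> set (pedges u ps)"
    proof
      assume "(f ` e, b) \<in> set (pedges (f u) (relabel f ps))"
      then obtain e' where e': "(e', b) \<in> set (pedges u ps)" "f ` e = f ` e'"
        by (auto simp: pedges_relabel)
      then have "e = e'"
        using inj_on_image_eq_iff[OF assms(2)] assms(3) pedges_subset by metis
      with e' show "(e, b) \<in> set (pedges u ps)" by simp
    qed (force simp: pedges_relabel)
    then show ?thesis using d assms(1) by (simp add: deco_pgraph)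
  qed
  then show ?thesis by (metis option.exhaust)
qed

lemma dg_iso_relabel:
  assumes "distinct (pverts u ps)" "inj_on f (set (pverts u ps))"
  shows "dg_iso (pgraph u ps) (pgraph (f u) (relabel f ps))"
  unfolding dg_iso_def
  using assms deco_relabel[OF assms]
  by (intro exI[of _ f]) (auto simp: bij_betw_def pverts_relabel)

text \<open>The converse of \<open>dg_iso_relabel\<close>: every isomorphism out of a path acts by
  relabelling. An isomorphism controls decorations only on subsets of the vertex set; elsewhere both
  sides are \<open>None\<close> because they are decorated graphs.\<close>

lemma isoD_relabel:
  assumes H: "decorated_graph H" and d: "distinct (pverts u ps)"
    and f: "bij_betw f (dverts (pgraph u ps)) (dverts H)"
    and e: "\<And>e. e \<subseteq> dverts (pgraph u ps) \<Longrightarrow> deco H (f ` e) = deco (pgraph u ps) e"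
  shows "distinct (pverts (f u) (relabel f ps))" "H = pgraph (f u) (relabel f ps)"
proof -
  have inj: "inj_on f (set (pverts u ps))" and im: "dverts H = f ` set (pverts u ps)"
    using f by (auto simp: bij_betw_def)
  show dd: "distinct (pverts (f u) (relabel f ps))"
    using d inj by (simp add: pverts_relabel distinct_map)
  have "deco H e = deco (pgraph (f u) (relabel f ps)) e" for e
  proof (cases "e \<subseteq> dverts H")
    case True
    then obtain e0 where e0: "e0 \<subseteq> set (pverts u ps)" "e = f ` e0"
      unfolding im by (auto simp: subset_image_iff)
    then show ?thesis using assms(4)[of e0] deco_relabel[OF d inj e0(1)] by simp
  next
    case False
    then have "deco H e = None" using H by (rule deco_outside[rotated])
    moreover have "\<not> e \<subseteq> dverts (pgraph (f u) (relabel f ps))"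
      using False im by (simp add: pverts_relabel)
    ultimately show ?thesis using deco_outside[OF decorated_graph_pgraph[OF dd]] by simp
  qed
  then have "deco H = deco (pgraph (f u) (relabel f ps))" by auto
  moreover have "dverts H = dverts (pgraph (f u) (relabel f ps))"
    using im by (simp add: pverts_relabel)
  ultimately show "H = pgraph (f u) (relabel f ps)" by (simp add: dgraph.expand)
qed

text \<open>The map sending the \<open>i\<close>-th vertex to the \<open>i\<close>-th vertex works.
  Hence the word of letters determines a path up to isomorphism.\<close>

lemma same_letters_relabel:
  assumes d: "distinct (pverts u ps)" and d': "distinct (pverts u' ps')"
    and l: "map fst ps = map fst ps'"
  shows "\<exists>f. inj_on f (set (pverts u ps)) \<and> f u = u' \<and> relabel f ps = ps'"
proof -
  let ?V = "pverts u ps" and ?V' = "pverts u' ps'"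
  define f where "f v = the (map_of (zip ?V ?V') v)" for v
  have len: "length ps = length ps'" using l by (metis length_map)
  have f: "f (?V ! i) = ?V' ! i" if "i \<le> length ps" for i
    unfolding f_def using that len d by (subst map_of_zip_nth) auto
  have m: "map f ?V = ?V'"
    using len f by (intro nth_equalityI) (auto simp: less_Suc_eq_le simp del: list.map)
  have "inj_on f (set ?V)" using d' m d by (metis distinct_map)
  moreover have "f u = u'" using f[of 0] by simp
  moreover have "relabel f ps = ps'"
  proof (rule nth_equalityI)
    fix i assume i: "i < length (relabel f ps)"
    have "fst (relabel f ps ! i) = fst (ps' ! i)"
      using i l len by (metis letters_relabel length_relabel nth_map)
    moreover have "snd (relabel f ps ! i) = snd (ps' ! i)"
      using i f[of "Suc i"] len by (simp add: relabel_def pverts_def)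
    ultimately show "relabel f ps ! i = ps' ! i" by (rule prod_eqI)
  qed (simp add: len)
  ultimately show ?thesis by blast
qed

definition enums :: "nat dgraph \<Rightarrow> (nat \<times> step list) set" where
  "enums H = {(u, ps). distinct (pverts u ps) \<and> H = pgraph u ps}"

text \<open>An enumeration has to start at a leaf, and its start determines it by
  \<open>pgraph_inj\<close>. The two leaves differ because there is at least one edge.\<close>

lemma card_enums:
  assumes "decorated_path l H" "l \<ge> 1"
  shows "card (enums H) = 2" "finite (enums H)"
proof -
  obtain vs where vs: "distinct vs" "length vs = Suc l" "dverts H = set vs"
    and "\<exists>ps. length ps = l \<and> pverts (hd vs) ps = vs \<and> H = pgraph (hd vs) ps"
    "\<exists>ps. length ps = l \<and> pverts (last vs) ps = rev vs \<and> H = pgraph (last vs) ps"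
    by (rule decorated_pathE[OF assms(1)])
  then obtain ps qs where ps: "length ps = l" "pverts (hd vs) ps = vs" "H = pgraph (hd vs) ps"
    and qs: "length qs = l" "pverts (last vs) qs = rev vs" "H = pgraph (last vs) qs" by auto
  have ne: "hd vs \<noteq> last vs"
  proof -
    have "vs \<noteq> []" using vs by auto
    then have "hd vs = vs ! 0" "last vs = vs ! l"
      using vs by (auto simp: hd_conv_nth last_conv_nth)
    then show ?thesis using vs assms(2) nth_eq_iff_index_eq[of vs 0 l] by auto
  qed
  have lv: "leaves H = {hd vs, last vs}"
  proof -
    have "distinct (pverts (hd vs) ps)" "ps \<noteq> []" using ps vs assms(2) by auto
    from leaves_pgraph[OF this] show ?thesis unfolding ps(3)[symmetric] ps(2) .
  qed
  have "enums H = {(hd vs, ps), (last vs, qs)}"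
  proof (intro set_eqI iffI)
    fix z assume "z \<in> enums H"
    then obtain u rs where z: "z = (u, rs)" "distinct (pverts u rs)" "H = pgraph u rs"
      by (auto simp: enums_def)
    have "card (set (pverts u rs)) = card (set vs)" using z(3) vs(3) by simp
    then have "rs \<noteq> []" using z(2) vs(1,2) assms(2) by (auto simp: distinct_card)
    then have "u \<in> leaves H" using leaves_pgraph[OF z(2)] z(3) by simp
    then have "u = hd vs \<or> u = last vs" using lv by auto
    then show "z \<in> {(hd vs, ps), (last vs, qs)}"
    proof
      assume u: "u = hd vs"
      have "rs = ps"
        by (rule pgraph_inj[of u]) (use z(2,3) ps vs(1) u in simp_all)
      then show ?thesis using u z(1) by simp
    next
      assume u: "u = last vs"
      have "rs = qs"
        by (rule pgraph_inj[of u]) (use z(2,3) qs vs(1) u in simp_all)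
      then show ?thesis using u z(1) by simp
    qed
  next
    fix z assume "z \<in> {(hd vs, ps), (last vs, qs)}"
    then consider "z = (hd vs, ps)" | "z = (last vs, qs)" by blast
    then show "z \<in> enums H"
      by cases (simp_all add: enums_def ps(2) qs(2) vs(1) ps(3)[symmetric] qs(3)[symmetric])
  qed
  then show "card (enums H) = 2" "finite (enums H)" using ne by auto
qed

text \<open>An automorphism is determined by the enumeration it produces from
  \<open>(u, ps)\<close>, being the identity off the path. Conversely,
  \<open>same_letters_relabel\<close> turns an enumeration with the same word into a vertex map,
  which is extended by the identity.\<close>

lemma card_enums_letters:
  assumes d: "distinct (pverts u ps)"
  shows "card {(v, qs) \<in> enums (pgraph u ps). map fst qs = map fst ps} =
         card (automorphisms (pgraph u ps))"
proof -
  let ?H = "pgraph u ps"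
  let ?g = "\<lambda>p. (p u, relabel p ps)"
  have "bij_betw ?g (automorphisms ?H) {(v, qs) \<in> enums ?H. map fst qs = map fst ps}"
  proof (rule bij_betw_imageI)
    show "inj_on ?g (automorphisms ?H)"
    proof (rule inj_onI)
      fix p q assume p: "p \<in> automorphisms ?H" and q: "q \<in> automorphisms ?H" and e: "?g p = ?g q"
      have "map p (pverts u ps) = map q (pverts u ps)"
        using e pverts_relabel by (metis prod.inject)
      then have "p v = q v" if "v \<in> set (pverts u ps)" for v using that by simp
      moreover have "p v = q v" if "v \<notin> set (pverts u ps)" for v
        using that p q by (auto simp: automorphisms_def permutes_def)
      ultimately show "p = q" by blast
    qed
    show "?g ` automorphisms ?H = {(v, qs) \<in> enums ?H. map fst qs = map fst ps}"
    proof (intro set_eqI iffI)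
      fix z assume "z \<in> ?g ` automorphisms ?H"
      then obtain p where p: "z = ?g p" "p \<in> automorphisms ?H" by auto
      then have "bij_betw p (dverts ?H) (dverts ?H)"
        "\<And>e. e \<subseteq> dverts ?H \<Longrightarrow> deco ?H (p ` e) = deco ?H e"
        by (auto simp: automorphisms_def permutes_imp_bij)
      from isoD_relabel[OF decorated_graph_pgraph[OF d] d this]
      show "z \<in> {(v, qs) \<in> enums ?H. map fst qs = map fst ps}"
        using p by (simp add: enums_def)
    next
      fix z assume "z \<in> {(v, qs) \<in> enums ?H. map fst qs = map fst ps}"
      then obtain v qs where z: "z = (v, qs)" "distinct (pverts v qs)" "?H = pgraph v qs"
        "map fst qs = map fst ps" by (auto simp: enums_def)
      obtain f where f: "inj_on f (set (pverts u ps))" "f u = v" "relabel f ps = qs"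
        using same_letters_relabel[OF d z(2)] z(4) by auto
      define p where "p x = (if x \<in> set (pverts u ps) then f x else x)" for x
      have im: "f ` set (pverts u ps) = set (pverts u ps)"
      proof -
        have "f ` set (pverts u ps) = set (pverts v qs)"
          using pverts_relabel[of f u ps] unfolding f(2,3) by (simp only: set_map)
        also have "\<dots> = set (pverts u ps)"
          using arg_cong[OF z(3), of dverts] by (simp only: dverts_pgraph)
        finally show ?thesis .
      qed
      have "bij_betw f (set (pverts u ps)) (set (pverts u ps))"
        using f(1) im by (simp only: bij_betw_def)
      then have "bij_betw p (set (pverts u ps)) (set (pverts u ps))"
        by (subst bij_betw_cong[where g = f]) (simp_all add: p_def)
      then have perm: "p permutes set (pverts u ps)"
        by (rule bij_imp_permutes) (simp add: p_def)
      have rl: "relabel p ps = qs"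
        unfolding f(3)[symmetric] relabel_def by (force simp: p_def pverts_def)
      have pu: "p u = v" using f by (simp add: p_def)
      have "deco ?H (p ` e) = deco ?H e" if "e \<subseteq> dverts ?H" for e
      proof -
        have "inj_on p (set (pverts u ps))" using permutes_inj[OF perm] inj_on_subset by blast
        from deco_relabel[OF d this, of e] that show ?thesis
          unfolding rl pu z(3)[symmetric] by simp
      qed
      then have "p \<in> automorphisms ?H"
        using perm by (simp add: automorphisms_def)
      then show "z \<in> ?g ` automorphisms ?H" using rl pu z(1) by force
    qed
  qed
  then show ?thesis by (simp add: bij_betw_same_card)
qed

lemma start_in_verts_of:
  assumes d: "distinct (pverts u ps)" and ne: "ps \<noteq> []"
  shows "u \<in> verts_of b (pgraph u ps) \<longleftrightarrow> fst (hd ps) = b"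
proof -
  obtain c y qs where ps: "ps = (c, y) # qs" using ne by (metis neq_Nil_conv surj_pair)
  have "u \<notin> e" if "(e, a) \<in> set (pedges y qs)" for e a
    using pedges_subset[OF that] d ps by auto
  then show ?thesis using d unfolding ps by (auto simp: verts_of_def edges_of_pgraph)
qed

lemma end_in_verts_of:
  assumes d: "distinct (pverts u ps)" and ne: "ps \<noteq> []"
  shows "last (pverts u ps) \<in> verts_of b (pgraph u ps) \<longleftrightarrow> fst (last ps) = b"
  using assms
proof (induction u ps rule: pedges.induct)
  case (2 x c y ps)
  note d = 2(2)
  have l: "last (pverts x ((c, y) # ps)) = last (pverts y ps)" by (simp add: pverts_def)
  have dy: "distinct (pverts y ps)" using d by simp
  show ?case
  proof (cases "ps = []")
    case True
    then show ?thesis using d by (auto simp: verts_of_def edges_of_pgraph)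
  next
    case False
    have mem: "last (pverts y ps) = snd (last ps)" "snd (last ps) \<in> snd ` set ps"
      using False by (auto simp: last_pverts)
    then have "last (pverts y ps) \<notin> {x, y}"
      using d by (auto simp: pverts_def)
    then have "last (pverts y ps) \<in> verts_of b (pgraph x ((c, y) # ps)) \<longleftrightarrow>
        last (pverts y ps) \<in> verts_of b (pgraph y ps)"
      by (auto simp: verts_of_def edges_of_pgraph[OF d] edges_of_pgraph[OF dy])
    then show ?thesis using 2(1)[OF dy False] l False by simp
  qed
qed auto

definition words :: "nat \<Rightarrow> decoration list set" where
  "words l = {w. length w = l \<and> hd w = Bullet \<and> last w = Bullet}"

lemma leaves_Bullet_iff:
  assumes "distinct (pverts u ps)" "ps \<noteq> []"
  shows "leaves (pgraph u ps) \<subseteq> verts_of Bullet (pgraph u ps) \<longleftrightarrow> map fst ps \<in> words (length ps)"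
  using start_in_verts_of[OF assms] end_in_verts_of[OF assms] leaves_pgraph[OF assms] assms(2)
  by (auto simp: words_def hd_map last_map)

lemma UNIV_decoration: "UNIV = {Bullet, Circ}"
  by (auto intro: decoration.exhaust)

instance decoration :: finite
  by standard (simp add: UNIV_decoration)

lemma finite_words [simp]: "finite (words l)"
  by (rule finite_subset[OF _ finite_lists_length_eq[of UNIV l]]) (auto simp: words_def)

definition dweight :: "real \<Rightarrow> real \<Rightarrow> decoration \<Rightarrow> real" where
  "dweight lam mu b = (case b of Bullet \<Rightarrow> lam | Circ \<Rightarrow> mu)"

text \<open>The weight of a word that is preceded by the letter \<open>a\<close>.\<close>

fun xiw :: "real \<Rightarrow> real \<Rightarrow> real \<Rightarrow> decoration \<Rightarrow> decoration list \<Rightarrow> real" where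
  "xiw lam mu rho a [] = 1"
| "xiw lam mu rho a (b # w) = (if a = b then 1 else rho) * dweight lam mu b * xiw lam mu rho b w"

lemma finite_edges_of_pgraph: "distinct (pverts u ps) \<Longrightarrow> finite (edges_of b (pgraph u ps))"
  by (rule finite_subset[of _ "fst ` set (pedges u ps)"]) (force simp: edges_of_pgraph)+

text \<open>Removing the first edge affects mixedness only at \<open>y\<close>, which is mixed
  exactly if the next letter differs; the start lies on one edge and never counts. The first letter
  is passed as its own predecessor, so that it costs no factor \<open>rho\<close>.\<close>

lemma Xi_weight_pgraph:
  assumes "distinct (pverts u ps)" "ps \<noteq> []"
  shows "Xi_weight lam mu rho (pgraph u ps) = xiw lam mu rho (fst (hd ps)) (map fst ps)"
  using assms
proof (induction u ps rule: pedges.induct)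
  case (2 x b y ps)
  note d = 2(2)
  have dy: "distinct (pverts y ps)" using d by simp
  let ?G = "pgraph x ((b, y) # ps)" and ?T = "pgraph y ps"
  have nx: "x \<notin> e" if "(e, c) \<in> set (pedges y ps)" for e c
    using pedges_subset[OF that] d by auto
  have E: "edges_of c ?G = (if c = b then insert {x, y} (edges_of c ?T) else edges_of c ?T)" for c
    by (auto simp: edges_of_pgraph[OF d] edges_of_pgraph[OF dy])
  have ni: "{x, y} \<notin> edges_of c ?T" for c
    using nx by (auto simp: edges_of_pgraph[OF dy])
  have c: "card (edges_of c ?G) = (if c = b then 1 else 0) + card (edges_of c ?T)" for c
    unfolding E using ni finite_edges_of_pgraph[OF dy] by simp
  have V: "verts_of c ?G = (if c = b then {x, y} \<union> verts_of c ?T else verts_of c ?T)" for c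
    unfolding verts_of_def E by auto
  have xv: "x \<notin> verts_of c ?T" for c
    using nx by (auto simp: verts_of_def edges_of_pgraph[OF dy])
  have lw: "lam ^ card (edges_of Bullet ?G) * mu ^ card (edges_of Circ ?G) =
     dweight lam mu b * (lam ^ card (edges_of Bullet ?T) * mu ^ card (edges_of Circ ?T))"
    unfolding c by (cases b) (auto simp: dweight_def)
  show ?case
  proof (cases "ps = []")
    case True
    then have "verts_of c ?T = {}" "edges_of c ?T = {}" for c
      using edges_of_pgraph[OF dy] by (auto simp: verts_of_def)
    then have D: "diff_verts ?G = {}" unfolding diff_verts_def V by (cases b) auto
    have "Xi_weight lam mu rho ?G = dweight lam mu b"
      unfolding Xi_weight_def lw D using \<open>\<And>c. edges_of c ?T = {}\<close> by simp
    then show ?thesis using True by simp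
  next
    case False
    have sv: "y \<in> verts_of c ?T \<longleftrightarrow> fst (hd ps) = c" for c
      using start_in_verts_of[OF dy False] .
    have fin: "finite (diff_verts ?T)"
      by (rule finite_subset[of _ "set (pverts y ps)"])
        (auto simp: diff_verts_def verts_of_def edges_of_pgraph[OF dy] dest: pedges_subset)
    have "diff_verts ?G = (if fst (hd ps) = b then diff_verts ?T else insert y (diff_verts ?T))"
      using xv sv unfolding diff_verts_def V
      by (cases b; cases "fst (hd ps)") auto
    moreover have "y \<notin> diff_verts ?T"
      using sv by (cases "fst (hd ps)") (auto simp: diff_verts_def)
    ultimately have D: "card (diff_verts ?G) = (if fst (hd ps) = b then 0 else 1) + card (diff_verts ?T)"
      using fin by simp
    have "Xi_weight lam mu rho ?G =
       (if b = fst (hd ps) then 1 else rho) * dweight lam mu b * Xi_weight lam mu rho ?T"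
      unfolding Xi_weight_def lw D by auto
    also have "\<dots> = xiw lam mu rho b (map fst ((b, y) # ps))"
      using 2(1)[OF dy False] False by (cases ps) auto
    finally show ?thesis by simp
  qed
qed simp

lemma Xi_weight_pgraph_word:
  assumes "distinct (pverts u ps)" "ps \<noteq> []" "map fst ps \<in> words l"
  shows "Xi_weight lam mu rho (pgraph u ps) = xiw lam mu rho Bullet (map fst ps)"
  using Xi_weight_pgraph[OF assms(1,2)] assms(2,3) by (simp add: words_def hd_map)

section \<open>Isomorphism classes of paths and words\<close>

definition iso_rel :: "(nat dgraph \<times> nat dgraph) set" where
  "iso_rel = {(G, H). decorated_graph G \<and> decorated_graph H \<and> dg_iso G H}"

definition bullet_paths :: "nat \<Rightarrow> nat dgraph set" where
  "bullet_paths l = {H. decorated_path l H \<and> leaves H \<subseteq> verts_of Bullet H}"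

lemma path_classes_eq: "path_classes l = bullet_paths l // iso_rel"
  by (simp add: path_classes_def bullet_paths_def iso_rel_def)

lemma dg_iso_sym:
  assumes "dg_iso G H" shows "dg_iso H G"
proof -
  obtain f where f: "bij_betw f (dverts G) (dverts H)"
    "\<And>e. e \<subseteq> dverts G \<Longrightarrow> deco H (f ` e) = deco G e"
    using assms unfolding dg_iso_def by blast
  define g where "g = inv_into (dverts G) f"
  have g: "bij_betw g (dverts H) (dverts G)"
    unfolding g_def by (rule bij_betw_inv_into[OF f(1)])
  have "deco G (g ` e) = deco H e" if "e \<subseteq> dverts H" for e
  proof -
    have "f ` g ` e = e"
      using that f(1) unfolding g_def by (simp add: bij_betw_def image_inv_into_cancel)
    moreover have "g ` e \<subseteq> dverts G" using g that by (auto simp: bij_betw_def)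
    ultimately show ?thesis using f(2)[of "g ` e"] by simp
  qed
  then show ?thesis using g unfolding dg_iso_def by blast
qed

lemma dg_iso_trans:
  assumes "dg_iso G H" "dg_iso H I" shows "dg_iso G I"
proof -
  obtain f where f: "bij_betw f (dverts G) (dverts H)"
    "\<And>e. e \<subseteq> dverts G \<Longrightarrow> deco H (f ` e) = deco G e"
    using assms(1) unfolding dg_iso_def by blast
  obtain g where g: "bij_betw g (dverts H) (dverts I)"
    "\<And>e. e \<subseteq> dverts H \<Longrightarrow> deco I (g ` e) = deco H e"
    using assms(2) unfolding dg_iso_def by blast
  have "deco I ((g \<circ> f) ` e) = deco G e" if "e \<subseteq> dverts G" for e
  proof -
    have "f ` e \<subseteq> dverts H" using f(1) that by (auto simp: bij_betw_def)
    then show ?thesis using f(2)[OF that] g(2)[of "f ` e"] by (simp add: image_comp)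
  qed
  then show ?thesis using bij_betw_trans[OF f(1) g(1)] unfolding dg_iso_def by blast
qed

lemma dg_iso_refl: "dg_iso G G"
  unfolding dg_iso_def by (intro exI[of _ id]) auto

lemma equiv_iso_rel: "equiv {H. decorated_graph H} iso_rel"
proof (rule equivI)
  show "refl_on {H. decorated_graph H} iso_rel"
    by (rule refl_onI) (auto simp: iso_rel_def dg_iso_refl)
  show "sym iso_rel" by (rule symI) (auto simp: iso_rel_def intro: dg_iso_sym)
  show "trans iso_rel" by (rule transI) (auto simp: iso_rel_def intro: dg_iso_trans)
qed (auto simp: iso_rel_def)

lemma bullet_pathsE:
  assumes "H \<in> bullet_paths l" "l \<ge> 1"
  obtains u ps where "distinct (pverts u ps)" "length ps = l" "H = pgraph u ps"
    "map fst ps \<in> words l"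
proof -
  have H: "decorated_path l H" "leaves H \<subseteq> verts_of Bullet H"
    using assms by (auto simp: bullet_paths_def)
  obtain vs where vs: "distinct vs"
    "\<exists>ps. length ps = l \<and> pverts (hd vs) ps = vs \<and> H = pgraph (hd vs) ps"
    using decorated_pathE[OF H(1)] by metis
  then obtain ps where ps: "length ps = l" "pverts (hd vs) ps = vs" "H = pgraph (hd vs) ps" by blast
  have d: "distinct (pverts (hd vs) ps)" using vs(1) ps(2) by simp
  have "ps \<noteq> []" using ps(1) assms(2) by auto
  then have "map fst ps \<in> words l"
    using leaves_Bullet_iff[OF d] H(2) ps(1,3) by metis
  with that d ps show ?thesis by blast
qed

lemma pgraph_in_bullet_paths:
  assumes "distinct (pverts u ps)" "length ps = l" "l \<ge> 1" "map fst ps \<in> words l"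
  shows "pgraph u ps \<in> bullet_paths l"
proof -
  have "ps \<noteq> []" using assms by auto
  then show ?thesis
    using leaves_Bullet_iff[OF assms(1)] decorated_path_pgraph[OF assms(1)] assms(2,4)
    by (simp add: bullet_paths_def)
qed

lemma iso_pgraphE:
  assumes "dg_iso (pgraph u ps) H" "decorated_graph H" "distinct (pverts u ps)"
  obtains v qs where "distinct (pverts v qs)" "H = pgraph v qs" "map fst qs = map fst ps"
proof -
  obtain f where f: "bij_betw f (dverts (pgraph u ps)) (dverts H)"
    "\<And>e. e \<subseteq> dverts (pgraph u ps) \<Longrightarrow> deco H (f ` e) = deco (pgraph u ps) e"
    using assms(1) unfolding dg_iso_def by blast
  from isoD_relabel[OF assms(2,3) f] show ?thesis
    by (rule that) simp_all
qed

lemma same_letters_iso: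
  assumes d: "distinct (pverts u ps)" and d': "distinct (pverts u' ps')"
    and l: "map fst ps = map fst ps'"
  shows "(pgraph u ps, pgraph u' ps') \<in> iso_rel"
proof -
  obtain f where f: "inj_on f (set (pverts u ps))" "f u = u'" "relabel f ps = ps'"
    using same_letters_relabel[OF assms] by blast
  have "dg_iso (pgraph u ps) (pgraph u' ps')"
    using dg_iso_relabel[OF d f(1)] unfolding f(2,3) .
  then show ?thesis using decorated_graph_pgraph d d' by (simp add: iso_rel_def)
qed

text \<open>Both the end condition and the weight can be read off the word, which an isomorphism
  carries along.\<close>

lemma bullet_paths_iso:
  assumes "H \<in> bullet_paths l" "(H, H') \<in> iso_rel" "l \<ge> 1"
  shows "H' \<in> bullet_paths l" "Xi_weight lam mu rho H' = Xi_weight lam mu rho H"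
proof -
  obtain u ps where ps: "distinct (pverts u ps)" "length ps = l" "H = pgraph u ps"
    "map fst ps \<in> words l" by (rule bullet_pathsE[OF assms(1,3)])
  have "dg_iso (pgraph u ps) H'" "decorated_graph H'"
    using assms(2) ps(3) by (auto simp: iso_rel_def)
  then obtain v qs where qs: "distinct (pverts v qs)" "H' = pgraph v qs" "map fst qs = map fst ps"
    using iso_pgraphE ps(1) by metis
  have lq: "length qs = l" using qs(3) ps(2) by (metis length_map)
  show "H' \<in> bullet_paths l"
    unfolding qs(2) by (rule pgraph_in_bullet_paths[OF qs(1) lq assms(3)]) (simp add: qs(3) ps(4))
  have "ps \<noteq> []" "qs \<noteq> []" using ps lq assms(3) by auto
  then show "Xi_weight lam mu rho H' = Xi_weight lam mu rho H"
    unfolding qs(2) ps(3)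
    using Xi_weight_pgraph_word[OF qs(1), of l] Xi_weight_pgraph_word[OF ps(1), of l] qs(3) ps(4)
    by simp
qed

lemma bullet_paths_decorated: "H \<in> bullet_paths l \<Longrightarrow> decorated_graph H"
  by (simp add: bullet_paths_def decorated_path_def)

lemma rep_path_class:
  assumes "c \<in> path_classes l" "l \<ge> 1"
  shows "rep c \<in> bullet_paths l" "iso_rel `` {rep c} = c"
proof -
  obtain H where H: "H \<in> bullet_paths l" "c = iso_rel `` {H}"
    using assms(1) by (auto simp: path_classes_eq elim: quotientE)
  have "H \<in> c" using bullet_paths_decorated[OF H(1)] H(2) by (simp add: iso_rel_def dg_iso_refl)
  then have "rep c \<in> c" unfolding rep_def by (rule someI)
  then have r: "(H, rep c) \<in> iso_rel" using H(2) by simp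
  show "rep c \<in> bullet_paths l" by (rule bullet_paths_iso(1)[OF H(1) r assms(2)])
  show "iso_rel `` {rep c} = c"
    using equiv_class_eq[OF equiv_iso_rel r] H(2) by simp
qed

lemma class_in_path_classes: "H \<in> bullet_paths l \<Longrightarrow> iso_rel `` {H} \<in> path_classes l"
  by (simp add: path_classes_eq quotientI)

lemma iso_rep_iff:
  assumes "c \<in> path_classes l" "l \<ge> 1" "decorated_graph S"
  shows "dg_iso S (rep c) \<longleftrightarrow> iso_rel `` {S} = c"
proof -
  have d: "decorated_graph (rep c)"
    using rep_path_class(1)[OF assms(1,2)] bullet_paths_decorated by blast
  then have "dg_iso S (rep c) \<longleftrightarrow> (S, rep c) \<in> iso_rel" using assms(3) by (simp add: iso_rel_def)
  also have "\<dots> \<longleftrightarrow> iso_rel `` {S} = iso_rel `` {rep c}"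
    using eq_equiv_class_iff[OF equiv_iso_rel] assms(3) d by simp
  finally show ?thesis using rep_path_class(2)[OF assms(1,2)] by simp
qed

text \<open>A concrete graph on the vertices \<open>0, ..., l\<close> for every word; it links the
  finitely many words with the isomorphism classes.\<close>

definition word_graph :: "decoration list \<Rightarrow> nat dgraph" where
  "word_graph w = pgraph 0 (zip w [1..<Suc (length w)])"

lemma word_graph_distinct: "distinct (pverts 0 (zip w [1..<Suc (length w)]))"
  by (simp add: pverts_def del: upt_Suc)

lemma letters_word_graph [simp]: "map fst (zip w [1..<Suc (length w)]) = w"
  by (rule map_fst_zip) (simp del: upt_Suc)

lemma word_graph_bullet_paths:
  assumes "w \<in> words l" "l \<ge> 1"
  shows "word_graph w \<in> bullet_paths l"
proof -
  have "length w = l" using assms by (simp add: words_def)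
  then show ?thesis unfolding word_graph_def using assms
    by (intro pgraph_in_bullet_paths word_graph_distinct) (auto simp del: upt_Suc)
qed

lemma finite_path_classes: assumes "l \<ge> 1" shows "finite (path_classes l)"
proof (rule finite_subset)
  show "path_classes l \<subseteq> (\<lambda>w. iso_rel `` {word_graph w}) ` words l"
  proof
    fix c assume c: "c \<in> path_classes l"
    obtain u ps where ps: "distinct (pverts u ps)" "length ps = l" "rep c = pgraph u ps"
      "map fst ps \<in> words l" by (rule bullet_pathsE[OF rep_path_class(1)[OF c assms] assms])
    have "(pgraph 0 (zip (map fst ps) [1..<Suc (length (map fst ps))]), pgraph u ps) \<in> iso_rel"
      by (rule same_letters_iso[OF word_graph_distinct ps(1)]) (rule letters_word_graph)
    then have "(word_graph (map fst ps), rep c) \<in> iso_rel"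
      unfolding word_graph_def ps(3) .
    from equiv_class_eq[OF equiv_iso_rel this]
    have "c = iso_rel `` {word_graph (map fst ps)}" using rep_path_class(2)[OF c assms] by simp
    then show "c \<in> (\<lambda>w. iso_rel `` {word_graph w}) ` words l" using ps(4) by blast
  qed
qed simp

text \<open>A path has exactly two enumerations, and the enumerations with a given word are permuted
  simply transitively by the automorphisms.\<close>

lemma card_class_words:
  assumes c: "c \<in> path_classes l" and l: "l \<ge> 1"
  shows "card {w \<in> words l. iso_rel `` {word_graph w} = c} * card (automorphisms (rep c)) = 2"
proof -
  let ?H = "rep c" and ?W = "{w \<in> words l. iso_rel `` {word_graph w} = c}"
  have H: "?H \<in> bullet_paths l" using rep_path_class(1)[OF c l] .
  then have dp: "decorated_path l ?H" by (simp add: bullet_paths_def)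
  have letters: "map fst ps \<in> ?W" if "(u, ps) \<in> enums ?H" for u ps
  proof -
    have ps: "distinct (pverts u ps)" "?H = pgraph u ps" using that by (auto simp: enums_def)
    have "card (dverts ?H) = Suc l"
      using dp unfolding decorated_path_def by (auto simp: distinct_card)
    then have len: "length ps = l" using ps distinct_card[OF ps(1)] by simp
    have lb: "leaves (pgraph u ps) \<subseteq> verts_of Bullet (pgraph u ps)"
      using H ps(2) by (simp add: bullet_paths_def)
    have ne: "ps \<noteq> []" using len l by auto
    have w: "map fst ps \<in> words l" using leaves_Bullet_iff[OF ps(1) ne] lb len by simp
    have "(pgraph 0 (zip (map fst ps) [1..<Suc (length (map fst ps))]), pgraph u ps) \<in> iso_rel"
      by (rule same_letters_iso[OF word_graph_distinct ps(1)]) (rule letters_word_graph)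
    then have "(word_graph (map fst ps), ?H) \<in> iso_rel"
      unfolding word_graph_def ps(2) .
    from equiv_class_eq[OF equiv_iso_rel this] w show ?thesis
      using rep_path_class(2)[OF c l] by simp
  qed
  have fib: "card {z \<in> enums ?H. map fst (snd z) = w} = card (automorphisms ?H)" if "w \<in> ?W" for w
  proof -
    have wl: "length w = l" using that by (simp add: words_def)
    have dw: "decorated_graph (word_graph w)"
      using word_graph_bullet_paths[of w l] that l bullet_paths_decorated by blast
    have "dg_iso (word_graph w) ?H" using iso_rep_iff[OF c l dw] that by blast
    then obtain u ps where ps: "distinct (pverts u ps)" "?H = pgraph u ps"
      "map fst ps = map fst (zip w [1..<Suc (length w)])"
      using iso_pgraphE[OF _ bullet_paths_decorated[OF H] word_graph_distinct]
      unfolding word_graph_def by metis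
    have "map fst ps = w" using ps(3) letters_word_graph by metis
    then have "{z \<in> enums ?H. map fst (snd z) = w} =
       {(v, qs) \<in> enums (pgraph u ps). map fst qs = map fst ps}" using ps(2) by auto
    then show ?thesis using card_enums_letters[OF ps(1)] ps(2) by simp
  qed
  have fin: "finite ?W" "finite (enums ?H)" using card_enums[OF dp l] by auto
  \<comment> \<open>The two enumerations of the representative are counted according to their
    words.\<close>
  have "2 = (\<Sum>z\<in>enums ?H. 1::nat)" using card_enums[OF dp l] by simp
  also have "\<dots> = (\<Sum>w\<in>?W. \<Sum>z\<in>{z \<in> enums ?H. map fst (snd z) = w}. 1)"
  proof (rule sum.group[symmetric])
    show "(\<lambda>z. map fst (snd z)) ` enums ?H \<subseteq> ?W"
    proof (rule image_subsetI)
      fix z assume "z \<in> enums ?H"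
      then show "map fst (snd z) \<in> ?W" using letters[of "fst z" "snd z"] by simp
    qed
  qed (fact fin)+
  also have "\<dots> = (\<Sum>w\<in>?W. card (automorphisms ?H))" using fib by simp
  finally show ?thesis by simp
qed

definition beta_words :: "real \<Rightarrow> real \<Rightarrow> real \<Rightarrow> nat \<Rightarrow> real" where
  "beta_words lam mu rho l = (\<Sum>w\<in>words l. (xiw lam mu rho Bullet w)\<^sup>2)"

lemma Xi_weight_word_graph:
  assumes "w \<in> words l" "l \<ge> 1"
  shows "Xi_weight lam mu rho (word_graph w) = xiw lam mu rho Bullet w"
proof -
  have l: "length w = l" using assms by (simp add: words_def)
  show ?thesis
    using Xi_weight_pgraph_word[OF word_graph_distinct[of w], of l lam mu rho] assms l
    by (simp add: word_graph_def del: upt_Suc) (metis One_nat_def length_0_conv not_one_le_zero)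
qed

text \<open>By \<open>card_class_words\<close> a class with \<open>a\<close> automorphisms is hit by
  \<open>2 / a\<close> words: a palindrome has a reflection and is alone in its class, any other
  word shares its class with its reversal. So the sum over words counts every class with twice its
  weight.\<close>

lemma beta_J_eq:
  assumes l: "l \<ge> 1"
  shows "beta_J lam mu rho l = beta_words lam mu rho l / 2"
proof -
  let ?f = "\<lambda>w. iso_rel `` {word_graph w}"
  have "beta_words lam mu rho l = (\<Sum>c\<in>path_classes l. \<Sum>w\<in>{w \<in> words l. ?f w = c}. (xiw lam mu rho Bullet w)\<^sup>2)"
    unfolding beta_words_def
    by (rule sum.group[symmetric])
      (use finite_path_classes[OF l] word_graph_bullet_paths l class_in_path_classes in auto)
  also have "\<dots> = (\<Sum>c\<in>path_classes l. 2 * ((Xi_weight lam mu rho (rep c))\<^sup>2 / real (card (automorphisms (rep c)))))"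
  proof (rule sum.cong[OF refl])
    fix c assume c: "c \<in> path_classes l"
    have "(xiw lam mu rho Bullet w)\<^sup>2 = (Xi_weight lam mu rho (rep c))\<^sup>2"
      if "w \<in> {w \<in> words l. ?f w = c}" for w
    proof -
      have b: "word_graph w \<in> bullet_paths l" using word_graph_bullet_paths that l by simp
      then have "dg_iso (word_graph w) (rep c)"
        using iso_rep_iff[OF c l bullet_paths_decorated[OF b]] that by simp
      then have "(word_graph w, rep c) \<in> iso_rel"
        using bullet_paths_decorated b rep_path_class(1)[OF c l] by (auto simp: iso_rel_def)
      from bullet_paths_iso(2)[OF b this l] show ?thesis
        using Xi_weight_word_graph[of w l] that l by simp
    qed
    then have S: "(\<Sum>w\<in>{w \<in> words l. ?f w = c}. (xiw lam mu rho Bullet w)\<^sup>2) =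
       real (card {w \<in> words l. ?f w = c}) * (Xi_weight lam mu rho (rep c))\<^sup>2" by simp
    define m a where "m = real (card {w \<in> words l. ?f w = c})"
      and "a = real (card (automorphisms (rep c)))"
    have "m * a = real (card {w \<in> words l. ?f w = c} * card (automorphisms (rep c)))"
      by (simp add: m_def a_def)
    also have "\<dots> = 2" unfolding card_class_words[OF c l] by simp
    finally have ma: "m * a = 2" .
    then have "a \<noteq> 0" by auto
    then have "m = 2 / a" using ma by (simp add: eq_divide_eq)
    then show "(\<Sum>w\<in>{w \<in> words l. ?f w = c}. (xiw lam mu rho Bullet w)\<^sup>2) =
       2 * ((Xi_weight lam mu rho (rep c))\<^sup>2 / real (card (automorphisms (rep c))))"
      unfolding S m_def[symmetric] a_def[symmetric] by simp
  qed
  also have "\<dots> = 2 * beta_J lam mu rho l"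
    unfolding beta_J_def by (simp add: sum_distrib_left)
  finally show ?thesis by simp
qed

section \<open>The statistic as a sum over oriented paths\<close>

definition path_steps :: "nat \<Rightarrow> nat \<Rightarrow> nat \<Rightarrow> nat \<Rightarrow> step list set" where
  "path_steps n l u v = {ps. length ps = l \<and> set (pverts u ps) \<subseteq> {..<n} \<and> distinct (pverts u ps) \<and>
     last (pverts u ps) = v \<and> map fst ps \<in> words l}"

lemma finite_path_steps [simp]: "finite (path_steps n l u v)"
proof (rule finite_subset)
  show "path_steps n l u v \<subseteq> {ps. set ps \<subseteq> UNIV \<times> {..<n} \<and> length ps = l}"
    unfolding path_steps_def pverts_def by force
qed (intro finite_lists_length_eq finite_SigmaI, simp_all)

text \<open>Prescribing the start \<open>u\<close> selects one of the two enumerations, so every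
  copy corresponds to a single step list. For \<open>u = v\<close> both sides are empty, as the two
  leaves of a path are distinct.\<close>

lemma bullet_paths_leaves_eq:
  assumes l: "l \<ge> 1"
  shows "{S \<in> bullet_paths l. dverts S \<subseteq> {..<n} \<and> leaves S = {u, v}} =
     pgraph u ` path_steps n l u v"
proof (intro set_eqI iffI)
  fix S assume S: "S \<in> {S \<in> bullet_paths l. dverts S \<subseteq> {..<n} \<and> leaves S = {u, v}}"
  then have dp: "decorated_path l S" by (simp add: bullet_paths_def)
  obtain vs where vs: "distinct vs" "length vs = Suc l" "dverts S = set vs"
    "\<exists>ps. length ps = l \<and> pverts (hd vs) ps = vs \<and> S = pgraph (hd vs) ps"
    "\<exists>ps. length ps = l \<and> pverts (last vs) ps = rev vs \<and> S = pgraph (last vs) ps"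
    by (rule decorated_pathE[OF dp])
  have ends: "u \<in> {hd vs, last vs}"
  proof -
    obtain ps where ps: "length ps = l" "pverts (hd vs) ps = vs" "S = pgraph (hd vs) ps"
      using vs(4) by blast
    have "distinct (pverts (hd vs) ps)" "ps \<noteq> []" using ps vs l by auto
    from leaves_pgraph[OF this] have "leaves S = {hd vs, last vs}"
      unfolding ps(3)[symmetric] ps(2) .
    then show ?thesis using S by auto
  qed
  have "\<exists>ps. length ps = l \<and> distinct (pverts u ps) \<and> S = pgraph u ps"
    using ends vs(1,4,5) by (metis distinct_rev empty_iff insert_iff)
  then obtain ps where ps: "length ps = l" "distinct (pverts u ps)" "S = pgraph u ps" by blast
  have ne: "ps \<noteq> []" using ps l by auto
  have lv: "leaves S = {u, last (pverts u ps)}" using leaves_pgraph[OF ps(2) ne] ps(3) by simp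
  have "last (pverts u ps) \<noteq> u"
    using ps(2) ne last_in_set[of "map snd ps"] by (auto simp: last_pverts pverts_def last_map)
  then have "last (pverts u ps) = v" using lv S by auto
  moreover have "set (pverts u ps) \<subseteq> {..<n}" using S ps(3) by simp
  moreover have "map fst ps \<in> words l"
    using leaves_Bullet_iff[OF ps(2) ne] S ps(1,3) by (simp add: bullet_paths_def)
  ultimately show "S \<in> pgraph u ` path_steps n l u v"
    using ps by (auto simp: path_steps_def)
next
  fix S assume "S \<in> pgraph u ` path_steps n l u v"
  then obtain ps where ps: "ps \<in> path_steps n l u v" "S = pgraph u ps" by blast
  then have "ps \<noteq> []" using l by (auto simp: path_steps_def)
  then show "S \<in> {S \<in> bullet_paths l. dverts S \<subseteq> {..<n} \<and> leaves S = {u, v}}"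
    using ps l pgraph_in_bullet_paths[of u ps l] leaves_pgraph[of u ps]
    by (auto simp: path_steps_def)
qed

text \<open>The factor 2 comes from \<open>beta_J_eq\<close>: the copies with prescribed ends are in
  bijection with oriented paths, whereas \<open>beta_J\<close> is only half of the sum over
  words.\<close>

lemma Phi_eq:
  assumes l: "l \<ge> 1"
  shows "Phi n l lam mu rho X Y xi u v =
    2 / (real n powr (real l / 2 - 1) * beta_words lam mu rho l) *
    (\<Sum>ps\<in>path_steps n l u v. xiw lam mu rho Bullet (map fst ps) *
       (1 / (real (num_colorings l) * kappa l) *
          (\<Sum>k<num_colorings l. chi (xi k) (set (pverts u ps)) * f_S (pgraph u ps) X Y)))"
proof -
  define C where "C = 1 / (real (num_colorings l) * kappa l)"
  define g where "g S = (\<Sum>k<num_colorings l. chi (xi k) (dverts S) * f_S S X Y)" for S :: "nat dgraph"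
  define SS where "SS = {S \<in> bullet_paths l. dverts S \<subseteq> {..<n} \<and> leaves S = {u, v}}"
  have fin: "finite SS" unfolding SS_def bullet_paths_leaves_eq[OF l] by simp
  have set: "{S. decorated_graph S \<and> dverts S \<subseteq> {..<n} \<and> dg_iso S (rep c) \<and> leaves S = {u, v}} =
     {S \<in> SS. iso_rel `` {S} = c}" if c: "c \<in> path_classes l" for c
  proof (intro set_eqI iffI)
    fix S assume S: "S \<in> {S. decorated_graph S \<and> dverts S \<subseteq> {..<n} \<and> dg_iso S (rep c) \<and> leaves S = {u, v}}"
    then have "(rep c, S) \<in> iso_rel"
      using bullet_paths_decorated[OF rep_path_class(1)[OF c l]] by (auto simp: iso_rel_def intro: dg_iso_sym)
    then have "S \<in> bullet_paths l" using bullet_paths_iso(1)[OF rep_path_class(1)[OF c l] _ l] by blast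
    then show "S \<in> {S \<in> SS. iso_rel `` {S} = c}"
      using S iso_rep_iff[OF c l] by (auto simp: SS_def)
  next
    fix S assume S: "S \<in> {S \<in> SS. iso_rel `` {S} = c}"
    then have "decorated_graph S" using bullet_paths_decorated by (auto simp: SS_def)
    with S show "S \<in> {S. decorated_graph S \<and> dverts S \<subseteq> {..<n} \<and> dg_iso S (rep c) \<and> leaves S = {u, v}}"
      using iso_rep_iff[OF c l] by (auto simp: SS_def)
  qed
  have "(\<Sum>c\<in>path_classes l. Xi_weight lam mu rho (rep c) * (C *
         (\<Sum>k<num_colorings l.
            \<Sum>S | decorated_graph S \<and> dverts S \<subseteq> {..<n} \<and> dg_iso S (rep c) \<and> leaves S = {u, v}.
              chi (xi k) (dverts S) * f_S S X Y))) =
     (\<Sum>c\<in>path_classes l. \<Sum>S\<in>{S \<in> SS. iso_rel `` {S} = c}. Xi_weight lam mu rho S * (C * g S))"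
  proof (rule sum.cong[OF refl])
    fix c assume c: "c \<in> path_classes l"
    have X: "Xi_weight lam mu rho S = Xi_weight lam mu rho (rep c)" if "S \<in> {S \<in> SS. iso_rel `` {S} = c}" for S
    proof -
      have b: "S \<in> bullet_paths l" using that by (simp add: SS_def)
      then have "dg_iso S (rep c)" using iso_rep_iff[OF c l bullet_paths_decorated[OF b]] that by simp
      then have "(S, rep c) \<in> iso_rel"
        using bullet_paths_decorated b rep_path_class(1)[OF c l] by (auto simp: iso_rel_def)
      from bullet_paths_iso(2)[OF b this l] show ?thesis by simp
    qed
    show "Xi_weight lam mu rho (rep c) * (C *
         (\<Sum>k<num_colorings l.
            \<Sum>S | decorated_graph S \<and> dverts S \<subseteq> {..<n} \<and> dg_iso S (rep c) \<and> leaves S = {u, v}.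
              chi (xi k) (dverts S) * f_S S X Y)) =
       (\<Sum>S\<in>{S \<in> SS. iso_rel `` {S} = c}. Xi_weight lam mu rho S * (C * g S))"
      unfolding set[OF c] g_def
      by (subst sum.swap) (simp add: X sum_distrib_left)
  qed
  \<comment> \<open>The copies are partitioned by their classes, so the double sum is a single sum
    over copies.\<close>
  also have "\<dots> = (\<Sum>S\<in>SS. Xi_weight lam mu rho S * (C * g S))"
    by (rule sum.group) (use fin finite_path_classes[OF l] class_in_path_classes in \<open>auto simp: SS_def\<close>)
  also have "\<dots> = (\<Sum>ps\<in>path_steps n l u v. Xi_weight lam mu rho (pgraph u ps) * (C * g (pgraph u ps)))"
    unfolding SS_def bullet_paths_leaves_eq[OF l]
    by (subst sum.reindex) (auto simp: inj_on_def path_steps_def dest: pgraph_inj)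
  also have "\<dots> = (\<Sum>ps\<in>path_steps n l u v. xiw lam mu rho Bullet (map fst ps) * (C * g (pgraph u ps)))"
  proof (rule sum.cong[OF refl])
    fix ps assume "ps \<in> path_steps n l u v"
    then have "distinct (pverts u ps)" "ps \<noteq> []" "map fst ps \<in> words l"
      using l by (auto simp: path_steps_def)
    then show "Xi_weight lam mu rho (pgraph u ps) * (C * g (pgraph u ps)) =
       xiw lam mu rho Bullet (map fst ps) * (C * g (pgraph u ps))"
      by (simp add: Xi_weight_pgraph_word)
  qed
  finally show ?thesis
    unfolding Phi_def C_def[symmetric] g_def beta_J_eq[OF l] by (simp add: C_def)
qed

section \<open>Moments of the model\<close>

text \<open>A key names one noise entry: the edge gives the position, the decoration tells whether
  the entry belongs to \<open>W\<close> or to \<open>Z\<close>.\<close>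

type_synonym key = "nat set \<times> decoration"

lemma pair_prob_product:
  fixes f :: "'a \<Rightarrow> real" and g :: "'b \<Rightarrow> real"
  assumes "prob_space M" "prob_space N" and f: "integrable M f" and g: "integrable N g"
  shows "integrable (M \<Otimes>\<^sub>M N) (\<lambda>z. f (fst z) * g (snd z))"
    and "(\<integral>z. f (fst z) * g (snd z) \<partial>(M \<Otimes>\<^sub>M N)) = (\<integral>x. f x \<partial>M) * (\<integral>y. g y \<partial>N)"
proof -
  interpret M: prob_space M by fact
  interpret N: prob_space N by fact
  interpret pair_sigma_finite M N ..
  have [measurable]: "f \<in> borel_measurable M" "g \<in> borel_measurable N" using f g by auto
  show i: "integrable (M \<Otimes>\<^sub>M N) (\<lambda>z. f (fst z) * g (snd z))"
  proof (rule Fubini_integrable)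
    show "integrable M (\<lambda>x. \<integral>y. norm (f (fst (x, y)) * g (snd (x, y))) \<partial>N)"
      using f g by (simp add: abs_mult integrable_mult_left)
    show "AE x in M. integrable N (\<lambda>y. f (fst (x, y)) * g (snd (x, y)))"
      using g by simp
  qed measurable
  have "(\<integral>z. f (fst z) * g (snd z) \<partial>(M \<Otimes>\<^sub>M N)) = (\<integral>x. (\<integral>y. f x * g y \<partial>N) \<partial>M)"
    using integral_fst'[OF i] by simp
  then show "(\<integral>z. f (fst z) * g (snd z) \<partial>(M \<Otimes>\<^sub>M N)) = (\<integral>x. f x \<partial>M) * (\<integral>y. g y \<partial>N)"
    by simp
qed

section \<open>Moments of noise and spikes\<close>

definition std_gauss :: "real measure" where
  "std_gauss = density lborel (\<lambda>r. ennreal (normal_density 0 1 r))"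

text \<open>Exponents up to 2 suffice, since each of two paths uses a noise entry at most
  once.\<close>

lemma std_gauss_moment:
  assumes "k \<le> 2"
  shows "has_bochner_integral std_gauss (\<lambda>r. r ^ k) (if k = 1 then 0 else 1)"
proof -
  have "has_bochner_integral lborel (\<lambda>r. normal_density 0 1 r * r ^ k) (if k = 1 then 0 else 1)"
  proof -
    consider "k = 0" | "k = 1" | "k = 2" using assms by linarith
    then show ?thesis
    proof cases
      case 1
      then show ?thesis using normal_moment_even[of 1 0 0] by simp
    next
      case 2
      then show ?thesis using normal_moment_odd[of 1 0 0] by simp
    next
      case 3
      then show ?thesis using normal_moment_even[of 1 0 1] by simp
    qed
  qed
  then show ?thesis
    unfolding std_gauss_def by (intro has_bochner_integral_density) (auto simp: normal_density_nonneg)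
qed

definition wigner_coord :: "nat \<times> nat \<Rightarrow> real measure" where
  "wigner_coord e = density lborel (\<lambda>r. ennreal (normal_density 0 (sqrt (1 + of_bool (fst e = snd e))) r))"

definition wigner_index :: "nat \<Rightarrow> (nat \<times> nat) set" where
  "wigner_index n = {(i, j). i \<le> j \<and> j < n}"

lemma finite_wigner_index [simp]: "finite (wigner_index n)"
  by (rule finite_subset[of _ "{..<n} \<times> {..<n}"]) (auto simp: wigner_index_def)

lemma wigner_law_eq: "wigner_law n = PiM (wigner_index n) wigner_coord"
  unfolding wigner_law_def wigner_index_def wigner_coord_def ..

lemma prob_space_wigner_coord: "prob_space (wigner_coord e)"
  unfolding wigner_coord_def by (rule prob_space_normal_density) (simp add: add_pos_nonneg)

lemma prob_space_wigner_law: "prob_space (wigner_law n)"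
  unfolding wigner_law_eq by (rule prob_space_PiM) (rule prob_space_wigner_coord)

definition pair_sets :: "nat \<Rightarrow> nat set set" where
  "pair_sets n = {e. e \<subseteq> {..<n} \<and> card e = 2}"

lemma finite_pair_sets [simp]: "finite (pair_sets n)"
  by (rule finite_subset[of _ "Pow {..<n}"]) (auto simp: pair_sets_def)

lemma pair_setsE:
  assumes "e \<in> pair_sets n"
  obtains i j where "i < j" "j < n" "e = {i, j}" "Min e = i" "Max e = j"
proof -
  have e2: "\<exists>a b. e = {a, b} \<and> a \<noteq> b" and sub: "e \<subseteq> {..<n}"
    using assms by (auto simp: pair_sets_def card_2_iff)
  have "\<exists>i j. e = {i, j} \<and> i < j"
    using e2 by (metis insert_commute linorder_neqE_nat)
  then obtain i j where "e = {i, j}" "i < j" by blast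
  then show thesis using sub by (intro that[of i j]) auto
qed

lemma inj_on_min_max: "inj_on (\<lambda>e. (Min e, Max e)) (pair_sets n)"
  by (rule inj_onI) (metis pair_setsE prod.inject)

text \<open>By independence the mean factorises over the entries. An entry in exactly one of the two
  sets occurs to the first power and annihilates the product; all others contribute 1.\<close>

lemma wigner_monomial:
  assumes "A \<subseteq> pair_sets n" "B \<subseteq> pair_sets n"
  shows "has_bochner_integral (wigner_law n)
    (\<lambda>W. (\<Prod>e\<in>A. W (Min e, Max e)) * (\<Prod>e\<in>B. W (Min e, Max e))) (of_bool (A = B))"
proof -
  let ?p = "\<lambda>e::nat set. (Min e, Max e)" and ?I = "wigner_index n"
  define m where "m i = (of_bool (i \<in> ?p ` A) + of_bool (i \<in> ?p ` B) :: nat)" for i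
  interpret product_sigma_finite wigner_coord
    by (intro product_sigma_finite.intro prob_space_imp_sigma_finite prob_space_wigner_coord)
  have inI: "?p e \<in> ?I" if "e \<in> pair_sets n" for e
    using that by (auto elim!: pair_setsE simp: wigner_index_def)
  \<comment> \<open>Edges have two distinct ends, so only off-diagonal entries occur and their
    variance is 1.\<close>
  have offdiag: "wigner_coord i = std_gauss" if "i \<in> ?p ` A \<or> i \<in> ?p ` B" for i
    using that assms by (force elim!: pair_setsE simp: wigner_coord_def std_gauss_def)
  have coord: "has_bochner_integral (wigner_coord i) (\<lambda>r. r ^ m i) (of_bool (i \<in> ?p ` A \<longleftrightarrow> i \<in> ?p ` B))" for i
  proof (cases "i \<in> ?p ` A \<or> i \<in> ?p ` B")
    case True
    have "m i \<le> 2" by (simp add: m_def)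
    from std_gauss_moment[OF this]
    have "has_bochner_integral (wigner_coord i) (\<lambda>r. r ^ m i) (if m i = 1 then 0 else 1)"
      using offdiag[OF True] by simp
    also have "(if m i = 1 then 0 else 1 :: real) = of_bool (i \<in> ?p ` A \<longleftrightarrow> i \<in> ?p ` B)"
      using True by (auto simp: m_def)
    finally show ?thesis .
  next
    case False
    interpret prob_space "wigner_coord i" by (rule prob_space_wigner_coord)
    show ?thesis using False by (simp add: m_def prob_space has_bochner_integral_iff)
  qed
  have reidx: "(\<Prod>e\<in>S. W (?p e)) = (\<Prod>i\<in>?I. W i ^ of_bool (i \<in> ?p ` S))"
    if "S \<subseteq> pair_sets n" for S and W :: "nat \<times> nat \<Rightarrow> real"
  proof -
    have "(\<Prod>e\<in>S. W (?p e)) = (\<Prod>i\<in>?p ` S. W i)"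
      using inj_on_subset[OF inj_on_min_max that] by (simp add: prod.reindex)
    also have "\<dots> = (\<Prod>i\<in>?p ` S. W i ^ of_bool (i \<in> ?p ` S))" by (rule prod.cong) auto
    also have "\<dots> = (\<Prod>i\<in>?I. W i ^ of_bool (i \<in> ?p ` S))"
      by (rule prod.mono_neutral_left) (use that inI in auto)
    finally show ?thesis .
  qed
  have eq: "(\<Prod>e\<in>A. W (?p e)) * (\<Prod>e\<in>B. W (?p e)) = (\<Prod>i\<in>?I. W i ^ m i)" for W :: "nat \<times> nat \<Rightarrow> real"
    unfolding reidx[OF assms(1)] reidx[OF assms(2)] m_def by (simp add: prod.distrib power_add)
  have AB: "(\<forall>i\<in>?I. i \<in> ?p ` A \<longleftrightarrow> i \<in> ?p ` B) \<longleftrightarrow> A = B"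
  proof
    assume *: "\<forall>i\<in>?I. i \<in> ?p ` A \<longleftrightarrow> i \<in> ?p ` B"
    have "?p ` A \<subseteq> ?I" "?p ` B \<subseteq> ?I" using inI assms by blast+
    then have "?p ` A = ?p ` B" using * by blast
    then show "A = B" using inj_on_image_eq_iff[OF inj_on_min_max assms] by simp
  qed simp
  have "integrable (PiM ?I wigner_coord) (\<lambda>W. \<Prod>i\<in>?I. W i ^ m i)"
    by (rule product_integrable_prod) (use coord in \<open>auto simp: has_bochner_integral_iff\<close>)
  moreover have "(\<integral>W. (\<Prod>i\<in>?I. W i ^ m i) \<partial>PiM ?I wigner_coord) =
      (\<Prod>i\<in>?I. of_bool (i \<in> ?p ` A \<longleftrightarrow> i \<in> ?p ` B))"
    by (subst product_integral_prod) (use coord in \<open>auto simp: has_bochner_integral_iff\<close>)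
  moreover have "(\<Prod>i\<in>?I. of_bool (i \<in> ?p ` A \<longleftrightarrow> i \<in> ?p ` B)) = (of_bool (A = B) :: real)"
  proof (cases "A = B")
    case False
    then have "\<exists>i\<in>?I. of_bool (i \<in> ?p ` A \<longleftrightarrow> i \<in> ?p ` B) = (0::real)" using AB by auto
    then show ?thesis using False by (simp add: prod_zero)
  qed simp
  ultimately show ?thesis unfolding eq wigner_law_eq by (simp add: has_bochner_integral_iff)
qed

definition valid_keys :: "nat \<Rightarrow> key set \<Rightarrow> bool" where
  "valid_keys n K \<longleftrightarrow> fst ` K \<subseteq> pair_sets n"

lemma valid_keys_subset: "valid_keys n K \<Longrightarrow> L \<subseteq> K \<Longrightarrow> valid_keys n L"
  by (auto simp: valid_keys_def)

lemma valid_keys_finite: "valid_keys n K \<Longrightarrow> finite K"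
  by (rule finite_subset[of _ "pair_sets n \<times> UNIV"]) (force simp: valid_keys_def)+

definition noise :: "(nat \<times> nat \<Rightarrow> real) \<Rightarrow> (nat \<times> nat \<Rightarrow> real) \<Rightarrow> key \<Rightarrow> real" where
  "noise W Z k = (case snd k of Bullet \<Rightarrow> W | Circ \<Rightarrow> Z) (Min (fst k), Max (fst k))"

lemma prod_keys_split:
  fixes f :: "key \<Rightarrow> 'c::comm_monoid_mult"
  assumes "finite K"
  shows "(\<Prod>k\<in>K. f k) = (\<Prod>e\<in>{e. (e, Bullet) \<in> K}. f (e, Bullet)) * (\<Prod>e\<in>{e. (e, Circ) \<in> K}. f (e, Circ))"
proof -
  let ?A = "{e. (e, Bullet) \<in> K}" and ?B = "{e. (e, Circ) \<in> K}"
  have K: "K = (\<lambda>e. (e, Bullet)) ` ?A \<union> (\<lambda>e. (e, Circ)) ` ?B"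
  proof (intro set_eqI iffI)
    fix k assume "k \<in> K"
    then show "k \<in> (\<lambda>e. (e, Bullet)) ` ?A \<union> (\<lambda>e. (e, Circ)) ` ?B"
      by (cases k; cases "snd k") auto
  qed auto
  have fin: "finite ?A" "finite ?B"
    by (rule finite_subset[of _ "fst ` K"], force, simp add: assms)+
  have "(\<Prod>k\<in>K. f k) = (\<Prod>k\<in>(\<lambda>e. (e, Bullet)) ` ?A \<union> (\<lambda>e. (e, Circ)) ` ?B. f k)"
    using K by simp
  also have "\<dots> = (\<Prod>k\<in>(\<lambda>e. (e, Bullet)) ` ?A. f k) * (\<Prod>k\<in>(\<lambda>e. (e, Circ)) ` ?B. f k)"
    by (rule prod.union_disjoint) (use fin in auto)
  finally show ?thesis by (simp add: prod.reindex inj_on_def)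
qed

definition co :: "decoration \<Rightarrow> real \<times> real \<Rightarrow> real" where
  "co b z = (case b of Bullet \<Rightarrow> fst z | Circ \<Rightarrow> snd z)"

definition sig :: "nat \<Rightarrow> real \<Rightarrow> real \<Rightarrow> (nat \<Rightarrow> real \<times> real) \<Rightarrow> key \<Rightarrow> real" where
  "sig n lam mu s k = dweight lam mu (snd k) / sqrt (real n) * (\<Prod>v\<in>fst k. co (snd k) (s v))"

text \<open>The exponent with which the spike coordinate of type \<open>b\<close> at
  \<open>v\<close> occurs in the product of the signals over \<open>K\<close>.\<close>

definition bdeg :: "key set \<Rightarrow> decoration \<Rightarrow> nat \<Rightarrow> nat" where
  "bdeg K b v = card {e. (e, b) \<in> K \<and> v \<in> e}"

lemma finite_letter_keys: "finite K \<Longrightarrow> finite {e. (e, b) \<in> K \<and> P e}"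
  by (rule finite_subset[of _ "fst ` K"]) force+

lemma bdeg_mono: "finite L \<Longrightarrow> K \<subseteq> L \<Longrightarrow> bdeg K b v \<le> bdeg L b v"
  unfolding bdeg_def by (rule card_mono) (auto simp: finite_letter_keys)

text \<open>Exchanging edges and vertices collects the powers of the spike at every vertex;
  afterwards the mean over the independent spikes factorises.\<close>

lemma prod_sig:
  assumes "valid_keys n K"
  shows "(\<Prod>k\<in>K. sig n lam mu s k) =
    (\<Prod>k\<in>K. dweight lam mu (snd k) / sqrt (real n)) *
    (\<Prod>v<n. fst (s v) ^ bdeg K Bullet v * snd (s v) ^ bdeg K Circ v)"
proof -
  have fin: "finite K" using valid_keys_finite[OF assms] .
  have *: "(\<Prod>e\<in>{e. (e, b) \<in> K}. \<Prod>v\<in>e. g v) = (\<Prod>v<n. g v ^ bdeg K b v)"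
    for b and g :: "nat \<Rightarrow> real"
  proof -
    let ?E = "{e. (e, b) \<in> K}"
    have finE: "finite ?E" by (rule finite_subset[of _ "fst ` K"], force, simp add: fin)
    have sub: "e \<subseteq> {..<n}" if "e \<in> ?E" for e
      using that assms unfolding valid_keys_def pair_sets_def by force
    have "(\<Prod>e\<in>?E. \<Prod>v\<in>e. g v) = (\<Prod>e\<in>?E. \<Prod>v<n. if v \<in> e then g v else 1)"
    proof (rule prod.cong[OF refl])
      fix e assume "e \<in> ?E"
      from sub[OF this] show "(\<Prod>v\<in>e. g v) = (\<Prod>v<n. if v \<in> e then g v else 1)"
        by (simp add: prod.inter_restrict[symmetric] Int_absorb1)
    qed
    also have "\<dots> = (\<Prod>v<n. \<Prod>e\<in>?E. if v \<in> e then g v else 1)" by (rule prod.swap)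
    also have "\<dots> = (\<Prod>v<n. g v ^ bdeg K b v)"
    proof (rule prod.cong[OF refl])
      fix v
      have "(\<Prod>e\<in>?E. if v \<in> e then g v else 1) = (\<Prod>e\<in>{e \<in> ?E. v \<in> e}. g v)"
        by (rule prod.inter_filter[OF finE, symmetric])
      then show "(\<Prod>e\<in>?E. if v \<in> e then g v else 1) = g v ^ bdeg K b v"
        by (simp add: bdeg_def)
    qed
    finally show ?thesis .
  qed
  have "(\<Prod>k\<in>K. \<Prod>v\<in>fst k. co (snd k) (s v)) =
      (\<Prod>v<n. fst (s v) ^ bdeg K Bullet v) * (\<Prod>v<n. snd (s v) ^ bdeg K Circ v)"
    by (subst prod_keys_split[OF fin]) (simp add: co_def *)
  then show ?thesis unfolding sig_def prod.distrib[symmetric] by (simp only: prod.distrib)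
qed

definition noise_part :: "key set \<Rightarrow> key set \<Rightarrow> decoration \<Rightarrow> (nat \<times> nat \<Rightarrow> real) \<Rightarrow> real" where
  "noise_part K L b W = (\<Prod>e\<in>{e. (e, b) \<in> K}. W (Min e, Max e)) * (\<Prod>e\<in>{e. (e, b) \<in> L}. W (Min e, Max e))"

text \<open>\<open>W\<close> and \<open>Z\<close> are independent with the same law, so the
  \<open>Circ\<close> part can be integrated over the same measure as the \<open>Bullet\<close>
  part. Both integrals are nonzero only if the sets agree for each decoration.\<close>

lemma noise_parts:
  assumes K: "valid_keys n K" and L: "valid_keys n L"
  shows "(\<Prod>k\<in>K. noise W Z k) * (\<Prod>k\<in>L. noise W Z k) =
      noise_part K L Bullet W * noise_part K L Circ Z"
    and "integrable (wigner_law n) (noise_part K L b)"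
    and "(\<integral>W. noise_part K L Bullet W \<partial>wigner_law n) * (\<integral>W. noise_part K L Circ W \<partial>wigner_law n) =
      of_bool (K = L)"
proof -
  let ?e = "\<lambda>b K. {e. (e, b) \<in> (K :: key set)}"
  have sub: "?e b K \<subseteq> pair_sets n" "?e b L \<subseteq> pair_sets n" for b
    using assms by (force simp: valid_keys_def)+
  show "(\<Prod>k\<in>K. noise W Z k) * (\<Prod>k\<in>L. noise W Z k) =
      noise_part K L Bullet W * noise_part K L Circ Z"
    unfolding prod_keys_split[OF valid_keys_finite[OF K]] prod_keys_split[OF valid_keys_finite[OF L]]
    by (simp add: noise_def noise_part_def)
  have f: "integrable (wigner_law n) (noise_part K L b)"
    "(\<integral>W. noise_part K L b W \<partial>wigner_law n) = of_bool (?e b K = ?e b L)" for b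
    using wigner_monomial[OF sub, of b b] unfolding noise_part_def by (auto simp: has_bochner_integral_iff)
  have "(?e Bullet K = ?e Bullet L \<and> ?e Circ K = ?e Circ L) \<longleftrightarrow> K = L"
  proof
    assume *: "?e Bullet K = ?e Bullet L \<and> ?e Circ K = ?e Circ L"
    have "(e, b) \<in> K \<longleftrightarrow> (e, b) \<in> L" for e b using * by (cases b) auto
    then show "K = L" by auto
  qed simp
  then show "(\<integral>W. noise_part K L Bullet W \<partial>wigner_law n) * (\<integral>W. noise_part K L Circ W \<partial>wigner_law n) =
      of_bool (K = L)"
    unfolding f by (simp add: of_bool_conj[symmetric] del: of_bool_conj)
  show "integrable (wigner_law n) (noise_part K L b)" by (rule f)
qed

lemma prob_space_coloring_law: "prob_space (coloring_law n l)"
  unfolding coloring_law_def by (intro prob_space_PiM prob_space_measure_pmf)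

lemma prob_space_spikes:
  "spike_prior rho C prior \<Longrightarrow> prob_space (PiM {..<n} (\<lambda>_. prior))"
  by (intro prob_space_PiM) (simp add: spike_prior_def)

lemma model_product:
  assumes sp: "prob_space (PiM {..<n} (\<lambda>_. prior))"
    and f: "integrable (PiM {..<n} (\<lambda>_. prior)) f1" "integrable (wigner_law n) f2"
      "integrable (wigner_law n) f3" "integrable (coloring_law n l) f4"
  shows "integrable (model_law prior n l) (\<lambda>(s, W, Z, xi). f1 s * (f2 W * (f3 Z * f4 xi)) :: real)"
    and "(\<integral>om. (\<lambda>(s, W, Z, xi). f1 s * (f2 W * (f3 Z * f4 xi))) om \<partial>model_law prior n l) =
      (\<integral>s. f1 s \<partial>PiM {..<n} (\<lambda>_. prior)) * ((\<integral>W. f2 W \<partial>wigner_law n) *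
        ((\<integral>W. f3 W \<partial>wigner_law n) * (\<integral>xi. f4 xi \<partial>coloring_law n l)))"
proof -
  let ?N = "wigner_law n" and ?Q = "coloring_law n l"
  note pN = prob_space_wigner_law[of n] and pQ = prob_space_coloring_law[of n l]
  have p1: "prob_space (?N \<Otimes>\<^sub>M ?Q)" by (rule prob_space_pair[OF pN pQ])
  have p2: "prob_space (?N \<Otimes>\<^sub>M (?N \<Otimes>\<^sub>M ?Q))" by (rule prob_space_pair[OF pN p1])
  note a = pair_prob_product[OF pN pQ f(3,4)]
  note b = pair_prob_product[OF pN p1 f(2) a(1)]
  note c = pair_prob_product[OF sp p2 f(1) b(1)]
  show "integrable (model_law prior n l) (\<lambda>(s, W, Z, xi). f1 s * (f2 W * (f3 Z * f4 xi)) :: real)"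
    using c(1) unfolding model_law_def by (simp add: case_prod_beta')
  show "(\<integral>om. (\<lambda>(s, W, Z, xi). f1 s * (f2 W * (f3 Z * f4 xi))) om \<partial>model_law prior n l) =
      (\<integral>s. f1 s \<partial>PiM {..<n} (\<lambda>_. prior)) * ((\<integral>W. f2 W \<partial>wigner_law n) *
        ((\<integral>W. f3 W \<partial>wigner_law n) * (\<integral>xi. f4 xi \<partial>coloring_law n l)))"
    using c(2) unfolding a(2) b(2) model_law_def by (simp add: case_prod_beta' a(2) b(2))
qed

definition prior_moment :: "(real \<times> real) measure \<Rightarrow> nat \<Rightarrow> nat \<Rightarrow> real" where
  "prior_moment prior a b = (\<integral>z. fst z ^ a * snd z ^ b \<partial>prior)"

text \<open>Everything is compared with the fourth power of the largest of \<open>1\<close>,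
  \<open>\<bar>x\<bar>\<close>, \<open>\<bar>y\<bar>\<close>, which is one of the three terms on the
  right.\<close>

lemma monomial_bound:
  fixes x y :: real
  assumes "a + b \<le> 4"
  shows "\<bar>x ^ a * y ^ b\<bar> \<le> 1 + x ^ 4 + y ^ 4"
proof -
  define m where "m = max 1 (max \<bar>x\<bar> \<bar>y\<bar>)"
  have m: "m \<ge> 1" "\<bar>x\<bar> \<le> m" "\<bar>y\<bar> \<le> m" by (auto simp: m_def)
  have "\<bar>x ^ a * y ^ b\<bar> = \<bar>x\<bar> ^ a * \<bar>y\<bar> ^ b" by (simp add: abs_mult power_abs)
  also have "\<dots> \<le> m ^ a * m ^ b" using m by (intro mult_mono power_mono) auto
  also have "\<dots> = m ^ (a + b)" by (simp add: power_add)
  also have "\<dots> \<le> m ^ 4" using m assms by (intro power_increasing) auto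
  also have "m ^ 4 \<le> 1 + x ^ 4 + y ^ 4"
  proof -
    have "m = 1 \<or> m = \<bar>x\<bar> \<or> m = \<bar>y\<bar>" by (auto simp: m_def max_def)
    then show ?thesis by (auto simp: power_abs[symmetric])
  qed
  finally show ?thesis .
qed

text \<open>The value \<open>1 + 2 * C\<close> is the constant called \<open>D\<close> in the
  estimates for pairs of paths.\<close>

lemma prior_moments:
  assumes sp: "spike_prior rho C prior" and ab: "a + b \<le> 4"
  shows "integrable prior (\<lambda>z. fst z ^ a * snd z ^ b)" "\<bar>prior_moment prior a b\<bar> \<le> 1 + 2 * C"
proof -
  interpret prob_space prior using sp by (simp add: spike_prior_def)
  have sets [measurable_cong]: "sets prior = sets borel" using sp by (simp add: spike_prior_def)
  have i: "integrable prior (\<lambda>z. 1 + fst z ^ 4 + snd z ^ 4)"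
    using sp by (auto simp: spike_prior_def)
  have [measurable]: "fst \<in> borel_measurable prior" "snd \<in> borel_measurable prior"
    unfolding measurable_cong_sets[OF sets refl]
    using measurable_fst[of "borel :: real measure" "borel :: real measure"]
      measurable_snd[of "borel :: real measure" "borel :: real measure"]
    unfolding borel_prod by blast+
  show int: "integrable prior (\<lambda>z. fst z ^ a * snd z ^ b)"
    by (rule Bochner_Integration.integrable_bound[OF i]) (use monomial_bound[OF ab] in \<open>auto intro!: AE_I2 order_trans[OF _ abs_ge_self]\<close>)
  have "\<bar>prior_moment prior a b\<bar> \<le> (\<integral>z. \<bar>fst z ^ a * snd z ^ b\<bar> \<partial>prior)"
    unfolding prior_moment_def by (rule integral_abs_bound)
  also have "\<dots> \<le> (\<integral>z. 1 + fst z ^ 4 + snd z ^ 4 \<partial>prior)"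
    by (rule integral_mono) (use int i monomial_bound[OF ab] in auto)
  also have "\<dots> = 1 + (\<integral>z. fst z ^ 4 \<partial>prior) + (\<integral>z. snd z ^ 4 \<partial>prior)"
    using sp by (simp add: spike_prior_def prob_space)
  also have "\<dots> \<le> 1 + 2 * C" using sp by (simp add: spike_prior_def)
  finally show "\<bar>prior_moment prior a b\<bar> \<le> 1 + 2 * C" .
qed

lemma prior_moment_values:
  assumes sp: "spike_prior rho C prior"
  shows "prior_moment prior 0 0 = 1" "prior_moment prior 2 0 = 1" "prior_moment prior 0 2 = 1"
    "prior_moment prior 1 1 = rho"
proof -
  interpret prob_space prior using sp by (simp add: spike_prior_def)
  show "prior_moment prior 0 0 = 1" "prior_moment prior 2 0 = 1" "prior_moment prior 0 2 = 1"
    "prior_moment prior 1 1 = rho"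
    using sp by (simp_all add: prior_moment_def spike_prior_def prob_space)
qed

lemma prior_moments_PiM:
  fixes a b :: "nat \<Rightarrow> nat"
  assumes sp: "spike_prior rho C prior" and ab: "\<And>v. v < n \<Longrightarrow> a v + b v \<le> 4"
  shows "integrable (PiM {..<n} (\<lambda>_. prior)) (\<lambda>s. \<Prod>v<n. fst (s v) ^ a v * snd (s v) ^ b v)"
    "(\<integral>s. (\<Prod>v<n. fst (s v) ^ a v * snd (s v) ^ b v) \<partial>PiM {..<n} (\<lambda>_. prior)) =
       (\<Prod>v<n. prior_moment prior (a v) (b v))"
proof -
  interpret prob_space prior using sp by (simp add: spike_prior_def)
  interpret product_sigma_finite "\<lambda>_::nat. prior"
    by (intro product_sigma_finite.intro prob_space_imp_sigma_finite prob_space_axioms)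
  note i = prior_moments(1)[OF sp ab]
  show "integrable (PiM {..<n} (\<lambda>_. prior)) (\<lambda>s. \<Prod>v<n. fst (s v) ^ a v * snd (s v) ^ b v)"
    using i by (intro product_integrable_prod[of "{..<n}" "\<lambda>v z. fst z ^ a v * snd z ^ b v"]) auto
  show "(\<integral>s. (\<Prod>v<n. fst (s v) ^ a v * snd (s v) ^ b v) \<partial>PiM {..<n} (\<lambda>_. prior)) =
       (\<Prod>v<n. prior_moment prior (a v) (b v))"
    unfolding prior_moment_def
    using i by (subst product_integral_prod[of "{..<n}" "\<lambda>v z. fst z ^ a v * snd z ^ b v"]) auto
qed

text \<open>The integrand is a polynomial in the spikes and the noise: expanding the edge products
  \<open>\<Prod>(sig + noise)\<close> leaves only the terms in which both paths use the same noise entries.\<close>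

lemma model_monomial:
  fixes lam mu :: real and g :: "nat \<Rightarrow> nat"
  assumes sp: "spike_prior rho C prior" and K: "valid_keys n K" and L: "valid_keys n L"
    and deg: "\<And>v. v < n \<Longrightarrow> bdeg K Bullet v + bdeg K Circ v + bdeg L Bullet v + bdeg L Circ v + g v \<le> 4"
    and q: "integrable (coloring_law n l) q"
  defines "J \<equiv> (\<lambda>(s, W, Z, xi). (\<Prod>k\<in>K. sig n lam mu s k + noise W Z k) *
      (\<Prod>k\<in>L. sig n lam mu s k + noise W Z k) * (\<Prod>v<n. fst (s v) ^ g v) * q xi)"
  shows "integrable (model_law prior n l) J"
    and "(\<integral>om. J om \<partial>model_law prior n l) =
      (\<Sum>N\<in>Pow (K \<inter> L). (\<Prod>k\<in>K - N. dweight lam mu (snd k) / sqrt (real n)) *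
         (\<Prod>k\<in>L - N. dweight lam mu (snd k) / sqrt (real n)) *
         (\<Prod>v<n. prior_moment prior (bdeg (K - N) Bullet v + bdeg (L - N) Bullet v + g v)
            (bdeg (K - N) Circ v + bdeg (L - N) Circ v))) * (\<integral>xi. q xi \<partial>coloring_law n l)"
proof -
  let ?S = "PiM {..<n} (\<lambda>_. prior)" and ?N = "wigner_law n" and ?Q = "coloring_law n l"
  have fK: "finite K" "finite L" using K L valid_keys_finite by auto
  define c where "c K = (\<Prod>k\<in>K. dweight lam mu (snd k) / sqrt (real n))" for K :: "key set"
  define mA where "mA A B v = bdeg (K - A) Bullet v + bdeg (L - B) Bullet v + g v" for A B v
  define mB where "mB A B v = bdeg (K - A) Circ v + bdeg (L - B) Circ v" for A B v
  define fs where "fs A B s = c (K - A) * c (L - B) * (\<Prod>v<n. fst (s v) ^ mA A B v * snd (s v) ^ mB A B v)"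
    for A B and s :: "nat \<Rightarrow> real \<times> real"
  define fn where "fn A B W Z = (\<Prod>k\<in>A. noise W Z k) * (\<Prod>k\<in>B. noise W Z k)" for A B W Z
  have J: "J (s, W, Z, xi) = (\<Sum>A\<in>Pow K. \<Sum>B\<in>Pow L. fs A B s * (fn A B W Z * q xi))" for s W Z xi
  proof -
    have P: "(\<Prod>k\<in>K. sig n lam mu s k + noise W Z k) =
        (\<Sum>A\<in>Pow K. (\<Prod>k\<in>A. noise W Z k) * (\<Prod>k\<in>K - A. sig n lam mu s k))"
      unfolding add.commute[of "sig _ _ _ _ _"] by (rule prod_add[OF fK(1)])
    have R: "(\<Prod>k\<in>L. sig n lam mu s k + noise W Z k) =
        (\<Sum>A\<in>Pow L. (\<Prod>k\<in>A. noise W Z k) * (\<Prod>k\<in>L - A. sig n lam mu s k))"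
      unfolding add.commute[of "sig _ _ _ _ _"] by (rule prod_add[OF fK(2)])
    have "J (s, W, Z, xi) = (\<Prod>k\<in>K. sig n lam mu s k + noise W Z k) *
        (\<Prod>k\<in>L. sig n lam mu s k + noise W Z k) * ((\<Prod>v<n. fst (s v) ^ g v) * q xi)"
      by (simp add: J_def mult.assoc)
    also have "\<dots> = (\<Sum>A\<in>Pow K. \<Sum>B\<in>Pow L.
        ((\<Prod>k\<in>A. noise W Z k) * (\<Prod>k\<in>K - A. sig n lam mu s k)) *
        ((\<Prod>k\<in>B. noise W Z k) * (\<Prod>k\<in>L - B. sig n lam mu s k)) * ((\<Prod>v<n. fst (s v) ^ g v) * q xi))"
      unfolding P R unfolding sum_product unfolding sum_distrib_right ..
    also have "\<dots> = (\<Sum>A\<in>Pow K. \<Sum>B\<in>Pow L. fs A B s * (fn A B W Z * q xi))"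
    proof (intro sum.cong refl)
      fix A B
      have vK: "valid_keys n (K - A)" "valid_keys n (L - B)"
        using K L by (auto intro: valid_keys_subset)
      show "((\<Prod>k\<in>A. noise W Z k) * (\<Prod>k\<in>K - A. sig n lam mu s k)) *
        ((\<Prod>k\<in>B. noise W Z k) * (\<Prod>k\<in>L - B. sig n lam mu s k)) * ((\<Prod>v<n. fst (s v) ^ g v) * q xi) =
        fs A B s * (fn A B W Z * q xi)"
        unfolding prod_sig[OF vK(1)] prod_sig[OF vK(2)] fs_def fn_def c_def mA_def mB_def
        by (simp add: power_add prod.distrib mult_ac)
    qed
    finally show ?thesis .
  qed
  \<comment> \<open>Removing noise edges only lowers the degrees, so every term of the expansion
    stays within the four available moments.\<close>
  have dle: "mA A B v + mB A B v \<le> 4" if "v < n" for A B v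
  proof -
    have mono: "bdeg (M - A) b v \<le> bdeg M b v" if "finite M" for M A b
      by (rule bdeg_mono[OF that]) auto
    show ?thesis
      using deg[OF that] mono[OF fK(1), of A Bullet] mono[OF fK(1), of A Circ]
        mono[OF fK(2), of B Bullet] mono[OF fK(2), of B Circ] by (simp add: mA_def mB_def)
  qed
  have fs: "integrable ?S (fs A B)"
    "(\<integral>s. fs A B s \<partial>?S) = c (K - A) * c (L - B) * (\<Prod>v<n. prior_moment prior (mA A B v) (mB A B v))" for A B
    unfolding fs_def using prior_moments_PiM[OF sp, of n "mA A B" "mB A B"] dle by simp_all
  have one: "integrable (model_law prior n l) (\<lambda>(s, W, Z, xi). fs A B s * (fn A B W Z * q xi))"
    "(\<integral>om. (\<lambda>(s, W, Z, xi). fs A B s * (fn A B W Z * q xi)) om \<partial>model_law prior n l) =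
       (\<integral>s. fs A B s \<partial>?S) * (of_bool (A = B) * (\<integral>xi. q xi \<partial>?Q))"
    if "A \<in> Pow K" "B \<in> Pow L" for A B
  proof -
    have v: "valid_keys n A" "valid_keys n B" using that K L by (auto intro: valid_keys_subset)
    note np = noise_parts[OF v]
    have eq: "(\<lambda>(s, W, Z, xi). fs A B s * (fn A B W Z * q xi)) =
        (\<lambda>(s, W, Z, xi). fs A B s * (noise_part A B Bullet W * (noise_part A B Circ Z * q xi)))"
      unfolding fn_def np(1) by (simp add: mult.assoc)
    note mp = model_product[OF prob_space_spikes[OF sp] fs(1) np(2) np(2) q, of A B Bullet Circ]
    show "integrable (model_law prior n l) (\<lambda>(s, W, Z, xi). fs A B s * (fn A B W Z * q xi))"
      unfolding eq by (rule mp(1))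
    show "(\<integral>om. (\<lambda>(s, W, Z, xi). fs A B s * (fn A B W Z * q xi)) om \<partial>model_law prior n l) =
       (\<integral>s. fs A B s \<partial>?S) * (of_bool (A = B) * (\<integral>xi. q xi \<partial>?Q))"
      unfolding eq mp(2) np(3)[symmetric] by (simp add: mult.assoc)
  qed
  show "integrable (model_law prior n l) J"
  proof -
    have "J = (\<lambda>om. \<Sum>A\<in>Pow K. \<Sum>B\<in>Pow L. (\<lambda>(s, W, Z, xi). fs A B s * (fn A B W Z * q xi)) om)"
      by (rule ext) (auto simp: J)
    then show ?thesis using one(1) by (auto intro!: Bochner_Integration.integrable_sum)
  qed
  have "(\<integral>om. J om \<partial>model_law prior n l) =
     (\<integral>om. (\<Sum>A\<in>Pow K. \<Sum>B\<in>Pow L. (\<lambda>(s, W, Z, xi). fs A B s * (fn A B W Z * q xi)) om) \<partial>model_law prior n l)"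
    by (rule Bochner_Integration.integral_cong[OF refl]) (auto simp: J)
  also have "\<dots> = (\<Sum>A\<in>Pow K. \<Sum>B\<in>Pow L. (\<integral>s. fs A B s \<partial>?S) * (of_bool (A = B) * (\<integral>xi. q xi \<partial>?Q)))"
    using one by (subst Bochner_Integration.integral_sum; (intro Bochner_Integration.integrable_sum)?; (intro sum.cong refl)?)
      (auto simp: Bochner_Integration.integral_sum)
  also have "\<dots> = (\<Sum>A\<in>Pow K. \<Sum>B\<in>Pow L. if B = A then (\<integral>s. fs A A s \<partial>?S) * (\<integral>xi. q xi \<partial>?Q) else 0)"
    by (intro sum.cong refl) auto
  also have "\<dots> = (\<Sum>A\<in>Pow K. if A \<in> Pow L then (\<integral>s. fs A A s \<partial>?S) * (\<integral>xi. q xi \<partial>?Q) else 0)"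
    using fK by (intro sum.cong refl) (simp add: sum.delta)
  also have "\<dots> = (\<Sum>A\<in>Pow K \<inter> Pow L. (\<integral>s. fs A A s \<partial>?S) * (\<integral>xi. q xi \<partial>?Q))"
    using fK by (subst sum.inter_restrict) auto
  also have "Pow K \<inter> Pow L = Pow (K \<inter> L)" by auto
  finally show "(\<integral>om. J om \<partial>model_law prior n l) =
      (\<Sum>N\<in>Pow (K \<inter> L). (\<Prod>k\<in>K - N. dweight lam mu (snd k) / sqrt (real n)) *
         (\<Prod>k\<in>L - N. dweight lam mu (snd k) / sqrt (real n)) *
         (\<Prod>v<n. prior_moment prior (bdeg (K - N) Bullet v + bdeg (L - N) Bullet v + g v)
            (bdeg (K - N) Circ v + bdeg (L - N) Circ v))) * (\<integral>xi. q xi \<partial>coloring_law n l)"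
    by (simp add: fs sum_distrib_right c_def mA_def mB_def)
qed

section \<open>Random colourings\<close>

definition one_coloring :: "nat \<Rightarrow> nat \<Rightarrow> (nat \<Rightarrow> nat) measure" where
  "one_coloring n l = (\<Pi>\<^sub>M i\<in>{..<n}. measure_pmf (pmf_of_set {..l}))"

lemma coloring_law_eq: "coloring_law n l = PiM {..<num_colorings l} (\<lambda>_. one_coloring n l)"
  by (simp add: coloring_law_def one_coloring_def)

lemma prob_space_one_coloring: "prob_space (one_coloring n l)"
  unfolding one_coloring_def by (intro prob_space_PiM prob_space_measure_pmf)

lemma kappa_pos: "kappa l > 0"
  by (simp add: kappa_def)

lemma num_colorings_kappa: "real (num_colorings l) * kappa l \<ge> 1" "num_colorings l > 0"
proof -
  have "1 / kappa l \<le> real (num_colorings l)" unfolding num_colorings_def by linarith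
  then show "real (num_colorings l) * kappa l \<ge> 1" using kappa_pos[of l] by (simp add: field_simps)
  then show "num_colorings l > 0" by (cases "num_colorings l = 0") auto
qed

lemma measurable_chi:
  assumes "V \<subseteq> {..<n}"
  shows "(\<lambda>xi. chi xi V) \<in> borel_measurable (one_coloring n l)"
proof -
  have fin: "finite V" using assms finite_subset by blast
  have c: "(\<lambda>xi. real (xi i)) \<in> borel_measurable (one_coloring n l)" if "i \<in> V" for i
    unfolding one_coloring_def
    by (rule measurable_compose[OF measurable_component_singleton]) (use that assms in auto)
  have "{xi \<in> space (one_coloring n l). \<forall>i\<in>V. \<forall>j\<in>V. real (xi i) = real (xi j) \<longrightarrow> i = j} \<in>
      sets (one_coloring n l)"
    by (intro sets.sets_Collect_finite_All fin sets.sets_Collect_imp borel_measurable_eq c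
        sets.sets_Collect_const)
  then have "{xi \<in> space (one_coloring n l). inj_on xi V} \<in> sets (one_coloring n l)"
    by (simp add: inj_on_def)
  then show ?thesis unfolding chi_def by (intro measurable_If) auto
qed

lemma chi_bounds [simp]: "0 \<le> chi xi V" "chi xi V \<le> 1" "\<bar>chi xi V\<bar> \<le> 1"
  by (simp_all add: chi_def)

lemma integral_double_sum:
  fixes f :: "'a \<Rightarrow> 'b \<Rightarrow> 'c \<Rightarrow> real"
  assumes "\<And>i j. i \<in> A \<Longrightarrow> j \<in> B \<Longrightarrow> integrable M (f i j)"
  shows "integrable M (\<lambda>x. \<Sum>i\<in>A. \<Sum>j\<in>B. f i j x)"
    "(\<integral>x. (\<Sum>i\<in>A. \<Sum>j\<in>B. f i j x) \<partial>M) = (\<Sum>i\<in>A. \<Sum>j\<in>B. \<integral>x. f i j x \<partial>M)"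
proof -
  have *: "integrable M (\<lambda>x. \<Sum>j\<in>B. f i j x)" if "i \<in> A" for i
    using assms that by (intro Bochner_Integration.integrable_sum) auto
  show "integrable M (\<lambda>x. \<Sum>i\<in>A. \<Sum>j\<in>B. f i j x)"
    by (rule Bochner_Integration.integrable_sum) (rule *)
  have "(\<integral>x. (\<Sum>i\<in>A. \<Sum>j\<in>B. f i j x) \<partial>M) = (\<Sum>i\<in>A. \<integral>x. (\<Sum>j\<in>B. f i j x) \<partial>M)"
    by (rule Bochner_Integration.integral_sum) (rule *)
  also have "\<dots> = (\<Sum>i\<in>A. \<Sum>j\<in>B. \<integral>x. f i j x \<partial>M)"
    using assms by (intro sum.cong refl Bochner_Integration.integral_sum) auto
  finally show "(\<integral>x. (\<Sum>i\<in>A. \<Sum>j\<in>B. f i j x) \<partial>M) = (\<Sum>i\<in>A. \<Sum>j\<in>B. \<integral>x. f i j x \<partial>M)" .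
qed

lemma prod_of_bool: "finite A \<Longrightarrow> (\<Prod>x\<in>A. of_bool (P x) :: real) = of_bool (\<forall>x\<in>A. P x)"
  by (induction A rule: finite_induct) auto

text \<open>The indicator of injectivity is the sum, over the \<open>(l + 1)!\<close> injective
  colourings of \<open>V\<close>, of the event that this colouring occurs; by independence each has
  probability \<open>(l + 1) ^ -(l + 1)\<close>.\<close>

lemma integral_chi:
  assumes V: "V \<subseteq> {..<n}" "card V = l + 1"
  shows "integrable (one_coloring n l) (\<lambda>xi. chi xi V)"
    and "(\<integral>xi. chi xi V \<partial>one_coloring n l) = kappa l"
proof -
  let ?p = "measure_pmf (pmf_of_set {..l})" and ?F = "{f \<in> V \<rightarrow>\<^sub>E {..l}. inj_on f V}"
  interpret P: prob_space "one_coloring n l" by (rule prob_space_one_coloring)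
  interpret product_sigma_finite "\<lambda>_::nat. ?p"
    by (intro product_sigma_finite.intro prob_space_imp_sigma_finite prob_space_measure_pmf)
  have fin: "finite V" using V finite_subset by blast
  have finF: "finite ?F" using fin by (auto intro: finite_subset[OF _ finite_PiE[of V "\<lambda>_. {..l}"]])
  show "integrable (one_coloring n l) (\<lambda>xi. chi xi V)"
    by (rule P.integrable_const_bound[of _ 1]) (use measurable_chi[OF V(1)] in auto)
  \<comment> \<open>The value 1 outside \<open>V\<close> lets the product run over all
    \<open>n\<close> independent coordinates.\<close>
  define h where "h f v x = (if v \<in> V then of_bool (x = f v) else 1 :: real)" for f :: "nat \<Rightarrow> nat" and v x
  have hi: "integrable ?p (h f v)" for f v
    by (rule measure_pmf.integrable_const_bound[of _ 1]) (auto simp: h_def)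
  have hv: "(\<integral>x. h f v x \<partial>?p) = (if v \<in> V then 1 / (real l + 1) else 1)" if "f \<in> ?F" for f v
  proof (cases "v \<in> V")
    case True
    then have "f v \<le> l" using that by auto
    have "(\<integral>x. h f v x \<partial>?p) = (\<Sum>x\<in>{f v}. h f v x * pmf (pmf_of_set {..l}) x)"
      by (rule integral_measure_pmf_real) (auto simp: h_def True split: if_splits)
    also have "\<dots> = 1 / (real l + 1)" using True \<open>f v \<le> l\<close> by (simp add: h_def indicator_def add.commute)
    finally show ?thesis using True by simp
  qed (simp add: h_def)
  \<comment> \<open>The coordinates live on all natural numbers, so colours are bounded by
    \<open>l\<close> only almost everywhere, and the expansion below holds only there.\<close>
  have AE: "AE xi in one_coloring n l. \<forall>v\<in>V. xi v \<le> l"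
  proof (rule AE_finite_allI[OF fin])
    fix v assume "v \<in> V"
    then show "AE xi in one_coloring n l. xi v \<le> l"
      unfolding one_coloring_def
      by (intro AE_PiM_component prob_space_measure_pmf) (use V in \<open>auto simp: AE_measure_pmf_iff\<close>)
  qed
  have eq: "chi xi V = (\<Sum>f\<in>?F. \<Prod>v<n. h f v (xi v))" if "\<forall>v\<in>V. xi v \<le> l" for xi
  proof -
    have "(\<Prod>v<n. h f v (xi v)) = of_bool (f = restrict xi V)" if "f \<in> ?F" for f
    proof -
      have "(\<Prod>v<n. h f v (xi v)) = (\<Prod>v\<in>V. of_bool (xi v = f v))"
        unfolding h_def using V(1) by (simp add: prod.inter_restrict[symmetric] Int_absorb1)
      also have "\<dots> = of_bool (\<forall>v\<in>V. xi v = f v)"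
        by (rule prod_of_bool[OF fin])
      also have "(\<forall>v\<in>V. xi v = f v) \<longleftrightarrow> f = restrict xi V"
      proof
        assume eq: "\<forall>v\<in>V. xi v = f v"
        show "f = restrict xi V"
        proof
          fix v show "f v = restrict xi V v"
            using eq that by (cases "v \<in> V") (auto simp: PiE_arb[of f V "\<lambda>_. {..l}"])
        qed
      qed simp
      finally show ?thesis .
    qed
    then have "(\<Sum>f\<in>?F. \<Prod>v<n. h f v (xi v)) = (\<Sum>f\<in>?F. if f = restrict xi V then 1 else 0)"
      by (intro sum.cong) auto
    also have "\<dots> = (if restrict xi V \<in> ?F then 1 else 0)" using finF by (simp add: sum.delta')
    also have "restrict xi V \<in> ?F \<longleftrightarrow> inj_on xi V" using that by (auto simp: inj_on_def)
    finally show ?thesis by (simp add: chi_def)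
  qed
  have "(\<integral>xi. chi xi V \<partial>one_coloring n l) = (\<integral>xi. (\<Sum>f\<in>?F. \<Prod>v<n. h f v (xi v)) \<partial>one_coloring n l)"
  proof (rule integral_cong_AE)
    show "(\<lambda>xi. \<Sum>f\<in>?F. \<Prod>v<n. h f v (xi v)) \<in> borel_measurable (one_coloring n l)"
      unfolding one_coloring_def
      by (intro borel_measurable_sum borel_measurable_prod measurable_compose[OF measurable_component_singleton]) auto
    show "AE xi in one_coloring n l. chi xi V = (\<Sum>f\<in>?F. \<Prod>v<n. h f v (xi v))"
      using AE by (rule AE_mp) (use eq in auto)
  qed (rule measurable_chi[OF V(1)])
  also have "\<dots> = (\<Sum>f\<in>?F. \<integral>xi. (\<Prod>v<n. h f v (xi v)) \<partial>one_coloring n l)"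
    unfolding one_coloring_def by (intro Bochner_Integration.integral_sum product_integrable_prod hi) auto
  also have "\<dots> = (\<Sum>f\<in>?F. \<Prod>v<n. (if v \<in> V then 1 / (real l + 1) else 1))"
    unfolding one_coloring_def using hi hv by (intro sum.cong refl) (subst product_integral_prod, auto)
  also have "\<dots> = real (card ?F) * (1 / (real l + 1)) ^ (l + 1)"
    using V by (simp add: prod.inter_restrict[symmetric] Int_absorb1)
  also have "card ?F = (\<Prod>i\<in>{0..<l + 1}. (l + 1) - i)"
    using card_inj_on_subset_funcset[OF fin _ subset_refl, of "{..l}"] V by simp
  also have "(\<Prod>i\<in>{0..<l + 1}. (l + 1) - i) = fact (l + 1)"
    by (simp only: fact_prod_rev) simp
  finally show "(\<integral>xi. chi xi V \<partial>one_coloring n l) = kappa l"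
    by (simp only: kappa_def power_divide power_one of_nat_add of_nat_1 of_nat_fact
        times_divide_eq_right mult_1_right)
qed

definition color_weight :: "nat \<Rightarrow> (nat \<Rightarrow> nat \<Rightarrow> nat) \<Rightarrow> nat set \<Rightarrow> real" where
  "color_weight l xi V =
     1 / (real (num_colorings l) * kappa l) * (\<Sum>k<num_colorings l. chi (xi k) V)"

text \<open>With \<open>T = t * kappa\<close>, equal colourings contribute at most \<open>T\<close>
  and different ones, being independent, exactly \<open>kappa ^ 2\<close> each, hence together at
  most \<open>T ^ 2\<close>. The number of colourings is chosen so that \<open>T >= 1\<close>, and
  then \<open>(T + T ^ 2) / T ^ 2 <= 2\<close>.\<close>

lemma color_weight_moments:
  assumes V: "V \<subseteq> {..<n}" "card V = l + 1" and V': "V' \<subseteq> {..<n}" "card V' = l + 1"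
  shows "integrable (coloring_law n l) (\<lambda>xi. color_weight l xi V)"
    "(\<integral>xi. color_weight l xi V \<partial>coloring_law n l) = 1"
    "integrable (coloring_law n l) (\<lambda>xi. color_weight l xi V * color_weight l xi V')"
    "0 \<le> (\<integral>xi. color_weight l xi V * color_weight l xi V' \<partial>coloring_law n l)"
    "(\<integral>xi. color_weight l xi V * color_weight l xi V' \<partial>coloring_law n l) \<le> 2"
proof -
  let ?t = "num_colorings l" and ?Q = "coloring_law n l" and ?O = "one_coloring n l"
  interpret O: prob_space ?O by (rule prob_space_one_coloring)
  interpret Q: prob_space ?Q by (rule prob_space_coloring_law)
  interpret product_sigma_finite "\<lambda>_::nat. ?O"
    by (intro product_sigma_finite.intro prob_space_imp_sigma_finite prob_space_one_coloring)
  have meas: "(\<lambda>xi. chi (xi k) U) \<in> borel_measurable ?Q" if "k < ?t" "U \<subseteq> {..<n}" for k U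
    unfolding coloring_law_eq
    by (rule measurable_compose[OF measurable_component_singleton[of k] measurable_chi[OF that(2)]])
      (use that in auto)
  have int2: "integrable ?Q (\<lambda>xi. chi (xi k) V * chi (xi k') V')" if "k < ?t" "k' < ?t" for k k'
    by (rule Q.integrable_const_bound[of _ 1])
      (use that meas V V' in \<open>auto simp: abs_mult intro!: AE_I2 mult_le_one\<close>)
  have int1: "integrable ?Q (\<lambda>xi. chi (xi k) V)" if "k < ?t" for k
    by (rule Q.integrable_const_bound[of _ 1]) (use that meas V in auto)
  \<comment> \<open>Replacing the second factor by 1 for \<open>k' = k\<close> treats the single
    mean and the mixed mean of two independent colourings with one product formula.\<close>
  have val: "(\<integral>xi. chi (xi k) V * (if k' = k then 1 else chi (xi k') V') \<partial>?Q) =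
      (if k' = k then kappa l else kappa l * kappa l)" if "k < ?t" "k' < ?t" for k k'
  proof -
    define h where "h i x = (if i = k then chi x V else if i = k' then chi x V' else 1)" for i x
    have hi: "integrable ?O (h i)" for i
      using integral_chi(1)[OF V] integral_chi(1)[OF V'] unfolding h_def by (cases "i = k"; cases "i = k'") auto
    have hv: "(\<integral>x. h i x \<partial>?O) = (if i = k then kappa l else if i = k' then kappa l else 1)" for i
      using integral_chi(2)[OF V] integral_chi(2)[OF V'] unfolding h_def by (cases "i = k"; cases "i = k'") (auto simp: O.prob_space)
    have split: "(\<Prod>i<?t. g i) = g k * (if k' = k then 1 else g k')"
      if "\<And>i. i \<noteq> k \<Longrightarrow> i \<noteq> k' \<Longrightarrow> g i = 1" for g :: "nat \<Rightarrow> real"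
    proof -
      have "(\<Prod>i<?t. g i) = (\<Prod>i\<in>{k, k'}. g i)"
        by (rule prod.mono_neutral_right) (use \<open>k < ?t\<close> \<open>k' < ?t\<close> that in auto)
      then show ?thesis by auto
    qed
    have "(\<integral>xi. chi (xi k) V * (if k' = k then 1 else chi (xi k') V') \<partial>?Q) =
        (\<integral>xi. (\<Prod>i<?t. h i (xi i)) \<partial>?Q)"
      by (rule Bochner_Integration.integral_cong[OF refl]) (subst split, auto simp: h_def)
    also have "\<dots> = (\<Prod>i<?t. \<integral>x. h i x \<partial>?O)"
      unfolding coloring_law_eq by (rule product_integral_prod) (auto simp: hi)
    also have "\<dots> = (if k' = k then kappa l else kappa l * kappa l)"
      unfolding hv by (subst split) auto
    finally show ?thesis .
  qed
  define T where "T = real ?t * kappa l"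
  have T: "T \<ge> 1" using num_colorings_kappa by (simp add: T_def)
  show "integrable ?Q (\<lambda>xi. color_weight l xi V)"
    unfolding color_weight_def using int1 by (intro integrable_mult_right Bochner_Integration.integrable_sum) auto
  have "(\<integral>xi. color_weight l xi V \<partial>?Q) = 1 / T * (\<Sum>k<?t. \<integral>xi. chi (xi k) V \<partial>?Q)"
    unfolding color_weight_def T_def[symmetric] using int1 by (simp add: Bochner_Integration.integral_sum)
  also have "(\<Sum>k<?t. \<integral>xi. chi (xi k) V \<partial>?Q) = T"
    using val[of k k for k] by (simp add: T_def)
  finally show "(\<integral>xi. color_weight l xi V \<partial>?Q) = 1" using T by simp
  have cc: "color_weight l xi V * color_weight l xi V' =
      1 / T\<^sup>2 * (\<Sum>k<?t. \<Sum>k'<?t. chi (xi k) V * chi (xi k') V')" for xi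
    unfolding color_weight_def T_def[symmetric] by (simp add: sum_product power2_eq_square)
  show "integrable ?Q (\<lambda>xi. color_weight l xi V * color_weight l xi V')"
    unfolding cc using int2 by (intro integrable_mult_right Bochner_Integration.integrable_sum) auto
  show "0 \<le> (\<integral>xi. color_weight l xi V * color_weight l xi V' \<partial>?Q)"
    unfolding cc by (intro integral_nonneg_AE AE_I2 mult_nonneg_nonneg sum_nonneg) auto
  have "(\<integral>xi. color_weight l xi V * color_weight l xi V' \<partial>?Q) =
      1 / T\<^sup>2 * (\<Sum>k<?t. \<Sum>k'<?t. \<integral>xi. chi (xi k) V * chi (xi k') V' \<partial>?Q)"
    unfolding cc by (subst integral_mult_right_zero, subst integral_double_sum(2)) (use int2 in auto)
  also have "\<dots> \<le> 1 / T\<^sup>2 * (\<Sum>k<?t. \<Sum>k'<?t. (if k' = k then kappa l else 0) + kappa l * kappa l)"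
  proof (intro mult_left_mono sum_mono)
    fix k k' assume k: "k \<in> {..<?t}" "k' \<in> {..<?t}"
    show "(\<integral>xi. chi (xi k) V * chi (xi k') V' \<partial>?Q) \<le> (if k' = k then kappa l else 0) + kappa l * kappa l"
    proof (cases "k' = k")
      case True
      have "(\<integral>xi. chi (xi k) V * chi (xi k') V' \<partial>?Q) \<le> (\<integral>xi. chi (xi k) V \<partial>?Q)"
        by (rule integral_mono) (use int2 int1 k in \<open>auto intro: mult_left_le\<close>)
      also have "\<dots> = kappa l" using val[of k k] k by simp
      finally show ?thesis using True mult_pos_pos[OF kappa_pos kappa_pos, of l l] by simp
    next
      case False
      then show ?thesis using val[of k k'] k by simp
    qed
  qed simp
  also have "\<dots> = 1 / T\<^sup>2 * (T + T\<^sup>2)"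
    by (simp add: sum.distrib T_def power2_eq_square algebra_simps)
  also have "\<dots> \<le> 2" using T by (simp add: field_simps power2_eq_square)
  finally show "(\<integral>xi. color_weight l xi V * color_weight l xi V' \<partial>?Q) \<le> 2" .
qed

section \<open>Local factors of a pair of paths\<close>

text \<open>As \<open>path_steps\<close>, but without the condition on the end letters. The
  competing path is summed over this larger set, which the transfer recursion can handle step by
  step.\<close>

definition spath :: "nat \<Rightarrow> nat \<Rightarrow> nat \<Rightarrow> nat \<Rightarrow> step list \<Rightarrow> bool" where
  "spath n l u v ps \<longleftrightarrow> length ps = l \<and> set (pverts u ps) \<subseteq> {..<n} \<and> distinct (pverts u ps) \<and>
     last (pverts u ps) = v"

definition keys :: "nat \<Rightarrow> step list \<Rightarrow> key set" where
  "keys u ps = set (pedges u ps)"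

definition inc :: "key set \<Rightarrow> nat \<Rightarrow> key set" where
  "inc K x = {k \<in> K. x \<in> fst k}"

lemma finite_keys [simp]: "finite (keys u ps)"
  by (simp add: keys_def)

lemma card_keys: "spath n l u v ps \<Longrightarrow> card (keys u ps) = l"
  by (simp add: keys_def spath_def distinct_card distinct_pedges')

lemma valid_keys_path: "spath n l u v ps \<Longrightarrow> valid_keys n (keys u ps)"
  unfolding valid_keys_def pair_sets_def keys_def spath_def
  using pedges_subset pedges_card by fastforce

lemma bdeg_inc: "bdeg K b x = card {k \<in> inc K x. snd k = b}"
proof -
  have "{k \<in> inc K x. snd k = b} = (\<lambda>e. (e, b)) ` {e. (e, b) \<in> K \<and> x \<in> e}"
    by (auto simp: inc_def)
  then show ?thesis by (simp add: bdeg_def card_image inj_on_def)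
qed

lemma finite_inc [simp]: "finite K \<Longrightarrow> finite (inc K x)"
  by (simp add: inc_def)

lemma bdeg_total: "finite K \<Longrightarrow> bdeg K Bullet x + bdeg K Circ x = card (inc K x)"
proof -
  assume "finite K"
  then have "card ({k \<in> inc K x. snd k = Bullet} \<union> {k \<in> inc K x. snd k = Circ}) =
     card {k \<in> inc K x. snd k = Bullet} + card {k \<in> inc K x. snd k = Circ}"
    by (intro card_Un_disjoint) auto
  moreover have "{k \<in> inc K x. snd k = Bullet} \<union> {k \<in> inc K x. snd k = Circ} = inc K x"
    by (auto intro: decoration.exhaust)
  ultimately show ?thesis by (simp add: bdeg_inc)
qed

lemma spath_nth_eq_iff:
  "spath n l u v ps \<Longrightarrow> i \<le> l \<Longrightarrow> j \<le> l \<Longrightarrow> pverts u ps ! i = pverts u ps ! j \<longleftrightarrow> i = j"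
  by (simp add: spath_def nth_eq_iff_index_eq)

lemma spath_verts:
  assumes "spath n l u v ps"
  shows "set (pverts u ps) = (\<lambda>j. pverts u ps ! j) ` {..l}"
proof -
  have "length (pverts u ps) = Suc l" using assms by (simp add: spath_def)
  then show ?thesis by (auto simp: set_conv_nth less_Suc_eq_le)
qed

lemma spath_last: "spath n l u v ps \<Longrightarrow> pverts u ps ! l = v"
  unfolding spath_def by (metis length_pverts diff_Suc_1 last_conv_nth list.size(3) nat.distinct(1))

lemma keys_nth: "spath n l u v ps \<Longrightarrow> keys u ps = (\<lambda>i. pedges u ps ! i) ` {..<l}"
  by (auto simp: keys_def spath_def set_conv_nth)

lemma inc_path:
  assumes p: "spath n l u v ps" and j: "j \<le> l"
  shows "inc (keys u ps) (pverts u ps ! j) =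
    (if j < l then {pedges u ps ! j} else {}) \<union> (if 0 < j then {pedges u ps ! (j - 1)} else {})"
proof -
  have len: "length ps = l" using p by (simp add: spath_def)
  have "pverts u ps ! j \<in> fst (pedges u ps ! i) \<longleftrightarrow> i = j \<or> Suc i = j" if "i < l" for i
    using that j len spath_nth_eq_iff[OF p, of j i] spath_nth_eq_iff[OF p, of j "Suc i"]
    by (auto simp: pedges_nth)
  then have "inc (keys u ps) (pverts u ps ! j) =
      (\<lambda>i. pedges u ps ! i) ` {i. i < l \<and> (i = j \<or> Suc i = j)}"
    unfolding inc_def keys_nth[OF p] by auto
  also have "{i. i < l \<and> (i = j \<or> Suc i = j)} = (if j < l then {j} else {}) \<union> (if 0 < j then {j - 1} else {})"
    using j by auto
  finally show ?thesis by (simp add: image_Un)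
qed

lemma inc_outside:
  "x \<notin> set (pverts u ps) \<Longrightarrow> inc (keys u ps) x = {}"
  using pedges_subset by (fastforce simp: inc_def keys_def)

lemma card_inc_le:
  assumes p: "spath n l u v ps"
  shows "card (inc (keys u ps) x) \<le> 2"
proof (cases "x \<in> set (pverts u ps)")
  case True
  then obtain j where "j \<le> l" "x = pverts u ps ! j" using spath_verts[OF p] by auto
  then show ?thesis by (auto simp: inc_path[OF p] card_insert_if)
qed (simp add: inc_outside)

lemma pedges_nth_neq:
  "spath n l u v ps \<Longrightarrow> i < l \<Longrightarrow> j < l \<Longrightarrow> i \<noteq> j \<Longrightarrow> pedges u ps ! i \<noteq> pedges u ps ! j"
  by (simp add: spath_def nth_eq_iff_index_eq distinct_pedges')

lemma card_inc_interior:
  assumes p: "spath n l u v ps" and x: "x \<in> set (pverts u ps)" "x \<noteq> u" "x \<noteq> v"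
  shows "card (inc (keys u ps) x) = 2"
proof -
  obtain j where j: "j \<le> l" "x = pverts u ps ! j" using spath_verts[OF p] x by auto
  have "0 < j" using j x by (cases "j = 0") auto
  moreover have "j < l" using j x spath_last[OF p] by (cases "j = l") auto
  moreover from calculation have "pedges u ps ! j \<noteq> pedges u ps ! (j - 1)"
    by (intro pedges_nth_neq[OF p]) auto
  ultimately show ?thesis using j by (simp add: inc_path[OF p] card_insert_if)
qed

lemma card_inc_end:
  assumes p: "spath n l u v ps" and x: "x = u \<or> x = v"
  shows "card (inc (keys u ps) x) \<le> 1"
proof -
  have "x = pverts u ps ! 0 \<or> x = pverts u ps ! l" using x spath_last[OF p] by auto
  then show ?thesis using inc_path[OF p, of 0] inc_path[OF p, of l] by (auto simp: card_insert_if)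
qed

text \<open>The share of a single vertex in \<open>rho ^ card (diff_verts H)\<close>. It coincides
  with the mixed moment of the prior at an interior vertex of a path.\<close>

definition turn_weight :: "real \<Rightarrow> key set \<Rightarrow> nat \<Rightarrow> real" where
  "turn_weight rho K x = (if bdeg K Bullet x = 1 \<and> bdeg K Circ x = 1 then rho else 1)"

lemma turn_weight_bounds:
  assumes "0 < rho" "rho \<le> 1"
  shows "0 < turn_weight rho K x" "rho \<le> turn_weight rho K x" "turn_weight rho K x \<le> 1"
  using assms by (auto simp: turn_weight_def)

text \<open>In this form the weight is a product of local factors and can be compared with the
  moments edge by edge and vertex by vertex.\<close>

lemma Xi_weight_keys:
  assumes p: "spath n l u v ps"
  shows "Xi_weight lam mu rho (pgraph u ps) =
     (\<Prod>k\<in>keys u ps. dweight lam mu (snd k)) * (\<Prod>x<n. turn_weight rho (keys u ps) x)"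
proof -
  let ?K = "keys u ps"
  have d: "distinct (pverts u ps)" using p by (simp add: spath_def)
  have E: "edges_of b (pgraph u ps) = {e. (e, b) \<in> ?K}" for b
    by (simp add: edges_of_pgraph[OF d] keys_def)
  have 1: "(\<Prod>k\<in>?K. dweight lam mu (snd k)) =
     lam ^ card (edges_of Bullet (pgraph u ps)) * mu ^ card (edges_of Circ (pgraph u ps))"
    unfolding E by (subst prod_keys_split) (simp_all add: dweight_def)
  have v: "x \<in> verts_of b (pgraph u ps) \<longleftrightarrow> bdeg ?K b x > 0" for x b
    unfolding verts_of_def E bdeg_def using finite_letter_keys[of ?K b "\<lambda>e. x \<in> e"]
    by (auto simp: card_gt_0_iff)
  have dd: "diff_verts (pgraph u ps) = {x \<in> {..<n}. bdeg ?K Bullet x = 1 \<and> bdeg ?K Circ x = 1}"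
  proof (intro set_eqI iffI)
    fix x assume "x \<in> diff_verts (pgraph u ps)"
    then have pos: "bdeg ?K Bullet x > 0" "bdeg ?K Circ x > 0" by (auto simp: diff_verts_def v)
    moreover have "bdeg ?K Bullet x + bdeg ?K Circ x \<le> 2"
      using card_inc_le[OF p] by (simp add: bdeg_total)
    moreover have "x < n"
    proof (rule ccontr)
      assume "\<not> x < n"
      then have "x \<notin> set (pverts u ps)" using p by (auto simp: spath_def)
      then show False using pos inc_outside[of x u ps] by (simp add: bdeg_inc)
    qed
    ultimately show "x \<in> {x \<in> {..<n}. bdeg ?K Bullet x = 1 \<and> bdeg ?K Circ x = 1}" by auto
  qed (auto simp: diff_verts_def v)
  have 2: "(\<Prod>x<n. turn_weight rho ?K x) = rho ^ card (diff_verts (pgraph u ps))"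
    unfolding dd turn_weight_def by (subst prod.inter_filter[symmetric]) simp_all
  show ?thesis unfolding Xi_weight_def 1 2 ..
qed

text \<open>The bound \<open>pair_vertex\<close> for the moment at a vertex of the union of two paths from \<open>u\<close> to
  \<open>v\<close>: it is exact at vertices of only one of them, and trivial where the paths run together.\<close>

definition pair_vertex :: "real \<Rightarrow> real \<Rightarrow> nat \<Rightarrow> nat \<Rightarrow> step list \<Rightarrow> step list \<Rightarrow> nat \<Rightarrow> real" where
  "pair_vertex rho D u v ps qs x =
    (if x \<notin> set (pverts u qs) then turn_weight rho (keys u ps) x
     else if x \<notin> set (pverts u ps) then turn_weight rho (keys u qs) x
     else if inc (keys u ps) x = inc (keys u qs) x \<and> x \<noteq> u \<and> x \<noteq> v then 1 else D)"

text \<open>An interior vertex has degree 2, so its spike moment is \<open>E[X^2] = 1\<close>,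
  \<open>E[Y^2] = 1\<close> or \<open>E[XY] = rho\<close>; off the path it is 1. The statistic is
  weighted exactly by these values.\<close>

lemma single_path_moment:
  assumes sp: "spike_prior rho C prior" and rho: "0 < rho"
    and p: "spath n l u v ps" and x: "x \<noteq> u" "x \<noteq> v"
  shows "prior_moment prior (bdeg (keys u ps) Bullet x) (bdeg (keys u ps) Circ x) =
    turn_weight rho (keys u ps) x"
proof (cases "x \<in> set (pverts u ps)")
  case True
  have "bdeg (keys u ps) Bullet x + bdeg (keys u ps) Circ x = 2"
    using card_inc_interior[OF p True x] by (simp add: bdeg_total)
  then consider "bdeg (keys u ps) Bullet x = 0" "bdeg (keys u ps) Circ x = 2"
    | "bdeg (keys u ps) Bullet x = 1" "bdeg (keys u ps) Circ x = 1"
    | "bdeg (keys u ps) Bullet x = 2" "bdeg (keys u ps) Circ x = 0" by linarith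
  then show ?thesis
    using prior_moment_values[OF sp] by cases (simp_all add: turn_weight_def)
next
  case False
  then have "bdeg (keys u ps) b x = 0" for b by (simp add: bdeg_inc inc_outside)
  then show ?thesis using prior_moment_values[OF sp] by (simp add: turn_weight_def)
qed

text \<open>Here \<open>N\<close> is the set of shared edges at which the noise is chosen in both
  paths. A large moment at a vertex where the paths run together needs a shared edge outside
  \<open>N\<close>; the factors \<open>D\<close> attached to these edges are kept separate, to be
  offset by their weight \<open>1/n\<close>.\<close>

lemma pair_moment_bound:
  assumes sp: "spike_prior rho C prior" and rho: "0 < rho" and D: "D = 1 + 2 * C" "C \<ge> 0"
    and p: "spath n l u v ps" and q: "spath n l u v qs"
    and g: "\<And>x. x \<noteq> u \<Longrightarrow> x \<noteq> v \<Longrightarrow> g x = 0" "\<And>x. g x \<le> 2"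
    and N: "N \<subseteq> keys u ps \<inter> keys u qs"
  shows "\<bar>prior_moment prior (bdeg (keys u ps - N) Bullet x + bdeg (keys u qs - N) Bullet x + g x)
            (bdeg (keys u ps - N) Circ x + bdeg (keys u qs - N) Circ x)\<bar>
     \<le> pair_vertex rho D u v ps qs x * D ^ card (inc (keys u ps \<inter> keys u qs - N) x)"
    (is "\<bar>prior_moment prior ?a ?b\<bar> \<le> _")
proof -
  let ?K = "keys u ps" and ?L = "keys u qs"
  let ?T = "?K \<inter> ?L - N"
  have D1: "D \<ge> 1" using D by simp
  have NK: "N \<subseteq> ?K" "N \<subseteq> ?L" using N by auto
  \<comment> \<open>The extra factor \<open>g\<close> sits only at the ends, where each path has
    degree at most 1: \<open>1 + 1 + 2 = 4\<close>. Elsewhere two paths have degree at most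
    \<open>2 + 2\<close>.\<close>
  have deg: "?a + ?b \<le> 4"
  proof -
    have "bdeg (?K - N) Bullet x + bdeg (?K - N) Circ x \<le> card (inc ?K x)"
      using bdeg_total[of ?K x] bdeg_mono[of ?K "?K - N" _ x]
      by (metis Diff_subset add_mono finite_keys)
    moreover have "bdeg (?L - N) Bullet x + bdeg (?L - N) Circ x \<le> card (inc ?L x)"
      using bdeg_total[of ?L x] bdeg_mono[of ?L "?L - N" _ x]
      by (metis Diff_subset add_mono finite_keys)
    moreover have "card (inc ?K x) + card (inc ?L x) + g x \<le> 4"
      using card_inc_le[OF p, of x] card_inc_le[OF q, of x] card_inc_end[OF p, of x]
        card_inc_end[OF q, of x] g(1)[of x] g(2)[of x] by (cases "x = u \<or> x = v") auto
    ultimately show ?thesis by linarith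
  qed
  have le: "\<bar>prior_moment prior ?a ?b\<bar> \<le> D" using prior_moments(2)[OF sp deg] D by simp
  have ge1: "1 \<le> D ^ card (inc ?T x)" using D1 by (rule one_le_power)
  have bz: "bdeg M b x = 0" if "inc M x = {}" for M b using that by (simp add: bdeg_inc)
  have bs: "inc (M - N) x = inc M x" if "inc N x = {}" for M
    using that by (auto simp: inc_def)
  consider (p) "x \<notin> set (pverts u qs)" | (q) "x \<in> set (pverts u qs)" "x \<notin> set (pverts u ps)"
    | (m) "x \<in> set (pverts u qs)" "x \<in> set (pverts u ps)" "inc ?K x = inc ?L x" "x \<noteq> u" "x \<noteq> v"
    | (o) "x \<in> set (pverts u qs)" "x \<in> set (pverts u ps)" "\<not> (inc ?K x = inc ?L x \<and> x \<noteq> u \<and> x \<noteq> v)"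
    by blast
  then show ?thesis
  proof cases
    case p
    have xe: "x \<noteq> u" "x \<noteq> v" using p spath_last[OF q] spath_verts[OF q] by auto
    have z: "inc ?L x = {}" using inc_outside p by simp
    then have "inc N x = {}" "inc (?L - N) x = {}" using NK by (auto simp: inc_def)
    then have "\<bar>prior_moment prior ?a ?b\<bar> = turn_weight rho ?K x"
      using single_path_moment[OF sp rho \<open>spath n l u v ps\<close> xe] g(1)[OF xe] rho
      by (simp add: bz bdeg_inc bs) (simp add: turn_weight_def bdeg_inc)
    moreover have "0 \<le> turn_weight rho ?K x" using rho by (simp add: turn_weight_def)
    ultimately show ?thesis using p ge1 by (simp add: pair_vertex_def mult_le_cancel_left1)
  next
    case q
    have xe: "x \<noteq> u" "x \<noteq> v" using q spath_last[OF p] spath_verts[OF p] by auto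
    have z: "inc ?K x = {}" using inc_outside q by simp
    then have "inc N x = {}" "inc (?K - N) x = {}" using NK by (auto simp: inc_def)
    then have "\<bar>prior_moment prior ?a ?b\<bar> = turn_weight rho ?L x"
      using single_path_moment[OF sp rho \<open>spath n l u v qs\<close> xe] g(1)[OF xe] rho
      by (simp add: bz bdeg_inc bs) (simp add: turn_weight_def bdeg_inc)
    moreover have "0 \<le> turn_weight rho ?L x" using rho by (simp add: turn_weight_def)
    ultimately show ?thesis using q ge1 by (simp add: pair_vertex_def mult_le_cancel_left1)
  next
    case m
    show ?thesis
    proof (cases "inc ?T x = {}")
      case True
      \<comment> \<open>Every edge at \<open>x\<close> is shared and has its noise chosen, so no
        spike factor is left at \<open>x\<close> and the moment is 1.\<close>
      have "inc ?K x \<subseteq> ?L" "inc ?L x \<subseteq> ?K" using m(3) unfolding inc_def by blast+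
      then have "inc (?K - N) x \<subseteq> inc ?T x" "inc (?L - N) x \<subseteq> inc ?T x"
        unfolding inc_def by blast+
      then have "inc (?K - N) x = {}" "inc (?L - N) x = {}" using True by blast+
      then have "?a = 0" "?b = 0" using g(1)[OF m(4,5)] by (simp_all add: bz)
      then show ?thesis using m True prior_moment_values(1)[OF sp] by (simp add: pair_vertex_def)
    next
      case False
      \<comment> \<open>Some shared edge at \<open>x\<close> enters with its signal, and its factor
        \<open>D\<close> covers the moment.\<close>
      then have "card (inc ?T x) \<ge> 1" by (simp add: Suc_le_eq card_gt_0_iff)
      then have "D \<le> D ^ card (inc ?T x)" using D1 self_le_power by (metis less_eq_Suc_le One_nat_def)
      then show ?thesis using m le by (simp add: pair_vertex_def)
    qed
  next
    case o
    then have "pair_vertex rho D u v ps qs x = D" unfolding pair_vertex_def by presburger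
    moreover have "D \<le> D * D ^ card (inc ?T x)" using D1 ge1 by simp
    ultimately show ?thesis using le by (simp only: order_trans)
  qed
qed

lemma dweight_bounds:
  assumes "0 \<le> lam" "lam \<le> 1" "0 \<le> mu" "mu \<le> 1"
  shows "0 \<le> dweight lam mu b" "dweight lam mu b \<le> 1"
  using assms by (cases b; simp add: dweight_def)+

text \<open>Double counting of incidences: every edge has two ends.\<close>

lemma prod_power_inc:
  assumes v: "valid_keys n T"
  shows "(\<Prod>x<n. (D::real) ^ card (inc T x)) = (\<Prod>k\<in>T. D\<^sup>2)"
proof -
  have fin: "finite T" using valid_keys_finite[OF v] .
  have "(\<Prod>x<n. D ^ card (inc T x)) = (\<Prod>x<n. \<Prod>k\<in>T. if x \<in> fst k then D else 1)"
  proof (rule prod.cong[OF refl])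
    fix x
    have "(\<Prod>k\<in>T. if x \<in> fst k then D else 1) = (\<Prod>k\<in>inc T x. D)"
      unfolding inc_def by (rule prod.inter_filter[OF fin, symmetric])
    then show "D ^ card (inc T x) = (\<Prod>k\<in>T. if x \<in> fst k then D else 1)" by simp
  qed
  also have "\<dots> = (\<Prod>k\<in>T. \<Prod>x<n. if x \<in> fst k then D else 1)" by (rule prod.swap)
  also have "\<dots> = (\<Prod>k\<in>T. D\<^sup>2)"
  proof (rule prod.cong[OF refl])
    fix k assume "k \<in> T"
    then have k: "fst k \<subseteq> {..<n}" "card (fst k) = 2"
      using v by (auto simp: valid_keys_def pair_sets_def)
    have "(\<Prod>x<n. if x \<in> fst k then D else 1) = (\<Prod>x\<in>{..<n} \<inter> fst k. D)"
      by (rule prod.inter_restrict[symmetric]) simp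
    then show "(\<Prod>x<n. if x \<in> fst k then D else 1) = D\<^sup>2" using k by (simp add: Int_absorb1)
  qed
  finally show ?thesis .
qed

lemma pair_vertex_nonneg: "0 < rho \<Longrightarrow> 0 \<le> D \<Longrightarrow> 0 \<le> pair_vertex rho D u v ps qs x"
  by (auto simp: pair_vertex_def turn_weight_def)

text \<open>Summing over \<open>N\<close> is the expansion of a product: each shared edge
  contributes 1 if its noise is used and at most \<open>D^2 / n\<close> otherwise. There are at most
  \<open>l\<close> shared edges, whence the last factor, which stays bounded for logarithmic
  \<open>l\<close>.\<close>

lemma pair_sum_bound:
  assumes sp: "spike_prior rho C prior" and rho: "0 < rho" and D: "D = 1 + 2 * C" "C \<ge> 0"
    and lm: "0 \<le> lam" "lam \<le> 1" "0 \<le> mu" "mu \<le> 1" and n: "n > 0"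
    and p: "spath n l u v ps" and q: "spath n l u v qs"
    and g: "\<And>x. x \<noteq> u \<Longrightarrow> x \<noteq> v \<Longrightarrow> g x = 0" "\<And>x. g x \<le> 2"
  defines "K \<equiv> keys u ps" and "L \<equiv> keys u qs" and "w \<equiv> \<lambda>k. dweight lam mu (snd k) / sqrt (real n)"
  shows "\<bar>\<Sum>N\<in>Pow (K \<inter> L). (\<Prod>k\<in>K - N. w k) * (\<Prod>k\<in>L - N. w k) *
         (\<Prod>x<n. prior_moment prior (bdeg (K - N) Bullet x + bdeg (L - N) Bullet x + g x)
            (bdeg (K - N) Circ x + bdeg (L - N) Circ x))\<bar>
    \<le> (\<Prod>k\<in>K - L. w k) * (\<Prod>k\<in>L - K. w k) * (\<Prod>x<n. pair_vertex rho D u v ps qs x) *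
       (1 + D\<^sup>2 / real n) ^ l"
proof -
  let ?P = "\<Prod>x<n. pair_vertex rho D u v ps qs x"
  let ?c = "(\<Prod>k\<in>K - L. w k) * (\<Prod>k\<in>L - K. w k) * ?P"
  have fin: "finite K" "finite L" by (auto simp: K_def L_def)
  have D1: "D \<ge> 1" using D by simp
  have vK: "valid_keys n K" "valid_keys n L"
    using valid_keys_path[OF p] valid_keys_path[OF q] by (auto simp: K_def L_def)
  have w0: "0 \<le> w k" for k using dweight_bounds[OF lm] by (simp add: w_def)
  have w1: "(w k)\<^sup>2 \<le> 1 / n" for k
  proof -
    have "(dweight lam mu (snd k))\<^sup>2 \<le> 1" using dweight_bounds[OF lm] by (simp add: power_le_one)
    then show ?thesis using n by (simp add: w_def power_divide divide_right_mono)
  qed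
  have tm: "\<bar>(\<Prod>k\<in>K - N. w k) * (\<Prod>k\<in>L - N. w k) *
         (\<Prod>x<n. prior_moment prior (bdeg (K - N) Bullet x + bdeg (L - N) Bullet x + g x)
            (bdeg (K - N) Circ x + bdeg (L - N) Circ x))\<bar> \<le> ?c * (\<Prod>k\<in>K \<inter> L - N. (w k)\<^sup>2 * D\<^sup>2)"
    if N: "N \<subseteq> K \<inter> L" for N
  proof -
    let ?T = "K \<inter> L - N"
    have "K - N = (K - L) \<union> ?T" "L - N = (L - K) \<union> ?T" using N by auto
    then have pw: "(\<Prod>k\<in>K - N. w k) = (\<Prod>k\<in>K - L. w k) * (\<Prod>k\<in>?T. w k)"
      "(\<Prod>k\<in>L - N. w k) = (\<Prod>k\<in>L - K. w k) * (\<Prod>k\<in>?T. w k)"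
      using fin by (auto intro!: prod.union_disjoint)
    have "\<bar>\<Prod>x<n. prior_moment prior (bdeg (K - N) Bullet x + bdeg (L - N) Bullet x + g x)
            (bdeg (K - N) Circ x + bdeg (L - N) Circ x)\<bar> \<le>
         (\<Prod>x<n. pair_vertex rho D u v ps qs x * D ^ card (inc ?T x))"
      unfolding abs_prod
      using pair_moment_bound[OF sp rho D p q g] N
      by (intro prod_mono conjI abs_ge_zero) (simp add: K_def L_def)
    also have "\<dots> = ?P * (\<Prod>k\<in>?T. D\<^sup>2)"
      using prod_power_inc[OF valid_keys_subset[OF vK(1)], of ?T D] by (auto simp: prod.distrib)
    finally have "\<bar>(\<Prod>k\<in>K - N. w k) * (\<Prod>k\<in>L - N. w k) *
         (\<Prod>x<n. prior_moment prior (bdeg (K - N) Bullet x + bdeg (L - N) Bullet x + g x)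
            (bdeg (K - N) Circ x + bdeg (L - N) Circ x))\<bar> \<le>
        ((\<Prod>k\<in>K - N. w k) * (\<Prod>k\<in>L - N. w k)) * (?P * (\<Prod>k\<in>?T. D\<^sup>2))"
      unfolding abs_mult using w0 by (simp add: prod_nonneg mult_left_mono)
    also have "\<dots> = ?c * (\<Prod>k\<in>?T. (w k)\<^sup>2 * D\<^sup>2)"
      unfolding pw by (simp add: prod.distrib power2_eq_square power_mult_distrib mult_ac)
    finally show ?thesis .
  qed
  have P0: "?P \<ge> 0" using pair_vertex_nonneg[OF rho] D1 by (intro prod_nonneg) auto
  have c0: "?c \<ge> 0" using w0 P0 by (simp add: prod_nonneg)
  have "\<bar>\<Sum>N\<in>Pow (K \<inter> L). (\<Prod>k\<in>K - N. w k) * (\<Prod>k\<in>L - N. w k) *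
         (\<Prod>x<n. prior_moment prior (bdeg (K - N) Bullet x + bdeg (L - N) Bullet x + g x)
            (bdeg (K - N) Circ x + bdeg (L - N) Circ x))\<bar>
      \<le> (\<Sum>N\<in>Pow (K \<inter> L). ?c * (\<Prod>k\<in>K \<inter> L - N. (w k)\<^sup>2 * D\<^sup>2))"
    by (rule order_trans[OF sum_abs sum_mono]) (use tm in auto)
  also have "\<dots> = ?c * (\<Prod>k\<in>K \<inter> L. 1 + (w k)\<^sup>2 * D\<^sup>2)"
    using prod_add[of "K \<inter> L" "\<lambda>_. 1" "\<lambda>k. (w k)\<^sup>2 * D\<^sup>2"] fin
    by (simp add: sum_distrib_left)
  also have "\<dots> \<le> ?c * (1 + D\<^sup>2 / real n) ^ l"
  proof (rule mult_left_mono[OF _ c0])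
    have "(\<Prod>k\<in>K \<inter> L. 1 + (w k)\<^sup>2 * D\<^sup>2) \<le> (\<Prod>k\<in>K \<inter> L. 1 + D\<^sup>2 / real n)"
    proof (intro prod_mono conjI)
      fix k
      show "1 + (w k)\<^sup>2 * D\<^sup>2 \<le> 1 + D\<^sup>2 / real n"
        using mult_right_mono[OF w1[of k], of "D\<^sup>2"] by simp
    qed (simp add: add_nonneg_nonneg)
    also have "\<dots> = (1 + D\<^sup>2 / real n) ^ card (K \<inter> L)" by simp
    also have "\<dots> \<le> (1 + D\<^sup>2 / real n) ^ l"
    proof (rule power_increasing)
      show "card (K \<inter> L) \<le> l"
        using card_mono[of K "K \<inter> L"] fin card_keys[OF p] by (simp add: K_def)
    qed simp
    finally show "(\<Prod>k\<in>K \<inter> L. 1 + (w k)\<^sup>2 * D\<^sup>2) \<le> (1 + D\<^sup>2 / real n) ^ l" .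
  qed
  finally show ?thesis .
qed

text \<open>The cost of the second path at \<open>x\<close> after the turn weight of the first path
  has been divided out. As that weight may be as small as \<open>rho\<close>, a contact costs
  \<open>D / rho\<close>; off the first path the turn weight of the second path occurs twice, once
  from the moment and once from its own coefficient.\<close>

definition vertex_factor :: "real \<Rightarrow> real \<Rightarrow> nat \<Rightarrow> nat \<Rightarrow> step list \<Rightarrow> step list \<Rightarrow> nat \<Rightarrow> real" where
  "vertex_factor rho D u v ps qs x =
    (if x \<notin> set (pverts u ps) then (turn_weight rho (keys u qs) x)\<^sup>2
     else if inc (keys u ps) x = inc (keys u qs) x \<and> x \<noteq> u \<and> x \<noteq> v then 1 else D / rho)"

definition edge_factor :: "nat \<Rightarrow> real \<Rightarrow> real \<Rightarrow> key set \<Rightarrow> key \<Rightarrow> real" where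
  "edge_factor n lam mu K k = (if k \<in> K then 1 else (dweight lam mu (snd k))\<^sup>2 / real n)"

text \<open>Both paths have \<open>l\<close> edges, so as many edges are missing from one as from
  the other. The factors \<open>1 / sqrt n\<close> of the edges used only by the first path can
  therefore be moved to those used only by the second, which then carry their squared weight over
  \<open>n\<close>. One weight of the first path is split off, so that the outer sum will be over
  its square.\<close>

lemma pair_product_relative:
  assumes rho: "0 < rho" "rho \<le> 1" and D: "D \<ge> 1"
    and lm: "0 \<le> lam" "lam \<le> 1" "0 \<le> mu" "mu \<le> 1" and n: "n > 0"
    and p: "spath n l u v ps" and q: "spath n l u v qs"
  defines "K \<equiv> keys u ps" and "L \<equiv> keys u qs" and "w \<equiv> \<lambda>k. dweight lam mu (snd k) / sqrt (real n)"
  shows "Xi_weight lam mu rho (pgraph u qs) *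
      ((\<Prod>k\<in>K - L. w k) * (\<Prod>k\<in>L - K. w k) * (\<Prod>x<n. pair_vertex rho D u v ps qs x)) \<le>
    Xi_weight lam mu rho (pgraph u ps) *
      ((\<Prod>k\<in>L. edge_factor n lam mu K k) * (\<Prod>x\<in>set (pverts u qs). vertex_factor rho D u v ps qs x))"
proof -
  have fin: "finite K" "finite L" by (auto simp: K_def L_def)
  define dw where "dw k = dweight lam mu (snd k)" for k :: key
  have dw: "0 \<le> dw k" for k using dweight_bounds[OF lm] by (simp add: dw_def)
  have cKL: "card (K - L) = card (L - K)"
  proof -
    have "card K = card L" using card_keys[OF p] card_keys[OF q] by (simp add: K_def L_def)
    moreover have "card K = card (K - L) + card (K \<inter> L)" "card L = card (L - K) + card (K \<inter> L)"
      using fin by (auto simp: card_Diff_subset_Int Int_commute card_mono)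
    ultimately show ?thesis by simp
  qed
  have E: "(\<Prod>k\<in>L. dw k) * ((\<Prod>k\<in>K - L. w k) * (\<Prod>k\<in>L - K. w k)) =
      (\<Prod>k\<in>K. dw k) * (\<Prod>k\<in>L. edge_factor n lam mu K k)"
  proof -
    have split: "(\<Prod>k\<in>A. f k) = (\<Prod>k\<in>A \<inter> B. f k) * (\<Prod>k\<in>A - B. f k)" if "finite A"
      for A B and f :: "key \<Rightarrow> real"
      using prod.Int_Diff[OF that] .
    have wd: "(\<Prod>k\<in>A. w k) = (\<Prod>k\<in>A. dw k) / sqrt n ^ card A" for A
      by (simp add: w_def dw_def prod_dividef)
    have "(\<Prod>k\<in>L. edge_factor n lam mu K k) = (\<Prod>k\<in>L - K. (dw k)\<^sup>2 / n)"
      by (subst split[OF fin(2), of _ K]) (simp add: edge_factor_def dw_def)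
    also have "\<dots> = (\<Prod>k\<in>L - K. dw k)\<^sup>2 / (sqrt n ^ card (L - K))\<^sup>2"
      using n by (simp add: prod_dividef prod_power_distrib power_mult[symmetric] mult.commute)
        (simp add: power_mult)
    finally have e: "(\<Prod>k\<in>L. edge_factor n lam mu K k) = \<dots>" .
    show ?thesis
      unfolding e wd cKL split[OF fin(2), of dw K] split[OF fin(1), of dw L]
      by (simp add: Int_commute power2_eq_square)
  qed
  \<comment> \<open>The comparison is made at each vertex separately; it loses something only at
    contacts, through \<open>turn_weight <= 1\<close> and \<open>turn_weight >= rho\<close>.\<close>
  have V: "pair_vertex rho D u v ps qs x * turn_weight rho L x \<le>
      turn_weight rho K x * (if x \<in> set (pverts u qs) then vertex_factor rho D u v ps qs x else 1)" for x
  proof -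
    note tw = turn_weight_bounds[OF rho]
    consider (p) "x \<notin> set (pverts u qs)" | (q) "x \<in> set (pverts u qs)" "x \<notin> set (pverts u ps)"
      | (m) "x \<in> set (pverts u qs)" "x \<in> set (pverts u ps)" "inc K x = inc L x" "x \<noteq> u" "x \<noteq> v"
      | (o) "x \<in> set (pverts u qs)" "x \<in> set (pverts u ps)" "\<not> (inc K x = inc L x \<and> x \<noteq> u \<and> x \<noteq> v)"
      by blast
    then show ?thesis
    proof cases
      case p
      then have "turn_weight rho L x = 1"
        by (simp add: turn_weight_def bdeg_inc inc_outside L_def)
      then show ?thesis using p by (simp add: pair_vertex_def K_def)
    next
      case q
      then have "turn_weight rho K x = 1"
        by (simp add: turn_weight_def bdeg_inc inc_outside K_def)
      then show ?thesis using q by (simp add: pair_vertex_def vertex_factor_def L_def power2_eq_square)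
    next
      case m
      then have "turn_weight rho K x = turn_weight rho L x" by (simp add: turn_weight_def bdeg_inc)
      then show ?thesis using m by (simp add: pair_vertex_def vertex_factor_def K_def L_def)
    next
      case o
      have "D * turn_weight rho L x \<le> D * 1" using tw D by (intro mult_left_mono) auto
      also have "\<dots> \<le> D * (turn_weight rho K x / rho)"
        using tw(2)[of K x] rho D by (intro mult_left_mono) auto
      finally have "D * turn_weight rho L x \<le> turn_weight rho K x * (D / rho)" by (simp add: mult.commute)
      moreover have "pair_vertex rho D u v ps qs x = D" "vertex_factor rho D u v ps qs x = D / rho"
        using o unfolding pair_vertex_def vertex_factor_def K_def L_def by presburger+
      ultimately show ?thesis using o(1) by simp
    qed
  qed
  have "(\<Prod>x<n. pair_vertex rho D u v ps qs x * turn_weight rho L x) \<le>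
     (\<Prod>x<n. turn_weight rho K x * (if x \<in> set (pverts u qs) then vertex_factor rho D u v ps qs x else 1))"
    using V turn_weight_bounds(1)[OF rho] pair_vertex_nonneg[OF rho(1)] D
    by (intro prod_mono conjI mult_nonneg_nonneg) (auto intro: less_imp_le)
  also have "\<dots> = (\<Prod>x<n. turn_weight rho K x) * (\<Prod>x\<in>set (pverts u qs). vertex_factor rho D u v ps qs x)"
  proof -
    have "(\<Prod>x<n. if x \<in> set (pverts u qs) then vertex_factor rho D u v ps qs x else 1) =
       (\<Prod>x\<in>{..<n} \<inter> set (pverts u qs). vertex_factor rho D u v ps qs x)"
      by (rule prod.inter_restrict[symmetric]) simp
    moreover have "{..<n} \<inter> set (pverts u qs) = set (pverts u qs)" using q by (auto simp: spath_def)
    ultimately show ?thesis by (simp add: prod.distrib)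
  qed
  finally have VV: "(\<Prod>x<n. pair_vertex rho D u v ps qs x) * (\<Prod>x<n. turn_weight rho L x) \<le>
     (\<Prod>x<n. turn_weight rho K x) * (\<Prod>x\<in>set (pverts u qs). vertex_factor rho D u v ps qs x)"
    by (simp add: prod.distrib)
  have E0: "0 \<le> (\<Prod>k\<in>K. dw k) * (\<Prod>k\<in>L. edge_factor n lam mu K k)"
    using dw by (intro mult_nonneg_nonneg prod_nonneg) (auto simp: edge_factor_def)
  have "Xi_weight lam mu rho (pgraph u qs) *
      ((\<Prod>k\<in>K - L. w k) * (\<Prod>k\<in>L - K. w k) * (\<Prod>x<n. pair_vertex rho D u v ps qs x)) =
    ((\<Prod>k\<in>L. dw k) * ((\<Prod>k\<in>K - L. w k) * (\<Prod>k\<in>L - K. w k))) *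
      ((\<Prod>x<n. pair_vertex rho D u v ps qs x) * (\<Prod>x<n. turn_weight rho L x))"
    unfolding Xi_weight_keys[OF q] L_def[symmetric] dw_def by (simp add: mult_ac)
  also have "\<dots> \<le> ((\<Prod>k\<in>K. dw k) * (\<Prod>k\<in>L. edge_factor n lam mu K k)) *
     ((\<Prod>x<n. turn_weight rho K x) * (\<Prod>x\<in>set (pverts u qs). vertex_factor rho D u v ps qs x))"
    unfolding E by (rule mult_left_mono[OF VV E0])
  also have "\<dots> = Xi_weight lam mu rho (pgraph u ps) *
      ((\<Prod>k\<in>L. edge_factor n lam mu K k) * (\<Prod>x\<in>set (pverts u qs). vertex_factor rho D u v ps qs x))"
    unfolding Xi_weight_keys[OF p] K_def[symmetric] dw_def by (simp add: mult_ac)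
  finally show ?thesis .
qed

text \<open>The weight of the continuation of the second path from \<open>x\<close>: \<open>m\<close> tells whether the edge
  leading to \<open>x\<close> is shared with the first path, \<open>a\<close> is its decoration.\<close>

fun cont_weight :: "nat \<Rightarrow> real \<Rightarrow> real \<Rightarrow> real \<Rightarrow> real \<Rightarrow> key set \<Rightarrow> nat set \<Rightarrow>
    bool \<Rightarrow> decoration \<Rightarrow> nat \<Rightarrow> step list \<Rightarrow> real" where
  "cont_weight n lam mu rho M K V m a x [] = M"
| "cont_weight n lam mu rho M K V m a x ((b, y) # qs) =
    (if x \<notin> V then (if a = b then 1 else rho\<^sup>2) else if m \<and> ({x, y}, b) \<in> K then 1 else M) *
    edge_factor n lam mu K ({x, y}, b) *
    cont_weight n lam mu rho M K V (({x, y}, b) \<in> K) b y qs"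

lemma edge_factor_nonneg: "0 \<le> edge_factor n lam mu K k"
  by (simp add: edge_factor_def)

lemma vertex_factor_nonneg: "0 < rho \<Longrightarrow> 0 \<le> D \<Longrightarrow> 0 \<le> vertex_factor rho D u v ps qs x"
  by (simp add: vertex_factor_def)

text \<open>The products are peeled off along the second path, by downward induction on the
  position. The first vertex lies on the first path and is charged \<open>D / rho\<close>, so the
  letter \<open>a\<close> preceding it is arbitrary.\<close>

lemma pair_product_le_cont_weight:
  assumes rho: "0 < rho" "rho \<le> 1" and D: "D \<ge> 1" and l: "l > 0"
    and p: "spath n l u v ps" and q: "spath n l u v qs"
  shows "(\<Prod>k\<in>keys u qs. edge_factor n lam mu (keys u ps) k) *
      (\<Prod>x\<in>set (pverts u qs). vertex_factor rho D u v ps qs x) \<le>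
    cont_weight n lam mu rho (D / rho) (keys u ps) (set (pverts u ps)) False a u qs"
proof -
  define ef where "ef i = edge_factor n lam mu (keys u ps) (pedges u qs ! i)" for i
  define vf where "vf i = vertex_factor rho D u v ps qs (pverts u qs ! i)" for i
  let ?K = "keys u ps" and ?V = "set (pverts u ps)"
  let ?cw = "cont_weight n lam mu rho (D / rho) ?K ?V"
  define kk where "kk i = pedges u qs ! i" for i
  have len: "length qs = l" using q by (simp add: spath_def)
  have M1: "D / rho \<ge> 1" using rho D by (simp add: le_divide_eq)
  have uV: "u \<in> ?V" "v \<in> ?V" using spath_last[OF p] spath_verts[OF p] by auto
  have pe: "pedges u qs ! j = ({pverts u qs ! j, pverts u qs ! Suc j}, fst (qs ! j))" if "j < l" for j
    using that len by (simp add: pedges_nth)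
  have qj: "qs ! j = (fst (qs ! j), pverts u qs ! Suc j)" if "j < l" for j
    using that len by (simp add: pverts_def)
  have ends: "vf j \<le> D / rho" for j
    using turn_weight_bounds[OF rho, of "keys u qs" "pverts u qs ! j"] M1
      power_le_one[of "turn_weight rho (keys u qs) (pverts u qs ! j)" 2]
    by (auto simp: vf_def vertex_factor_def)
  have ef0: "0 \<le> ef i" "0 \<le> vf i" for i
    using edge_factor_nonneg vertex_factor_nonneg rho D by (auto simp: ef_def vf_def)
  have inner: "(\<Prod>i=j..<l. ef i) * (\<Prod>i=j..l. vf i) \<le>
      ?cw (pedges u qs ! (j - 1) \<in> ?K) (fst (qs ! (j - 1))) (pverts u qs ! j) (drop j qs)"
    if "1 \<le> j" "j \<le> l" for j
    using that(2,1)
  proof (induction rule: inc_induct)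
    case base
    then show ?case using len ends by simp
  next
    case (step j)
    have j: "j < l" "0 < j" using step by auto
    let ?x = "pverts u qs ! j" and ?y = "pverts u qs ! Suc j" and ?b = "fst (qs ! j)"
    have dr: "drop j qs = (?b, ?y) # drop (Suc j) qs"
      using j len qj[of j] by (metis Cons_nth_drop_Suc)
    have IH: "(\<Prod>i=Suc j..<l. ef i) * (\<Prod>i=Suc j..l. vf i) \<le>
      ?cw (pedges u qs ! j \<in> ?K) ?b ?y (drop (Suc j) qs)"
      using step.IH by simp
    have incq: "inc (keys u qs) ?x = {pedges u qs ! j, pedges u qs ! (j - 1)}"
      using inc_path[OF q, of j] j by auto
    have ne: "pedges u qs ! j \<noteq> pedges u qs ! (j - 1)"
      using j by (intro pedges_nth_neq[OF q]) auto
    have vfj: "vf j \<le> (if ?x \<notin> ?V then (if fst (qs ! (j - 1)) = ?b then 1 else rho\<^sup>2)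
        else if pedges u qs ! (j - 1) \<in> ?K \<and> pedges u qs ! j \<in> ?K then 1 else D / rho)"
    proof -
      consider (a) "?x \<notin> ?V" | (b) "?x \<in> ?V" "pedges u qs ! (j - 1) \<in> ?K \<and> pedges u qs ! j \<in> ?K"
        | (c) "?x \<in> ?V" "\<not> (pedges u qs ! (j - 1) \<in> ?K \<and> pedges u qs ! j \<in> ?K)" by blast
      then show ?thesis
      proof cases
        case a
        have "turn_weight rho (keys u qs) ?x = rho" if "fst (qs ! (j - 1)) \<noteq> ?b"
        proof -
          have "{k \<in> inc (keys u qs) ?x. snd k = ?b} = {pedges u qs ! j}"
            "{k \<in> inc (keys u qs) ?x. snd k = fst (qs ! (j - 1))} = {pedges u qs ! (j - 1)}"
            unfolding incq using pe[of j] pe[of "j - 1"] j that by auto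
          then have "bdeg (keys u qs) ?b ?x = 1" "bdeg (keys u qs) (fst (qs ! (j - 1))) ?x = 1"
            by (simp_all add: bdeg_inc)
          then show ?thesis
            using that by (cases ?b; cases "fst (qs ! (j - 1))") (auto simp: turn_weight_def)
        qed
        then show ?thesis using a turn_weight_bounds[OF rho, of "keys u qs" ?x]
          by (auto simp: vf_def vertex_factor_def power_le_one)
      next
        case b
        \<comment> \<open>Both edges of the second path at this vertex are shared. The first path
          has at most two edges there, hence the same ones, and the factor is 1.\<close>
        have sub: "inc (keys u qs) ?x \<subseteq> inc ?K ?x"
          using b pe[of "j - 1"] pe[of j] j unfolding incq by (auto simp: inc_def)
        moreover have "card (inc ?K ?x) \<le> card (inc (keys u qs) ?x)"
          using card_inc_le[OF p, of ?x] ne unfolding incq by simp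
        ultimately have "inc ?K ?x = inc (keys u qs) ?x"
          using card_seteq[of "inc ?K ?x" "inc (keys u qs) ?x"] by simp
        moreover have "?x \<noteq> u" "?x \<noteq> v"
          using spath_nth_eq_iff[OF q, of j 0] spath_nth_eq_iff[OF q, of j l] spath_last[OF q] j by auto
        ultimately show ?thesis using b by (simp add: vf_def vertex_factor_def)
      next
        case c
        then show ?thesis using ends[of j] by auto
      qed
    qed
    have "(\<Prod>i=j..<l. ef i) * (\<Prod>i=j..l. vf i) =
        vf j * ef j * ((\<Prod>i=Suc j..<l. ef i) * (\<Prod>i=Suc j..l. vf i))"
      using j by (simp add: prod.atLeast_Suc_lessThan prod.atLeast_Suc_atMost mult_ac)
    also have "\<dots> \<le> (if ?x \<notin> ?V then (if fst (qs ! (j - 1)) = ?b then 1 else rho\<^sup>2)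
        else if pedges u qs ! (j - 1) \<in> ?K \<and> pedges u qs ! j \<in> ?K then 1 else D / rho) * ef j *
        ?cw (pedges u qs ! j \<in> ?K) ?b ?y (drop (Suc j) qs)"
      using vfj ef0 M1 IH by (intro mult_mono mult_nonneg_nonneg prod_nonneg) (auto split: if_splits)
    also have "\<dots> = ?cw (pedges u qs ! (j - 1) \<in> ?K) (fst (qs ! (j - 1))) ?x (drop j qs)"
      by (simp only: dr cont_weight.simps ef_def pe[OF j(1)])
    finally show ?case .
  qed
  have ex: "(\<Prod>k\<in>keys u qs. edge_factor n lam mu ?K k) = (\<Prod>i=0..<l. ef i)"
    unfolding keys_nth[OF q] ef_def
    by (subst prod.reindex) (auto simp: inj_on_def atLeast0LessThan dest: pedges_nth_neq[OF q])
  have vx: "(\<Prod>x\<in>set (pverts u qs). vertex_factor rho D u v ps qs x) = (\<Prod>i=0..l. vf i)"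
    unfolding spath_verts[OF q] vf_def
    by (subst prod.reindex) (auto simp: inj_on_def atLeast0AtMost spath_nth_eq_iff[OF q])
  have "qs = qs ! 0 # drop (Suc 0) qs" using l len by (metis Cons_nth_drop_Suc drop0)
  then have dr: "qs = (fst (qs ! 0), pverts u qs ! Suc 0) # drop (Suc 0) qs" using qj[of 0] l by simp
  have IH: "(\<Prod>i=Suc 0..<l. ef i) * (\<Prod>i=Suc 0..l. vf i) \<le>
      ?cw (pedges u qs ! 0 \<in> ?K) (fst (qs ! 0)) (pverts u qs ! Suc 0) (drop (Suc 0) qs)"
    using inner[of "Suc 0"] l by simp
  have "(\<Prod>i=0..<l. ef i) * (\<Prod>i=0..l. vf i) =
      vf 0 * ef 0 * ((\<Prod>i=Suc 0..<l. ef i) * (\<Prod>i=Suc 0..l. vf i))"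
    using l by (simp add: prod.atLeast_Suc_lessThan prod.atLeast_Suc_atMost mult_ac)
  also have "\<dots> \<le> D / rho * ef 0 *
      ?cw (pedges u qs ! 0 \<in> ?K) (fst (qs ! 0)) (pverts u qs ! Suc 0) (drop (Suc 0) qs)"
    using ends ef0 M1 IH by (intro mult_mono mult_nonneg_nonneg prod_nonneg) auto
  also have "\<dots> = ?cw False a u qs"
    by (subst (3) dr) (use uV pe[of 0] l in \<open>simp add: ef_def\<close>)
  finally show ?thesis unfolding ex vx .
qed

section \<open>Summation over pairs of paths\<close>

text \<open>For a fixed path \<open>ps\<close>, the weights of all competing paths are summed by a transfer argument:
  a walker is off the path, or on it, and in the latter case it may be aligned with it (at position
  \<open>j\<close> at time \<open>j\<close>). While running along the path it gains a factor 1 per step, whereas off the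
  path the sum grows by the Perron eigenvalue \<open>A\<close> of the transfer matrix with eigenvector \<open>h\<close>;
  every visit to the path costs a factor \<open>1/n\<close>.\<close>

locale transfer =
  fixes n l u v :: nat and ps :: "step list" and lam mu rho M A :: real
    and h :: "decoration \<Rightarrow> real" and al th ga k0 :: real
  assumes path: "spath n l u v ps" and l: "l \<ge> 1" and n: "n \<ge> 1"
    and lm: "0 \<le> lam" "lam \<le> 1" "0 \<le> mu" "mu \<le> 1" and rho: "0 < rho" "rho \<le> 1" and M: "M \<ge> 1"
    and A: "A > 1"
    and eigen: "\<And>a. (\<Sum>b\<in>UNIV. (if a = b then 1 else rho\<^sup>2) * (dweight lam mu b)\<^sup>2 * h b) = A * h a"
    and h: "\<And>a. h a > 0"
    and th: "th \<ge> 0" "\<And>a. 2 * M\<^sup>2 \<le> th * h a * (A - 1)" "th \<le> al"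
    and ga: "M * (h Bullet + h Circ) * al + 2 * M ^ 3 \<le> ga * (A - 1)" "ga \<ge> 0"
    and k0: "4 * M\<^sup>2 \<le> k0" "\<And>a. 4 * M * ga \<le> al * k0 * h a"
begin

definition "K = keys u ps"
definition "V = set (pverts u ps)"
definition "p j = pverts u ps ! j"
text \<open>The eigenvalue with a correction that absorbs the steps landing on the first path. It is
  harmless: \<open>(Ah / A) ^ l\<close> is bounded as soon as \<open>l^2\<close> is of order at most
  \<open>n\<close>.\<close>

definition "Ah = A + k0 * (1 + real l) / real n"
definition "E r = Ah ^ r / real n"
text \<open>Bounds with \<open>r\<close> steps to go, for a walker on the first path.
  \<open>P\<close> stands for the aligned position \<open>l - r\<close>, from which following the
  path ends at \<open>v\<close> in time, \<open>N\<close> for the remaining cases. The letter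
  \<open>d\<close> means that the last edge was shared, \<open>f\<close> that it was not. Only the
  \<open>P\<close> bounds contain a term without the factor \<open>1/n\<close>.\<close>

definition "Nd r = ga * E r"
definition "Pd r = M + Nd r"
definition "Pf r = M * (M + 2 * Nd r)"
definition "Nf r = 2 * M * Nd r"
text \<open>The subtracted constant serves the induction: the recursion off the path has an
  inhomogeneous term of order \<open>1/n\<close> from landing at the aligned position, and since
  \<open>A > 1\<close> the multiple \<open>th / n\<close> of \<open>h\<close> gains enough in each
  step to swallow it.\<close>

definition "Off r a = h a * (al * E r - th / real n)"
text \<open>Bounds the total weight of leaving a path vertex by an unshared edge: the next vertex is
  off the path, or the aligned one, or one of \<open>l\<close> others on the path.\<close>

definition "U r = (\<Sum>b\<in>UNIV. (dweight lam mu b)\<^sup>2 * (Off r b + (Pf r + real l * Nf r) / real n))"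

abbreviation "cw \<equiv> cont_weight n lam mu rho M K V"

text \<open>Of the past, only the previous vertex \<open>z\<close> is kept as forbidden. This is the
  part of self-avoidance that matters: it prevents turning back along a shared edge, which would
  gain a factor 1 per step without ever advancing.\<close>

definition conts :: "nat \<Rightarrow> nat \<Rightarrow> nat \<Rightarrow> step list set" where
  "conts r z x = {qs. length qs = r \<and> snd ` set qs \<subseteq> {..<n} \<and> distinct (pverts x qs) \<and>
     z \<notin> snd ` set qs \<and> last (pverts x qs) = v}"

definition val :: "nat \<Rightarrow> bool \<Rightarrow> decoration \<Rightarrow> nat \<Rightarrow> nat \<Rightarrow> real" where
  "val r m a z x = (\<Sum>qs\<in>conts r z x. cw m a x qs)"

lemma finite_conts [simp]: "finite (conts r z x)"
proof (rule finite_subset)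
  show "conts r z x \<subseteq> {ps. set ps \<subseteq> UNIV \<times> {..<n} \<and> length ps = r}"
    unfolding conts_def by force
qed (intro finite_lists_length_eq finite_SigmaI, simp_all)

lemma k0_nonneg: "k0 \<ge> 0" using k0(1) M by (smt (verit) zero_le_power2)

lemma Ah: "Ah \<ge> A" "Ah \<ge> 1"
proof -
  have "k0 * (1 + real l) / real n \<ge> 0" using k0_nonneg by simp
  then show "Ah \<ge> A" "Ah \<ge> 1" using A by (auto simp: Ah_def)
qed

lemma E: "E r \<ge> 1 / real n" "E r > 0" "E (Suc r) = Ah * E r"
proof -
  have "Ah ^ r \<ge> 1" using Ah by (intro one_le_power) auto
  then show "E r \<ge> 1 / real n" "E r > 0" using n by (auto simp: E_def divide_right_mono divide_pos_pos)
qed (simp add: E_def)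

lemma Nd_nonneg: "Nd r \<ge> 0" using ga E by (simp add: Nd_def less_imp_le)

lemma Off_nonneg: "Off r a \<ge> 0"
proof -
  have "th / n \<le> al * (1 / n)" using th by (simp add: divide_right_mono)
  also have "\<dots> \<le> al * E r" using th E by (intro mult_left_mono) auto
  finally show ?thesis using h[of a] by (simp add: Off_def)
qed

lemma Pf_Nf_nonneg: "Pf r \<ge> 0" "Nf r \<ge> 0" "Pd r \<ge> M"
  using Nd_nonneg[of r] M by (auto simp: Pf_def Nf_def Pd_def)

lemma dw2: "0 \<le> (dweight lam mu b)\<^sup>2" "(dweight lam mu b)\<^sup>2 \<le> 1"
  using dweight_bounds[OF lm, of b] by (auto simp: power_le_one)

lemma UNIV_sum: "(\<Sum>b\<in>UNIV. f b) = f Bullet + (f Circ :: real)"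
  by (simp add: UNIV_decoration)

lemma landing: "Pf r + real l * Nf r = M\<^sup>2 + 2 * M * (1 + real l) * Nd r"
  by (simp add: Pf_def Nf_def power2_eq_square algebra_simps)

lemma U_nonneg: "U r \<ge> 0"
  unfolding U_def using Off_nonneg Pf_Nf_nonneg by (intro sum_nonneg mult_nonneg_nonneg add_nonneg_nonneg) auto

text \<open>One step multiplies \<open>E\<close> by \<open>Ah\<close>, so \<open>Nd\<close> grows by
  \<open>ga * (A - 1) * E r\<close> plus a term with \<open>k0 * (1 + l) / n\<close>. The first pays
  for vertices off the path and the aligned landing, the second for landings followed by further
  excursions. Hence leaving the path is absorbed by the growth of \<open>Nd\<close>.\<close>

lemma U_bound: "M * U r \<le> Nd (Suc r) - Nd r"
proof -
  have "U r \<le> (\<Sum>b\<in>UNIV. h b * (al * E r) + (Pf r + real l * Nf r) / real n)"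
    unfolding U_def
  proof (rule sum_mono)
    fix b
    have nn: "0 \<le> Off r b + (Pf r + real l * Nf r) / real n"
      using Off_nonneg Pf_Nf_nonneg by (intro add_nonneg_nonneg) auto
    have "(dweight lam mu b)\<^sup>2 * (Off r b + (Pf r + real l * Nf r) / real n) \<le>
        1 * (Off r b + (Pf r + real l * Nf r) / real n)"
      by (rule mult_right_mono[OF dw2(2) nn])
    also have "Off r b \<le> h b * (al * E r)" using h[of b] th by (simp add: Off_def)
    finally show "(dweight lam mu b)\<^sup>2 * (Off r b + (Pf r + real l * Nf r) / real n) \<le>
        h b * (al * E r) + (Pf r + real l * Nf r) / real n" by simp
  qed
  also have "\<dots> = (h Bullet + h Circ) * al * E r + 2 * M\<^sup>2 * (1 / n) + 4 * M * (1 + real l) / n * (ga * E r)"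
    unfolding UNIV_sum landing Nd_def by (simp add: algebra_simps add_divide_distrib)
  also have "\<dots> \<le> (h Bullet + h Circ) * al * E r + 2 * M\<^sup>2 * E r + 4 * M * (1 + real l) / n * (ga * E r)"
    using E(1)[of r] by (intro add_mono[OF add_mono[OF order_refl mult_left_mono] order_refl]) auto
  finally have "M * U r \<le> M * ((h Bullet + h Circ) * al * E r + 2 * M\<^sup>2 * E r + 4 * M * (1 + real l) / n * (ga * E r))"
    using M by (intro mult_left_mono) auto
  also have "\<dots> = (M * (h Bullet + h Circ) * al + 2 * M ^ 3) * E r + 4 * M\<^sup>2 * ((1 + real l) / n * (ga * E r))"
    by (simp add: algebra_simps power2_eq_square power3_eq_cube)
  also have "\<dots> \<le> ga * (A - 1) * E r + k0 * ((1 + real l) / n * (ga * E r))"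
    using ga k0(1) E(2)[of r]
    by (intro order_refl add_mono mult_right_mono divide_nonneg_nonneg mult_nonneg_nonneg) auto
  also have "\<dots> = Nd (Suc r) - Nd r"
    unfolding Nd_def E(3) Ah_def by (simp add: algebra_simps)
  finally show ?thesis .
qed

lemma Nd_mono: "Nd r \<le> Nd (Suc r)"
  using U_bound[of r] U_nonneg[of r] M by (smt (verit) mult_nonneg_nonneg)

text \<open>The part proportional to \<open>h\<close> is multiplied exactly by \<open>A\<close>. Of
  the landing term, the constant part is taken by \<open>th\<close> and the part proportional to
  \<open>E\<close> by the correction in \<open>Ah\<close>.\<close>

lemma Off_step:
  "(\<Sum>b\<in>UNIV. (if a = b then 1 else rho\<^sup>2) * (dweight lam mu b)\<^sup>2 * (Off r b + (Pf r + real l * Nf r) / real n))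
     \<le> Off (Suc r) a"
proof -
  define L where "L = (Pf r + real l * Nf r) / real n"
  have L0: "0 \<le> L" using Pf_Nf_nonneg by (simp add: L_def)
  have c: "0 \<le> (if a = b then 1 else rho\<^sup>2) * (dweight lam mu b)\<^sup>2"
    "(if a = b then 1 else rho\<^sup>2) * (dweight lam mu b)\<^sup>2 \<le> 1" for b
    using dw2[of b] rho by (auto intro!: mult_le_one power_le_one)
  have "(\<Sum>b\<in>UNIV. (if a = b then 1 else rho\<^sup>2) * (dweight lam mu b)\<^sup>2 * (Off r b + L)) =
     (\<Sum>b\<in>UNIV. (if a = b then 1 else rho\<^sup>2) * (dweight lam mu b)\<^sup>2 * h b) * (al * E r - th / n) +
     (\<Sum>b\<in>UNIV. (if a = b then 1 else rho\<^sup>2) * (dweight lam mu b)\<^sup>2 * L)"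
    by (simp add: Off_def UNIV_sum algebra_simps)
  also have "\<dots> \<le> A * h a * (al * E r - th / n) + (\<Sum>b\<in>(UNIV::decoration set). 1 * L)"
    unfolding eigen using c L0 by (intro add_left_mono sum_mono mult_right_mono) auto
  also have "\<dots> = A * h a * (al * E r - th / n) + 2 * M\<^sup>2 / n + 4 * M * ga * ((1 + real l) / n * E r)"
    unfolding L_def landing Nd_def by (simp add: UNIV_decoration algebra_simps add_divide_distrib)
  also have "\<dots> \<le> A * h a * (al * E r - th / n) + th * h a * (A - 1) / n + al * k0 * h a * ((1 + real l) / n * E r)"
    using th(2)[of a] k0(2)[of a] E(2)[of r] by (intro order_refl add_mono mult_right_mono divide_right_mono) auto
  also have "\<dots> = Off (Suc r) a"
    unfolding Off_def E(3) Ah_def by (simp add: algebra_simps add_divide_distrib diff_divide_distrib)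
  finally show ?thesis by (simp add: L_def)
qed

text \<open>Conditioning on the first step. Only an inequality holds, because afterwards
  \<open>x\<close> is forbidden but the earlier \<open>z\<close> no longer is; all weights are
  nonnegative.\<close>

lemma val_Suc:
  "val (Suc r) m a z x \<le> (\<Sum>(b, y)\<in>UNIV \<times> {y. y < n \<and> y \<noteq> z \<and> y \<noteq> x}.
     (if x \<notin> V then (if a = b then 1 else rho\<^sup>2) else if m \<and> ({x, y}, b) \<in> K then 1 else M) *
     edge_factor n lam mu K ({x, y}, b) * val r (({x, y}, b) \<in> K) b x y)"
proof -
  let ?B = "UNIV \<times> {y. y < n \<and> y \<noteq> z \<and> y \<noteq> x}"
  let ?f = "\<lambda>(s, qs). s # qs :: step list"
  have cwn: "0 \<le> cw m a x qs" for m a x qs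
    using M rho edge_factor_nonneg by (induction qs arbitrary: m a x) auto
  have sub: "conts (Suc r) z x \<subseteq> ?f ` (SIGMA s:?B. conts r x (snd s))"
  proof
    fix qs assume q: "qs \<in> conts (Suc r) z x"
    then obtain b y qs' where qs: "qs = (b, y) # qs'"
      by (cases qs) (auto simp: conts_def)
    have "(b, y) \<in> ?B" "qs' \<in> conts r x y"
      using q unfolding qs conts_def by (auto simp: pverts_def)
    then show "qs \<in> ?f ` (SIGMA s:?B. conts r x (snd s))"
      unfolding qs by (intro image_eqI[of _ _ "((b, y), qs')"]) auto
  qed
  have "val (Suc r) m a z x \<le> (\<Sum>qs\<in>?f ` (SIGMA s:?B. conts r x (snd s)). cw m a x qs)"
    unfolding val_def by (rule sum_mono2[OF _ sub]) (use cwn in auto)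
  also have "\<dots> = (\<Sum>z\<in>(SIGMA s:?B. conts r x (snd s)). cw m a x (?f z))"
    by (subst sum.reindex) (auto simp: inj_on_def)
  also have "\<dots> = (\<Sum>s\<in>?B. \<Sum>qs\<in>conts r x (snd s). cw m a x (s # qs))"
    by (subst sum.Sigma) (auto simp: case_prod_beta')
  also have "\<dots> = (\<Sum>(b, y)\<in>?B.
     (if x \<notin> V then (if a = b then 1 else rho\<^sup>2) else if m \<and> ({x, y}, b) \<in> K then 1 else M) *
     edge_factor n lam mu K ({x, y}, b) * val r (({x, y}, b) \<in> K) b x y)"
    by (intro sum.cong refl) (auto simp: val_def sum_distrib_left)
  finally show ?thesis .
qed

lemma val_nonneg: "0 \<le> val r m a z x"
proof -
  have "0 \<le> cw m a x qs" for qs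
    using M rho edge_factor_nonneg by (induction qs arbitrary: m a x) auto
  then show ?thesis unfolding val_def by (intro sum_nonneg) auto
qed

text \<open>The \<open>1/n\<close> of an unshared edge averages over the next vertex: at most
  \<open>n\<close> vertices off the path, one aligned vertex \<open>p c\<close>, and
  \<open>l\<close> others on the path.\<close>

lemma unshared_sum:
  assumes f: "\<And>b. 0 \<le> f b" and c: "c \<le> l"
    and off: "\<And>b y. y \<notin> V \<Longrightarrow> y < n \<Longrightarrow> val r False b x y \<le> Off r b"
    and al: "\<And>b. val r False b x (p c) \<le> Pf r"
    and mis: "\<And>b y. y \<in> V \<Longrightarrow> y \<noteq> p c \<Longrightarrow> val r False b x y \<le> Nf r"
  shows "(\<Sum>(b, y)\<in>UNIV \<times> {..<n}. f b * ((dweight lam mu b)\<^sup>2 / real n) * val r False b x y) \<le>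
    (\<Sum>b\<in>UNIV. f b * (dweight lam mu b)\<^sup>2 * (Off r b + (Pf r + real l * Nf r) / real n))"
proof -
  have V: "V \<subseteq> {..<n}" "finite V" "card V = Suc l"
    using path by (auto simp: V_def spath_def distinct_card)
  have pc: "p c \<in> V" using spath_verts[OF path] c by (auto simp: V_def p_def)
  have "(\<Sum>y<n. val r False b x y) \<le> real n * Off r b + Pf r + real l * Nf r" for b
  proof -
    have "(\<Sum>y<n. val r False b x y) = (\<Sum>y\<in>{..<n} - V. val r False b x y) + (\<Sum>y\<in>V. val r False b x y)"
      by (rule sum.subset_diff) (use V in auto)
    also have "(\<Sum>y\<in>V. val r False b x y) = val r False b x (p c) + (\<Sum>y\<in>V - {p c}. val r False b x y)"
      by (rule sum.remove[OF V(2) pc])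
    also have "(\<Sum>y\<in>{..<n} - V. val r False b x y) \<le> (\<Sum>y\<in>{..<n} - V. Off r b)"
      by (rule sum_mono) (use off in auto)
    also have "\<dots> \<le> real n * Off r b"
      using Off_nonneg card_mono[of "{..<n}" "{..<n} - V"] by (auto intro!: mult_right_mono)
    also have "(\<Sum>y\<in>V - {p c}. val r False b x y) \<le> (\<Sum>y\<in>V - {p c}. Nf r)"
      by (rule sum_mono) (use mis in auto)
    also have "\<dots> = real l * Nf r" using V pc by simp
    also note al[of b]
    finally show ?thesis by simp
  qed
  note B = this
  have "(\<Sum>(b, y)\<in>UNIV \<times> {..<n}. f b * ((dweight lam mu b)\<^sup>2 / real n) * val r False b x y) =
      (\<Sum>b\<in>UNIV. f b * ((dweight lam mu b)\<^sup>2 / real n) * (\<Sum>y<n. val r False b x y))"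
    by (simp add: sum.cartesian_product[symmetric] sum_distrib_left)
  also have "\<dots> \<le> (\<Sum>b\<in>UNIV. f b * ((dweight lam mu b)\<^sup>2 / real n) * (real n * Off r b + Pf r + real l * Nf r))"
    by (intro sum_mono mult_left_mono B mult_nonneg_nonneg f) auto
  also have "\<dots> = (\<Sum>b\<in>UNIV. f b * (dweight lam mu b)\<^sup>2 * (Off r b + (Pf r + real l * Nf r) / real n))"
    using n by (intro sum.cong refl) (simp add: field_simps)
  finally show ?thesis .
qed

definition adj :: "nat \<Rightarrow> nat \<Rightarrow> bool" where
  "adj i i' \<longleftrightarrow> i \<le> l \<and> i' \<le> l \<and> (i = Suc i' \<or> i' = Suc i)"

lemma p_eq_iff: "i \<le> l \<Longrightarrow> j \<le> l \<Longrightarrow> p i = p j \<longleftrightarrow> i = j"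
  using spath_nth_eq_iff[OF path] by (simp add: p_def)

lemma V_eq: "V = p ` {..l}"
  using spath_verts[OF path] by (simp add: V_def p_def)

lemma shared_edge:
  assumes "({p i, y}, b) \<in> K" "i \<le> l" "y \<noteq> p i"
  shows "(i < l \<and> y = p (Suc i) \<and> b = fst (ps ! i)) \<or> (0 < i \<and> y = p (i - 1) \<and> b = fst (ps ! (i - 1)))"
proof -
  have len: "length ps = l" using path by (simp add: spath_def)
  have "({p i, y}, b) \<in> inc K (p i)" using assms by (simp add: inc_def)
  then have "(i < l \<and> ({p i, y}, b) = pedges u ps ! i) \<or> (0 < i \<and> ({p i, y}, b) = pedges u ps ! (i - 1))"
    using inc_path[OF path assms(2)] by (auto simp: K_def p_def split: if_splits)
  then show ?thesis
  proof
    assume "i < l \<and> ({p i, y}, b) = pedges u ps ! i"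
    then show ?thesis using len assms(3) by (auto simp: pedges_nth p_def doubleton_eq_iff)
  next
    assume a: "0 < i \<and> ({p i, y}, b) = pedges u ps ! (i - 1)"
    then show ?thesis using len assms by (auto simp: pedges_nth p_def doubleton_eq_iff)
  qed
qed

lemma shared_start: "({x, y}, b) \<in> K \<Longrightarrow> x \<in> V"
  using pedges_subset by (fastforce simp: K_def V_def keys_def)

text \<open>The induction hypothesis, for all kinds of position at once. After a shared edge the
  direction of travel is known: moving backwards along the path excludes following it to
  \<open>v\<close>, so the large bound \<open>Pd\<close> is needed only for an aligned walker moving
  forwards.\<close>

definition bounds_at :: "nat \<Rightarrow> bool" where
  "bounds_at r \<longleftrightarrow>
    (\<forall>a z x. x < n \<longrightarrow> x \<notin> V \<longrightarrow> val r False a z x \<le> Off r a) \<and>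
    (\<forall>a z. val r False a z (p (l - r)) \<le> Pf r) \<and>
    (\<forall>a z i. i \<le> l \<longrightarrow> i \<noteq> l - r \<longrightarrow> val r False a z (p i) \<le> Nf r) \<and>
    (\<forall>a i i'. adj i i' \<longrightarrow> val r True a (p i') (p i) \<le> (if i = l - r \<and> i = Suc i' then Pd r else Nd r))"

lemma bounds_at_0: "bounds_at 0"
proof -
  have pl: "p l = v" using spath_last[OF path] by (simp add: p_def)
  have c0: "conts 0 z x = (if x = v then {[]} else {})" for z x by (auto simp: conts_def)
  have v0: "val 0 m a z x = (if x = v then M else 0)" for m a z x
    by (simp add: val_def c0)
  have "M \<le> Pf 0" using M Nd_nonneg[of 0] mult_mono[of 1 M M "M + 2 * Nd 0"] by (simp add: Pf_def)
  moreover have "v \<in> V" using pl V_eq by auto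
  moreover have "val 0 True a (p i') (p i) \<le> (if i = l - 0 \<and> i = Suc i' then Pd 0 else Nd 0)"
    if "adj i i'" for a i i'
  proof (cases "p i = v")
    case True
    then have "i = l" using that p_eq_iff[of i l] pl by (simp add: adj_def)
    then have "i = Suc i'" using that by (auto simp: adj_def)
    then show ?thesis using \<open>i = l\<close> True Pf_Nf_nonneg(3)[of 0] by (simp add: v0)
  qed (use Nd_nonneg Pf_Nf_nonneg M in \<open>auto simp: v0 intro: order_trans[of _ M]\<close>)
  moreover have "p i \<noteq> v" if "i \<le> l" "i \<noteq> l" for i using p_eq_iff[of i l] pl that by simp
  ultimately show ?thesis
    unfolding bounds_at_def using Off_nonneg Pf_Nf_nonneg by (auto simp: v0 pl)
qed

lemma bounds_at_Suc:
  assumes B: "bounds_at r" and r: "Suc r \<le> l"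
  shows "bounds_at (Suc r)"
proof -
  define j where "j = l - Suc r"
  have jr: "l - r = Suc j" "Suc j \<le> l" using r by (auto simp: j_def)
  have off: "val r False a z x \<le> Off r a" if "x \<notin> V" "x < n" for a z x
    using B that by (simp add: bounds_at_def)
  have alg: "val r False a z (p (Suc j)) \<le> Pf r" for a z
    using B jr by (simp add: bounds_at_def)
  have mis: "val r False a z y \<le> Nf r" if y: "y \<in> V" "y \<noteq> p (Suc j)" for a z y
  proof -
    obtain i where "i \<le> l" "y = p i" using y V_eq by auto
    then show ?thesis using B jr y unfolding bounds_at_def by metis
  qed
  have adjb: "val r True a (p i') (p i) \<le> (if i = Suc j \<and> i = Suc i' then Pd r else Nd r)" if "adj i i'" for a i i'
    using B jr that by (simp add: bounds_at_def)
  note us = unshared_sum[OF _ jr(2) off alg mis]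
  have pv: "p i < n" if "i \<le> l" for i
    using path that V_eq by (auto simp: V_def spath_def)
  \<comment> \<open>leaving a vertex off the path\<close>
  have c1: "val (Suc r) False a z x \<le> Off (Suc r) a" if x: "x < n" "x \<notin> V" for a z x
  proof -
    let ?f = "\<lambda>b. if a = b then 1 else rho\<^sup>2"
    have nk: "({x, y}, b) \<notin> K" for y b using x shared_start by blast
    have "val (Suc r) False a z x \<le> (\<Sum>(b, y)\<in>UNIV \<times> {y. y < n \<and> y \<noteq> z \<and> y \<noteq> x}.
        ?f b * ((dweight lam mu b)\<^sup>2 / real n) * val r False b x y)"
      using val_Suc[of r False a z x] x nk by (simp add: edge_factor_def)
    also have "\<dots> \<le> (\<Sum>(b, y)\<in>UNIV \<times> {..<n}. ?f b * ((dweight lam mu b)\<^sup>2 / real n) * val r False b x y)"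
      using val_nonneg by (intro sum_mono2) (auto split: if_splits)
    also have "\<dots> \<le> (\<Sum>b\<in>UNIV. ?f b * (dweight lam mu b)\<^sup>2 * (Off r b + (Pf r + real l * Nf r) / real n))"
      by (rule us) auto
    also have "\<dots> \<le> Off (Suc r) a" by (rule Off_step)
    finally show ?thesis .
  qed
  \<comment> \<open>leaving a vertex of the path: the shared continuations are singled out\<close>
  define fw where "fw z i = (if i < l \<and> p (Suc i) \<noteq> z then val r True (fst (ps ! i)) (p i) (p (Suc i)) else 0)" for z i
  define bw where "bw z i = (if 0 < i \<and> p (i - 1) \<noteq> z then val r True (fst (ps ! (i - 1))) (p i) (p (i - 1)) else 0)" for z i
  \<comment> \<open>A path vertex has at most one shared continuation in each direction; all others
    are unshared and together cost at most \<open>M * U r\<close>. The turn factor is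
    \<open>M\<close>, except when a shared edge is followed by a shared one.\<close>
  have gen: "val (Suc r) m a z (p i) \<le> (if m then 1 else M) * (fw z i + bw z i) + M * U r"
    if i: "i \<le> l" for m a z i
  proof -
    let ?x = "p i"
    let ?B = "UNIV \<times> {y. y < n \<and> y \<noteq> z \<and> y \<noteq> ?x}"
    define S where "S = {(b, y) \<in> ?B. ({?x, y}, b) \<in> K}"
    have xV: "?x \<in> V" using i V_eq by auto
    have "val (Suc r) m a z ?x \<le> (\<Sum>(b, y)\<in>?B.
        (if m \<and> ({?x, y}, b) \<in> K then 1 else M) * edge_factor n lam mu K ({?x, y}, b) *
        val r (({?x, y}, b) \<in> K) b ?x y)"
      using val_Suc[of r m a z ?x] xV by simp
    also have "\<dots> = (\<Sum>(b, y)\<in>S.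
        (if m \<and> ({?x, y}, b) \<in> K then 1 else M) * edge_factor n lam mu K ({?x, y}, b) *
        val r (({?x, y}, b) \<in> K) b ?x y) + (\<Sum>(b, y)\<in>?B - S.
        (if m \<and> ({?x, y}, b) \<in> K then 1 else M) * edge_factor n lam mu K ({?x, y}, b) *
        val r (({?x, y}, b) \<in> K) b ?x y)"
      by (subst add.commute, rule sum.subset_diff) (auto simp: S_def)
    also have "(\<Sum>(b, y)\<in>?B - S.
        (if m \<and> ({?x, y}, b) \<in> K then 1 else M) * edge_factor n lam mu K ({?x, y}, b) *
        val r (({?x, y}, b) \<in> K) b ?x y) =
        (\<Sum>(b, y)\<in>?B - S. M * ((dweight lam mu b)\<^sup>2 / real n) * val r False b ?x y)"
    proof (rule sum.cong[OF refl])
      fix s assume s: "s \<in> ?B - S"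
      obtain b y where sby: "s = (b, y)" by (cases s)
      have "({?x, y}, b) \<notin> K" using s unfolding sby S_def by blast
      then show "(case s of (b, y) \<Rightarrow> (if m \<and> ({?x, y}, b) \<in> K then 1 else M) *
          edge_factor n lam mu K ({?x, y}, b) * val r (({?x, y}, b) \<in> K) b ?x y) =
          (case s of (b, y) \<Rightarrow> M * ((dweight lam mu b)\<^sup>2 / real n) * val r False b ?x y)"
        unfolding sby by (simp add: edge_factor_def)
    qed
    also have "\<dots> \<le> (\<Sum>(b, y)\<in>UNIV \<times> {..<n}. M * ((dweight lam mu b)\<^sup>2 / real n) * val r False b ?x y)"
      using val_nonneg M by (intro sum_mono2) (auto split: if_splits)
    also have "\<dots> \<le> (\<Sum>b\<in>UNIV. M * (dweight lam mu b)\<^sup>2 * (Off r b + (Pf r + real l * Nf r) / real n))"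
      by (rule us) (use M in auto)
    also have "\<dots> = M * U r" by (simp add: U_def sum_distrib_left mult.assoc)
    also have "(\<Sum>(b, y)\<in>S.
        (if m \<and> ({?x, y}, b) \<in> K then 1 else M) * edge_factor n lam mu K ({?x, y}, b) *
        val r (({?x, y}, b) \<in> K) b ?x y) = (\<Sum>(b, y)\<in>S. (if m then 1 else M) * val r True b ?x y)"
      by (rule sum.cong) (auto simp: S_def edge_factor_def)
    also have "\<dots> = (if m then 1 else M) * (\<Sum>(b, y)\<in>S. val r True b ?x y)"
      by (simp add: sum_distrib_left case_prod_beta')
    also have "(\<Sum>(b, y)\<in>S. val r True b ?x y) \<le> fw z i + bw z i"
    proof -
      let ?F = "(if i < l \<and> p (Suc i) \<noteq> z then {(fst (ps ! i), p (Suc i))} else {})"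
      let ?G = "(if 0 < i \<and> p (i - 1) \<noteq> z then {(fst (ps ! (i - 1)), p (i - 1))} else {})"
      have "S \<subseteq> ?F \<union> ?G"
        using shared_edge[OF _ i] by (auto simp: S_def)
      then have "(\<Sum>(b, y)\<in>S. val r True b ?x y) \<le> (\<Sum>(b, y)\<in>?F \<union> ?G. val r True b ?x y)"
        using val_nonneg by (intro sum_mono2) auto
      also have "\<dots> \<le> (\<Sum>(b, y)\<in>?F. val r True b ?x y) + (\<Sum>(b, y)\<in>?G. val r True b ?x y)"
        using sum_Un[of ?F ?G "\<lambda>(b, y). val r True b ?x y"]
          sum_nonneg[of "?F \<inter> ?G" "\<lambda>(b, y). val r True b ?x y"] val_nonneg by auto
      also have "\<dots> = fw z i + bw z i" by (simp add: fw_def bw_def)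
      finally show ?thesis .
    qed
    finally show ?thesis using M by (simp add: mult_left_mono)
  qed
  have fwb: "fw z i \<le> (if i = j then Pd r else Nd r)" "bw z i \<le> Nd r" if "i \<le> l" for z i
  proof -
    show "fw z i \<le> (if i = j then Pd r else Nd r)"
      using adjb[of "Suc i" i "fst (ps ! i)"] that Nd_nonneg[of r] Pf_Nf_nonneg(3)[of r] M
      by (auto simp: fw_def adj_def split: if_splits)
    show "bw z i \<le> Nd r"
    proof (cases "0 < i \<and> p (i - 1) \<noteq> z")
      case True
      then have "adj (i - 1) i" "i - 1 \<noteq> Suc i" using that by (auto simp: adj_def)
      then have "val r True (fst (ps ! (i - 1))) (p i) (p (i - 1)) \<le> Nd r"
        using adjb[of "i - 1" i "fst (ps ! (i - 1))"] by presburger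
      then show ?thesis using True by (simp add: bw_def)
    next
      case False
      then have "bw z i = 0" by (auto simp: bw_def)
      then show ?thesis using Nd_nonneg[of r] by simp
    qed
  qed
  have Ub: "M * U r \<le> Nd (Suc r) - Nd r" "U r \<le> M * U r"
    using U_bound U_nonneg[of r] M by (auto simp: mult_le_cancel_right1)
  \<comment> \<open>Joining at the aligned position: forwards gives \<open>Pd\<close>, backwards
    only \<open>Nd\<close>, and the unshared steps are covered by the increase of
    \<open>Nd\<close>.\<close>
  have c2: "val (Suc r) False a z (p j) \<le> Pf (Suc r)" for a z
  proof -
    have jl: "j \<le> l" using jr by simp
    have "val (Suc r) False a z (p j) \<le> M * (fw z j + bw z j) + M * U r"
      using gen[OF jl, of False] by simp
    also have "\<dots> \<le> M * (Pd r + Nd r) + M * (M * U r)"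
      using fwb[OF jl, of z] Ub M by (intro add_mono mult_left_mono) auto
    also have "\<dots> = M * (M + Nd r + Nd r + M * U r)" by (simp add: Pd_def algebra_simps)
    also have "\<dots> \<le> M * (M + 2 * Nd (Suc r))"
      using Ub Nd_mono[of r] M by (intro mult_left_mono) auto
    finally show ?thesis by (simp add: Pf_def)
  qed
  have c3: "val (Suc r) False a z (p i) \<le> Nf (Suc r)" if i: "i \<le> l" "i \<noteq> j" for a z i
  proof -
    have "val (Suc r) False a z (p i) \<le> M * (fw z i + bw z i) + M * U r"
      using gen[OF i(1), of False] by simp
    also have "\<dots> \<le> M * (Nd r + Nd r) + M * (M * U r)"
      using fwb[OF i(1), of z] i Ub M by (intro add_mono mult_left_mono) auto
    also have "\<dots> = M * (Nd r + Nd r + M * U r)" by (simp add: algebra_simps)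
    also have "\<dots> \<le> M * (2 * Nd (Suc r))"
      using Ub Nd_mono[of r] M by (intro mult_left_mono) auto
    finally show ?thesis by (simp add: Nf_def)
  qed
  have c4: "val (Suc r) True a (p i') (p i) \<le> (if i = j \<and> i = Suc i' then Pd (Suc r) else Nd (Suc r))"
    if ii: "adj i i'" for a i i'
  proof -
    have i: "i \<le> l" "i' \<le> l" using ii by (auto simp: adj_def)
    have g: "val (Suc r) True a (p i') (p i) \<le> fw (p i') i + bw (p i') i + M * U r"
      using gen[OF i(1), of True] by simp
    \<comment> \<open>The forbidden vertex \<open>p i'\<close> removes the direction the walker came
      from, so a single shared continuation remains. Its factor is 1, and the bound increases only
      by \<open>M * U r\<close>.\<close>
    show ?thesis
    proof (cases "i = Suc i'")
      case True
      then have "bw (p i') i = 0" by (simp add: bw_def)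
      then show ?thesis using g fwb(1)[OF i(1), of "p i'"] True Ub
        by (auto simp: Pd_def split: if_splits)
    next
      case False
      then have "i' = Suc i" using ii by (auto simp: adj_def)
      then have "fw (p i') i = 0" by (simp add: fw_def)
      then show ?thesis using g fwb(2)[OF i(1), of "p i'"] False Ub by auto
    qed
  qed
  show ?thesis
    unfolding bounds_at_def j_def[symmetric] using c1 c2 c3 c4 by blast
qed

lemma bounds_all: "r \<le> l \<Longrightarrow> bounds_at r"
  by (induction r) (auto intro: bounds_at_0 bounds_at_Suc)

text \<open>The second path starts at \<open>u = p 0\<close> with \<open>l\<close> steps to go, that
  is, at the aligned position and after no shared edge, so the bound \<open>Pf l\<close>
  applies.\<close>

lemma total_bound:
  "(\<Sum>qs\<in>{qs. spath n l u v qs}. cw False Bullet u qs) \<le> M * (M + 2 * ga * Ah ^ l / real n)"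
proof -
  have un: "u < n" using path by (auto simp: spath_def pverts_def)
  then have "{qs. spath n l u v qs} = conts l u u"
    by (auto simp: spath_def conts_def pverts_def)
  then have "(\<Sum>qs\<in>{qs. spath n l u v qs}. cw False Bullet u qs) = val l False Bullet u (p (l - l))"
    by (simp add: val_def p_def)
  then show ?thesis
    using bounds_all[of l] by (simp add: bounds_at_def Pf_def Nd_def E_def mult.assoc)
qed

end

section \<open>The growth of the normalising constant\<close>

lemma finite_length_words [simp]: "finite {w :: decoration list. length w = r}"
  using finite_lists_length_eq[of "UNIV :: decoration set" r] by simp

lemma sum_words_Suc:
  "(\<Sum>w | length w = Suc r. f w) = (\<Sum>b\<in>(UNIV::decoration set). \<Sum>w | length w = r. (f (b # w) :: real))"
proof -
  have eq: "{w :: decoration list. length w = Suc r} = (\<lambda>(b, w). b # w) ` (UNIV \<times> {w. length w = r})"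
    by (auto simp: image_iff length_Suc_conv)
  show ?thesis
    unfolding eq by (subst sum.reindex) (auto simp: inj_on_def sum.cartesian_product case_prod_beta')
qed

text \<open>Induction with the eigenvector: the constant 1 at the end of a word dominates
  \<open>h\<close> divided by the sum of its entries, and each letter multiplies \<open>h\<close> by
  \<open>A\<close>.\<close>

lemma words_sum_ge:
  assumes eigen: "\<And>a. (\<Sum>b\<in>UNIV. (if a = b then 1 else rho\<^sup>2) * (dweight lam mu b)\<^sup>2 * h b) = A * h a"
    and h: "\<And>a. h a > 0" and A: "A > 0"
  shows "A ^ r * h a / (h Bullet + h Circ) \<le> (\<Sum>w | length w = r. (xiw lam mu rho a w)\<^sup>2)"
proof (induction r arbitrary: a)
  case 0
  have "h a \<le> h Bullet + h Circ" using h[of Bullet] h[of Circ] by (cases a) auto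
  moreover have "h Bullet + h Circ > 0" using h[of Bullet] h[of Circ] by simp
  ultimately show ?case by simp
next
  case (Suc r)
  let ?H = "h Bullet + h Circ"
  have "A ^ Suc r * h a / ?H = A ^ r * (A * h a) / ?H" by simp
  also have "\<dots> = (\<Sum>b\<in>UNIV. (if a = b then 1 else rho\<^sup>2) * (dweight lam mu b)\<^sup>2 * (A ^ r * h b / ?H))"
    unfolding eigen[symmetric] sum_distrib_left sum_divide_distrib by (intro sum.cong) auto
  also have "\<dots> \<le> (\<Sum>b\<in>UNIV. (if a = b then 1 else rho\<^sup>2) * (dweight lam mu b)\<^sup>2 *
      (\<Sum>w | length w = r. (xiw lam mu rho b w)\<^sup>2))"
    by (intro sum_mono mult_left_mono Suc.IH) auto
  also have "\<dots> = (\<Sum>w | length w = Suc r. (xiw lam mu rho a w)\<^sup>2)"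
    unfolding sum_words_Suc by (intro sum.cong refl) (auto simp: sum_distrib_left power_mult_distrib)
  finally show ?case .
qed

text \<open>A final \<open>Bullet\<close> multiplies the weight by \<open>lam\<close>, and by
  \<open>rho\<close> if the last letter changes.\<close>

lemma xiw_append_ge:
  assumes "0 \<le> lam" "0 \<le> mu" "0 < rho" "rho \<le> 1"
  shows "rho\<^sup>2 * lam\<^sup>2 * (xiw lam mu rho a w)\<^sup>2 \<le> (xiw lam mu rho a (w @ [Bullet]))\<^sup>2"
proof (induction w arbitrary: a)
  case Nil
  have "rho\<^sup>2 \<le> 1" using assms by (simp add: power_le_one)
  then show ?case by (auto simp: dweight_def power_mult_distrib mult_left_le_one_le)
next
  case (Cons b w)
  have "rho\<^sup>2 * lam\<^sup>2 * (xiw lam mu rho a (b # w))\<^sup>2 =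
     ((if a = b then 1 else rho) * dweight lam mu b)\<^sup>2 * (rho\<^sup>2 * lam\<^sup>2 * (xiw lam mu rho b w)\<^sup>2)"
    by (simp add: power_mult_distrib)
  also have "\<dots> \<le> ((if a = b then 1 else rho) * dweight lam mu b)\<^sup>2 * (xiw lam mu rho b (w @ [Bullet]))\<^sup>2"
    by (rule mult_left_mono[OF Cons.IH]) simp
  also have "\<dots> = (xiw lam mu rho a ((b # w) @ [Bullet]))\<^sup>2" by (simp add: power_mult_distrib)
  finally show ?case .
qed

text \<open>A free word of length \<open>l - 2\<close> is enclosed between two letters
  \<open>Bullet\<close>, which enforces the end condition and costs only a constant.\<close>

lemma beta_words_ge:
  assumes eigen: "\<And>a. (\<Sum>b\<in>UNIV. (if a = b then 1 else rho\<^sup>2) * (dweight lam mu b)\<^sup>2 * h b) = A * h a"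
    and h: "\<And>a. h a > 0" and A: "A > 0"
    and lm: "0 \<le> lam" "0 \<le> mu" "0 < rho" "rho \<le> 1" and l: "l \<ge> 2"
  shows "lam ^ 4 * rho\<^sup>2 * h Bullet / (A\<^sup>2 * (h Bullet + h Circ)) * A ^ l \<le> beta_words lam mu rho l"
proof -
  obtain r where r: "l = Suc (Suc r)" using l by (metis add_2_eq_Suc le_Suc_ex)
  let ?f = "\<lambda>w. Bullet # w @ [Bullet]"
  have "lam ^ 4 * rho\<^sup>2 * h Bullet / (A\<^sup>2 * (h Bullet + h Circ)) * A ^ l =
      lam\<^sup>2 * (rho\<^sup>2 * lam\<^sup>2) * (A ^ r * h Bullet / (h Bullet + h Circ))"
    using A unfolding r by (simp add: power4_eq_xxxx power2_eq_square)
  also have "\<dots> \<le> lam\<^sup>2 * (rho\<^sup>2 * lam\<^sup>2) * (\<Sum>w | length w = r. (xiw lam mu rho Bullet w)\<^sup>2)"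
    by (intro mult_left_mono words_sum_ge[OF eigen h A]) auto
  also have "\<dots> \<le> (\<Sum>w | length w = r. (xiw lam mu rho Bullet (?f w))\<^sup>2)"
    unfolding sum_distrib_left
  proof (rule sum_mono)
    fix w
    have "lam\<^sup>2 * (rho\<^sup>2 * lam\<^sup>2 * (xiw lam mu rho Bullet w)\<^sup>2) \<le>
        lam\<^sup>2 * (xiw lam mu rho Bullet (w @ [Bullet]))\<^sup>2"
      by (rule mult_left_mono[OF xiw_append_ge[OF lm]]) simp
    then show "lam\<^sup>2 * (rho\<^sup>2 * lam\<^sup>2) * (xiw lam mu rho Bullet w)\<^sup>2 \<le> (xiw lam mu rho Bullet (?f w))\<^sup>2"
      by (simp add: dweight_def power_mult_distrib mult.assoc)
  qed
  also have "\<dots> = (\<Sum>w\<in>?f ` {w. length w = r}. (xiw lam mu rho Bullet w)\<^sup>2)"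
    by (subst sum.reindex) (auto simp: inj_on_def)
  also have "\<dots> \<le> beta_words lam mu rho l"
    unfolding beta_words_def by (rule sum_mono2) (auto simp: words_def r)
  finally show ?thesis .
qed

section \<open>Counting vertex sequences\<close>

definition vertex_lists :: "nat \<Rightarrow> nat \<Rightarrow> nat \<Rightarrow> nat \<Rightarrow> nat list set" where
  "vertex_lists n l u v = {ys. length ys = l \<and> set (u # ys) \<subseteq> {..<n} \<and> distinct (u # ys) \<and> last (u # ys) = v}"

text \<open>Letters and vertices of a path can be chosen independently of each other. Hence the sum
  over paths is the product of a counting factor and a sum over words.\<close>

lemma sum_path_steps:
  fixes f :: "decoration list \<Rightarrow> real"
  shows "(\<Sum>ps\<in>path_steps n l u v. f (map fst ps)) = real (card (vertex_lists n l u v)) * (\<Sum>w\<in>words l. f w)"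
proof -
  have "path_steps n l u v = (\<lambda>(w, ys). zip w ys) ` (words l \<times> vertex_lists n l u v)"
  proof (intro set_eqI iffI)
    fix ps assume "ps \<in> path_steps n l u v"
    then show "ps \<in> (\<lambda>(w, ys). zip w ys) ` (words l \<times> vertex_lists n l u v)"
      by (intro image_eqI[of _ _ "(map fst ps, map snd ps)"])
        (auto simp: path_steps_def vertex_lists_def pverts_def zip_map_fst_snd)
  next
    fix ps assume "ps \<in> (\<lambda>(w, ys). zip w ys) ` (words l \<times> vertex_lists n l u v)"
    then obtain w ys where ps: "ps = zip w ys" "w \<in> words l" "ys \<in> vertex_lists n l u v" by auto
    then have "length w = length ys" by (simp add: words_def vertex_lists_def)
    then have "pverts u ps = u # ys" "map fst ps = w" "length ps = length ys"
      using ps by (simp_all add: pverts_def)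
    then show "ps \<in> path_steps n l u v" using ps by (simp add: path_steps_def vertex_lists_def)
  qed
  moreover have "inj_on (\<lambda>(w, ys). zip w ys) (words l \<times> vertex_lists n l u v)"
    by (intro inj_onI) (auto simp: words_def vertex_lists_def zip_eq_conv)
  ultimately have "(\<Sum>ps\<in>path_steps n l u v. f (map fst ps)) =
      (\<Sum>(w, ys)\<in>words l \<times> vertex_lists n l u v. f (map fst (zip w ys)))"
    by (simp add: sum.reindex case_prod_beta')
  also have "\<dots> = (\<Sum>(w, ys)\<in>words l \<times> vertex_lists n l u v. f w)"
    by (intro sum.cong refl) (auto simp: words_def vertex_lists_def)
  also have "\<dots> = real (card (vertex_lists n l u v)) * (\<Sum>w\<in>words l. f w)"
    by (simp add: sum.cartesian_product[symmetric] sum_distrib_left)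
  finally show ?thesis .
qed

lemma card_vertex_lists:
  assumes "u < n" "v < n" "u \<noteq> v" "1 \<le> l" "l < n"
  shows "card (vertex_lists n l u v) = \<Prod>{n - l .. n - 2}"
proof -
  let ?S = "{zs. length zs = l - 1 \<and> distinct zs \<and> set zs \<subseteq> {..<n} - {u, v}}"
  have "vertex_lists n l u v = (\<lambda>zs. zs @ [v]) ` ?S"
  proof (intro set_eqI iffI)
    fix ys assume y: "ys \<in> vertex_lists n l u v"
    then have ne: "ys \<noteq> []" using assms by (auto simp: vertex_lists_def)
    then have "last ys = v" using y by (auto simp: vertex_lists_def)
    then have e: "ys = butlast ys @ [v]" using ne by (metis append_butlast_last_id)
    have "distinct (butlast ys @ [v])" "set (butlast ys @ [v]) \<subseteq> {..<n} - {u}"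
      unfolding e[symmetric] using y by (auto simp: vertex_lists_def)
    then have "butlast ys \<in> ?S" using y by (auto simp: vertex_lists_def)
    then show "ys \<in> (\<lambda>zs. zs @ [v]) ` ?S" using e by blast
  qed (use assms in \<open>auto simp: vertex_lists_def\<close>)
  then have "card (vertex_lists n l u v) = card ?S"
    by (simp add: card_image inj_on_def)
  also have "\<dots> = \<Prod>{n - 2 - (l - 1) + 1 .. n - 2}"
    using card_lists_distinct_length_eq[of "{..<n} - {u, v}" "l - 1"] assms
    by (simp add: numeral_2_eq_2)
  also have "n - 2 - (l - 1) + 1 = n - l" using assms by simp
  finally show ?thesis .
qed

lemma card_vertex_lists_le:
  assumes "u < n" "v < n" "u \<noteq> v" "1 \<le> l"
  shows "real (card (vertex_lists n l u v)) \<le> real n ^ (l - 1)"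
proof (cases "l < n")
  case True
  have "real (\<Prod>{n - l .. n - 2}) = (\<Prod>k\<in>{n - l .. n - 2}. real k)" by simp
  also have "\<dots> \<le> (\<Prod>k\<in>{n - l .. n - 2}. real n)" by (rule prod_mono) auto
  also have "\<dots> = real n ^ (l - 1)" using True assms by simp
  finally show ?thesis using card_vertex_lists[OF assms True] by simp
next
  case False
  have "vertex_lists n l u v = {}"
  proof -
    have "False" if "ys \<in> vertex_lists n l u v" for ys
    proof -
      have "card (set (u # ys)) \<le> card {..<n}"
        by (rule card_mono) (use that in \<open>auto simp: vertex_lists_def\<close>)
      moreover have "card (set (u # ys)) = Suc l"
        using that distinct_card[of "u # ys"] by (simp add: vertex_lists_def)
      ultimately show False using False by simp
    qed
    then show ?thesis by blast
  qed
  then show ?thesis by simp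
qed

text \<open>Each of the \<open>l - 1\<close> factors is at least \<open>n - l\<close>, and the
  Bernoulli inequality applies. The error \<open>l^2 / n\<close> governs the convergence of the
  mean.\<close>

lemma card_vertex_lists_ge:
  assumes "u < n" "v < n" "u \<noteq> v" "1 \<le> l" "l < n"
  shows "(1 - (real l)\<^sup>2 / real n) * real n ^ (l - 1) \<le> real (card (vertex_lists n l u v))"
proof -
  have n: "real n > 0" using assms by simp
  have "1 - (real l)\<^sup>2 / real n \<le> 1 + real (l - 1) * (- (real l / real n))"
  proof -
    have "real (l - 1) * real l \<le> (real l)\<^sup>2" unfolding power2_eq_square by (intro mult_right_mono) auto
    then show ?thesis using n by (simp add: divide_right_mono)
  qed
  also have "\<dots> \<le> (1 + - (real l / real n)) ^ (l - 1)"
    by (rule Bernoulli_inequality) (use n assms in \<open>simp add: field_simps\<close>)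
  finally have "(1 - (real l)\<^sup>2 / real n) * real n ^ (l - 1) \<le> (1 + - (real l / real n)) ^ (l - 1) * real n ^ (l - 1)"
    by (rule mult_right_mono) simp
  also have "\<dots> = (\<Prod>k\<in>{n - l .. n - 2}. real n - real l)"
    using n assms by (simp add: power_mult_distrib[symmetric] field_simps)
  also have "\<dots> \<le> (\<Prod>k\<in>{n - l .. n - 2}. real k)"
    by (rule prod_mono) (use assms in auto)
  also have "\<dots> = real (card (vertex_lists n l u v))" using card_vertex_lists[OF assms] by simp
  finally show ?thesis .
qed

text \<open>An eigenvector of the matrix with rows \<open>(lam^2, rho^2 mu^2)\<close> and
  \<open>(rho^2 lam^2, mu^2)\<close>, read off its first row.\<close>

definition perron :: "real \<Rightarrow> real \<Rightarrow> real \<Rightarrow> decoration \<Rightarrow> real" where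
  "perron lam mu rho a = (case a of Bullet \<Rightarrow> rho\<^sup>2 * mu\<^sup>2 | Circ \<Rightarrow> A_plus lam mu rho - lam\<^sup>2)"

text \<open>This says that \<open>A_plus\<close> is a root of the characteristic polynomial; it
  supplies the second row of the eigenvalue equation.\<close>

lemma A_plus_quadratic:
  assumes "0 \<le> rho"
  shows "(A_plus lam mu rho)\<^sup>2 - A_plus lam mu rho * (lam\<^sup>2 + mu\<^sup>2) + lam\<^sup>2 * mu\<^sup>2 * (1 - rho ^ 4) = 0"
proof -
  define d where "d = lam^4 + mu^4 - (2 - 4 * rho^4) * lam\<^sup>2 * mu\<^sup>2"
  have "d = (lam\<^sup>2 - mu\<^sup>2)\<^sup>2 + 4 * rho^4 * lam\<^sup>2 * mu\<^sup>2"
    by (simp add: d_def power2_eq_square power4_eq_xxxx algebra_simps)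
  also have "\<dots> \<ge> 0" using assms by (intro add_nonneg_nonneg mult_nonneg_nonneg) auto
  finally have s: "sqrt d * sqrt d = d" by simp
  have "A_plus lam mu rho = 1/2 * (lam\<^sup>2 + mu\<^sup>2 + sqrt d)" by (simp add: A_plus_def d_def)
  moreover have "a\<^sup>2 - a * S = (q * q - S\<^sup>2) / 4" if "a = 1/2 * (S + q)" for a S q :: real
    unfolding that by (simp add: power2_eq_square field_simps)
  ultimately have "(A_plus lam mu rho)\<^sup>2 - A_plus lam mu rho * (lam\<^sup>2 + mu\<^sup>2) + lam\<^sup>2 * mu\<^sup>2 * (1 - rho ^ 4) =
     (sqrt d * sqrt d - (lam\<^sup>2 + mu\<^sup>2)\<^sup>2) / 4 + lam\<^sup>2 * mu\<^sup>2 * (1 - rho ^ 4)"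
    by metis
  also have "\<dots> = 0" unfolding s by (simp add: d_def power2_eq_square power4_eq_xxxx field_simps)
  finally show ?thesis .
qed

text \<open>If one signal strength vanishes, then \<open>A_plus\<close> is the square of the other
  one and does not exceed 1. Positivity is needed for the eigenvector and for the lower bound on the
  normalising constant.\<close>

lemma A_plus_pos_params:
  assumes "0 \<le> lam" "lam \<le> 1" "0 \<le> mu" "mu \<le> 1" "A_plus lam mu rho > 1"
  shows "lam > 0" "mu > 0"
proof -
  have q: "sqrt (x ^ 4) = x\<^sup>2" for x :: real
    using real_sqrt_abs[of "x\<^sup>2"] by simp
  have "A_plus 0 mu rho = mu\<^sup>2" "A_plus lam 0 rho = lam\<^sup>2"
    by (simp_all add: A_plus_def q)
  moreover have "lam\<^sup>2 \<le> 1" "mu\<^sup>2 \<le> 1" using assms by (auto simp: power_le_one)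
  ultimately show "lam > 0" "mu > 0" using assms by (metis less_eq_real_def not_less)+
qed

lemma perron:
  assumes "0 \<le> lam" "lam \<le> 1" "0 \<le> mu" "mu \<le> 1" "0 < rho" "A_plus lam mu rho > 1"
  shows "perron lam mu rho a > 0"
    "(\<Sum>b\<in>UNIV. (if a = b then 1 else rho\<^sup>2) * (dweight lam mu b)\<^sup>2 * perron lam mu rho b) =
      A_plus lam mu rho * perron lam mu rho a"
proof -
  have "lam\<^sup>2 \<le> 1" using assms by (simp add: power_le_one)
  then show "perron lam mu rho a > 0"
    using assms A_plus_pos_params[OF assms(1-4,6)] by (cases a) (auto simp: perron_def)
  show "(\<Sum>b\<in>UNIV. (if a = b then 1 else rho\<^sup>2) * (dweight lam mu b)\<^sup>2 * perron lam mu rho b) =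
      A_plus lam mu rho * perron lam mu rho a"
  proof (cases a)
    case Bullet
    then show ?thesis by (simp add: UNIV_decoration perron_def dweight_def algebra_simps)
  next
    case Circ
    then show ?thesis using A_plus_quadratic[of rho lam mu] assms
      by (simp add: UNIV_decoration perron_def dweight_def algebra_simps power2_eq_square power4_eq_xxxx)
  qed
qed

section \<open>Moments of the statistic\<close>

lemma path_steps_spath: "ps \<in> path_steps n l u v \<Longrightarrow> spath n l u v ps"
  by (simp add: path_steps_def spath_def)

lemma f_S_keys:
  assumes p: "spath n l u v ps"
  shows "f_S (pgraph u ps) (X_of lam n (s, W, Z, xi)) (Y_of mu n (s, W, Z, xi)) =
    (\<Prod>k\<in>keys u ps. sig n lam mu s k + noise W Z k)"
proof -
  let ?K = "keys u ps"
  have d: "distinct (pverts u ps)" using p by (simp add: spath_def)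
  have E: "edges_of b (pgraph u ps) = {e. (e, b) \<in> ?K}" for b
    by (simp add: edges_of_pgraph[OF d] keys_def)
  have ent: "X_of lam n (s, W, Z, xi) (Min e) (Max e) = sig n lam mu s (e, Bullet) + noise W Z (e, Bullet)"
    "Y_of mu n (s, W, Z, xi) (Min e) (Max e) = sig n lam mu s (e, Circ) + noise W Z (e, Circ)"
    if e: "e \<in> pair_sets n" for e
  proof -
    obtain i j where "i < j" "e = {i, j}" "Min e = i" "Max e = j" by (rule pair_setsE[OF e])
    then show "X_of lam n (s, W, Z, xi) (Min e) (Max e) = sig n lam mu s (e, Bullet) + noise W Z (e, Bullet)"
      "Y_of mu n (s, W, Z, xi) (Min e) (Max e) = sig n lam mu s (e, Circ) + noise W Z (e, Circ)"
      by (simp_all add: X_of_def Y_of_def sig_def noise_def sym_entry_def dweight_def co_def)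
  qed
  have ps: "e \<in> pair_sets n" if "(e, b) \<in> ?K" for e b
    using valid_keys_path[OF p] that by (force simp: valid_keys_def)
  show ?thesis
    unfolding f_S_def E by (subst prod_keys_split[OF finite_keys]) (auto intro!: arg_cong2[of _ _ _ _ times] prod.cong simp: ent ps)
qed

definition Phi_const :: "nat \<Rightarrow> nat \<Rightarrow> real \<Rightarrow> real \<Rightarrow> real \<Rightarrow> real" where
  "Phi_const n l lam mu rho = 2 / (real n powr (real l / 2 - 1) * beta_words lam mu rho l)"

lemma Phi_rv_eq:
  assumes l: "l \<ge> 1"
  shows "Phi_rv n l lam mu rho u v (s, W, Z, xi) = Phi_const n l lam mu rho *
    (\<Sum>ps\<in>path_steps n l u v. xiw lam mu rho Bullet (map fst ps) *
       (color_weight l xi (set (pverts u ps)) * (\<Prod>k\<in>keys u ps. sig n lam mu s k + noise W Z k)))"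
proof -
  have "Phi_rv n l lam mu rho u v (s, W, Z, xi) = Phi_const n l lam mu rho *
    (\<Sum>ps\<in>path_steps n l u v. xiw lam mu rho Bullet (map fst ps) *
       (1 / (real (num_colorings l) * kappa l) *
          (\<Sum>k<num_colorings l. chi (xi k) (set (pverts u ps)) *
             f_S (pgraph u ps) (X_of lam n (s, W, Z, xi)) (Y_of mu n (s, W, Z, xi)))))"
    unfolding Phi_rv_def Phi_eq[OF l] Phi_const_def by (simp add: xi_of_def)
  also have "\<dots> = Phi_const n l lam mu rho *
    (\<Sum>ps\<in>path_steps n l u v. xiw lam mu rho Bullet (map fst ps) *
       (color_weight l xi (set (pverts u ps)) * (\<Prod>k\<in>keys u ps. sig n lam mu s k + noise W Z k)))"
    by (intro arg_cong[of _ _ "\<lambda>z. Phi_const n l lam mu rho * z"] sum.cong refl)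
      (simp add: f_S_keys[OF path_steps_spath] color_weight_def sum_distrib_right[symmetric] mult.assoc)
  finally show ?thesis .
qed

lemma card_path_verts: "spath n l u v ps \<Longrightarrow> card (set (pverts u ps)) = l + 1"
  by (simp add: spath_def distinct_card)

lemma xiw_path:
  assumes "ps \<in> path_steps n l u v" "l \<ge> 1"
  shows "xiw lam mu rho Bullet (map fst ps) = Xi_weight lam mu rho (pgraph u ps)"
proof -
  have "distinct (pverts u ps)" "ps \<noteq> []" "map fst ps \<in> words l" "length ps = l"
    using assms by (auto simp: path_steps_def)
  then show ?thesis using Xi_weight_pgraph_word by simp
qed

lemma xiw_nonneg: "0 \<le> lam \<Longrightarrow> 0 \<le> mu \<Longrightarrow> 0 \<le> rho \<Longrightarrow> 0 \<le> xiw lam mu rho a w"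
  by (induction w arbitrary: a) (auto simp: dweight_def split: decoration.split)

definition pair_term where
  "pair_term n l lam mu u g ps qs = (\<lambda>(s, W, Z, xi).
     (\<Prod>k\<in>keys u ps. sig n lam mu s k + noise W Z k) *
     (\<Prod>k\<in>keys u qs. sig n lam mu s k + noise W Z k) * (\<Prod>v<n. fst (s v) ^ g v) *
     (color_weight l xi (set (pverts u ps)) * color_weight l xi (set (pverts u qs))))"

text \<open>The factor 2 is the bound on the mixed mean of two colour weights. Multiplying by the
  coefficient of the second path turns the estimate into one relative to the first path.\<close>

lemma pair_term_bound:
  assumes sp: "spike_prior rho C prior" and rho: "0 < rho" "rho \<le> 1" and D: "D = 1 + 2 * C" "C \<ge> 0"
    and lm: "0 \<le> lam" "lam \<le> 1" "0 \<le> mu" "mu \<le> 1" and n: "n > 0" and l: "l \<ge> 1"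
    and p: "spath n l u v ps" and q: "spath n l u v qs"
    and g: "\<And>x. x \<noteq> u \<Longrightarrow> x \<noteq> v \<Longrightarrow> g x = 0" "\<And>x. g x \<le> 2"
  shows "integrable (model_law prior n l) (pair_term n l lam mu u g ps qs)"
    and "Xi_weight lam mu rho (pgraph u qs) *
        \<bar>\<integral>om. pair_term n l lam mu u g ps qs om \<partial>model_law prior n l\<bar> \<le>
      2 * (1 + D\<^sup>2 / real n) ^ l * Xi_weight lam mu rho (pgraph u ps) *
        cont_weight n lam mu rho (D / rho) (keys u ps) (set (pverts u ps)) False Bullet u qs"
proof -
  let ?K = "keys u ps" and ?L = "keys u qs"
  define q' where "q' xi = color_weight l xi (set (pverts u ps)) * color_weight l xi (set (pverts u qs))" for xi
  have D1: "D \<ge> 1" using D by simp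
  have deg: "bdeg ?K Bullet x + bdeg ?K Circ x + bdeg ?L Bullet x + bdeg ?L Circ x + g x \<le> 4" for x
    using card_inc_le[OF p, of x] card_inc_le[OF q, of x] card_inc_end[OF p, of x]
      card_inc_end[OF q, of x] g(1)[of x] g(2)[of x] bdeg_total[OF finite_keys, of u ps x]
      bdeg_total[OF finite_keys, of u qs x]
    by (cases "x = u \<or> x = v") auto
  have sub: "set (pverts u ps) \<subseteq> {..<n}" "set (pverts u qs) \<subseteq> {..<n}"
    using p q by (auto simp: spath_def)
  note cm = color_weight_moments[OF sub(1) card_path_verts[OF p] sub(2) card_path_verts[OF q]]
  have qi: "integrable (coloring_law n l) q'" unfolding q'_def by (rule cm(3))
  note mm = model_monomial[OF sp valid_keys_path[OF p] valid_keys_path[OF q] deg qi, of lam mu]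
  have pt: "pair_term n l lam mu u g ps qs = (\<lambda>(s, W, Z, xi). (\<Prod>k\<in>?K. sig n lam mu s k + noise W Z k) *
      (\<Prod>k\<in>?L. sig n lam mu s k + noise W Z k) * (\<Prod>v<n. fst (s v) ^ g v) * q' xi)"
    unfolding pair_term_def q'_def ..
  show "integrable (model_law prior n l) (pair_term n l lam mu u g ps qs)"
    unfolding pt by (rule mm(1))
  let ?b = "(\<Prod>k\<in>?K - ?L. dweight lam mu (snd k) / sqrt (real n)) *
     (\<Prod>k\<in>?L - ?K. dweight lam mu (snd k) / sqrt (real n)) * (\<Prod>x<n. pair_vertex rho D u v ps qs x)"
  have q2: "\<bar>\<integral>xi. q' xi \<partial>coloring_law n l\<bar> \<le> 2" using cm(4,5) by (simp add: q'_def)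
  have XI: "0 \<le> Xi_weight lam mu rho (pgraph u qs)" "0 \<le> Xi_weight lam mu rho (pgraph u ps)"
    using lm rho by (simp_all add: Xi_weight_def)
  have b0: "0 \<le> ?b" using pair_vertex_nonneg[OF rho(1), of D u v ps qs] D1 dweight_bounds[OF lm]
    by (simp add: prod_nonneg)
  have "\<bar>\<integral>om. pair_term n l lam mu u g ps qs om \<partial>model_law prior n l\<bar> \<le> ?b * (1 + D\<^sup>2 / real n) ^ l * 2"
    unfolding pt mm(2) abs_mult
    by (rule mult_mono[OF pair_sum_bound[OF sp rho(1) D lm n p q g] q2]) (use b0 in auto)
  then have "Xi_weight lam mu rho (pgraph u qs) *
        \<bar>\<integral>om. pair_term n l lam mu u g ps qs om \<partial>model_law prior n l\<bar> \<le>
     Xi_weight lam mu rho (pgraph u qs) * (?b * (1 + D\<^sup>2 / real n) ^ l * 2)"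
    using XI(1) by (rule mult_left_mono)
  also have "\<dots> = 2 * (1 + D\<^sup>2 / real n) ^ l * (Xi_weight lam mu rho (pgraph u qs) * ?b)" by simp
  also have "\<dots> \<le> 2 * (1 + D\<^sup>2 / real n) ^ l * (Xi_weight lam mu rho (pgraph u ps) *
      ((\<Prod>k\<in>?L. edge_factor n lam mu ?K k) * (\<Prod>x\<in>set (pverts u qs). vertex_factor rho D u v ps qs x)))"
    by (intro mult_left_mono pair_product_relative[OF rho D1 lm n p q]) auto
  also have "\<dots> \<le> 2 * (1 + D\<^sup>2 / real n) ^ l * (Xi_weight lam mu rho (pgraph u ps) *
      cont_weight n lam mu rho (D / rho) (keys u ps) (set (pverts u ps)) False Bullet u qs)"
    using l XI by (intro mult_left_mono pair_product_le_cont_weight[OF rho D1 _ p q]) auto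
  finally show "Xi_weight lam mu rho (pgraph u qs) *
        \<bar>\<integral>om. pair_term n l lam mu u g ps qs om \<partial>model_law prior n l\<bar> \<le>
      2 * (1 + D\<^sup>2 / real n) ^ l * Xi_weight lam mu rho (pgraph u ps) *
        cont_weight n lam mu rho (D / rho) (keys u ps) (set (pverts u ps)) False Bullet u qs"
    by (simp add: mult.assoc)
qed

text \<open>The constants can be chosen one after the other: \<open>th\<close> from the eigenvector,
  \<open>al = th\<close>, then \<open>ga\<close>, and finally \<open>k0\<close> as a sum that meets
  both of its requirements. None of them depends on \<open>n\<close>, \<open>l\<close> or the
  path.\<close>

lemma transfer_constants:
  assumes lm: "0 \<le> lam" "lam \<le> 1" "0 \<le> mu" "mu \<le> 1" and rho: "0 < rho" "rho \<le> 1"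
    and A: "A_plus lam mu rho > 1" and M: "M \<ge> 1"
  obtains al th ga k0 where
    "\<And>n l u v ps. spath n l u v ps \<Longrightarrow> l \<ge> 1 \<Longrightarrow> n \<ge> 1 \<Longrightarrow>
       transfer n l u v ps lam mu rho M (A_plus lam mu rho) (perron lam mu rho) al th ga k0"
    "ga \<ge> 0" "k0 \<ge> 0"
proof -
  let ?A = "A_plus lam mu rho" and ?h = "perron lam mu rho"
  note h = perron(1)[OF lm rho(1) A]
  define hm where "hm = min (?h Bullet) (?h Circ)"
  have hm: "hm > 0" "hm \<le> ?h a" for a using h by (auto simp: hm_def) (cases a; simp)
  define th where "th = 2 * M\<^sup>2 / (hm * (?A - 1))"
  define ga where "ga = (M * (?h Bullet + ?h Circ) * th + 2 * M ^ 3) / (?A - 1)"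
  define k0 where "k0 = 4 * M\<^sup>2 + 4 * M * ga / (th * hm)"
  have th0: "th > 0" using M hm A by (simp add: th_def)
  have ga0: "ga \<ge> 0" using M A th0 h[of Bullet] h[of Circ] by (simp add: ga_def)
  have th1: "2 * M\<^sup>2 \<le> th * ?h a * (?A - 1)" for a
  proof -
    have "2 * M\<^sup>2 = th * hm * (?A - 1)" using hm A by (simp add: th_def)
    also have "\<dots> \<le> th * ?h a * (?A - 1)" using th0 hm A by (intro mult_right_mono mult_left_mono) auto
    finally show ?thesis .
  qed
  have k1: "4 * M * ga \<le> th * k0 * ?h a" for a
  proof -
    have "4 * M * ga = th * (4 * M * ga / (th * hm)) * hm" using th0 hm by simp
    also have "\<dots> \<le> th * k0 * ?h a"
      using th0 hm ga0 M by (intro mult_mono) (auto simp: k0_def)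
    finally show ?thesis .
  qed
  have k00: "4 * M\<^sup>2 \<le> k0" "k0 \<ge> 0" using M ga0 th0 hm by (auto simp: k0_def)
  show ?thesis
  proof (rule that[of th th ga k0])
    fix n l u v ps assume "spath n l u v ps" "(l::nat) \<ge> 1" "(n::nat) \<ge> 1"
    then show "transfer n l u v ps lam mu rho M ?A ?h th th ga k0"
      using lm rho M A perron(2)[OF lm rho(1) A] h th0 th1 k00 k1 ga0
      by unfold_locales (auto simp: ga_def)
  qed (use ga0 k00 in auto)
qed

lemma ln_square_le:
  assumes "n \<ge> (1::nat)"
  shows "(ln (real n))\<^sup>2 \<le> 4 * real n" "ln (real n) \<le> real n" "0 \<le> ln (real n)"
proof -
  have "ln (real n) = 2 * ln (sqrt (real n))" using assms by (simp add: ln_sqrt)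
  also have "\<dots> \<le> 2 * sqrt (real n)" using ln_le_minus_one[of "sqrt (real n)"] assms by simp
  finally have "ln (real n) \<le> 2 * sqrt (real n)" .
  moreover show z: "0 \<le> ln (real n)" using assms by simp
  ultimately have "(ln (real n))\<^sup>2 \<le> (2 * sqrt (real n))\<^sup>2" by (intro power_mono)
  then show "(ln (real n))\<^sup>2 \<le> 4 * real n" by (simp add: power_mult_distrib)
  show "ln (real n) \<le> real n" using ln_le_minus_one[of "real n"] assms by simp
qed

text \<open>The growth condition forces \<open>l >= 2\<close>, since a single factor
  \<open>1 + delta < 1.1\<close> is below \<open>n^2 >= 4\<close>; then \<open>K > 0\<close>
  follows. The crude bound of \<open>l^2\<close> by a multiple of \<open>n\<close> controls the
  second moment, the logarithmic one the convergence of the mean.\<close>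

lemma admissible_facts:
  assumes d: "0 < delta" "delta < 0.1" and ad: "admissible_length delta K n l" and n: "n \<ge> 2"
  shows "l \<ge> 2" "K > 0" "(real l)\<^sup>2 \<le> 4 * K\<^sup>2 * real n" "real l \<le> K * real n"
    "(real l)\<^sup>2 \<le> K\<^sup>2 * (ln (real n))\<^sup>2"
proof -
  have a: "real l \<le> K * ln (real n)" "(1 + delta) ^ l \<ge> (real n)\<^sup>2"
    using ad by (auto simp: admissible_length_def)
  have "(2::real)\<^sup>2 \<le> (real n)\<^sup>2" using n by (intro power_mono) auto
  then have ge4: "(1 + delta) ^ l \<ge> 4" using a by simp
  show l: "l \<ge> 2"
  proof (rule ccontr)
    assume "\<not> l \<ge> 2"
    then have "(1 + delta) ^ l \<le> (1 + delta) ^ 1" using d by (intro power_increasing) auto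
    then show False using ge4 d by simp
  qed
  note lnn = ln_square_le[of n]
  have "K * ln (real n) > 0" using a(1) l by linarith
  then show K: "K > 0" using lnn(3) n by (simp add: zero_less_mult_iff)
  show l2: "(real l)\<^sup>2 \<le> K\<^sup>2 * (ln (real n))\<^sup>2"
    using power_mono[OF a(1), of 2] by (simp add: power_mult_distrib)
  also have "\<dots> \<le> K\<^sup>2 * (4 * real n)" using lnn(1) n by (intro mult_left_mono) auto
  finally show "(real l)\<^sup>2 \<le> 4 * K\<^sup>2 * real n" by simp
  have "K * ln (real n) \<le> K * real n" using lnn(2) n K by (intro mult_left_mono) auto
  with a(1) show "real l \<le> K * real n" by linarith
qed

lemma power_le_exp: "0 \<le> x \<Longrightarrow> (1 + x) ^ l \<le> exp (real l * x)" for x :: real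
  using power_mono[OF exp_ge_add_one_self[of x], of l] by (simp add: exp_of_nat_mult)

lemma finite_spath [simp]: "finite {qs. spath n l u v qs}"
proof (rule finite_subset)
  show "{qs. spath n l u v qs} \<subseteq> {ps. set ps \<subseteq> UNIV \<times> {..<n} \<and> length ps = l}"
    unfolding spath_def pverts_def by force
qed (intro finite_lists_length_eq finite_SigmaI, simp_all)

lemma cont_weight_nonneg:
  "M \<ge> 0 \<Longrightarrow> rho \<ge> 0 \<Longrightarrow> 0 \<le> cont_weight n lam mu rho M K V m a x qs"
  using edge_factor_nonneg by (induction qs arbitrary: m a x) auto

text \<open>After summation over the first path, the scale of the second moment is
  \<open>n / B\<close>. It is tiny, and it meets a sum over second paths of order at most
  \<open>1 + A ^ l / n\<close>.\<close>

lemma Phi_const_square: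
  assumes n: "n \<ge> 1" and l: "l \<ge> 2" and B: "B = beta_words lam mu rho l" "B > 0"
  shows "(Phi_const n l lam mu rho)\<^sup>2 * real n ^ (l - 1) * B = 4 * (real n / B)"
proof -
  have "(real n powr (real l / 2 - 1))\<^sup>2 = real n powr (real l - 2)"
    using n by (simp add: powr_power)
  also have "real l - 2 = real (l - 2)" using l by simp
  also have "real n powr real (l - 2) = real n ^ (l - 2)" using n by (simp add: powr_realpow)
  finally have p: "(real n powr (real l / 2 - 1))\<^sup>2 = real n ^ (l - 2)" .
  have "l - 1 = Suc (l - 2)" using l by simp
  then have q: "real n ^ (l - 1) = real n * real n ^ (l - 2)" by (metis power_Suc)
  have "real n ^ (l - 2) > 0" using n by simp
  then show ?thesis
    unfolding Phi_const_def power_divide power_mult_distrib p q B(1)[symmetric]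
    using B(2) n by (simp add: power2_eq_square)
qed

lemma Phi_square_expand:
  assumes l: "l \<ge> 1"
  shows "(\<lambda>om. (Phi_rv n l lam mu rho u v om)\<^sup>2 * (\<Prod>x<n. x_of om x ^ g x)) =
    (\<lambda>om. (Phi_const n l lam mu rho)\<^sup>2 * (\<Sum>ps\<in>path_steps n l u v. \<Sum>qs\<in>path_steps n l u v.
       xiw lam mu rho Bullet (map fst ps) * xiw lam mu rho Bullet (map fst qs) *
       pair_term n l lam mu u g ps qs om))"
proof
  fix om :: outcome
  obtain s W Z xi where om: "om = (s, W, Z, xi)" by (metis surj_pair)
  define a where "a ps = xiw lam mu rho Bullet (map fst ps) *
       (color_weight l xi (set (pverts u ps)) * (\<Prod>k\<in>keys u ps. sig n lam mu s k + noise W Z k))" for ps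
  have "Phi_rv n l lam mu rho u v om = Phi_const n l lam mu rho * (\<Sum>ps\<in>path_steps n l u v. a ps)"
    unfolding om Phi_rv_eq[OF l] a_def ..
  then have "(Phi_rv n l lam mu rho u v om)\<^sup>2 * (\<Prod>x<n. x_of om x ^ g x) =
     (Phi_const n l lam mu rho)\<^sup>2 * ((\<Sum>ps\<in>path_steps n l u v. \<Sum>qs\<in>path_steps n l u v. a ps * a qs) *
       (\<Prod>x<n. x_of om x ^ g x))"
    by (simp add: power_mult_distrib power2_eq_square sum_product)
  also have "\<dots> = (Phi_const n l lam mu rho)\<^sup>2 * (\<Sum>ps\<in>path_steps n l u v. \<Sum>qs\<in>path_steps n l u v.
       xiw lam mu rho Bullet (map fst ps) * xiw lam mu rho Bullet (map fst qs) *
       pair_term n l lam mu u g ps qs om)"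
    unfolding sum_distrib_right
    by (rule arg_cong[of _ _ "\<lambda>z. (Phi_const n l lam mu rho)\<^sup>2 * z"], intro sum.cong refl)
      (simp add: a_def pair_term_def om x_of_def)
  finally show "(Phi_rv n l lam mu rho u v om)\<^sup>2 * (\<Prod>x<n. x_of om x ^ g x) = \<dots>" .
qed

text \<open>The exponent \<open>g\<close> treats both second moments at once: \<open>g = 0\<close>
  for the plain one, and \<open>g = 2\<close> at \<open>u\<close> and \<open>v\<close> for the one
  with the spikes.\<close>

lemma second_moment_bound:
  assumes lm: "0 \<le> lam" "lam \<le> 1" "0 \<le> mu" "mu \<le> 1" and rho: "0 < rho" "rho \<le> 1"
    and d: "0 < delta" "delta < 0.1" and A: "A_plus lam mu rho > 1 + delta" and C: "C \<ge> 0"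
  shows "\<exists>R>0. \<forall>prior n l u v g. spike_prior rho C prior \<longrightarrow> admissible_length delta K n l \<longrightarrow>
      u < n \<longrightarrow> v < n \<longrightarrow> u \<noteq> v \<longrightarrow> (\<forall>x. x \<noteq> u \<longrightarrow> x \<noteq> v \<longrightarrow> g x = 0) \<longrightarrow> (\<forall>x. g x \<le> 2) \<longrightarrow>
      integrable (model_law prior n l) (\<lambda>om. (Phi_rv n l lam mu rho u v om)\<^sup>2 * (\<Prod>x<n. x_of om x ^ g x)) \<and>
      (\<integral>om. (Phi_rv n l lam mu rho u v om)\<^sup>2 * (\<Prod>x<n. x_of om x ^ g x) \<partial>model_law prior n l) \<le> R"
proof -
  let ?A = "A_plus lam mu rho" and ?h = "perron lam mu rho"
  define D where "D = 1 + 2 * C"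
  define M where "M = D / rho"
  have A1: "?A > 1" using A d by simp
  have D1: "D \<ge> 1" using C by (simp add: D_def)
  then have M: "M \<ge> 1" using rho by (simp add: M_def le_divide_eq)
  obtain al th ga k0 where tr: "\<And>n l u v ps. spath n l u v ps \<Longrightarrow> l \<ge> 1 \<Longrightarrow> n \<ge> 1 \<Longrightarrow>
       transfer n l u v ps lam mu rho M ?A ?h al th ga k0" and ga: "ga \<ge> 0" "k0 \<ge> 0"
    by (rule transfer_constants[OF lm rho A1 M]) (rule that)
  note h = perron[OF lm rho(1) A1]
  define cB where "cB = lam ^ 4 * rho\<^sup>2 * ?h Bullet / (?A\<^sup>2 * (?h Bullet + ?h Circ))"
  have lampos: "lam > 0" by (rule A_plus_pos_params(1)[OF lm A1])
  have cB: "cB > 0"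
    unfolding cB_def using lampos rho h(1)[of Bullet] h(1)[of Circ] A1 by (intro divide_pos_pos mult_pos_pos add_pos_pos) auto
  \<comment> \<open>The 8 is 2 from the colourings times 4 from the squared prefactor, and the
    exponential bounds \<open>(1 + D^2 / n) ^ l\<close>. The summand \<open>M / cB\<close> bounds
    the pairs that run together, the other one the pairs that separate.\<close>
  define R where "R = 8 * exp (D\<^sup>2 * K) * (M * (M / cB + 2 * ga * exp (8 * k0 * K\<^sup>2) / cB))"
  have R: "R > 0"
    unfolding R_def using M cB ga by (intro mult_pos_pos add_pos_nonneg) auto
  show ?thesis
  proof (intro exI[of _ R] conjI[OF R] allI impI)
    fix prior n l u v and g :: "nat \<Rightarrow> nat"
    assume sp: "spike_prior rho C prior" and ad: "admissible_length delta K n l"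
      and uv: "u < n" "v < n" "u \<noteq> v" and g': "\<forall>x. x \<noteq> u \<longrightarrow> x \<noteq> v \<longrightarrow> g x = 0" "\<forall>x. g x \<le> 2"
    have g: "\<And>x. x \<noteq> u \<Longrightarrow> x \<noteq> v \<Longrightarrow> g x = 0" "\<And>x. g x \<le> 2" using g' by auto
    have n: "n \<ge> 2" using uv by simp
    note af = admissible_facts[OF d ad n]
    have l1: "l \<ge> 1" using af by simp
    have n1: "n \<ge> 1" "n > 0" using n by auto
    let ?m = "model_law prior n l" and ?P = "path_steps n l u v"
    let ?x = "\<lambda>ps. xiw lam mu rho Bullet (map fst ps)"
    define B where "B = beta_words lam mu rho l"
    have Bge: "cB * ?A ^ l \<le> B"
      unfolding cB_def B_def
      by (rule beta_words_ge[OF h(2) h(1)]) (use A1 lm rho af in auto)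
    have A0: "?A ^ l > 0" using A1 by simp
    then have B0: "B > 0" using Bge cB by (smt (verit) mult_pos_pos)
    define G where "G = ?A + k0 * (1 + real l) / real n"
    have G0: "G \<ge> 0" using A1 ga by (auto simp: G_def intro!: add_nonneg_nonneg)
    have nn: "0 \<le> 2 * (1 + D\<^sup>2 / real n) ^ l * (M * (M + 2 * ga * G ^ l / real n))"
      using G0 M ga D1 by (intro mult_nonneg_nonneg add_nonneg_nonneg divide_nonneg_nonneg zero_le_power) auto
    define c0 where "c0 = Phi_const n l lam mu rho"
    have pt: "integrable ?m (pair_term n l lam mu u g ps qs)"
      "?x qs * \<bar>\<integral>om. pair_term n l lam mu u g ps qs om \<partial>?m\<bar> \<le>
       2 * (1 + D\<^sup>2 / real n) ^ l * ?x ps *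
        cont_weight n lam mu rho M (keys u ps) (set (pverts u ps)) False Bullet u qs"
      if "ps \<in> ?P" "qs \<in> ?P" for ps qs
      using pair_term_bound[OF sp rho D_def C lm n1(2) l1 path_steps_spath[OF that(1)] path_steps_spath[OF that(2)] g]
      unfolding xiw_path[OF that(1) l1] xiw_path[OF that(2) l1] M_def by auto
    have ci: "integrable ?m (\<lambda>om. ?x ps * ?x qs * pair_term n l lam mu u g ps qs om)"
      if "ps \<in> ?P" "qs \<in> ?P" for ps qs
      using pt(1)[OF that] by simp
    have I: "integrable ?m (\<lambda>om. (Phi_rv n l lam mu rho u v om)\<^sup>2 * (\<Prod>x<n. x_of om x ^ g x))"
      unfolding Phi_square_expand[OF l1]
      by (intro integrable_mult_right integral_double_sum(1) ci)
    have x0: "0 \<le> ?x ps" for ps using xiw_nonneg lm rho by auto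
    have tb: "(\<Sum>qs\<in>?P. cont_weight n lam mu rho M (keys u ps) (set (pverts u ps)) False Bullet u qs)
        \<le> M * (M + 2 * ga * G ^ l / real n)" if "ps \<in> ?P" for ps
    proof -
      interpret transfer n l u v ps lam mu rho M ?A ?h al th ga k0
        by (rule tr[OF path_steps_spath[OF that] l1 n1(1)])
      have "(\<Sum>qs\<in>?P. cont_weight n lam mu rho M (keys u ps) (set (pverts u ps)) False Bullet u qs)
          \<le> (\<Sum>qs\<in>{qs. spath n l u v qs}. cont_weight n lam mu rho M (keys u ps) (set (pverts u ps)) False Bullet u qs)"
        using M rho by (intro sum_mono2 cont_weight_nonneg) (auto intro: path_steps_spath)
      also have "\<dots> \<le> M * (M + 2 * ga * G ^ l / real n)"
        using total_bound unfolding K_def V_def Ah_def G_def .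
      finally show ?thesis .
    qed
    have "(\<integral>om. (Phi_rv n l lam mu rho u v om)\<^sup>2 * (\<Prod>x<n. x_of om x ^ g x) \<partial>?m) =
       c0\<^sup>2 * (\<Sum>ps\<in>?P. \<Sum>qs\<in>?P. ?x ps * ?x qs * (\<integral>om. pair_term n l lam mu u g ps qs om \<partial>?m))"
      unfolding Phi_square_expand[OF l1] c0_def
      by (subst integral_mult_right_zero, subst integral_double_sum(2)) (use ci in auto)
    also have "\<dots> \<le> c0\<^sup>2 * (\<Sum>ps\<in>?P. \<Sum>qs\<in>?P. ?x ps * (2 * (1 + D\<^sup>2 / real n) ^ l * ?x ps *
        cont_weight n lam mu rho M (keys u ps) (set (pverts u ps)) False Bullet u qs))"
    proof (intro mult_left_mono sum_mono)
      fix ps qs assume pq: "ps \<in> ?P" "qs \<in> ?P"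
      have "?x ps * ?x qs * (\<integral>om. pair_term n l lam mu u g ps qs om \<partial>?m) \<le>
          ?x ps * (?x qs * \<bar>\<integral>om. pair_term n l lam mu u g ps qs om \<partial>?m\<bar>)"
        unfolding mult.assoc by (intro mult_left_mono x0 abs_ge_self)
      also have "\<dots> \<le> ?x ps * (2 * (1 + D\<^sup>2 / real n) ^ l * ?x ps *
        cont_weight n lam mu rho M (keys u ps) (set (pverts u ps)) False Bullet u qs)"
        by (rule mult_left_mono[OF pt(2)[OF pq] x0])
      finally show "?x ps * ?x qs * (\<integral>om. pair_term n l lam mu u g ps qs om \<partial>?m) \<le> \<dots>" .
    qed simp
    also have "\<dots> = c0\<^sup>2 * (\<Sum>ps\<in>?P. 2 * (1 + D\<^sup>2 / real n) ^ l * (?x ps)\<^sup>2 *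
       (\<Sum>qs\<in>?P. cont_weight n lam mu rho M (keys u ps) (set (pverts u ps)) False Bullet u qs))"
      by (simp add: sum_distrib_left power2_eq_square mult_ac)
    also have "\<dots> \<le> c0\<^sup>2 * (\<Sum>ps\<in>?P. 2 * (1 + D\<^sup>2 / real n) ^ l * (?x ps)\<^sup>2 * (M * (M + 2 * ga * G ^ l / real n)))"
      by (intro mult_left_mono sum_mono tb) (auto intro!: mult_nonneg_nonneg)
    also have "\<dots> = 2 * (1 + D\<^sup>2 / real n) ^ l * (M * (M + 2 * ga * G ^ l / real n)) *
        (c0\<^sup>2 * (\<Sum>ps\<in>?P. (?x ps)\<^sup>2))"
      by (simp add: sum_distrib_left mult_ac)
    \<comment> \<open>The bound on the inner sum is the same for every first path, so the squared
      weights of the first path sum to the normalising constant times the number of vertex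
      sequences.\<close>
    also have "(\<Sum>ps\<in>?P. (?x ps)\<^sup>2) = real (card (vertex_lists n l u v)) * B"
      unfolding B_def beta_words_def by (rule sum_path_steps)
    also have "2 * (1 + D\<^sup>2 / real n) ^ l * (M * (M + 2 * ga * G ^ l / real n)) *
        (c0\<^sup>2 * (real (card (vertex_lists n l u v)) * B)) \<le>
      2 * (1 + D\<^sup>2 / real n) ^ l * (M * (M + 2 * ga * G ^ l / real n)) *
        (c0\<^sup>2 * (real n ^ (l - 1) * B))"
      using B0 by (intro mult_left_mono[OF _ nn] mult_left_mono mult_right_mono card_vertex_lists_le[OF uv l1]) auto
    also have "c0\<^sup>2 * (real n ^ (l - 1) * B) = 4 * (real n / B)"
      using Phi_const_square[OF n1(1) af(1) B_def B0] by (simp add: c0_def mult.assoc)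
    also have "2 * (1 + D\<^sup>2 / real n) ^ l * (M * (M + 2 * ga * G ^ l / real n)) * (4 * (real n / B)) =
       8 * (1 + D\<^sup>2 / real n) ^ l * (M * (M * (real n / B) + 2 * ga * (G ^ l / B)))"
      using n1 B0 by (simp add: field_simps)
    also have "\<dots> \<le> R"
    proof -
      have e1: "(1 + D\<^sup>2 / real n) ^ l \<le> exp (D\<^sup>2 * K)"
      proof -
        have "(1 + D\<^sup>2 / real n) ^ l \<le> exp (real l * (D\<^sup>2 / real n))" by (rule power_le_exp) simp
        also have "real l * (D\<^sup>2 / real n) \<le> K * real n * (D\<^sup>2 / real n)"
          using af(4) by (intro mult_right_mono) auto
        also have "\<dots> = D\<^sup>2 * K" using n1 by simp
        finally show ?thesis by simp
      qed
      \<comment> \<open>This is where \<open>(1 + delta) ^ l >= n^2\<close> enters: \<open>B\<close>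
        is at least a constant times \<open>A ^ l\<close>, which exceeds \<open>n\<close>.\<close>
      have e2: "real n / B \<le> 1 / cB"
      proof -
        have "real n \<le> (real n)\<^sup>2" using n1 by (simp add: power2_eq_square)
        also have "\<dots> \<le> (1 + delta) ^ l" using ad by (simp add: admissible_length_def)
        also have "\<dots> \<le> ?A ^ l" using A d by (intro power_mono) auto
        finally have "cB * real n \<le> cB * ?A ^ l" using cB by (intro mult_left_mono) auto
        then have "cB * real n \<le> B" using Bge by simp
        then show ?thesis using cB B0 by (simp add: field_simps)
      qed
      \<comment> \<open>The corrected eigenvalue differs from \<open>A\<close> by a factor at most
        \<open>1 + e\<close> with \<open>l * e\<close> bounded, because \<open>l * (1 + l)\<close>
        is of order at most \<open>n\<close>.\<close>
      have e3: "G ^ l / B \<le> exp (8 * k0 * K\<^sup>2) / cB"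
      proof -
        define e where "e = k0 * (1 + real l) / real n"
        have e0: "e \<ge> 0" using ga by (simp add: e_def)
        have "G \<le> ?A * (1 + e)" unfolding G_def e_def[symmetric]
          using mult_right_mono[of 1 ?A e] A1 e0 by (simp add: distrib_left)
        then have "G ^ l \<le> (?A * (1 + e)) ^ l"
          using A1 e0 by (intro power_mono) (auto simp: G_def e_def[symmetric])
        also have "\<dots> = ?A ^ l * (1 + e) ^ l" by (rule power_mult_distrib)
        also have "(1 + e) ^ l \<le> exp (real l * e)" by (rule power_le_exp[OF e0])
        also have "real l * e \<le> 8 * k0 * K\<^sup>2"
        proof -
          have "real l * (1 + real l) \<le> 2 * (real l)\<^sup>2"
            using l1 by (simp add: power2_eq_square distrib_left)
          also have "\<dots> \<le> 8 * K\<^sup>2 * real n" using af(3) by linarith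
          finally have "k0 * (real l * (1 + real l)) \<le> k0 * (8 * K\<^sup>2 * real n)"
            using ga by (intro mult_left_mono) auto
          then show ?thesis using n1 by (simp add: e_def field_simps)
        qed
        finally have "G ^ l \<le> ?A ^ l * exp (8 * k0 * K\<^sup>2)" using A0 by simp
        then have "cB * G ^ l \<le> (cB * ?A ^ l) * exp (8 * k0 * K\<^sup>2)" using cB by simp
        also have "\<dots> \<le> B * exp (8 * k0 * K\<^sup>2)" using Bge by (intro mult_right_mono) auto
        finally show ?thesis using cB B0 by (simp add: field_simps)
      qed
      have f1: "M * (M * (real n / B) + 2 * ga * (G ^ l / B)) \<le>
          M * (M * (1 / cB) + 2 * ga * (exp (8 * k0 * K\<^sup>2) / cB))"
        using e2 e3 M ga by (intro mult_left_mono add_mono) auto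
      have f2: "0 \<le> M * (M * (real n / B) + 2 * ga * (G ^ l / B))"
        using M ga B0 G0 by (intro mult_nonneg_nonneg add_nonneg_nonneg divide_nonneg_nonneg zero_le_power) auto
      have f3: "8 * (1 + D\<^sup>2 / real n) ^ l \<le> 8 * exp (D\<^sup>2 * K)" using e1 by simp
      have "8 * (1 + D\<^sup>2 / real n) ^ l * (M * (M * (real n / B) + 2 * ga * (G ^ l / B))) \<le>
          8 * exp (D\<^sup>2 * K) * (M * (M * (1 / cB) + 2 * ga * (exp (8 * k0 * K\<^sup>2) / cB)))"
        by (rule mult_mono[OF f3 f1 _ f2]) simp
      then show ?thesis by (simp add: R_def)
    qed
    finally show "integrable ?m (\<lambda>om. (Phi_rv n l lam mu rho u v om)\<^sup>2 * (\<Prod>x<n. x_of om x ^ g x)) \<and>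
      (\<integral>om. (Phi_rv n l lam mu rho u v om)\<^sup>2 * (\<Prod>x<n. x_of om x ^ g x) \<partial>?m) \<le> R"
      using I by blast
  qed
qed

section \<open>The estimator\<close>

lemma prod_two_points:
  fixes u v n :: nat
  assumes "u < n" "v < n" "u \<noteq> v"
  shows "(\<Prod>x<n. f x ^ (if x = u \<or> x = v then m else 0)) = (f u ^ m * f v ^ m :: real)"
proof -
  have "(\<Prod>x<n. f x ^ (if x = u \<or> x = v then m else 0)) = (\<Prod>x\<in>{u, v}. f x ^ m)"
    by (rule prod.mono_neutral_cong_right) (use assms in auto)
  then show ?thesis using assms by simp
qed

lemma valid_keys_empty [simp]: "valid_keys n {}"
  by (simp add: valid_keys_def)

lemma bdeg_empty [simp]: "bdeg {} b x = 0"
  by (simp add: bdeg_def)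

text \<open>The instance of \<open>model_monomial\<close> without any edges.\<close>

lemma spike_monomial:
  fixes g :: "nat \<Rightarrow> nat"
  assumes sp: "spike_prior rho C prior" and g: "\<And>x. g x \<le> 4"
  shows "integrable (model_law prior n l) (\<lambda>om. \<Prod>x<n. x_of om x ^ g x)"
    "(\<integral>om. (\<Prod>x<n. x_of om x ^ g x) \<partial>model_law prior n l) = (\<Prod>x<n. prior_moment prior (g x) 0)"
proof -
  interpret Q: prob_space "coloring_law n l" by (rule prob_space_coloring_law)
  note m = model_monomial[OF sp valid_keys_empty valid_keys_empty, of n g l "\<lambda>_. 1" 1 1]
  have eq: "(\<lambda>om. \<Prod>x<n. x_of om x ^ g x) = (\<lambda>(s, W, Z, xi). (\<Prod>k\<in>{}. sig n 1 1 s k + noise W Z k) *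
      (\<Prod>k\<in>{}. sig n 1 1 s k + noise W Z k) * (\<Prod>v<n. fst (s v) ^ g v) * 1)"
    by (auto simp: x_of_def)
  show "integrable (model_law prior n l) (\<lambda>om. \<Prod>x<n. x_of om x ^ g x)"
    unfolding eq by (rule m(1)) (use g in auto)
  show "(\<integral>om. (\<Prod>x<n. x_of om x ^ g x) \<partial>model_law prior n l) = (\<Prod>x<n. prior_moment prior (g x) 0)"
    unfolding eq by (subst m(2)) (use g in \<open>auto simp: Q.prob_space\<close>)
qed

lemma spike_square_moment:
  assumes sp: "spike_prior rho C prior" and uw: "u < n" "w < n"
  shows "integrable (model_law prior n l) (\<lambda>om. (x_of om u)\<^sup>2 * (x_of om w)\<^sup>2)"
    "(\<integral>om. (x_of om u)\<^sup>2 * (x_of om w)\<^sup>2 \<partial>model_law prior n l) \<le> 1 + 2 * C"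
proof -
  define g where "g x = (if x = u then 2 else 0) + (if x = w then 2 else 0 :: nat)" for x
  have g4: "g x \<le> 4" for x by (simp add: g_def)
  have eq: "(\<Prod>x<n. f x ^ g x) = (f u)\<^sup>2 * (f w)\<^sup>2" for f :: "nat \<Rightarrow> real"
  proof -
    have "(\<Prod>x<n. f x ^ (if x = y then 2 else 0)) = (f y)\<^sup>2" if "y < n" for y
    proof -
      have "(\<Prod>x<n. f x ^ (if x = y then 2 else 0)) = (\<Prod>x\<in>{y}. f x ^ 2)"
        by (rule prod.mono_neutral_cong_right) (use that in auto)
      then show ?thesis by simp
    qed
    then show ?thesis using uw by (simp add: g_def power_add prod.distrib)
  qed
  have C0: "C \<ge> 0"
  proof -
    have "0 \<le> (\<integral>s. fst s ^ 4 \<partial>prior)" by (intro integral_nonneg_AE AE_I2) auto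
    also have "\<dots> \<le> C" using sp by (simp add: spike_prior_def)
    finally show ?thesis .
  qed
  show "integrable (model_law prior n l) (\<lambda>om. (x_of om u)\<^sup>2 * (x_of om w)\<^sup>2)"
    using spike_monomial(1)[where g = g and n = n and l = l, OF sp g4] unfolding eq .
  have "(\<integral>om. (x_of om u)\<^sup>2 * (x_of om w)\<^sup>2 \<partial>model_law prior n l) = (\<Prod>x<n. prior_moment prior (g x) 0)"
    using spike_monomial(2)[where g = g and n = n and l = l, OF sp g4] unfolding eq .
  also have "\<dots> \<le> 1 + 2 * C"
  proof (cases "u = w")
    case True
    have "(\<Prod>x<n. prior_moment prior (g x) 0) = (\<Prod>x\<in>{u}. prior_moment prior (g x) 0)"
      by (rule prod.mono_neutral_right) (use uw True prior_moment_values[OF sp] in \<open>auto simp: g_def\<close>)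
    also have "\<dots> \<le> 1 + 2 * C" using prior_moments(2)[OF sp, of 4 0] True by (simp add: g_def)
    finally show ?thesis .
  next
    case False
    have "prior_moment prior (g x) 0 = 1" for x
      using False prior_moment_values[OF sp] by (simp add: g_def numeral_2_eq_2)
    then show ?thesis using C0 by simp
  qed
  finally show "(\<integral>om. (x_of om u)\<^sup>2 * (x_of om w)\<^sup>2 \<partial>model_law prior n l) \<le> 1 + 2 * C" .
qed

text \<open>Measurability is obtained from the integrability of a suitable monomial.\<close>

lemma measurable_x_of:
  assumes sp: "spike_prior rho C prior" and u: "u < n"
  shows "(\<lambda>om. x_of om u) \<in> borel_measurable (model_law prior n l)"
proof -
  have "(\<Prod>x<n. x_of om x ^ (if x = u then 1 else 0)) = x_of om u" for om
  proof -
    have "(\<Prod>x<n. x_of om x ^ (if x = u then 1 else 0)) = (\<Prod>x\<in>{u}. x_of om x)"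
      by (rule prod.mono_neutral_cong_right) (use u in auto)
    then show ?thesis by simp
  qed
  then show ?thesis
    using spike_monomial(1)[OF sp, of "\<lambda>x. if x = u then 1 else 0" n l] by auto
qed

definition single_term where
  "single_term n l lam mu u g ps = (\<lambda>(s, W, Z, xi).
     (\<Prod>k\<in>keys u ps. sig n lam mu s k + noise W Z k) * (\<Prod>v<n. fst (s v) ^ g v) *
     color_weight l xi (set (pverts u ps)))"

lemma single_term_integral:
  fixes g :: "nat \<Rightarrow> nat"
  assumes sp: "spike_prior rho C prior" and p: "spath n l u v ps"
    and g: "\<And>x. x \<noteq> u \<Longrightarrow> x \<noteq> v \<Longrightarrow> g x = 0" "\<And>x. g x \<le> 2"
  shows "integrable (model_law prior n l) (single_term n l lam mu u g ps)"
    "(\<integral>om. single_term n l lam mu u g ps om \<partial>model_law prior n l) =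
      (\<Prod>k\<in>keys u ps. dweight lam mu (snd k) / sqrt (real n)) *
      (\<Prod>x<n. prior_moment prior (bdeg (keys u ps) Bullet x + g x) (bdeg (keys u ps) Circ x))"
proof -
  let ?K = "keys u ps"
  define q where "q xi = color_weight l xi (set (pverts u ps))" for xi
  have sub: "set (pverts u ps) \<subseteq> {..<n}" using p by (simp add: spath_def)
  note cm = color_weight_moments[OF sub card_path_verts[OF p] sub card_path_verts[OF p]]
  have qi: "integrable (coloring_law n l) q" unfolding q_def by (rule cm(1))
  have deg: "bdeg ?K Bullet x + bdeg ?K Circ x + bdeg {} Bullet x + bdeg {} Circ x + g x \<le> 4" for x
    using card_inc_le[OF p, of x] g(2)[of x] bdeg_total[OF finite_keys, of u ps x] by simp
  note mm = model_monomial[OF sp valid_keys_path[OF p] valid_keys_empty deg qi, of lam mu]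
  have eq: "single_term n l lam mu u g ps = (\<lambda>(s, W, Z, xi). (\<Prod>k\<in>?K. sig n lam mu s k + noise W Z k) *
      (\<Prod>k\<in>{}. sig n lam mu s k + noise W Z k) * (\<Prod>v<n. fst (s v) ^ g v) * q xi)"
    unfolding single_term_def q_def by simp
  show "integrable (model_law prior n l) (single_term n l lam mu u g ps)"
    unfolding eq by (rule mm(1))
  show "(\<integral>om. single_term n l lam mu u g ps om \<partial>model_law prior n l) =
      (\<Prod>k\<in>keys u ps. dweight lam mu (snd k) / sqrt (real n)) *
      (\<Prod>x<n. prior_moment prior (bdeg (keys u ps) Bullet x + g x) (bdeg (keys u ps) Circ x))"
  proof -
    have "(\<integral>xi. q xi \<partial>coloring_law n l) = 1" using cm(2) unfolding q_def .
    then show ?thesis unfolding eq mm(2) by simp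
  qed
qed

lemma Phi_expand:
  assumes l: "l \<ge> 1"
  shows "(\<lambda>om. Phi_rv n l lam mu rho u v om * (\<Prod>x<n. x_of om x ^ g x)) =
    (\<lambda>om. Phi_const n l lam mu rho * (\<Sum>ps\<in>path_steps n l u v.
       xiw lam mu rho Bullet (map fst ps) * single_term n l lam mu u g ps om))"
proof
  fix om :: outcome
  obtain s W Z xi where om: "om = (s, W, Z, xi)" by (metis surj_pair)
  show "Phi_rv n l lam mu rho u v om * (\<Prod>x<n. x_of om x ^ g x) =
    Phi_const n l lam mu rho * (\<Sum>ps\<in>path_steps n l u v.
       xiw lam mu rho Bullet (map fst ps) * single_term n l lam mu u g ps om)"
    unfolding om Phi_rv_eq[OF l] mult.assoc sum_distrib_right
    by (rule arg_cong[of _ _ "\<lambda>z. Phi_const n l lam mu rho * z"], intro sum.cong refl)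
      (simp add: single_term_def x_of_def)
qed

lemma measurable_Phi:
  assumes sp: "spike_prior rho C prior" and l: "l \<ge> 1"
  shows "Phi_rv n l lam mu rho' u v \<in> borel_measurable (model_law prior n l)"
proof -
  have "integrable (model_law prior n l) (\<lambda>om. Phi_rv n l lam mu rho' u v om * (\<Prod>x<n. x_of om x ^ (\<lambda>_. 0) x))"
    unfolding Phi_expand[OF l]
    by (intro integrable_mult_right Bochner_Integration.integrable_sum single_term_integral(1)[OF sp path_steps_spath])
      auto
  then show ?thesis by auto
qed

text \<open>The end condition on the letters is used here: with the additional factor from
  \<open>x\<close> the moment at an end becomes \<open>E[X^2] = 1\<close> and not
  \<open>rho\<close>.\<close>

lemma path_end_degrees:
  assumes ps: "ps \<in> path_steps n l u v" and l: "l \<ge> 1" and x: "x = u \<or> x = v"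
  shows "bdeg (keys u ps) Bullet x = 1" "bdeg (keys u ps) Circ x = 0"
proof -
  have p: "spath n l u v ps" using ps by (rule path_steps_spath)
  have len: "length ps = l" and w: "map fst ps \<in> words l" using ps by (auto simp: path_steps_def)
  have ne: "ps \<noteq> []" using len l by auto
  have "\<exists>k. inc (keys u ps) x = {k} \<and> snd k = Bullet"
  proof (cases "x = u")
    case True
    have "inc (keys u ps) x = {pedges u ps ! 0}" using inc_path[OF p, of 0] True l by simp
    moreover have "snd (pedges u ps ! 0) = Bullet"
      using w ne len l by (simp add: pedges_nth words_def hd_map hd_conv_nth)
    ultimately show ?thesis by blast
  next
    case False
    have "inc (keys u ps) x = {pedges u ps ! (l - 1)}"
      using inc_path[OF p, of l] False x l spath_last[OF p] by simp
    moreover have "snd (pedges u ps ! (l - 1)) = Bullet"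
      using w ne len l by (simp add: pedges_nth words_def last_map last_conv_nth)
    ultimately show ?thesis by blast
  qed
  then obtain k where k: "inc (keys u ps) x = {k}" "snd k = Bullet" by blast
  have "{k' \<in> inc (keys u ps) x. snd k' = Bullet} = {k}" "{k' \<in> inc (keys u ps) x. snd k' = Circ} = {}"
    using k by auto
  then show "bdeg (keys u ps) Bullet x = 1" "bdeg (keys u ps) Circ x = 0"
    unfolding bdeg_inc by simp_all
qed

text \<open>A single path cannot match any noise, so only the pure signal survives, and its mean is
  the weight of the path times \<open>n ^ (-l/2)\<close>. The weighted sum is thus a sum of squares
  and cancels the normalising constant, leaving the number of vertex sequences.\<close>

lemma Phi_mean:
  assumes sp: "spike_prior rho C prior" and rho: "0 < rho" and l: "l \<ge> 1"
    and uv: "u < n" "v < n" "u \<noteq> v" and B: "beta_words lam mu rho l \<noteq> 0"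
  shows "integrable (model_law prior n l) (\<lambda>om. Phi_rv n l lam mu rho u v om * x_of om u * x_of om v)"
    "(\<integral>om. Phi_rv n l lam mu rho u v om * x_of om u * x_of om v \<partial>model_law prior n l) =
      2 * real (card (vertex_lists n l u v)) / real n ^ (l - 1)"
proof -
  define g where "g x = (if x = u \<or> x = v then 1 else 0 :: nat)" for x
  have g: "\<And>x. x \<noteq> u \<Longrightarrow> x \<noteq> v \<Longrightarrow> g x = 0" "\<And>x. g x \<le> 2" by (auto simp: g_def)
  have eq: "(\<lambda>om. Phi_rv n l lam mu rho u v om * x_of om u * x_of om v) =
      (\<lambda>om. Phi_rv n l lam mu rho u v om * (\<Prod>x<n. x_of om x ^ g x))"
    unfolding g_def using prod_two_points[OF uv, of _ 1] by (simp add: mult.assoc)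
  note st = single_term_integral[OF sp path_steps_spath g]
  have n: "real n > 0" using uv by simp
  show I: "integrable (model_law prior n l) (\<lambda>om. Phi_rv n l lam mu rho u v om * x_of om u * x_of om v)"
    unfolding eq Phi_expand[OF l]
    by (intro integrable_mult_right Bochner_Integration.integrable_sum st(1))
  have val: "(\<integral>om. single_term n l lam mu u g ps om \<partial>model_law prior n l) =
      xiw lam mu rho Bullet (map fst ps) / sqrt (real n) ^ l" if ps: "ps \<in> path_steps n l u v" for ps
  proof -
    have p: "spath n l u v ps" using ps by (rule path_steps_spath)
    have "prior_moment prior (bdeg (keys u ps) Bullet x + g x) (bdeg (keys u ps) Circ x) =
        turn_weight rho (keys u ps) x" for x
    proof (cases "x = u \<or> x = v")
      case True
      then show ?thesis
        using path_end_degrees[OF ps l True] prior_moment_values[OF sp]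
        by (simp add: g_def turn_weight_def numeral_2_eq_2)
    next
      case False
      then show ?thesis using single_path_moment[OF sp rho p, of x] g(1)[of x] by simp
    qed
    then have "(\<integral>om. single_term n l lam mu u g ps om \<partial>model_law prior n l) =
      (\<Prod>k\<in>keys u ps. dweight lam mu (snd k) / sqrt (real n)) * (\<Prod>x<n. turn_weight rho (keys u ps) x)"
      using st(2)[OF ps] by simp
    also have "\<dots> = Xi_weight lam mu rho (pgraph u ps) / sqrt (real n) ^ l"
      unfolding Xi_weight_keys[OF p] by (simp add: prod_dividef card_keys[OF p])
    finally show ?thesis using xiw_path[OF ps l] by simp
  qed
  have "(\<integral>om. Phi_rv n l lam mu rho u v om * x_of om u * x_of om v \<partial>model_law prior n l) =
      Phi_const n l lam mu rho * (\<Sum>ps\<in>path_steps n l u v. xiw lam mu rho Bullet (map fst ps) *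
        (\<integral>om. single_term n l lam mu u g ps om \<partial>model_law prior n l))"
    unfolding eq Phi_expand[OF l]
    by (subst integral_mult_right_zero, subst Bochner_Integration.integral_sum) (use st(1) in auto)
  also have "\<dots> = Phi_const n l lam mu rho / sqrt (real n) ^ l *
      (\<Sum>ps\<in>path_steps n l u v. (xiw lam mu rho Bullet (map fst ps))\<^sup>2)"
    by (simp add: val sum_distrib_left power2_eq_square mult_ac)
  also have "(\<Sum>ps\<in>path_steps n l u v. (xiw lam mu rho Bullet (map fst ps))\<^sup>2) =
      real (card (vertex_lists n l u v)) * beta_words lam mu rho l"
    unfolding beta_words_def by (rule sum_path_steps)
  also have "Phi_const n l lam mu rho / sqrt (real n) ^ l * (real (card (vertex_lists n l u v)) * beta_words lam mu rho l) =
      2 * real (card (vertex_lists n l u v)) / (real n powr (real l / 2 - 1) * sqrt (real n) ^ l)"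
    using B by (simp add: Phi_const_def)
  also have "real n powr (real l / 2 - 1) * sqrt (real n) ^ l = real n ^ (l - 1)"
  proof -
    have "sqrt (real n) ^ l = real n powr (real l / 2)"
      using n by (simp add: powr_half_sqrt[symmetric] powr_power)
    then have "real n powr (real l / 2 - 1) * sqrt (real n) ^ l = real n powr (real l - 1)"
      by (simp add: powr_add[symmetric])
    also have "real l - 1 = real (l - 1)" using l by simp
    finally show ?thesis using n by (simp add: powr_realpow)
  qed
  finally show "(\<integral>om. Phi_rv n l lam mu rho u v om * x_of om u * x_of om v \<partial>model_law prior n l) =
      2 * real (card (vertex_lists n l u v)) / real n ^ (l - 1)" .
qed

lemma prob_space_model_law: "spike_prior rho C prior \<Longrightarrow> prob_space (model_law prior n l)"
  unfolding model_law_def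
  by (intro prob_space_pair prob_space_spikes prob_space_wigner_law prob_space_coloring_law)

lemma Phi_rv_diag: "l \<ge> 1 \<Longrightarrow> Phi_rv n l lam mu rho w w om = 0"
proof -
  assume l: "l \<ge> 1"
  have "ps \<notin> path_steps n l w w" for ps
  proof
    assume ps: "ps \<in> path_steps n l w w"
    then have "map snd ps \<noteq> []" using l by (auto simp: path_steps_def)
    then have "w \<in> set (map snd ps)"
      using ps last_in_set[of "map snd ps"] by (simp add: path_steps_def pverts_def)
    then show False using ps by (simp add: path_steps_def pverts_def)
  qed
  then have "path_steps n l w w = {}" by blast
  then show ?thesis using l unfolding Phi_rv_def by (simp add: Phi_eq)
qed

text \<open>The Cauchy-Schwarz inequality. The last identity also covers vanishing norms: there the
  inner product is 0, as is the overlap by the convention for division.\<close>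

lemma overlap_bounds:
  "0 \<le> overlap n a b" "overlap n a b \<le> 1"
  "\<bar>\<Sum>u<n. a u * b u\<bar> = overlap n a b * (sqrt (\<Sum>u<n. (a u)\<^sup>2) * sqrt (\<Sum>u<n. (b u)\<^sup>2))"
proof -
  let ?S = "\<bar>\<Sum>u<n. a u * b u\<bar>" and ?N = "sqrt (\<Sum>u<n. (a u)\<^sup>2) * sqrt (\<Sum>u<n. (b u)\<^sup>2)"
  have cs: "?S \<le> ?N"
    using L2_set_mult_ineq[where f = a and g = b and A = "{..<n}"] sum_abs[of "\<lambda>u. a u * b u" "{..<n}"]
    by (simp add: L2_set_def abs_mult)
  have N0: "0 \<le> ?N" by (intro mult_nonneg_nonneg real_sqrt_ge_zero sum_nonneg) auto
  show "0 \<le> overlap n a b" unfolding overlap_def using N0 by simp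
  show "overlap n a b \<le> 1"
  proof (cases "?N = 0")
    case False
    then have "?N > 0" using N0 by linarith
    then show ?thesis unfolding overlap_def using cs by (metis divide_le_eq_1_pos)
  next
    case True
    then show ?thesis unfolding overlap_def by (metis div_by_0 zero_le_one)
  qed
  show "?S = overlap n a b * ?N" unfolding overlap_def using cs N0 by (cases "?N = 0") auto
qed

text \<open>The overlap is bounded below through \<open>E[<x_hat, x> x_w]\<close>; truncation of the weight
  \<open>Y = |x| |x_w| / sqrt n\<close> at the level \<open>m\<close> costs at most \<open>E[Y^2] / m\<close>.\<close>

lemma overlap_lower_bound:
  assumes sp: "spike_prior rho C prior" and l: "l \<ge> 1" and w: "w < n" and n: "n \<ge> 2"
    and R: "R \<ge> 2"
    and s1: "\<And>u. u < n \<Longrightarrow> u \<noteq> w \<Longrightarrow> integrable (model_law prior n l) (\<lambda>om. (Phi_rv n l lam mu rho w u om)\<^sup>2)"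
      "\<And>u. u < n \<Longrightarrow> u \<noteq> w \<Longrightarrow> (\<integral>om. (Phi_rv n l lam mu rho w u om)\<^sup>2 \<partial>model_law prior n l) \<le> R"
    and s2: "\<And>u. u < n \<Longrightarrow> u \<noteq> w \<Longrightarrow> integrable (model_law prior n l)
        (\<lambda>om. (Phi_rv n l lam mu rho w u om)\<^sup>2 * (x_of om w)\<^sup>2 * (x_of om u)\<^sup>2)"
      "\<And>u. u < n \<Longrightarrow> u \<noteq> w \<Longrightarrow> (\<integral>om. (Phi_rv n l lam mu rho w u om)\<^sup>2 * (x_of om w)\<^sup>2 * (x_of om u)\<^sup>2
         \<partial>model_law prior n l) \<le> R"
    and me: "\<And>u. u < n \<Longrightarrow> u \<noteq> w \<Longrightarrow> integrable (model_law prior n l)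
        (\<lambda>om. Phi_rv n l lam mu rho w u om * x_of om w * x_of om u)"
      "\<And>u. u < n \<Longrightarrow> u \<noteq> w \<Longrightarrow> 3 / 2 \<le> (\<integral>om. Phi_rv n l lam mu rho w u om * x_of om w * x_of om u
         \<partial>model_law prior n l)"
  shows "1 / (16 * (R ^ 4)\<^sup>2 * (1 + 2 * C)) \<le>
    (\<integral>om. overlap n (x_hat R n l lam mu rho w om) (x_of om) \<partial>model_law prior n l)"
proof -
  let ?M = "model_law prior n l"
  interpret prob_space ?M by (rule prob_space_model_law[OF sp])
  define a where "a = R ^ 4"
  have a: "a \<ge> 2 * R" "a > 0"
  proof -
    have "2 * R \<le> 2 ^ 3 * R" using R by simp
    also have "\<dots> \<le> R ^ 3 * R" using R by (intro mult_right_mono power_mono) auto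
    also have "\<dots> = a" by (simp add: a_def power4_eq_xxxx power3_eq_cube)
    finally show "a \<ge> 2 * R" .
    then show "a > 0" using R by linarith
  qed
  have C1: "1 + 2 * C \<ge> 1"
  proof -
    have "0 \<le> (\<integral>s. fst s ^ 4 \<partial>prior)" by (intro integral_nonneg_AE AE_I2) auto
    also have "\<dots> \<le> C" using sp by (simp add: spike_prior_def)
    finally show ?thesis by simp
  qed
  define P where "P u om = Phi_rv n l lam mu rho w u om" for u om
  define xh where "xh om u = x_hat R n l lam mu rho w om u" for om u
  define x where "x om u = x_of om u" for om u
  have xh: "xh om u = P u om * of_bool (\<bar>P u om\<bar> \<le> a)" for om u
    by (simp add: xh_def x_hat_def P_def a_def)
  have [measurable]: "P u \<in> borel_measurable ?M" for u
    unfolding P_def by (rule measurable_Phi[OF sp l])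
  have mx [measurable]: "(\<lambda>om. x om u) \<in> borel_measurable ?M" if "u < n" for u
    unfolding x_def by (rule measurable_x_of[OF sp that])
  have mxh [measurable]: "(\<lambda>om. xh om u) \<in> borel_measurable ?M" for u
    unfolding xh by measurable
  have xhb: "\<bar>xh om u\<bar> \<le> a" for om u using a by (auto simp: xh abs_mult)
  have xhw: "xh om w = 0" for om by (simp add: xh P_def Phi_rv_diag[OF l])
  define S where "S om = (\<Sum>u<n. xh om u * x om u)" for om
  define N2 where "N2 om = (\<Sum>u<n. (x om u)\<^sup>2)" for om
  define ov where "ov om = overlap n (xh om) (x om)" for om
  define Y where "Y om = sqrt (N2 om) * \<bar>x om w\<bar> / sqrt n" for om
  have mov [measurable]: "ov \<in> borel_measurable ?M"
    unfolding ov_def overlap_def using mx mxh by measurable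
  have iov: "integrable ?M ov"
    by (rule integrable_const_bound[of _ 1]) (use overlap_bounds in \<open>auto simp: ov_def\<close>)
  have one: "integrable ?M (\<lambda>om. xh om u * x om w * x om u)"
    "1 \<le> (\<integral>om. xh om u * x om w * x om u \<partial>?M)" if u: "u < n" "u \<noteq> w" for u
  proof -
    \<comment> \<open>Beyond the truncation level, \<open>\<bar>P\<bar>\<close> is at most
      \<open>P^2 / a\<close>, and the product of spikes is at most half of one plus its square. So
      the truncation error has mean at most \<open>R / a\<close>, where
      \<open>a >= 2 * R\<close>.\<close>
    define D where "D om = ((P u om)\<^sup>2 + (P u om)\<^sup>2 * (x om w)\<^sup>2 * (x om u)\<^sup>2) / (2 * a)" for om
    have iD: "integrable ?M D" unfolding D_def using s1(1)[OF u] s2(1)[OF u]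
      by (intro integrable_divide integrable_add) (auto simp: P_def x_def)
    have ptw: "\<bar>P u om * x om w * x om u - xh om u * x om w * x om u\<bar> \<le> D om" for om
    proof (cases "\<bar>P u om\<bar> \<le> a")
      case True
      then show ?thesis using a by (simp add: xh D_def)
    next
      case False
      let ?t = "\<bar>x om w * x om u\<bar>"
      have "\<bar>P u om\<bar> * a \<le> \<bar>P u om\<bar> * \<bar>P u om\<bar>" using False by (intro mult_left_mono) auto
      then have "\<bar>P u om\<bar> \<le> (P u om)\<^sup>2 / a" using a by (simp add: field_simps power2_eq_square)
      then have "\<bar>P u om\<bar> * ?t \<le> (P u om)\<^sup>2 / a * ?t" by (rule mult_right_mono) simp
      also have "?t \<le> (1 + ?t\<^sup>2) / 2" using sum_squares_bound[of 1 ?t] by simp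
      then have "(P u om)\<^sup>2 / a * ?t \<le> (P u om)\<^sup>2 / a * ((1 + ?t\<^sup>2) / 2)" using a by (intro mult_left_mono) auto
      also have "\<dots> = D om" by (simp add: D_def field_simps power_mult_distrib)
      finally show ?thesis using False by (simp add: xh abs_mult mult.assoc)
    qed
    have iP: "integrable ?M (\<lambda>om. P u om * x om w * x om u)"
      using me(1)[OF u] by (simp add: P_def x_def)
    have idiff: "integrable ?M (\<lambda>om. P u om * x om w * x om u - xh om u * x om w * x om u)"
      by (rule Bochner_Integration.integrable_bound[OF iD])
        (use u w ptw in \<open>auto intro!: AE_I2 order_trans[OF _ abs_ge_self]\<close>)
    have "integrable ?M (\<lambda>om. P u om * x om w * x om u - (P u om * x om w * x om u - xh om u * x om w * x om u))"
      by (rule Bochner_Integration.integrable_diff[OF iP idiff])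
    then show i: "integrable ?M (\<lambda>om. xh om u * x om w * x om u)" by simp
    have "(\<integral>om. P u om * x om w * x om u - xh om u * x om w * x om u \<partial>?M) \<le> (\<integral>om. D om \<partial>?M)"
      by (rule integral_mono[OF idiff iD]) (use ptw in \<open>auto intro: order_trans[OF abs_ge_self]\<close>)
    also have "(\<integral>om. D om \<partial>?M) = ((\<integral>om. (P u om)\<^sup>2 \<partial>?M) + (\<integral>om. (P u om)\<^sup>2 * (x om w)\<^sup>2 * (x om u)\<^sup>2 \<partial>?M)) / (2 * a)"
      unfolding D_def using s1(1)[OF u] s2(1)[OF u] by (simp add: P_def x_def)
    also have "\<dots> \<le> (R + R) / (2 * a)"
      using s1(2)[OF u] s2(2)[OF u] a by (intro divide_right_mono add_mono) (auto simp: P_def x_def)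
    also have "\<dots> \<le> 1 / 2" using a by (simp add: field_simps)
    finally have "(\<integral>om. P u om * x om w * x om u \<partial>?M) - (\<integral>om. xh om u * x om w * x om u \<partial>?M) \<le> 1 / 2"
      using iP i by simp
    then show "1 \<le> (\<integral>om. xh om u * x om w * x om u \<partial>?M)"
      using me(2)[OF u] by (simp add: P_def x_def)
  qed
  \<comment> \<open>The summand \<open>u = w\<close> disappears because the statistic vanishes on
    the diagonal.\<close>
  have Sx: "S om * x om w = (\<Sum>u\<in>{..<n} - {w}. xh om u * x om w * x om u)" for om
  proof -
    have "S om * x om w = (\<Sum>u<n. xh om u * x om w * x om u)"
      unfolding S_def sum_distrib_right by (intro sum.cong refl) (simp add: mult_ac)
    also have "\<dots> = (\<Sum>u\<in>{..<n} - {w}. xh om u * x om w * x om u)"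
      using w by (subst sum.remove[of _ w]) (auto simp: xhw)
    finally show ?thesis .
  qed
  have iS: "integrable ?M (\<lambda>om. S om * x om w)"
    unfolding Sx using one(1) by (intro Bochner_Integration.integrable_sum) auto
  have "real n / 2 \<le> real (card ({..<n} - {w}))" using w n by simp
  also have "\<dots> = (\<Sum>u\<in>{..<n} - {w}. 1)" by simp
  also have "\<dots> \<le> (\<Sum>u\<in>{..<n} - {w}. \<integral>om. xh om u * x om w * x om u \<partial>?M)"
    using one(2) by (intro sum_mono) auto
  also have "\<dots> = (\<integral>om. S om * x om w \<partial>?M)"
    unfolding Sx using one(1) by (intro Bochner_Integration.integral_sum[symmetric]) auto
  finally have lower: "real n / 2 \<le> (\<integral>om. S om * x om w \<partial>?M)" .
  \<comment> \<open>With this level, the tail of the weight costs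
    \<open>a * (1 + 2 * C) / m = 1/4\<close>, half of the lower bound \<open>1/2\<close>.\<close>
  define m where "m = 4 * a * (1 + 2 * C)"
  have m: "m > 0" using a C1 by (simp add: m_def)
  have Y2: "(Y om)\<^sup>2 = (\<Sum>u<n. (x om u)\<^sup>2 * (x om w)\<^sup>2) / n" for om
    unfolding Y_def N2_def by (simp add: power_divide power_mult_distrib sum_nonneg sum_distrib_right)
  have iY: "integrable ?M (\<lambda>om. (Y om)\<^sup>2)"
    unfolding Y2 x_def using spike_square_moment(1)[OF sp _ w]
    by (intro integrable_divide Bochner_Integration.integrable_sum) auto
  have EY: "(\<integral>om. (Y om)\<^sup>2 \<partial>?M) \<le> 1 + 2 * C"
  proof -
    have "(\<integral>om. (Y om)\<^sup>2 \<partial>?M) = (\<Sum>u<n. \<integral>om. (x_of om u)\<^sup>2 * (x_of om w)\<^sup>2 \<partial>?M) / n"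
      unfolding Y2 x_def using spike_square_moment(1)[OF sp _ w] by (simp add: Bochner_Integration.integral_sum)
    also have "\<dots> \<le> (\<Sum>u<n. 1 + 2 * C) / n"
      using spike_square_moment(2)[OF sp _ w] by (intro divide_right_mono sum_mono) auto
    also have "\<dots> = 1 + 2 * C" using n by simp
    finally show ?thesis .
  qed
  have ptw: "S om * x om w \<le> real n * a * (m * ov om + (Y om)\<^sup>2 / m)" for om
  proof -
    have Y0: "0 \<le> Y om" by (simp add: Y_def N2_def sum_nonneg)
    have ov01: "0 \<le> ov om" "ov om \<le> 1" using overlap_bounds by (auto simp: ov_def)
    have nx: "sqrt (\<Sum>u<n. (xh om u)\<^sup>2) \<le> a * sqrt n"
    proof -
      have "(\<Sum>u<n. (xh om u)\<^sup>2) \<le> (\<Sum>u<n. a\<^sup>2)"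
        using xhb a by (intro sum_mono) (simp add: abs_le_square_iff[symmetric])
      then have "sqrt (\<Sum>u<n. (xh om u)\<^sup>2) \<le> sqrt (real n * a\<^sup>2)" by simp
      then show ?thesis using a by (simp add: real_sqrt_mult mult.commute)
    qed
    have "S om * x om w \<le> \<bar>S om\<bar> * \<bar>x om w\<bar>" by (metis abs_ge_self abs_mult)
    also have "\<bar>S om\<bar> = ov om * (sqrt (\<Sum>u<n. (xh om u)\<^sup>2) * sqrt (N2 om))"
      unfolding S_def ov_def N2_def by (rule overlap_bounds(3))
    also have "\<dots> * \<bar>x om w\<bar> \<le> ov om * (a * sqrt n * sqrt (N2 om)) * \<bar>x om w\<bar>"
      using ov01 nx by (intro mult_right_mono mult_left_mono) (auto simp: N2_def sum_nonneg)
    also have "\<dots> = real n * a * (ov om * Y om)"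
    proof -
      have *: "o' * (a * q * N) * y = q * q * a * (o' * (N * y / q))" if "q > 0" for o' q N y
        using that by simp
      have "sqrt (real n) > 0" using n by simp
      from *[OF this] show ?thesis by (simp add: Y_def)
    qed
    \<comment> \<open>Below the level \<open>m\<close> the weight is replaced by \<open>m\<close>;
      above it the overlap is bounded by 1 and the weight by its square over
      \<open>m\<close>.\<close>
    also have "ov om * Y om \<le> m * ov om + (Y om)\<^sup>2 / m"
    proof (cases "Y om \<le> m")
      case True
      then have "ov om * Y om \<le> ov om * m" using ov01 by (intro mult_left_mono) auto
      then show ?thesis using m by (simp add: mult.commute add_increasing2)
    next
      case False
      have "ov om * Y om \<le> Y om" using ov01 Y0 by (simp add: mult_left_le_one_le)
      also have "\<dots> \<le> (Y om)\<^sup>2 / m"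
        using False m Y0 by (simp add: field_simps power2_eq_square mult_left_mono)
      finally show ?thesis using ov01 m by (simp add: add_increasing)
    qed
    then have "real n * a * (ov om * Y om) \<le> real n * a * (m * ov om + (Y om)\<^sup>2 / m)"
      using a by (intro mult_left_mono) auto
    finally show ?thesis .
  qed
  have "real n / 2 \<le> (\<integral>om. real n * a * (m * ov om + (Y om)\<^sup>2 / m) \<partial>?M)"
    by (rule order_trans[OF lower integral_mono[OF iS]]) (use iov iY ptw in auto)
  also have "\<dots> = real n * a * (m * (\<integral>om. ov om \<partial>?M) + (\<integral>om. (Y om)\<^sup>2 \<partial>?M) / m)"
    using iov iY by simp
  also have "\<dots> \<le> real n * a * (m * (\<integral>om. ov om \<partial>?M) + (1 + 2 * C) / m)"
    using EY a m by (intro mult_left_mono add_left_mono divide_right_mono) auto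
  finally have "1 / 2 \<le> a * (m * (\<integral>om. ov om \<partial>?M) + (1 + 2 * C) / m)"
    using n by (simp add: mult.assoc)
  also have "\<dots> = a * m * (\<integral>om. ov om \<partial>?M) + 1 / 4"
  proof -
    have p: "q / (4 * q) = 1 / 4" if "q > 0" for q :: real using that by simp
    have "a * (1 + 2 * C) > 0" using a C1 by simp
    from p[OF this] have "a * ((1 + 2 * C) / m) = 1 / 4" unfolding m_def by (simp only: mult.assoc times_divide_eq_right)
    then show ?thesis by (simp only: distrib_left mult.assoc)
  qed
  finally have "1 / 4 \<le> a * m * (\<integral>om. ov om \<partial>?M)" by simp
  then have "1 / (4 * (a * m)) \<le> (\<integral>om. ov om \<partial>?M)"
    using a m by (simp add: field_simps)
  then show ?thesis
    unfolding ov_def xh_def x_def m_def a_def by (simp add: power2_eq_square mult_ac)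
qed

lemma spike_prior_mono:
  assumes "spike_prior rho C prior" "C \<le> C'" shows "spike_prior rho C' prior"
  using assms unfolding spike_prior_def by auto

lemma beta_words_pos:
  assumes lm: "0 \<le> lam" "lam \<le> 1" "0 \<le> mu" "mu \<le> 1" and rho: "0 < rho" "rho \<le> 1"
    and A: "A_plus lam mu rho > 1" and l: "l \<ge> 2"
  shows "beta_words lam mu rho l > 0"
proof -
  note h = perron[OF lm rho(1) A]
  have "0 < lam ^ 4 * rho\<^sup>2 * perron lam mu rho Bullet /
      ((A_plus lam mu rho)\<^sup>2 * (perron lam mu rho Bullet + perron lam mu rho Circ)) * A_plus lam mu rho ^ l"
    using A_plus_pos_params(1)[OF lm A] rho h(1)[of Bullet] h(1)[of Circ] A
    by (intro mult_pos_pos divide_pos_pos add_pos_pos) auto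
  also have "\<dots> \<le> beta_words lam mu rho l"
    by (rule beta_words_ge[OF h(2) h(1)]) (use A lm rho l in auto)
  finally show ?thesis .
qed

text \<open>The number of vertex sequences lies between \<open>(1 - l^2 / n) * n ^ (l - 1)\<close>
  and \<open>n ^ (l - 1)\<close>.\<close>

lemma mean_close:
  assumes "u < n" "v < n" "u \<noteq> v" "1 \<le> l" "(real l)\<^sup>2 / real n < 1"
  shows "\<bar>2 * real (card (vertex_lists n l u v)) / real n ^ (l - 1) - 2\<bar> \<le> 2 * ((real l)\<^sup>2 / real n)"
proof -
  have n: "real n ^ (l - 1) > 0" "real n > 0" using assms by auto
  have "l < n"
  proof (rule ccontr)
    assume "\<not> l < n"
    then have "(real n)\<^sup>2 \<le> (real l)\<^sup>2" by (intro power_mono) auto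
    moreover have "real n \<le> (real n)\<^sup>2" using n(2) by (simp add: power2_eq_square)
    ultimately have "real n \<le> (real l)\<^sup>2" by linarith
    then show False using assms(5) n(2) by (simp add: field_simps)
  qed
  define N where "N = real (card (vertex_lists n l u v))"
  have "N \<le> real n ^ (l - 1)" unfolding N_def by (rule card_vertex_lists_le[OF assms(1-4)])
  then have up: "N / real n ^ (l - 1) \<le> 1" using n by simp
  have "(1 - (real l)\<^sup>2 / real n) * real n ^ (l - 1) \<le> N"
    unfolding N_def by (rule card_vertex_lists_ge[OF assms(1-4) \<open>l < n\<close>])
  then have "1 - (real l)\<^sup>2 / real n \<le> N / real n ^ (l - 1)" using n by (simp add: pos_le_divide_eq)
  then have "\<bar>2 * (N / real n ^ (l - 1)) - 2\<bar> \<le> 2 * ((real l)\<^sup>2 / real n)" using up by linarith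
  then show ?thesis by (simp add: N_def)
qed

lemma statistical_part:
  fixes lam mu rho delta K C :: real
  assumes lm: "0 \<le> lam" "lam \<le> 1" "0 \<le> mu" "mu \<le> 1" and rho: "0 < rho" "rho \<le> 1"
    and d: "0 < delta" "delta < 0.1" and A: "A_plus lam mu rho > 1 + delta"
  shows "\<exists>R>0. \<exists>c>0. \<forall>prior. spike_prior rho C prior \<longrightarrow>
        (\<forall>n l u v. admissible_length delta K n l \<and> u < n \<and> v < n \<and> u \<noteq> v \<longrightarrow>
           integrable (model_law prior n l)
             (\<lambda>om. Phi_rv n l lam mu rho u v om * x_of om u * x_of om v) \<and>
           integrable (model_law prior n l) (\<lambda>om. (Phi_rv n l lam mu rho u v om)\<^sup>2) \<and>
           (\<integral>om. (Phi_rv n l lam mu rho u v om)\<^sup>2 \<partial>model_law prior n l) \<le> R \<and>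
           integrable (model_law prior n l)
             (\<lambda>om. (Phi_rv n l lam mu rho u v om)\<^sup>2 * (x_of om u)\<^sup>2 * (x_of om v)\<^sup>2) \<and>
           (\<integral>om. (Phi_rv n l lam mu rho u v om)\<^sup>2 * (x_of om u)\<^sup>2 * (x_of om v)\<^sup>2
              \<partial>model_law prior n l) \<le> R) \<and>
        (\<forall>l :: nat \<Rightarrow> nat. (\<forall>\<^sub>F n in sequentially. admissible_length delta K n (l n)) \<longrightarrow>
           (\<forall>\<eta>>0. \<forall>\<^sub>F n in sequentially. \<forall>u<n. \<forall>v<n. u \<noteq> v \<longrightarrow>
              \<bar>(\<integral>om. Phi_rv n (l n) lam mu rho u v om * x_of om u * x_of om v
                  \<partial>model_law prior n (l n)) - 2\<bar> < \<eta>) \<and>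
           (\<forall>\<^sub>F n in sequentially. \<forall>w<n.
              (\<integral>om. overlap n (x_hat R n (l n) lam mu rho w om) (x_of om)
                 \<partial>model_law prior n (l n)) \<ge> c))"
proof -
  \<comment> \<open>The real \<open>C\<close> is arbitrary here; a larger nonnegative bound on the
    fourth moments serves as well.\<close>
  define C' where "C' = max C 0"
  have C': "C' \<ge> 0" "C \<le> C'" by (auto simp: C'_def)
  have A1: "A_plus lam mu rho > 1" using A d by simp
  obtain R0 where R0: "R0 > 0" and sm:
    "\<forall>prior n l u v g. spike_prior rho C' prior \<longrightarrow> admissible_length delta K n l \<longrightarrow>
      u < n \<longrightarrow> v < n \<longrightarrow> u \<noteq> v \<longrightarrow> (\<forall>x. x \<noteq> u \<longrightarrow> x \<noteq> v \<longrightarrow> g x = 0) \<longrightarrow> (\<forall>x. g x \<le> 2) \<longrightarrow>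
      integrable (model_law prior n l) (\<lambda>om. (Phi_rv n l lam mu rho u v om)\<^sup>2 * (\<Prod>x<n. x_of om x ^ g x)) \<and>
      (\<integral>om. (Phi_rv n l lam mu rho u v om)\<^sup>2 * (\<Prod>x<n. x_of om x ^ g x) \<partial>model_law prior n l) \<le> R0"
    using second_moment_bound[OF lm rho d A C'(1), of K] by (elim exE conjE) (rule that)
  \<comment> \<open>A value of at least 2 ensures \<open>R ^ 4 >= 2 * R\<close>, as the truncation
    requires.\<close>
  define R where "R = max R0 2"
  have R: "R \<ge> 2" "R0 \<le> R" by (auto simp: R_def)
  have Rpos: "R > 0" using R by simp
  define c where "c = 1 / (16 * (R ^ 4)\<^sup>2 * (1 + 2 * C'))"
  have c: "c > 0" using R C' by (auto simp: c_def intro!: divide_pos_pos mult_pos_pos)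
  have main: "integrable (model_law prior n l) (\<lambda>om. Phi_rv n l lam mu rho u v om * x_of om u * x_of om v)"
    "integrable (model_law prior n l) (\<lambda>om. (Phi_rv n l lam mu rho u v om)\<^sup>2)"
    "(\<integral>om. (Phi_rv n l lam mu rho u v om)\<^sup>2 \<partial>model_law prior n l) \<le> R"
    "integrable (model_law prior n l) (\<lambda>om. (Phi_rv n l lam mu rho u v om)\<^sup>2 * (x_of om u)\<^sup>2 * (x_of om v)\<^sup>2)"
    "(\<integral>om. (Phi_rv n l lam mu rho u v om)\<^sup>2 * (x_of om u)\<^sup>2 * (x_of om v)\<^sup>2 \<partial>model_law prior n l) \<le> R"
    "(\<integral>om. Phi_rv n l lam mu rho u v om * x_of om u * x_of om v \<partial>model_law prior n l) =
       2 * real (card (vertex_lists n l u v)) / real n ^ (l - 1)"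
    if sp: "spike_prior rho C' prior" and ad: "admissible_length delta K n l"
      and uv: "u < n" "v < n" "u \<noteq> v" for prior n l u v
  proof -
    have n: "n \<ge> 2" using uv by simp
    note af = admissible_facts[OF d ad n]
    have l1: "l \<ge> 1" using af by simp
    have B: "beta_words lam mu rho l \<noteq> 0" using beta_words_pos[OF lm rho A1 af(1)] by simp
    show "integrable (model_law prior n l) (\<lambda>om. Phi_rv n l lam mu rho u v om * x_of om u * x_of om v)"
      "(\<integral>om. Phi_rv n l lam mu rho u v om * x_of om u * x_of om v \<partial>model_law prior n l) =
       2 * real (card (vertex_lists n l u v)) / real n ^ (l - 1)"
      by (rule Phi_mean[OF sp rho(1) l1 uv B])+
    have g0: "integrable (model_law prior n l) (\<lambda>om. (Phi_rv n l lam mu rho u v om)\<^sup>2) \<and>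
      (\<integral>om. (Phi_rv n l lam mu rho u v om)\<^sup>2 \<partial>model_law prior n l) \<le> R0"
      using sm[rule_format, OF sp ad uv, of "\<lambda>_. 0"] by simp
    have g2: "integrable (model_law prior n l) (\<lambda>om. (Phi_rv n l lam mu rho u v om)\<^sup>2 * ((x_of om u)\<^sup>2 * (x_of om v)\<^sup>2)) \<and>
      (\<integral>om. (Phi_rv n l lam mu rho u v om)\<^sup>2 * ((x_of om u)\<^sup>2 * (x_of om v)\<^sup>2) \<partial>model_law prior n l) \<le> R0"
      using sm[rule_format, OF sp ad uv, of "\<lambda>x. if x = u \<or> x = v then 2 else 0"]
      unfolding prod_two_points[OF uv] by simp
    show "integrable (model_law prior n l) (\<lambda>om. (Phi_rv n l lam mu rho u v om)\<^sup>2)"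
      "(\<integral>om. (Phi_rv n l lam mu rho u v om)\<^sup>2 \<partial>model_law prior n l) \<le> R"
      "integrable (model_law prior n l) (\<lambda>om. (Phi_rv n l lam mu rho u v om)\<^sup>2 * (x_of om u)\<^sup>2 * (x_of om v)\<^sup>2)"
      "(\<integral>om. (Phi_rv n l lam mu rho u v om)\<^sup>2 * (x_of om u)\<^sup>2 * (x_of om v)\<^sup>2 \<partial>model_law prior n l) \<le> R"
      using g0 g2 R by (auto simp: mult.assoc)
  qed
  have lim: "((\<lambda>n. K\<^sup>2 * ((ln (real n))\<^sup>2 / real n)) \<longlongrightarrow> 0) sequentially"
  proof -
    have "((\<lambda>n. (ln (real n))\<^sup>2 / real n) \<longlongrightarrow> 0) sequentially" by real_asymp
    then show ?thesis by (rule tendsto_mult_right_zero)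
  qed
  have asym: "\<forall>\<^sub>F n in sequentially. \<forall>u<n. \<forall>v<n. u \<noteq> v \<longrightarrow>
      \<bar>(\<integral>om. Phi_rv n (l n) lam mu rho u v om * x_of om u * x_of om v \<partial>model_law prior n (l n)) - 2\<bar> < eta"
    if sp: "spike_prior rho C' prior" and ad: "\<forall>\<^sub>F n in sequentially. admissible_length delta K n (l n)"
      and eta: "eta > 0" for prior l eta
  proof -
    have "\<forall>\<^sub>F n in sequentially. K\<^sup>2 * ((ln (real n))\<^sup>2 / real n) < min 1 (eta / 2)"
      by (rule order_tendstoD(2)[OF lim]) (use eta in auto)
    then show ?thesis using ad
    proof eventually_elim
      case (elim n)
      show ?case
      proof (intro allI impI)
        fix u v assume uv: "u < n" "v < n" "u \<noteq> v"
        have n: "n \<ge> 2" using uv by simp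
        note af = admissible_facts[OF d elim(2) n]
        have "(real (l n))\<^sup>2 / real n \<le> K\<^sup>2 * (ln (real n))\<^sup>2 / real n"
          using af(5) by (intro divide_right_mono) auto
        then have s: "(real (l n))\<^sup>2 / real n < min 1 (eta / 2)"
          using elim(1) unfolding times_divide_eq_right by (rule le_less_trans)
        have "\<bar>2 * real (card (vertex_lists n (l n) u v)) / real n ^ (l n - 1) - 2\<bar> \<le> 2 * ((real (l n))\<^sup>2 / real n)"
          by (rule mean_close[OF uv]) (use af s in auto)
        also have "\<dots> < eta" using s unfolding min_less_iff_conj by linarith
        finally show "\<bar>(\<integral>om. Phi_rv n (l n) lam mu rho u v om * x_of om u * x_of om v
            \<partial>model_law prior n (l n)) - 2\<bar> < eta"
          unfolding main(6)[OF sp elim(2) uv] .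
      qed
    qed
  qed
  have ov: "\<forall>\<^sub>F n in sequentially. \<forall>w<n.
      (\<integral>om. overlap n (x_hat R n (l n) lam mu rho w om) (x_of om) \<partial>model_law prior n (l n)) \<ge> c"
    if sp: "spike_prior rho C' prior" and ad: "\<forall>\<^sub>F n in sequentially. admissible_length delta K n (l n)"
    for prior l
    \<comment> \<open>Tolerance \<open>1/2\<close> around the limit 2 supplies the lower bound
      \<open>3/2\<close> on all means, uniformly in the pair of vertices.\<close>
    using asym[OF sp ad half_gt_zero[OF zero_less_one]] ad eventually_ge_at_top[of 2]
  proof eventually_elim
    case (elim n)
    show ?case
    proof (intro allI impI)
      fix w assume w: "w < n"
      note af = admissible_facts[OF d elim(2,3)]
      have l1: "l n \<ge> 1" using af by simp
      show "c \<le> (\<integral>om. overlap n (x_hat R n (l n) lam mu rho w om) (x_of om) \<partial>model_law prior n (l n))"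
        unfolding c_def
      proof (rule overlap_lower_bound[OF sp l1 w elim(3) R(1)])
        fix u assume u: "u < n" "u \<noteq> w"
        note m = main[OF sp elim(2) w u(1) u(2)[symmetric]]
        show "integrable (model_law prior n (l n)) (\<lambda>om. (Phi_rv n (l n) lam mu rho w u om)\<^sup>2)"
          "(\<integral>om. (Phi_rv n (l n) lam mu rho w u om)\<^sup>2 \<partial>model_law prior n (l n)) \<le> R"
          "integrable (model_law prior n (l n)) (\<lambda>om. (Phi_rv n (l n) lam mu rho w u om)\<^sup>2 * (x_of om w)\<^sup>2 * (x_of om u)\<^sup>2)"
          "(\<integral>om. (Phi_rv n (l n) lam mu rho w u om)\<^sup>2 * (x_of om w)\<^sup>2 * (x_of om u)\<^sup>2 \<partial>model_law prior n (l n)) \<le> R"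
          "integrable (model_law prior n (l n)) (\<lambda>om. Phi_rv n (l n) lam mu rho w u om * x_of om w * x_of om u)"
          by (rule m)+
        have "\<bar>(\<integral>om. Phi_rv n (l n) lam mu rho w u om * x_of om w * x_of om u \<partial>model_law prior n (l n)) - 2\<bar> < 1/2"
          using u w by (intro elim(1)[rule_format]) auto
        then show "3 / 2 \<le> (\<integral>om. Phi_rv n (l n) lam mu rho w u om * x_of om w * x_of om u \<partial>model_law prior n (l n))"
          by linarith
      qed
    qed
  qed
  show ?thesis
  proof (rule exI[of _ R], rule conjI[OF Rpos], rule exI[of _ c], rule conjI[OF c], intro conjI allI impI)
    fix prior assume "spike_prior rho C prior"
    then have sp: "spike_prior rho C' prior" using spike_prior_mono C' by blast
    {
      fix n l u v assume "admissible_length delta K n l \<and> u < n \<and> v < n \<and> u \<noteq> v"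
      then have a: "admissible_length delta K n l" "u < n" "v < n" "u \<noteq> v" by auto
      note m = main[OF sp a]
      show "integrable (model_law prior n l)
             (\<lambda>om. Phi_rv n l lam mu rho u v om * x_of om u * x_of om v)"
           "integrable (model_law prior n l) (\<lambda>om. (Phi_rv n l lam mu rho u v om)\<^sup>2)"
           "(\<integral>om. (Phi_rv n l lam mu rho u v om)\<^sup>2 \<partial>model_law prior n l) \<le> R"
           "integrable (model_law prior n l)
             (\<lambda>om. (Phi_rv n l lam mu rho u v om)\<^sup>2 * (x_of om u)\<^sup>2 * (x_of om v)\<^sup>2)"
           "(\<integral>om. (Phi_rv n l lam mu rho u v om)\<^sup>2 * (x_of om u)\<^sup>2 * (x_of om v)\<^sup>2
              \<partial>model_law prior n l) \<le> R"
        by (rule m)+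
    }
    {
      fix l :: "nat \<Rightarrow> nat" assume ad: "\<forall>\<^sub>F n in sequentially. admissible_length delta K n (l n)"
      {
        fix eta :: real assume "eta > 0"
        then show "\<forall>\<^sub>F n in sequentially. \<forall>u<n. \<forall>v<n. u \<noteq> v \<longrightarrow>
              \<bar>(\<integral>om. Phi_rv n (l n) lam mu rho u v om * x_of om u * x_of om v
                  \<partial>model_law prior n (l n)) - 2\<bar> < eta"
          by (rule asym[OF sp ad])
      }
      show "\<forall>\<^sub>F n in sequentially. \<forall>w<n.
              (\<integral>om. overlap n (x_hat R n (l n) lam mu rho w om) (x_of om)
                 \<partial>model_law prior n (l n)) \<ge> c"
        by (rule ov[OF sp ad])
    }
  qed
qed

section \<open>The program\<close>

lemma store_simps [simp]:
  "nreg (set_nreg d a s) = (nreg s)(d := a)" "narr (set_nreg d a s) = narr s"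
  "rreg (set_nreg d a s) = rreg s" "rarr (set_nreg d a s) = rarr s"
  "nreg (set_narr b p a s) = nreg s" "narr (set_narr b p a s) = (narr s)(b := (narr s b)(p := a))"
  "rreg (set_narr b p a s) = rreg s" "rarr (set_narr b p a s) = rarr s"
  "nreg (set_rreg d r s) = nreg s" "narr (set_rreg d r s) = narr s"
  "rreg (set_rreg d r s) = (rreg s)(d := r)" "rarr (set_rreg d r s) = rarr s"
  "nreg (set_rarr b p r s) = nreg s" "narr (set_rarr b p r s) = narr s"
  "rreg (set_rarr b p r s) = rreg s" "rarr (set_rarr b p r s) = (rarr s)(b := (rarr s b)(p := r))"
  by (simp_all add: set_nreg_def set_narr_def set_rreg_def set_rarr_def)

section \<open>Total correctness with step counts\<close>

definition ok :: "prog \<Rightarrow> store \<Rightarrow> nat \<Rightarrow> (store \<Rightarrow> bool) \<Rightarrow> bool" where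
  "ok c s T Q \<longleftrightarrow> (\<exists>t s'. runs c s t s' \<and> t \<le> T \<and> Q s')"

lemma ok_mono: "ok c s T Q \<Longrightarrow> T \<le> T' \<Longrightarrow> (\<And>s'. Q s' \<Longrightarrow> Q' s') \<Longrightarrow> ok c s T' Q'"
  unfolding ok_def by (meson order_trans)

lemma ok_Seq:
  assumes "ok P s T1 Q" "\<And>s1. Q s1 \<Longrightarrow> ok R s1 T2 W"
  shows "ok (Seq P R) s (T1 + T2) W"
proof -
  obtain t1 s1 where 1: "runs P s t1 s1" "t1 \<le> T1" "Q s1" using assms(1) by (auto simp: ok_def)
  from assms(2)[OF 1(3)] obtain t2 s2 where 2: "runs R s1 t2 s2" "t2 \<le> T2" "W s2"
    unfolding ok_def by blast
  show ?thesis unfolding ok_def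
    using runs.intros(14)[OF 1(1) 2(1)] 1 2 add_mono by blast
qed

fun atomic :: "prog \<Rightarrow> bool" where
  "atomic (Seq _ _) = False"
| "atomic (IfLessN _ _ _ _) = False"
| "atomic (IfLessR _ _ _ _) = False"
| "atomic (WhileLessN _ _ _) = False"
| "atomic _ = True"

text \<open>Straight-line code is evaluated by a function, so that the effect of a whole block is
  found by rewriting.\<close>

fun exec :: "prog \<Rightarrow> store \<Rightarrow> store" where
  "exec (ConstN d k) s = set_nreg d k s"
| "exec (AddN d i j) s = set_nreg d (nreg s i + nreg s j) s"
| "exec (SubN d i j) s = set_nreg d (nreg s i - nreg s j) s"
| "exec (LoadN d b i) s = set_nreg d (narr s b (nreg s i)) s"
| "exec (StoreN b i j) s = set_narr b (nreg s i) (nreg s j) s"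
| "exec (OfNat d i) s = set_rreg d (real (nreg s i)) s"
| "exec (AddR d i j) s = set_rreg d (rreg s i + rreg s j) s"
| "exec (SubR d i j) s = set_rreg d (rreg s i - rreg s j) s"
| "exec (MulR d i j) s = set_rreg d (rreg s i * rreg s j) s"
| "exec (DivR d i j) s = set_rreg d (rreg s i / rreg s j) s"
| "exec (SqrtR d i) s = set_rreg d (sqrt (rreg s i)) s"
| "exec (LoadR d b i) s = set_rreg d (rarr s b (nreg s i)) s"
| "exec (StoreR b i j) s = set_rarr b (nreg s i) (rreg s j) s"
| "exec _ s = s"

fun seqs :: "prog list \<Rightarrow> prog" where
  "seqs [] = ConstN 0 0"
| "seqs [c] = c"
| "seqs (c # cs) = Seq c (seqs cs)"

lemma runs_atomic: "atomic c \<Longrightarrow> runs c s 1 (exec c s)"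
  by (cases c) (auto intro: runs.intros[unfolded One_nat_def] simp del: One_nat_def simp: One_nat_def)

lemma runs_seqs: "cs \<noteq> [] \<Longrightarrow> list_all atomic cs \<Longrightarrow> runs (seqs cs) s (length cs) (fold exec cs s)"
proof (induction cs arbitrary: s rule: seqs.induct)
  case (2 c)
  then show ?case using runs_atomic[of c s] by simp
next
  case (3 c c' cs)
  then have 1: "runs c s 1 (exec c s)"
    and 2: "runs (seqs (c' # cs)) (exec c s) (length (c' # cs)) (fold exec (c' # cs) (exec c s))"
    using runs_atomic[of c s] by simp_all
  show ?case using runs.intros(14)[OF 1 2] by simp
qed simp

lemma ok_seqs:
  assumes "cs \<noteq> []" "list_all atomic cs" "Q (fold exec cs s)" "length cs \<le> T"
  shows "ok (seqs cs) s T Q"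
  using runs_seqs[OF assms(1,2)] assms(3,4) unfolding ok_def by blast

lemma ok_IfLessN:
  assumes "nreg s i < nreg s j \<Longrightarrow> ok P s T Q" "\<not> nreg s i < nreg s j \<Longrightarrow> ok R s T Q"
  shows "ok (IfLessN i j P R) s (Suc T) Q"
  using assms runs.intros(15,16) unfolding ok_def by (metis Suc_le_mono)

lemma ok_IfLessR:
  assumes "rreg s i < rreg s j \<Longrightarrow> ok P s T Q" "\<not> rreg s i < rreg s j \<Longrightarrow> ok R s T Q"
  shows "ok (IfLessR i j P R) s (Suc T) Q"
  using assms runs.intros(17,18) unfolding ok_def by (metis Suc_le_mono)

text \<open>By convention the natural-number register 2 holds the constant 1.\<close>

definition For :: "nat \<Rightarrow> nat \<Rightarrow> prog \<Rightarrow> prog" where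
  "For i N c = Seq (ConstN i 0) (WhileLessN i N (Seq c (AddN i i 2)))"

text \<open>The invariant after the body is stated for the store with the counter already advanced,
  so it may refer to the counter. Each round costs 2 beyond the body, for the test and the
  increment; initialisation and the last test cost another 2.\<close>

lemma ok_For:
  assumes init: "I 0 (set_nreg i 0 s)" "nreg s N = b" "nreg s 2 = 1" "i \<noteq> N" "i \<noteq> 2"
    and body: "\<And>j s. j < b \<Longrightarrow> I j s \<Longrightarrow> nreg s i = j \<Longrightarrow> nreg s N = b \<Longrightarrow> nreg s 2 = 1 \<Longrightarrow>
      ok c s T (\<lambda>s'. nreg s' i = j \<and> nreg s' N = b \<and> nreg s' 2 = 1 \<and> I (Suc j) (set_nreg i (Suc j) s'))"
  shows "ok (For i N c) s (2 + b * (T + 2)) (\<lambda>s'. I b s' \<and> nreg s' N = b \<and> nreg s' 2 = 1)"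
proof -
  have loop: "ok (WhileLessN i N (Seq c (AddN i i 2))) s (1 + (b - j) * (T + 2))
      (\<lambda>s'. I b s' \<and> nreg s' N = b \<and> nreg s' 2 = 1)"
    if "j \<le> b" "I j s" "nreg s i = j" "nreg s N = b" "nreg s 2 = 1" for j s
    using that
  proof (induction "b - j" arbitrary: j s)
    case 0
    then have "runs (WhileLessN i N (Seq c (AddN i i 2))) s 1 s" by (intro runs.intros(20)) auto
    then show ?case unfolding ok_def using 0 by auto
  next
    case (Suc d)
    then have j: "j < b" by simp
    obtain t s1 where s1: "runs c s t s1" "t \<le> T" "nreg s1 i = j" "nreg s1 N = b" "nreg s1 2 = 1"
      "I (Suc j) (set_nreg i (Suc j) s1)"
      using body[OF j Suc.prems(2-5)] by (auto simp: ok_def)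
    let ?s2 = "set_nreg i (Suc j) s1"
    have "runs (AddN i i 2) s1 1 (set_nreg i (nreg s1 i + nreg s1 2) s1)" by (rule runs.intros)
    then have add: "runs (AddN i i 2) s1 1 ?s2" using s1 by simp
    have "ok (WhileLessN i N (Seq c (AddN i i 2))) ?s2 (1 + (b - Suc j) * (T + 2))
      (\<lambda>s'. I b s' \<and> nreg s' N = b \<and> nreg s' 2 = 1)"
      by (rule Suc.hyps(1)) (use Suc.hyps(2) s1 init(4,5) j in auto)
    then obtain t3 s3 where s3: "runs (WhileLessN i N (Seq c (AddN i i 2))) ?s2 t3 s3"
      "t3 \<le> 1 + (b - Suc j) * (T + 2)" "I b s3 \<and> nreg s3 N = b \<and> nreg s3 2 = 1" by (auto simp: ok_def)
    have "runs (WhileLessN i N (Seq c (AddN i i 2))) s (Suc (t + 1 + t3)) s3"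
      by (rule runs.intros(19)[OF _ runs.intros(14)[OF s1(1) add] s3(1)]) (use Suc.prems j in simp)
    moreover have "Suc (t + 1 + t3) \<le> 1 + (b - j) * (T + 2)"
    proof -
      have "b - j = Suc (b - Suc j)" using j by simp
      then show ?thesis using s1(2) s3(2) by simp
    qed
    ultimately show ?case unfolding ok_def using s3(3) by blast
  qed
  have "ok (ConstN i 0) s 1 (\<lambda>s'. s' = set_nreg i 0 s)"
    unfolding ok_def using runs.intros(1)[of i 0 s] by blast
  then have "ok (For i N c) s (1 + (1 + (b - 0) * (T + 2))) (\<lambda>s'. I b s' \<and> nreg s' N = b \<and> nreg s' 2 = 1)"
    unfolding For_def by (rule ok_Seq) (use loop[of 0] init in auto)
  then show ?thesis by simp
qed

text \<open>The four sets list the natural registers, real registers, natural arrays and real arrays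
  that may change.\<close>

definition frame :: "nat set \<Rightarrow> nat set \<Rightarrow> nat set \<Rightarrow> nat set \<Rightarrow> store \<Rightarrow> store \<Rightarrow> bool" where
  "frame N R B A s s' \<longleftrightarrow> (\<forall>r. r \<notin> N \<longrightarrow> nreg s' r = nreg s r) \<and> (\<forall>r. r \<notin> R \<longrightarrow> rreg s' r = rreg s r) \<and>
     (\<forall>b. b \<notin> B \<longrightarrow> narr s' b = narr s b) \<and> (\<forall>b. b \<notin> A \<longrightarrow> rarr s' b = rarr s b)"

lemma frame_trans: "frame N R B A s s' \<Longrightarrow> frame N R B A s' s'' \<Longrightarrow> frame N R B A s s''"
  by (auto simp: frame_def)

lemma frame_mono:
  "frame N R B A s s' \<Longrightarrow> N \<subseteq> N' \<Longrightarrow> R \<subseteq> R' \<Longrightarrow> B \<subseteq> B' \<Longrightarrow> A \<subseteq> A' \<Longrightarrow> frame N' R' B' A' s s'"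
  unfolding frame_def by blast

lemma frame_refl [simp]: "frame N R B A s s"
  by (simp add: frame_def)

lemma frame_set [simp]:
  "frame N R B A s (set_nreg d a s') \<longleftrightarrow> frame N R B A s s'" if "d \<in> N"
  using that by (auto simp: frame_def)

lemma frameD:
  assumes "frame N R B A s s'"
  shows "r \<notin> N \<Longrightarrow> nreg s' r = nreg s r" "r \<notin> R \<Longrightarrow> rreg s' r = rreg s r"
    "b \<notin> B \<Longrightarrow> narr s' b = narr s b" "b \<notin> A \<Longrightarrow> rarr s' b = rarr s b"
  using assms by (auto simp: frame_def)

text \<open>Register conventions of the program below. Naturals: 0 \<open>n\<close>, 1 \<open>l\<close>, 2 one, 3 zero, 4 \<open>l + 1\<close>,
  5 \<open>2 ^ (l + 1)\<close>, 6 number of colourings, 7 colouring \<open>k\<close>, 8 \<open>k * n\<close>, 9 colour subset \<open>m\<close>,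
  18 target \<open>v\<close>, 19 step \<open>j\<close>, 15 vertex \<open>x\<close>, 16 \<open>x * n\<close>, 14 vertex \<open>y\<close>. Reals: 0 \<open>lam\<close>, 1 \<open>mu\<close>,
  2 \<open>rho\<close>, 3 zero, 4 one, 5 prefactor, 6 signed prefactor, 11 and 12 accumulators. Natural arrays:
  0 colours, 1 powers of two. Real arrays: 0 \<open>X\<close>, 1 \<open>Y\<close>, 2 result, 3 indicator of the colour subset,
  4 its value at each vertex, 5 and 6 the walk sums by decoration, 7 and 8 their updates.\<close>

definition "body_y = seqs [AddN 17 16 14, LoadR 7 0 17, MulR 7 0 7, LoadR 8 5 14, MulR 7 7 8,
  LoadR 9 4 14, MulR 7 7 9, LoadR 8 1 17, MulR 8 1 8, LoadR 10 6 14, MulR 8 8 10, MulR 8 8 9,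
  MulR 10 2 8, AddR 10 7 10, AddR 11 11 10, MulR 10 2 7, AddR 10 10 8, AddR 12 12 10]"

definition "prog_y = For 14 0 body_y"

text \<open>The contribution of a step to \<open>y\<close> along a \<open>Bullet\<close> edge,
  before the factor for a change of letter; \<open>q2\<close> is its counterpart for
  \<open>Circ\<close>.\<close>

definition q1 :: "store \<Rightarrow> nat \<Rightarrow> nat \<Rightarrow> real" where
  "q1 s xb y = rreg s 0 * rarr s 0 (xb + y) * rarr s 5 y * rarr s 4 y"

definition q2 :: "store \<Rightarrow> nat \<Rightarrow> nat \<Rightarrow> real" where
  "q2 s xb y = rreg s 1 * rarr s 1 (xb + y) * rarr s 6 y * rarr s 4 y"

lemma prog_y_ok:
  assumes s: "nreg s 0 = n" "nreg s 2 = 1" "nreg s 16 = xb"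
  shows "ok prog_y s (2 + n * 20) (\<lambda>s'. frame {14, 17} {7, 8, 9, 10, 11, 12} {} {} s s' \<and>
    rreg s' 11 = rreg s 11 + (\<Sum>y<n. q1 s xb y + rreg s 2 * q2 s xb y) \<and>
    rreg s' 12 = rreg s 12 + (\<Sum>y<n. rreg s 2 * q1 s xb y + q2 s xb y))"
proof -
  define I where "I j s' \<longleftrightarrow> frame {14, 17} {7, 8, 9, 10, 11, 12} {} {} s s' \<and>
    rreg s' 11 = rreg s 11 + (\<Sum>y<j. q1 s xb y + rreg s 2 * q2 s xb y) \<and>
    rreg s' 12 = rreg s 12 + (\<Sum>y<j. rreg s 2 * q1 s xb y + q2 s xb y)" for j s'
  have "ok prog_y s (2 + n * (18 + 2)) (\<lambda>s'. I n s' \<and> nreg s' 0 = n \<and> nreg s' 2 = 1)"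
    unfolding prog_y_def
  proof (rule ok_For)
    fix j s1 assume j: "j < n" "I j s1" "nreg s1 14 = j" "nreg s1 0 = n" "nreg s1 2 = 1"
    then have f: "frame {14, 17} {7, 8, 9, 10, 11, 12} {} {} s s1" by (simp add: I_def)
    show "ok body_y s1 18 (\<lambda>s'. nreg s' 14 = j \<and> nreg s' 0 = n \<and> nreg s' 2 = 1 \<and> I (Suc j) (set_nreg 14 (Suc j) s'))"
      unfolding body_y_def
      by (rule ok_seqs) (use j s frameD[OF f] in \<open>simp_all add: I_def frame_def q1_def q2_def algebra_simps\<close>)
  qed (use s in \<open>auto simp: I_def\<close>)
  then show ?thesis by (rule ok_mono) (auto simp: I_def)
qed

definition "prog_x = Seq (ConstN 16 0) (For 15 0
  (Seq (seqs [AddR 11 3 3, AddR 12 3 3]) (Seq prog_y (seqs [StoreR 7 15 11, StoreR 8 15 12, AddN 16 16 0]))))"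

lemma prog_x_ok:
  assumes s: "nreg s 0 = n" "nreg s 2 = 1" "rreg s 3 = 0"
  shows "ok prog_x s (3 + n * (9 + n * 20)) (\<lambda>s'. frame {14, 15, 16, 17} {7, 8, 9, 10, 11, 12} {} {7, 8} s s' \<and>
    (\<forall>x<n. rarr s' 7 x = (\<Sum>y<n. q1 s (x * n) y + rreg s 2 * q2 s (x * n) y)) \<and>
    (\<forall>x<n. rarr s' 8 x = (\<Sum>y<n. rreg s 2 * q1 s (x * n) y + q2 s (x * n) y)))"
proof -
  let ?F = "frame {14, 15, 16, 17} {7, 8, 9, 10, 11, 12} {} {7, 8}"
  define I where "I j s' \<longleftrightarrow> ?F s s' \<and> nreg s' 16 = j * n \<and>
    (\<forall>x<j. rarr s' 7 x = (\<Sum>y<n. q1 s (x * n) y + rreg s 2 * q2 s (x * n) y)) \<and>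
    (\<forall>x<j. rarr s' 8 x = (\<Sum>y<n. rreg s 2 * q1 s (x * n) y + q2 s (x * n) y))" for j s'
  have "ok prog_x s (1 + (2 + n * ((2 + ((2 + n * 20) + 3)) + 2))) (\<lambda>s'. I n s' \<and> nreg s' 0 = n \<and> nreg s' 2 = 1)"
    unfolding prog_x_def
  proof (rule ok_Seq)
    show "ok (ConstN 16 0) s 1 (\<lambda>s'. s' = set_nreg 16 0 s)"
      unfolding ok_def using runs.intros(1)[of 16 0 s] by blast
    fix s0 assume s0: "s0 = set_nreg 16 0 s"
    show "ok (For 15 0 (Seq (seqs [AddR 11 3 3, AddR 12 3 3]) (Seq prog_y (seqs [StoreR 7 15 11, StoreR 8 15 12, AddN 16 16 0]))))
       s0 (2 + n * ((2 + ((2 + n * 20) + 3)) + 2)) (\<lambda>s'. I n s' \<and> nreg s' 0 = n \<and> nreg s' 2 = 1)"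
    proof (rule ok_For)
      fix j s1 assume j: "j < n" "I j s1" "nreg s1 15 = j" "nreg s1 0 = n" "nreg s1 2 = 1"
      then have f: "?F s s1" by (simp add: I_def)
      show "ok (Seq (seqs [AddR 11 3 3, AddR 12 3 3]) (Seq prog_y (seqs [StoreR 7 15 11, StoreR 8 15 12, AddN 16 16 0])))
         s1 (2 + ((2 + n * 20) + 3))
         (\<lambda>s'. nreg s' 15 = j \<and> nreg s' 0 = n \<and> nreg s' 2 = 1 \<and> I (Suc j) (set_nreg 15 (Suc j) s'))"
      proof (rule ok_Seq)
        show "ok (seqs [AddR 11 3 3, AddR 12 3 3]) s1 2 (\<lambda>s'. s' = set_rreg 12 0 (set_rreg 11 0 s1))"
          by (rule ok_seqs) (use s frameD[OF f] in simp_all)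
        fix s2 assume s2: "s2 = set_rreg 12 0 (set_rreg 11 0 s1)"
        have n2: "nreg s2 0 = n" "nreg s2 2 = 1" "nreg s2 16 = j * n" using j s2 by (auto simp: I_def)
        show "ok (Seq prog_y (seqs [StoreR 7 15 11, StoreR 8 15 12, AddN 16 16 0])) s2 ((2 + n * 20) + 3)
          (\<lambda>s'. nreg s' 15 = j \<and> nreg s' 0 = n \<and> nreg s' 2 = 1 \<and> I (Suc j) (set_nreg 15 (Suc j) s'))"
        proof (rule ok_Seq[OF prog_y_ok[OF n2]], elim conjE)
          fix s3
          assume f3: "frame {14, 17} {7, 8, 9, 10, 11, 12} {} {} s2 s3"
            and v: "rreg s3 11 = rreg s2 11 + (\<Sum>y<n. q1 s2 (j * n) y + rreg s2 2 * q2 s2 (j * n) y)"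
              "rreg s3 12 = rreg s2 12 + (\<Sum>y<n. rreg s2 2 * q1 s2 (j * n) y + q2 s2 (j * n) y)"
          have q: "q1 s2 (j * n) y = q1 s (j * n) y" "q2 s2 (j * n) y = q2 s (j * n) y" "rreg s2 2 = rreg s 2" for y
            unfolding s2 q1_def q2_def using frameD[OF f] by simp_all
          have v': "rreg s3 11 = (\<Sum>y<n. q1 s (j * n) y + rreg s 2 * q2 s (j * n) y)"
            "rreg s3 12 = (\<Sum>y<n. rreg s 2 * q1 s (j * n) y + q2 s (j * n) y)"
            unfolding v q by (simp_all add: s2)
          have f': "?F s s3"
            using f f3 unfolding s2 frame_def by simp
          show "ok (seqs [StoreR 7 15 11, StoreR 8 15 12, AddN 16 16 0]) s3 3
            (\<lambda>s'. nreg s' 15 = j \<and> nreg s' 0 = n \<and> nreg s' 2 = 1 \<and> I (Suc j) (set_nreg 15 (Suc j) s'))"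
            by (rule ok_seqs) (use j s2 f' frameD[OF f3] v' in \<open>auto simp: I_def frame_def less_Suc_eq\<close>)
        qed
      qed
    qed (use s s0 in \<open>auto simp: I_def frame_def\<close>)
  qed
  then show ?thesis by (rule ok_mono) (auto simp: I_def algebra_simps)
qed

text \<open>New walk sums are first collected in separate arrays and copied afterwards, since every
  entry of a matrix product needs all the old ones.\<close>

definition "prog_copy = For 14 0 (seqs [LoadR 7 7 14, StoreR 5 14 7, LoadR 7 8 14, StoreR 6 14 7])"

lemma prog_copy_ok:
  assumes s: "nreg s 0 = n" "nreg s 2 = 1"
  shows "ok prog_copy s (2 + n * 6) (\<lambda>s'. frame {14} {7} {} {5, 6} s s' \<and>
    (\<forall>x<n. rarr s' 5 x = rarr s 7 x) \<and> (\<forall>x<n. rarr s' 6 x = rarr s 8 x))"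
proof -
  define I where "I j s' \<longleftrightarrow> frame {14} {7} {} {5, 6} s s' \<and>
    (\<forall>x<j. rarr s' 5 x = rarr s 7 x) \<and> (\<forall>x<j. rarr s' 6 x = rarr s 8 x)" for j s'
  have "ok prog_copy s (2 + n * (4 + 2)) (\<lambda>s'. I n s' \<and> nreg s' 0 = n \<and> nreg s' 2 = 1)"
    unfolding prog_copy_def
  proof (rule ok_For)
    fix j s1 assume j: "j < n" "I j s1" "nreg s1 14 = j" "nreg s1 0 = n" "nreg s1 2 = 1"
    then have f: "frame {14} {7} {} {5, 6} s s1" by (simp add: I_def)
    show "ok (seqs [LoadR 7 7 14, StoreR 5 14 7, LoadR 7 8 14, StoreR 6 14 7]) s1 4
        (\<lambda>s'. nreg s' 14 = j \<and> nreg s' 0 = n \<and> nreg s' 2 = 1 \<and> I (Suc j) (set_nreg 14 (Suc j) s'))"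
      by (rule ok_seqs) (use j s frameD[OF f] in \<open>auto simp: I_def frame_def less_Suc_eq\<close>)
  qed (use s in \<open>auto simp: I_def\<close>)
  then show ?thesis by (rule ok_mono) (auto simp: I_def)
qed

text \<open>The weighted number of walks with \<open>j\<close> steps from \<open>x\<close> to
  \<open>v\<close> whose last letter is \<open>Bullet\<close>, when \<open>b\<close> is the letter
  before the first step. \<open>A\<close> restricts the vertices reached; the start is not included
  and gets its factor at the very end. The matrices are stored row by row.\<close>

fun ust :: "nat \<Rightarrow> real \<Rightarrow> real \<Rightarrow> real \<Rightarrow> (nat \<Rightarrow> real) \<Rightarrow> (nat \<Rightarrow> real) \<Rightarrow> (nat \<Rightarrow> real) \<Rightarrow>
    nat \<Rightarrow> nat \<Rightarrow> nat \<Rightarrow> decoration \<Rightarrow> real" where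
  "ust n lam mu rho X Y A v 0 x b = (if x = v \<and> b = Bullet then 1 else 0)"
| "ust n lam mu rho X Y A v (Suc j) x b = (\<Sum>y<n.
     (if b = Bullet then 1 else rho) * (lam * X (x * n + y) * ust n lam mu rho X Y A v j y Bullet * A y) +
     (if b = Circ then 1 else rho) * (mu * Y (x * n + y) * ust n lam mu rho X Y A v j y Circ * A y))"

lemma ust_cong:
  assumes "\<And>y. y < n \<Longrightarrow> A y = A' y"
  shows "ust n lam mu rho X Y A v j x b = ust n lam mu rho X Y A' v j x b"
  by (induction j arbitrary: x b) (auto simp: assms intro!: sum.cong)

abbreviation "sust s \<equiv> ust (nreg s 0) (rreg s 0) (rreg s 1) (rreg s 2) (rarr s 0) (rarr s 1) (rarr s 4)"

definition "prog_j = For 19 1 (Seq prog_x prog_copy)"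

definition "time_j n l = 2 + l * ((3 + n * (9 + n * 20)) + (2 + n * 6) + 2 :: nat)"

lemma prog_j_ok:
  assumes s: "nreg s 0 = n" "nreg s 1 = l" "nreg s 2 = 1" "rreg s 3 = 0"
    and U: "\<forall>x<n. rarr s 5 x = sust s v 0 x Bullet" "\<forall>x<n. rarr s 6 x = sust s v 0 x Circ"
  shows "ok prog_j s (time_j n l) (\<lambda>s'. frame {14, 15, 16, 17, 19} {7, 8, 9, 10, 11, 12} {} {5, 6, 7, 8} s s' \<and>
    (\<forall>x<n. rarr s' 5 x = sust s v l x Bullet) \<and> (\<forall>x<n. rarr s' 6 x = sust s v l x Circ))"
proof -
  let ?F = "frame {14, 15, 16, 17, 19} {7, 8, 9, 10, 11, 12} {} {5, 6, 7, 8}"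
  define I where "I j s' \<longleftrightarrow> ?F s s' \<and>
    (\<forall>x<n. rarr s' 5 x = sust s v j x Bullet) \<and> (\<forall>x<n. rarr s' 6 x = sust s v j x Circ)" for j s'
  have "ok prog_j s (2 + l * (((3 + n * (9 + n * 20)) + (2 + n * 6)) + 2)) (\<lambda>s'. I l s' \<and> nreg s' 1 = l \<and> nreg s' 2 = 1)"
    unfolding prog_j_def
  proof (rule ok_For)
    fix j s1 assume j: "j < l" "I j s1" "nreg s1 19 = j" "nreg s1 1 = l" "nreg s1 2 = 1"
    then have f: "?F s s1" by (simp add: I_def)
    have s1: "nreg s1 0 = n" "rreg s1 3 = 0" using s frameD[OF f] by simp_all
    show "ok (Seq prog_x prog_copy) s1 ((3 + n * (9 + n * 20)) + (2 + n * 6))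
        (\<lambda>s'. nreg s' 19 = j \<and> nreg s' 1 = l \<and> nreg s' 2 = 1 \<and> I (Suc j) (set_nreg 19 (Suc j) s'))"
    proof (rule ok_Seq[OF prog_x_ok[OF s1(1) j(5) s1(2)]], elim conjE)
      fix s2
      assume f2: "frame {14, 15, 16, 17} {7, 8, 9, 10, 11, 12} {} {7, 8} s1 s2"
        and v7: "\<forall>x<n. rarr s2 7 x = (\<Sum>y<n. q1 s1 (x * n) y + rreg s1 2 * q2 s1 (x * n) y)"
        and v8: "\<forall>x<n. rarr s2 8 x = (\<Sum>y<n. rreg s1 2 * q1 s1 (x * n) y + q2 s1 (x * n) y)"
      have s2: "nreg s2 0 = n" "nreg s2 2 = 1" using s1 j frameD[OF f2] by simp_all
      have w7: "rarr s2 7 x = sust s v (Suc j) x Bullet" if "x < n" for x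
        using that v7 j(2) s frameD[OF f] by (auto simp: I_def q1_def q2_def intro!: sum.cong)
      have w8: "rarr s2 8 x = sust s v (Suc j) x Circ" if "x < n" for x
        using that v8 j(2) s frameD[OF f] by (auto simp: I_def q1_def q2_def intro!: sum.cong)
      show "ok prog_copy s2 (2 + n * 6)
        (\<lambda>s'. nreg s' 19 = j \<and> nreg s' 1 = l \<and> nreg s' 2 = 1 \<and> I (Suc j) (set_nreg 19 (Suc j) s'))"
      proof (rule ok_mono[OF prog_copy_ok[OF s2] order_refl], elim conjE)
        fix s3
        assume f3: "frame {14} {7} {} {5, 6} s2 s3"
          and v: "\<forall>x<n. rarr s3 5 x = rarr s2 7 x" "\<forall>x<n. rarr s3 6 x = rarr s2 8 x"
        have "?F s s3" using f f2 f3 unfolding frame_def by simp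
        moreover have "nreg s3 19 = j" "nreg s3 1 = l" "nreg s3 2 = 1"
          using j frameD[OF f2] frameD[OF f3] by simp_all
        ultimately show "nreg s3 19 = j \<and> nreg s3 1 = l \<and> nreg s3 2 = 1 \<and> I (Suc j) (set_nreg 19 (Suc j) s3)"
          using v w7 w8 by (simp add: I_def del: ust.simps)
      qed
    qed
  qed (use s U in \<open>auto simp: I_def\<close>)
  then show ?thesis by (rule ok_mono) (auto simp: I_def time_j_def)
qed

definition "prog_init = Seq (For 14 0 (seqs [StoreR 5 14 3, StoreR 6 14 3])) (StoreR 5 18 4)"

lemma prog_init_ok:
  assumes s: "nreg s 0 = n" "nreg s 2 = 1" "rreg s 3 = 0" "rreg s 4 = 1" "nreg s 18 = v"
  shows "ok prog_init s (3 + n * 4) (\<lambda>s'. frame {14} {} {} {5, 6} s s' \<and>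
    (\<forall>x<n. rarr s' 5 x = sust s v 0 x Bullet) \<and> (\<forall>x<n. rarr s' 6 x = sust s v 0 x Circ))"
proof -
  define I where "I j s' \<longleftrightarrow> frame {14} {} {} {5, 6} s s' \<and>
    (\<forall>x<j. rarr s' 5 x = 0) \<and> (\<forall>x<j. rarr s' 6 x = 0)" for j s'
  have loop: "ok (For 14 0 (seqs [StoreR 5 14 3, StoreR 6 14 3])) s (2 + n * (2 + 2))
      (\<lambda>s'. I n s' \<and> nreg s' 0 = n \<and> nreg s' 2 = 1)"
  proof (rule ok_For)
    fix j s1 assume j: "j < n" "I j s1" "nreg s1 14 = j" "nreg s1 0 = n" "nreg s1 2 = 1"
    then have f: "frame {14} {} {} {5, 6} s s1" by (simp add: I_def)
    show "ok (seqs [StoreR 5 14 3, StoreR 6 14 3]) s1 2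
        (\<lambda>s'. nreg s' 14 = j \<and> nreg s' 0 = n \<and> nreg s' 2 = 1 \<and> I (Suc j) (set_nreg 14 (Suc j) s'))"
      by (rule ok_seqs) (use j s frameD[OF f] in \<open>auto simp: I_def frame_def less_Suc_eq\<close>)
  qed (use s in \<open>auto simp: I_def\<close>)
  have "ok prog_init s (2 + n * (2 + 2) + 1) (\<lambda>s'. frame {14} {} {} {5, 6} s s' \<and>
    (\<forall>x<n. rarr s' 5 x = sust s v 0 x Bullet) \<and> (\<forall>x<n. rarr s' 6 x = sust s v 0 x Circ))"
    unfolding prog_init_def
  proof (rule ok_Seq[OF loop])
    fix s1 assume s1: "I n s1 \<and> nreg s1 0 = n \<and> nreg s1 2 = 1"
    then have f: "frame {14} {} {} {5, 6} s s1" by (simp add: I_def)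
    have "runs (StoreR 5 18 4) s1 1 (set_rarr 5 (nreg s1 18) (rreg s1 4) s1)" by (rule runs.intros)
    then show "ok (StoreR 5 18 4) s1 1 (\<lambda>s'. frame {14} {} {} {5, 6} s s' \<and>
      (\<forall>x<n. rarr s' 5 x = sust s v 0 x Bullet) \<and> (\<forall>x<n. rarr s' 6 x = sust s v 0 x Circ))"
      unfolding ok_def
      by (intro exI[of _ 1] exI[of _ "set_rarr 5 (nreg s1 18) (rreg s1 4) s1"])
        (use s s1 frameD[OF f] in \<open>auto simp: I_def frame_def\<close>)
  qed
  then show ?thesis by (rule ok_mono) auto
qed

lemma index_inj:
  assumes "v < n" "v' < n" shows "x * n + v = x' * n + v' \<longleftrightarrow> x = x' \<and> v = (v' :: nat)"
proof
  assume e: "x * n + v = x' * n + v'"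
  have "x = (x * n + v) div n" "x' = (x' * n + v') div n" using assms by simp_all
  with e have "x = x'" by simp
  with e show "x = x' \<and> v = v'" by simp
qed simp

text \<open>Adds the contribution of the current colour subset to the column of \<open>v\<close>:
  the walk sum for \<open>Bullet\<close> minus \<open>rho\<close> times that for
  \<open>Circ\<close>, times the indicator at the start vertex and the signed prefactor.\<close>

definition "prog_acc = Seq (ConstN 16 0) (For 15 0 (seqs [AddN 17 16 18, LoadR 7 6 15, MulR 7 2 7,
  LoadR 8 5 15, SubR 8 8 7, LoadR 9 4 15, MulR 8 8 9, MulR 8 8 6, LoadR 7 2 17, AddR 7 7 8,
  StoreR 2 17 7, AddN 16 16 0]))"

lemma prog_acc_ok:
  assumes s: "nreg s 0 = n" "nreg s 2 = 1" "nreg s 18 = v" and v: "v < n"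
  shows "ok prog_acc s (3 + n * 14) (\<lambda>s'. frame {15, 16, 17} {7, 8, 9} {} {2} s s' \<and>
    (\<forall>x<n. \<forall>v'<n. rarr s' 2 (x * n + v') = rarr s 2 (x * n + v') +
       (if v' = v then (rarr s 5 x - rreg s 2 * rarr s 6 x) * rarr s 4 x * rreg s 6 else 0)))"
proof -
  define I where "I j s' \<longleftrightarrow> frame {15, 16, 17} {7, 8, 9} {} {2} s s' \<and> nreg s' 16 = j * n \<and>
    (\<forall>x<n. \<forall>v'<n. rarr s' 2 (x * n + v') = rarr s 2 (x * n + v') +
       (if v' = v \<and> x < j then (rarr s 5 x - rreg s 2 * rarr s 6 x) * rarr s 4 x * rreg s 6 else 0))" for j s'
  have "ok prog_acc s (1 + (2 + n * (12 + 2))) (\<lambda>s'. I n s' \<and> nreg s' 0 = n \<and> nreg s' 2 = 1)"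
    unfolding prog_acc_def
  proof (rule ok_Seq)
    show "ok (ConstN 16 0) s 1 (\<lambda>s'. s' = set_nreg 16 0 s)"
      unfolding ok_def using runs.intros(1)[of 16 0 s] by blast
    fix s0 assume s0: "s0 = set_nreg 16 0 s"
    show "ok (For 15 0 (seqs [AddN 17 16 18, LoadR 7 6 15, MulR 7 2 7,
      LoadR 8 5 15, SubR 8 8 7, LoadR 9 4 15, MulR 8 8 9, MulR 8 8 6, LoadR 7 2 17, AddR 7 7 8,
      StoreR 2 17 7, AddN 16 16 0])) s0 (2 + n * (12 + 2)) (\<lambda>s'. I n s' \<and> nreg s' 0 = n \<and> nreg s' 2 = 1)"
    proof (rule ok_For)
      fix j s1 assume j: "j < n" "I j s1" "nreg s1 15 = j" "nreg s1 0 = n" "nreg s1 2 = 1"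
      then have f: "frame {15, 16, 17} {7, 8, 9} {} {2} s s1" by (simp add: I_def)
      have out: "rarr s1 2 (x * n + v') = rarr s 2 (x * n + v') +
       (if v' = v \<and> x < j then (rarr s 5 x - rreg s 2 * rarr s 6 x) * rarr s 4 x * rreg s 6 else 0)"
        if "x < n" "v' < n" for x v' using j(2) that by (simp add: I_def)
      have n16: "nreg s1 16 = j * n" using j(2) by (simp add: I_def)
      define val where "val = rarr s 2 (j * n + v) + (rarr s 5 j - rreg s 2 * rarr s 6 j) * rarr s 4 j * rreg s 6"
      have new: "((rarr s1 2)(j * n + v := val)) (x * n + v') = rarr s 2 (x * n + v') +
       (if v' = v \<and> x < Suc j then (rarr s 5 x - rreg s 2 * rarr s 6 x) * rarr s 4 x * rreg s 6 else 0)"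
        if "x < n" "v' < n" for x v'
        using out[OF that] that v index_inj[OF that(2) v, of x j] by (auto simp: val_def less_Suc_eq)
      let ?cs = "[AddN 17 16 18, LoadR 7 6 15, MulR 7 2 7,
        LoadR 8 5 15, SubR 8 8 7, LoadR 9 4 15, MulR 8 8 9, MulR 8 8 6, LoadR 7 2 17, AddR 7 7 8,
        StoreR 2 17 7, AddN 16 16 0]"
      define s4 where "s4 = fold exec ?cs s1"
      have r2: "rarr s4 2 = (rarr s1 2)(j * n + v := val)"
        using out[of j v] j s v n16 frameD[OF f] by (simp add: val_def s4_def)
      show "ok (seqs ?cs) s1 12
        (\<lambda>s'. nreg s' 15 = j \<and> nreg s' 0 = n \<and> nreg s' 2 = 1 \<and> I (Suc j) (set_nreg 15 (Suc j) s'))"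
      proof (rule ok_seqs)
        have "frame {15, 16, 17} {7, 8, 9} {} {2} s s4"
          using frameD[OF f] by (simp add: frame_def s4_def)
        moreover have "nreg s4 16 = Suc j * n" using n16 j by (simp add: s4_def)
        moreover have "nreg s4 15 = j" "nreg s4 0 = n" "nreg s4 2 = 1"
          using j by (simp_all add: s4_def)
        ultimately show "nreg (fold exec ?cs s1) 15 = j \<and> nreg (fold exec ?cs s1) 0 = n \<and>
          nreg (fold exec ?cs s1) 2 = 1 \<and> I (Suc j) (set_nreg 15 (Suc j) (fold exec ?cs s1))"
          unfolding I_def s4_def[symmetric] using new r2 by simp
      qed simp_all
    qed (use s s0 in \<open>auto simp: I_def frame_def\<close>)
  qed
  then show ?thesis by (rule ok_mono) (auto simp: I_def)
qed

definition "prog_v = For 18 0 (Seq prog_init (Seq prog_j prog_acc))"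

definition "time_v n l = 2 + n * ((3 + n * 4) + (time_j n l + (3 + n * 14)) + 2)"

lemma prog_v_ok:
  assumes s: "nreg s 0 = n" "nreg s 1 = l" "nreg s 2 = 1" "rreg s 3 = 0" "rreg s 4 = 1"
  shows "ok prog_v s (time_v n l) (\<lambda>s'. frame {14, 15, 16, 17, 18, 19} {7, 8, 9, 10, 11, 12} {} {2, 5, 6, 7, 8} s s' \<and>
    (\<forall>x<n. \<forall>v<n. rarr s' 2 (x * n + v) = rarr s 2 (x * n + v) +
       (sust s v l x Bullet - rreg s 2 * sust s v l x Circ) * rarr s 4 x * rreg s 6))"
proof -
  let ?F = "frame {14, 15, 16, 17, 18, 19} {7, 8, 9, 10, 11, 12} {} {2, 5, 6, 7, 8}"
  define I where "I j s' \<longleftrightarrow> ?F s s' \<and>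
    (\<forall>x<n. \<forall>v<n. rarr s' 2 (x * n + v) = rarr s 2 (x * n + v) +
       (if v < j then (sust s v l x Bullet - rreg s 2 * sust s v l x Circ) * rarr s 4 x * rreg s 6 else 0))" for j s'
  have "ok prog_v s (2 + n * (((3 + n * 4) + (time_j n l + (3 + n * 14))) + 2)) (\<lambda>s'. I n s' \<and> nreg s' 0 = n \<and> nreg s' 2 = 1)"
    unfolding prog_v_def
  proof (rule ok_For)
    fix j s1 assume j: "j < n" "I j s1" "nreg s1 18 = j" "nreg s1 0 = n" "nreg s1 2 = 1"
    then have f: "?F s s1" by (simp add: I_def)
    have s1: "nreg s1 0 = n" "nreg s1 2 = 1" "rreg s1 3 = 0" "rreg s1 4 = 1" "nreg s1 18 = j"
      using s j frameD[OF f] by simp_all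
    have us1: "sust s1 = sust s" using frameD[OF f] by (intro ext) simp
    show "ok (Seq prog_init (Seq prog_j prog_acc)) s1 ((3 + n * 4) + (time_j n l + (3 + n * 14)))
      (\<lambda>s'. nreg s' 18 = j \<and> nreg s' 0 = n \<and> nreg s' 2 = 1 \<and> I (Suc j) (set_nreg 18 (Suc j) s'))"
    proof (rule ok_Seq[OF prog_init_ok[OF s1]], elim conjE)
      fix s2
      assume f2: "frame {14} {} {} {5, 6} s1 s2"
        and u2: "\<forall>x<n. rarr s2 5 x = sust s1 j 0 x Bullet" "\<forall>x<n. rarr s2 6 x = sust s1 j 0 x Circ"
      have us2: "sust s2 = sust s" using frameD[OF f2] us1 by (intro ext) simp
      have s2: "nreg s2 0 = n" "nreg s2 1 = l" "nreg s2 2 = 1" "rreg s2 3 = 0"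
        using s s1 frameD[OF f] frameD[OF f2] by simp_all
      have u2': "\<forall>x<n. rarr s2 5 x = sust s2 j 0 x Bullet" "\<forall>x<n. rarr s2 6 x = sust s2 j 0 x Circ"
        using u2 unfolding us2 us1 .
      show "ok (Seq prog_j prog_acc) s2 (time_j n l + (3 + n * 14))
        (\<lambda>s'. nreg s' 18 = j \<and> nreg s' 0 = n \<and> nreg s' 2 = 1 \<and> I (Suc j) (set_nreg 18 (Suc j) s'))"
      proof (rule ok_Seq[OF prog_j_ok[OF s2 u2']], elim conjE)
        fix s3
        assume f3: "frame {14, 15, 16, 17, 19} {7, 8, 9, 10, 11, 12} {} {5, 6, 7, 8} s2 s3"
          and u3: "\<forall>x<n. rarr s3 5 x = sust s2 j l x Bullet" "\<forall>x<n. rarr s3 6 x = sust s2 j l x Circ"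
        have s3: "nreg s3 0 = n" "nreg s3 2 = 1" "nreg s3 18 = j"
          using s1 frameD[OF f2] frameD[OF f3] by simp_all
        have same: "rreg s3 2 = rreg s 2" "rreg s3 6 = rreg s 6" "rarr s3 4 = rarr s 4" "rarr s3 2 = rarr s1 2"
          using frameD[OF f] frameD[OF f2] frameD[OF f3] by simp_all
        show "ok prog_acc s3 (3 + n * 14)
          (\<lambda>s'. nreg s' 18 = j \<and> nreg s' 0 = n \<and> nreg s' 2 = 1 \<and> I (Suc j) (set_nreg 18 (Suc j) s'))"
        proof (rule ok_mono[OF prog_acc_ok[OF s3 j(1)] order_refl], elim conjE)
          fix s4
          assume f4: "frame {15, 16, 17} {7, 8, 9} {} {2} s3 s4"
            and o4: "\<forall>x<n. \<forall>v'<n. rarr s4 2 (x * n + v') = rarr s3 2 (x * n + v') +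
              (if v' = j then (rarr s3 5 x - rreg s3 2 * rarr s3 6 x) * rarr s3 4 x * rreg s3 6 else 0)"
          have F: "?F s s4" using f f2 f3 f4 unfolding frame_def by simp
          have "nreg s4 18 = j" "nreg s4 0 = n" "nreg s4 2 = 1"
            using s3 frameD[OF f4] by simp_all
          moreover have "rarr s4 2 (x * n + v) = rarr s 2 (x * n + v) +
             (if v < Suc j then (sust s v l x Bullet - rreg s 2 * sust s v l x Circ) * rarr s 4 x * rreg s 6 else 0)"
            if "x < n" "v < n" for x v
          proof -
            have "rarr s1 2 (x * n + v) = rarr s 2 (x * n + v) +
              (if v < j then (sust s v l x Bullet - rreg s 2 * sust s v l x Circ) * rarr s 4 x * rreg s 6 else 0)"
              using j(2) that by (simp add: I_def)
            then show ?thesis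
              using o4 that u3 unfolding same us2 by (auto simp: less_Suc_eq)
          qed
          ultimately show "nreg s4 18 = j \<and> nreg s4 0 = n \<and> nreg s4 2 = 1 \<and> I (Suc j) (set_nreg 18 (Suc j) s4)"
            using F by (simp add: I_def)
        qed
      qed
    qed
  qed (use s in \<open>auto simp: I_def\<close>)
  then show ?thesis by (rule ok_mono) (auto simp: I_def time_v_def)
qed

section \<open>Colour subsets and the outer loops\<close>

definition bitr :: "nat \<Rightarrow> nat \<Rightarrow> real" where
  "bitr m d = (if odd (m div 2 ^ d) then 1 else 0)"

text \<open>The product over all colours is \<open>-1\<close> to the number of missing colours, the
  sign of inclusion-exclusion.\<close>

definition signr :: "nat \<Rightarrow> nat \<Rightarrow> real" where
  "signr m d = (if odd (m div 2 ^ d) then 1 else -1)"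

text \<open>The machine cannot divide natural numbers, so bits are extracted from the top: bit
  \<open>d\<close> is set iff the remainder modulo \<open>2 ^ Suc d\<close> is at least
  \<open>2 ^ d\<close>, and subtracting the power then gives the next remainder.\<close>

lemma mod_pow_Suc:
  "m mod 2 ^ Suc d = (if odd (m div 2 ^ d) then 2 ^ d + m mod 2 ^ d else m mod (2 ^ d :: nat))"
proof -
  have "m mod 2 ^ Suc d = 2 ^ d * (m div 2 ^ d mod 2) + m mod 2 ^ d"
    using mod_mult2_eq[of m "2 ^ d" 2] by (simp add: mult.commute)
  then show ?thesis by (simp add: odd_iff_mod_2_eq_one)
qed

definition "prog_dec = Seq (seqs [AddN 10 9 3, AddR 6 5 3]) (For 11 4
  (Seq (seqs [SubN 12 1 11, LoadN 13 1 12])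
    (IfLessN 10 13 (seqs [StoreR 3 12 3, SubR 6 3 6]) (seqs [StoreR 3 12 4, SubN 10 10 13]))))"

lemma prog_dec_ok:
  assumes s: "nreg s 1 = l" "nreg s 2 = 1" "nreg s 3 = 0" "nreg s 4 = l + 1" "rreg s 3 = 0" "rreg s 4 = 1"
    and m: "nreg s 9 = m" "m < 2 ^ (l + 1)" and pw: "\<forall>d\<le>l. narr s 1 d = 2 ^ d"
  shows "ok prog_dec s (4 + (l + 1) * 7) (\<lambda>s'. frame {10, 11, 12, 13} {6} {} {3} s s' \<and>
    (\<forall>d\<le>l. rarr s' 3 d = bitr m d) \<and> rreg s' 6 = rreg s 5 * (\<Prod>d<l + 1. signr m d))"
proof -
  let ?F = "frame {10, 11, 12, 13} {6} {} {3}"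
  \<comment> \<open>After \<open>j\<close> rounds the top \<open>j\<close> bits have been written
    and their signs multiplied; the register keeps the remainder formed by the lower bits.\<close>
  define I where "I j s' \<longleftrightarrow> ?F s s' \<and> nreg s' 10 = m mod 2 ^ (l + 1 - j) \<and>
    (\<forall>d\<le>l. l + 1 - j \<le> d \<longrightarrow> rarr s' 3 d = bitr m d) \<and>
    rreg s' 6 = rreg s 5 * (\<Prod>d\<in>{l + 1 - j..<l + 1}. signr m d)" for j s'
  have "ok prog_dec s (2 + (2 + (l + 1) * ((2 + Suc 2) + 2))) (\<lambda>s'. I (l + 1) s' \<and> nreg s' 4 = l + 1 \<and> nreg s' 2 = 1)"
    unfolding prog_dec_def
  proof (rule ok_Seq)
    show "ok (seqs [AddN 10 9 3, AddR 6 5 3]) s 2 (\<lambda>s'. s' = set_rreg 6 (rreg s 5) (set_nreg 10 m s))"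
      by (rule ok_seqs) (use s m in simp_all)
    fix s0 assume s0: "s0 = set_rreg 6 (rreg s 5) (set_nreg 10 m s)"
    show "ok (For 11 4 (Seq (seqs [SubN 12 1 11, LoadN 13 1 12])
      (IfLessN 10 13 (seqs [StoreR 3 12 3, SubR 6 3 6]) (seqs [StoreR 3 12 4, SubN 10 10 13])))) s0
      (2 + (l + 1) * ((2 + Suc 2) + 2)) (\<lambda>s'. I (l + 1) s' \<and> nreg s' 4 = l + 1 \<and> nreg s' 2 = 1)"
    proof (rule ok_For)
      fix j s1 assume j: "j < l + 1" "I j s1" "nreg s1 11 = j" "nreg s1 4 = l + 1" "nreg s1 2 = 1"
      then have f: "?F s s1" by (simp add: I_def)
      define d where "d = l - j"
      have d: "d \<le> l" "l + 1 - j = Suc d" "l + 1 - Suc j = d" using j by (auto simp: d_def)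
      have r: "nreg s1 10 = m mod 2 ^ Suc d" using j(2) unfolding I_def d(2) by blast
      have arr: "rarr s1 3 d' = bitr m d'" if "d' \<le> l" "Suc d \<le> d'" for d'
        using j(2) that unfolding I_def d(2) by blast
      have sg: "rreg s1 6 = rreg s 5 * (\<Prod>d\<in>{Suc d..<l + 1}. signr m d)"
        using j(2) unfolding I_def d(2) by blast
      have split: "(\<Prod>d\<in>{d..<l + 1}. signr m d) = signr m d * (\<Prod>d\<in>{Suc d..<l + 1}. signr m d)"
        by (rule prod.atLeast_Suc_lessThan) (use d in simp)
      show "ok (Seq (seqs [SubN 12 1 11, LoadN 13 1 12])
          (IfLessN 10 13 (seqs [StoreR 3 12 3, SubR 6 3 6]) (seqs [StoreR 3 12 4, SubN 10 10 13]))) s1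
          (2 + Suc 2) (\<lambda>s'. nreg s' 11 = j \<and> nreg s' 4 = l + 1 \<and> nreg s' 2 = 1 \<and> I (Suc j) (set_nreg 11 (Suc j) s'))"
      proof (rule ok_Seq)
        show "ok (seqs [SubN 12 1 11, LoadN 13 1 12]) s1 2 (\<lambda>s'. s' = set_nreg 13 (2 ^ d) (set_nreg 12 d s1))"
          by (rule ok_seqs) (use s j d pw frameD[OF f] in \<open>simp_all add: d_def\<close>)
        fix s2 assume s2: "s2 = set_nreg 13 (2 ^ d) (set_nreg 12 d s1)"
        have lt: "nreg s2 10 < nreg s2 13 \<longleftrightarrow> \<not> odd (m div 2 ^ d)"
          unfolding s2 using r mod_pow_Suc[of m d] by simp
        have vals: "rreg s2 3 = 0" "rreg s2 4 = 1" "nreg s2 12 = d" "nreg s2 13 = 2 ^ d" "nreg s2 10 = m mod 2 ^ Suc d"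
          "rreg s2 6 = rreg s1 6" "rarr s2 3 = rarr s1 3" "nreg s2 11 = j" "nreg s2 4 = l + 1" "nreg s2 2 = 1"
          using s j r frameD[OF f] by (simp_all add: s2)
        have F2: "?F s s2" using frameD[OF f] by (simp add: s2 frame_def)
        show "ok (IfLessN 10 13 (seqs [StoreR 3 12 3, SubR 6 3 6]) (seqs [StoreR 3 12 4, SubN 10 10 13])) s2 (Suc 2)
          (\<lambda>s'. nreg s' 11 = j \<and> nreg s' 4 = l + 1 \<and> nreg s' 2 = 1 \<and> I (Suc j) (set_nreg 11 (Suc j) s'))"
        proof (rule ok_IfLessN)
          assume "nreg s2 10 < nreg s2 13"
          then have e: "\<not> odd (m div 2 ^ d)" using lt by simp
          show "ok (seqs [StoreR 3 12 3, SubR 6 3 6]) s2 2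
            (\<lambda>s'. nreg s' 11 = j \<and> nreg s' 4 = l + 1 \<and> nreg s' 2 = 1 \<and> I (Suc j) (set_nreg 11 (Suc j) s'))"
          proof (rule ok_seqs)
            define s3 where "s3 = fold exec [StoreR 3 12 3, SubR 6 3 6] s2"
            have "?F s s3" using frameD[OF F2] by (simp add: frame_def s3_def)
            moreover have "nreg s3 10 = m mod 2 ^ d" using vals e mod_pow_Suc[of m d] by (simp add: s3_def)
            moreover have "rarr s3 3 d' = bitr m d'" if "d' \<le> l" "d \<le> d'" for d'
              using that arr[of d'] vals e by (cases "d' = d") (auto simp: s3_def bitr_def)
            moreover have "rreg s3 6 = rreg s 5 * (\<Prod>d\<in>{d..<l + 1}. signr m d)"
              unfolding split using vals sg e by (simp add: s3_def signr_def)
            moreover have "nreg s3 11 = j" "nreg s3 4 = l + 1" "nreg s3 2 = 1" using vals by (simp_all add: s3_def)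
            ultimately show "nreg (fold exec [StoreR 3 12 3, SubR 6 3 6] s2) 11 = j \<and>
              nreg (fold exec [StoreR 3 12 3, SubR 6 3 6] s2) 4 = l + 1 \<and>
              nreg (fold exec [StoreR 3 12 3, SubR 6 3 6] s2) 2 = 1 \<and>
              I (Suc j) (set_nreg 11 (Suc j) (fold exec [StoreR 3 12 3, SubR 6 3 6] s2))"
              unfolding I_def d(3) s3_def[symmetric] by simp
          qed simp_all
        next
          assume "\<not> nreg s2 10 < nreg s2 13"
          then have e: "odd (m div 2 ^ d)" using lt by simp
          show "ok (seqs [StoreR 3 12 4, SubN 10 10 13]) s2 2
            (\<lambda>s'. nreg s' 11 = j \<and> nreg s' 4 = l + 1 \<and> nreg s' 2 = 1 \<and> I (Suc j) (set_nreg 11 (Suc j) s'))"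
          proof (rule ok_seqs)
            define s3 where "s3 = fold exec [StoreR 3 12 4, SubN 10 10 13] s2"
            have "?F s s3" using frameD[OF F2] by (simp add: frame_def s3_def)
            moreover have "nreg s3 10 = m mod 2 ^ d" using vals e mod_pow_Suc[of m d] by (simp add: s3_def)
            moreover have "rarr s3 3 d' = bitr m d'" if "d' \<le> l" "d \<le> d'" for d'
              using that arr[of d'] vals e by (cases "d' = d") (auto simp: s3_def bitr_def)
            moreover have "rreg s3 6 = rreg s 5 * (\<Prod>d\<in>{d..<l + 1}. signr m d)"
              unfolding split using vals sg e by (simp add: s3_def signr_def)
            moreover have "nreg s3 11 = j" "nreg s3 4 = l + 1" "nreg s3 2 = 1" using vals by (simp_all add: s3_def)
            ultimately show "nreg (fold exec [StoreR 3 12 4, SubN 10 10 13] s2) 11 = j \<and>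
              nreg (fold exec [StoreR 3 12 4, SubN 10 10 13] s2) 4 = l + 1 \<and>
              nreg (fold exec [StoreR 3 12 4, SubN 10 10 13] s2) 2 = 1 \<and>
              I (Suc j) (set_nreg 11 (Suc j) (fold exec [StoreR 3 12 4, SubN 10 10 13] s2))"
              unfolding I_def d(3) s3_def[symmetric] by simp
          qed simp_all
        qed
      qed
    qed (use s s0 m in \<open>auto simp: I_def frame_def\<close>)
  qed
  then show ?thesis by (rule ok_mono) (auto simp: I_def lessThan_atLeast0)
qed

definition "prog_fill = For 14 0 (seqs [AddN 17 8 14, LoadN 13 0 17, LoadR 7 3 13, StoreR 4 14 7])"

lemma prog_fill_ok:
  assumes s: "nreg s 0 = n" "nreg s 2 = 1"
  shows "ok prog_fill s (2 + n * 6) (\<lambda>s'. frame {13, 14, 17} {7} {} {4} s s' \<and>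
    (\<forall>y<n. rarr s' 4 y = rarr s 3 (narr s 0 (nreg s 8 + y))))"
proof -
  define I where "I j s' \<longleftrightarrow> frame {13, 14, 17} {7} {} {4} s s' \<and>
    (\<forall>y<j. rarr s' 4 y = rarr s 3 (narr s 0 (nreg s 8 + y)))" for j s'
  have "ok prog_fill s (2 + n * (4 + 2)) (\<lambda>s'. I n s' \<and> nreg s' 0 = n \<and> nreg s' 2 = 1)"
    unfolding prog_fill_def
  proof (rule ok_For)
    fix j s1 assume j: "j < n" "I j s1" "nreg s1 14 = j" "nreg s1 0 = n" "nreg s1 2 = 1"
    then have f: "frame {13, 14, 17} {7} {} {4} s s1" by (simp add: I_def)
    show "ok (seqs [AddN 17 8 14, LoadN 13 0 17, LoadR 7 3 13, StoreR 4 14 7]) s1 4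
        (\<lambda>s'. nreg s' 14 = j \<and> nreg s' 0 = n \<and> nreg s' 2 = 1 \<and> I (Suc j) (set_nreg 14 (Suc j) s'))"
      by (rule ok_seqs) (use j s frameD[OF f] in \<open>auto simp: I_def frame_def less_Suc_eq\<close>)
  qed (use s in \<open>auto simp: I_def\<close>)
  then show ?thesis by (rule ok_mono) (auto simp: I_def)
qed

text \<open>The contribution of colouring \<open>k\<close> (given by \<open>col\<close>) and colour subset \<open>m\<close> to the entry \<open>(x, v)\<close>.\<close>

definition contrib :: "nat \<Rightarrow> nat \<Rightarrow> real \<Rightarrow> real \<Rightarrow> real \<Rightarrow> (nat \<Rightarrow> real) \<Rightarrow> (nat \<Rightarrow> real) \<Rightarrow> (nat \<Rightarrow> nat) \<Rightarrow>
    nat \<Rightarrow> nat \<Rightarrow> nat \<Rightarrow> nat \<Rightarrow> real" where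
  "contrib n l lam mu rho X Y col k m x v =
    (ust n lam mu rho X Y (\<lambda>y. bitr m (col (k * n + y))) v l x Bullet -
     rho * ust n lam mu rho X Y (\<lambda>y. bitr m (col (k * n + y))) v l x Circ) *
    bitr m (col (k * n + x)) * (\<Prod>d<l + 1. signr m d)"

abbreviation "scontrib s \<equiv> contrib (nreg s 0) (nreg s 1) (rreg s 0) (rreg s 1) (rreg s 2) (rarr s 0) (rarr s 1) (narr s 0)"

definition base :: "nat \<Rightarrow> nat \<Rightarrow> store \<Rightarrow> bool" where
  "base n l s \<longleftrightarrow> nreg s 0 = n \<and> nreg s 1 = l \<and> nreg s 2 = 1 \<and> nreg s 3 = 0 \<and> nreg s 4 = l + 1 \<and>
     nreg s 5 = 2 ^ (l + 1) \<and> rreg s 3 = 0 \<and> rreg s 4 = 1 \<and> (\<forall>d\<le>l. narr s 1 d = 2 ^ d)"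

abbreviation "mframe \<equiv> frame ({9, 10, 11, 12, 13, 14, 15, 16, 17, 18, 19}) {6, 7, 8, 9, 10, 11, 12} {} {2, 3, 4, 5, 6, 7, 8}"
abbreviation "kframe \<equiv> frame ({7, 8, 9, 10, 11, 12, 13, 14, 15, 16, 17, 18, 19}) {6, 7, 8, 9, 10, 11, 12} {} {2, 3, 4, 5, 6, 7, 8}"

lemma base_frame: "kframe s s' \<Longrightarrow> base n l s \<Longrightarrow> base n l s'"
  by (simp add: base_def frame_def)

definition "prog_m = For 9 5 (Seq prog_dec (Seq prog_fill prog_v))"

definition "time_m n l = 2 + 2 ^ (l + 1) * ((4 + (l + 1) * 7) + ((2 + n * 6) + time_v n l) + 2)"

lemma prog_m_ok:
  assumes s: "base n l s" and k: "nreg s 8 = k * n"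
    and col: "\<And>y. y < n \<Longrightarrow> narr s 0 (k * n + y) \<le> l"
  shows "ok prog_m s (time_m n l) (\<lambda>s'. mframe s s' \<and>
    (\<forall>x<n. \<forall>v<n. rarr s' 2 (x * n + v) = rarr s 2 (x * n + v) +
       rreg s 5 * (\<Sum>m<2 ^ (l + 1). scontrib s k m x v)))"
proof -
  define I where "I j s' \<longleftrightarrow> mframe s s' \<and>
    (\<forall>x<n. \<forall>v<n. rarr s' 2 (x * n + v) = rarr s 2 (x * n + v) +
       rreg s 5 * (\<Sum>m<j. scontrib s k m x v))" for j s'
  have "ok prog_m s (2 + 2 ^ (l + 1) * (((4 + (l + 1) * 7) + ((2 + n * 6) + time_v n l)) + 2))
     (\<lambda>s'. I (2 ^ (l + 1)) s' \<and> nreg s' 5 = 2 ^ (l + 1) \<and> nreg s' 2 = 1)"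
    unfolding prog_m_def
  proof (rule ok_For)
    fix m s1 assume j: "m < 2 ^ (l + 1)" "I m s1" "nreg s1 9 = m" "nreg s1 5 = 2 ^ (l + 1)" "nreg s1 2 = 1"
    then have f: "mframe s s1" by (simp add: I_def)
    have s1: "nreg s1 1 = l" "nreg s1 2 = 1" "nreg s1 3 = 0" "nreg s1 4 = l + 1" "rreg s1 3 = 0" "rreg s1 4 = 1"
      "nreg s1 0 = n" "\<forall>d\<le>l. narr s1 1 d = 2 ^ d" "nreg s1 8 = k * n" "nreg s 0 = n" "nreg s 1 = l"
      using s k frameD[OF f] by (simp_all add: base_def)
    show "ok (Seq prog_dec (Seq prog_fill prog_v)) s1 ((4 + (l + 1) * 7) + ((2 + n * 6) + time_v n l))
      (\<lambda>s'. nreg s' 9 = m \<and> nreg s' 5 = 2 ^ (l + 1) \<and> nreg s' 2 = 1 \<and> I (Suc m) (set_nreg 9 (Suc m) s'))"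
    proof (rule ok_Seq[OF prog_dec_ok[OF s1(1-6) j(3,1) s1(8)]], elim conjE)
      fix s2
      assume f2: "frame {10, 11, 12, 13} {6} {} {3} s1 s2"
        and b2: "\<forall>d\<le>l. rarr s2 3 d = bitr m d" "rreg s2 6 = rreg s1 5 * (\<Prod>d<l + 1. signr m d)"
      have s2: "nreg s2 0 = n" "nreg s2 2 = 1" using s1 frameD[OF f2] by simp_all
      show "ok (Seq prog_fill prog_v) s2 ((2 + n * 6) + time_v n l)
        (\<lambda>s'. nreg s' 9 = m \<and> nreg s' 5 = 2 ^ (l + 1) \<and> nreg s' 2 = 1 \<and> I (Suc m) (set_nreg 9 (Suc m) s'))"
      proof (rule ok_Seq[OF prog_fill_ok[OF s2]], elim conjE)
        fix s3
        assume f3: "frame {13, 14, 17} {7} {} {4} s2 s3"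
          and a3: "\<forall>y<n. rarr s3 4 y = rarr s2 3 (narr s2 0 (nreg s2 8 + y))"
        have s3: "nreg s3 0 = n" "nreg s3 1 = l" "nreg s3 2 = 1" "rreg s3 3 = 0" "rreg s3 4 = 1"
          using s1 frameD[OF f2] frameD[OF f3] by simp_all
        have A: "rarr s3 4 y = bitr m (narr s 0 (k * n + y))" if "y < n" for y
          using a3 that b2(1) col[OF that] s1 frameD[OF f] frameD[OF f2] by simp
        have same: "rreg s3 0 = rreg s 0" "rreg s3 1 = rreg s 1" "rreg s3 2 = rreg s 2" "rarr s3 0 = rarr s 0"
          "rarr s3 1 = rarr s 1" "rarr s3 2 = rarr s1 2" "rreg s3 6 = rreg s 5 * (\<Prod>d<l + 1. signr m d)"
          using b2(2) frameD[OF f] frameD[OF f2] frameD[OF f3] by simp_all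
        show "ok prog_v s3 (time_v n l)
          (\<lambda>s'. nreg s' 9 = m \<and> nreg s' 5 = 2 ^ (l + 1) \<and> nreg s' 2 = 1 \<and> I (Suc m) (set_nreg 9 (Suc m) s'))"
        proof (rule ok_mono[OF prog_v_ok[OF s3] order_refl], elim conjE)
          fix s4
          assume f4: "frame {14, 15, 16, 17, 18, 19} {7, 8, 9, 10, 11, 12} {} {2, 5, 6, 7, 8} s3 s4"
            and o4: "\<forall>x<n. \<forall>v<n. rarr s4 2 (x * n + v) = rarr s3 2 (x * n + v) +
              (sust s3 v l x Bullet - rreg s3 2 * sust s3 v l x Circ) * rarr s3 4 x * rreg s3 6"
          have F: "mframe s s4" using f f2 f3 f4 unfolding frame_def by simp
          have "nreg s4 9 = m" "nreg s4 5 = 2 ^ (l + 1)" "nreg s4 2 = 1"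
            using j frameD[OF f2] frameD[OF f3] frameD[OF f4] by simp_all
          moreover have "rarr s4 2 (x * n + v) = rarr s 2 (x * n + v) + rreg s 5 * (\<Sum>m<Suc m. scontrib s k m x v)"
            if "x < n" "v < n" for x v
          proof -
            have u: "sust s3 v l x b = ust n (rreg s 0) (rreg s 1) (rreg s 2) (rarr s 0) (rarr s 1)
                (\<lambda>y. bitr m (narr s 0 (k * n + y))) v l x b" for b
              unfolding same s3(1) by (rule ust_cong) (rule A)
            have "rarr s1 2 (x * n + v) = rarr s 2 (x * n + v) + rreg s 5 * (\<Sum>m<m. scontrib s k m x v)"
              using j(2) that by (simp add: I_def)
            moreover have "rarr s4 2 (x * n + v) = rarr s3 2 (x * n + v) +
              (sust s3 v l x Bullet - rreg s3 2 * sust s3 v l x Circ) * rarr s3 4 x * rreg s3 6"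
              using o4 that by blast
            moreover have "(sust s3 v l x Bullet - rreg s3 2 * sust s3 v l x Circ) * rarr s3 4 x * rreg s3 6 =
              rreg s 5 * scontrib s k m x v"
              unfolding u unfolding same A[OF that(1)] contrib_def s1(10,11) by (simp only: mult_ac)
            ultimately show ?thesis unfolding same by (simp add: distrib_left)
          qed
          ultimately show "nreg s4 9 = m \<and> nreg s4 5 = 2 ^ (l + 1) \<and> nreg s4 2 = 1 \<and> I (Suc m) (set_nreg 9 (Suc m) s4)"
            using F by (simp add: I_def)
        qed
      qed
    qed
  qed (use s in \<open>auto simp: I_def base_def\<close>)
  then show ?thesis by (rule ok_mono) (auto simp: I_def time_m_def)
qed

definition "prog_k = Seq (ConstN 8 0) (For 7 6 (Seq prog_m (AddN 8 8 0)))"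

lemma prog_k_ok:
  assumes s: "base n l s" "nreg s 6 = t" and col: "\<And>k y. k < t \<Longrightarrow> y < n \<Longrightarrow> narr s 0 (k * n + y) \<le> l"
  shows "ok prog_k s (3 + t * (time_m n l + 3)) (\<lambda>s'. kframe s s' \<and>
    (\<forall>x<n. \<forall>v<n. rarr s' 2 (x * n + v) = rarr s 2 (x * n + v) +
       rreg s 5 * (\<Sum>k<t. \<Sum>m<2 ^ (l + 1). scontrib s k m x v)))"
proof -
  define I where "I j s' \<longleftrightarrow> kframe s s' \<and> nreg s' 8 = j * n \<and>
    (\<forall>x<n. \<forall>v<n. rarr s' 2 (x * n + v) = rarr s 2 (x * n + v) +
       rreg s 5 * (\<Sum>k<j. \<Sum>m<2 ^ (l + 1). scontrib s k m x v))" for j s'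
  have "ok prog_k s (1 + (2 + t * ((time_m n l + 1) + 2))) (\<lambda>s'. I t s' \<and> nreg s' 6 = t \<and> nreg s' 2 = 1)"
    unfolding prog_k_def
  proof (rule ok_Seq)
    show "ok (ConstN 8 0) s 1 (\<lambda>s'. s' = set_nreg 8 0 s)"
      unfolding ok_def using runs.intros(1)[of 8 0 s] by blast
    fix s0 assume s0: "s0 = set_nreg 8 0 s"
    show "ok (For 7 6 (Seq prog_m (AddN 8 8 0))) s0 (2 + t * ((time_m n l + 1) + 2))
      (\<lambda>s'. I t s' \<and> nreg s' 6 = t \<and> nreg s' 2 = 1)"
    proof (rule ok_For)
      fix k s1 assume j: "k < t" "I k s1" "nreg s1 7 = k" "nreg s1 6 = t" "nreg s1 2 = 1"
      then have f: "kframe s s1" and k8: "nreg s1 8 = k * n" by (simp_all add: I_def)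
      have b1: "base n l s1" by (rule base_frame[OF f s(1)])
      have c1: "\<And>y. y < n \<Longrightarrow> narr s1 0 (k * n + y) \<le> l" using col[OF j(1)] frameD[OF f] by simp
      have same: "scontrib s1 = scontrib s" "rreg s1 5 = rreg s 5" using frameD[OF f] by simp_all
      show "ok (Seq prog_m (AddN 8 8 0)) s1 (time_m n l + 1)
        (\<lambda>s'. nreg s' 7 = k \<and> nreg s' 6 = t \<and> nreg s' 2 = 1 \<and> I (Suc k) (set_nreg 7 (Suc k) s'))"
      proof (rule ok_Seq[OF prog_m_ok[OF b1 k8 c1]], assumption, elim conjE)
        fix s2
        assume f2: "mframe s1 s2" and o2: "\<forall>x<n. \<forall>v<n. rarr s2 2 (x * n + v) = rarr s1 2 (x * n + v) +
           rreg s1 5 * (\<Sum>m<2 ^ (l + 1). scontrib s1 k m x v)"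
        let ?s3 = "set_nreg 8 (nreg s2 8 + nreg s2 0) s2"
        have r: "runs (AddN 8 8 0) s2 1 ?s3" by (rule runs.intros)
        have "kframe s ?s3" using f f2 unfolding frame_def by simp
        moreover have "nreg ?s3 8 = Suc k * n" "nreg ?s3 7 = k" "nreg ?s3 6 = t" "nreg ?s3 2 = 1"
          using j k8 b1 frameD[OF f2] by (simp_all add: base_def)
        moreover have "rarr ?s3 2 (x * n + v) = rarr s 2 (x * n + v) +
            rreg s 5 * (\<Sum>k<Suc k. \<Sum>m<2 ^ (l + 1). scontrib s k m x v)" if "x < n" "v < n" for x v
        proof -
          have "rarr s1 2 (x * n + v) = rarr s 2 (x * n + v) +
            rreg s 5 * (\<Sum>k<k. \<Sum>m<2 ^ (l + 1). scontrib s k m x v)"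
            using j(2) that by (simp add: I_def)
          then show ?thesis using o2 that unfolding same by (simp add: distrib_left)
        qed
        ultimately have "nreg ?s3 7 = k \<and> nreg ?s3 6 = t \<and> nreg ?s3 2 = 1 \<and> I (Suc k) (set_nreg 7 (Suc k) ?s3)"
          by (simp add: I_def)
        then show "ok (AddN 8 8 0) s2 1
          (\<lambda>s'. nreg s' 7 = k \<and> nreg s' 6 = t \<and> nreg s' 2 = 1 \<and> I (Suc k) (set_nreg 7 (Suc k) s'))"
          unfolding ok_def using r by blast
      qed
    qed (use s s0 in \<open>auto simp: I_def frame_def base_def\<close>)
  qed
  then show ?thesis by (rule ok_mono) (auto simp: I_def algebra_simps)
qed

section \<open>Correctness of the colour coding\<close>

text \<open>Symmetry of the matrices enters because \<open>f_S\<close> reads the entry above the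
  diagonal, whereas the program reads it in the direction of travel.\<close>

lemma f_S_Cons:
  assumes d: "distinct (pverts x ((b, y) # ps))" and sym: "X y x = X x y" "Y y x = Y x y"
  shows "f_S (pgraph x ((b, y) # ps)) X Y = (case b of Bullet \<Rightarrow> X x y | Circ \<Rightarrow> Y x y) * f_S (pgraph y ps) X Y"
proof -
  have dy: "distinct (pverts y ps)" and xy: "x \<noteq> y" using d by (auto simp: pverts_def)
  have nx: "x \<notin> e" if "(e, c) \<in> set (pedges y ps)" for e c
    using pedges_subset[OF that] d by auto
  have E: "edges_of c (pgraph x ((b, y) # ps)) =
      (if c = b then insert {x, y} (edges_of c (pgraph y ps)) else edges_of c (pgraph y ps))" for c
    by (auto simp: edges_of_pgraph[OF d] edges_of_pgraph[OF dy])
  have ni: "{x, y} \<notin> edges_of c (pgraph y ps)" for c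
    using nx by (auto simp: edges_of_pgraph[OF dy])
  have mm: "X (Min {x, y}) (Max {x, y}) = X x y" "Y (Min {x, y}) (Max {x, y}) = Y x y"
    using sym by (auto simp: min_def max_def)
  show ?thesis
    unfolding f_S_def E using ni finite_edges_of_pgraph[OF dy] mm
    by (cases b) (auto simp del: Min_insert Max_insert)
qed

fun zprod :: "(nat \<Rightarrow> nat \<Rightarrow> real) \<Rightarrow> (nat \<Rightarrow> nat \<Rightarrow> real) \<Rightarrow> nat \<Rightarrow> step list \<Rightarrow> real" where
  "zprod X Y x [] = 1"
| "zprod X Y x ((b, y) # ps) = (case b of Bullet \<Rightarrow> X x y | Circ \<Rightarrow> Y x y) * zprod X Y y ps"

lemma f_S_zprod:
  assumes "distinct (pverts u ps)" "set (pverts u ps) \<subseteq> {..<n}"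
    "\<forall>i<n. \<forall>j<n. X i j = X j i \<and> Y i j = Y j i"
  shows "f_S (pgraph u ps) X Y = zprod X Y u ps"
  using assms
proof (induction X Y u ps rule: zprod.induct)
  case (1 X Y x)
  then show ?case by (simp add: f_S_def edges_of_pgraph)
next
  case (2 X Y x b y ps)
  have "x < n" "y < n" using 2(3) set_pverts_start[of y ps] by (auto simp: pverts_def)
  then have "X y x = X x y" "Y y x = Y x y" using 2(4) by auto
  then show ?case using 2 f_S_Cons[OF 2(2)] by simp
qed

text \<open>Vertices may repeat. The letter \<open>a\<close> before the first step makes the
  condition on the last letter meaningful for the empty walk as well.\<close>

definition walks :: "nat \<Rightarrow> nat \<Rightarrow> nat \<Rightarrow> decoration \<Rightarrow> nat \<Rightarrow> step list set" where
  "walks n v j a x = {ps. length ps = j \<and> snd ` set ps \<subseteq> {..<n} \<and> last (pverts x ps) = v \<and>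
     last (a # map fst ps) = Bullet}"

lemma finite_walks [simp]: "finite (walks n v j a x)"
proof (rule finite_subset)
  show "walks n v j a x \<subseteq> {ps. set ps \<subseteq> UNIV \<times> {..<n} \<and> length ps = j}"
    unfolding walks_def by force
qed (intro finite_lists_length_eq finite_SigmaI, simp_all)

lemma sum_walks_Suc:
  "(\<Sum>ps\<in>walks n v (Suc j) a x. f ps) = (\<Sum>y<n. \<Sum>b\<in>UNIV. \<Sum>ps\<in>walks n v j b y. (f ((b, y) # ps) :: real))"
proof -
  have eq: "walks n v (Suc j) a x = (\<lambda>((y, b), ps). (b, y) # ps) ` (SIGMA (y, b):{..<n} \<times> UNIV. walks n v j b y)"
  proof (intro set_eqI iffI)
    fix ps assume p: "ps \<in> walks n v (Suc j) a x"
    then obtain b y qs where ps: "ps = (b, y) # qs" by (cases ps) (auto simp: walks_def)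
    have "y < n" "qs \<in> walks n v j b y" using p by (auto simp: ps walks_def pverts_def)
    then show "ps \<in> (\<lambda>((y, b), ps). (b, y) # ps) ` (SIGMA (y, b):{..<n} \<times> UNIV. walks n v j b y)"
      unfolding ps by (intro image_eqI[of _ _ "((y, b), qs)"]) auto
  qed (force simp: walks_def pverts_def)
  have "(\<Sum>ps\<in>walks n v (Suc j) a x. f ps) =
      (\<Sum>p\<in>(SIGMA (y, b):{..<n} \<times> UNIV. walks n v j b y). f ((\<lambda>((y, b), ps). (b, y) # ps) p))"
    unfolding eq by (subst sum.reindex) (auto simp: inj_on_def)
  also have "\<dots> = (\<Sum>q\<in>{..<n} \<times> UNIV. \<Sum>ps\<in>walks n v j (snd q) (fst q). f ((snd q, fst q) # ps))"
    by (subst sum.Sigma) (auto simp: split_def)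
  also have "\<dots> = (\<Sum>y<n. \<Sum>b\<in>UNIV. \<Sum>ps\<in>walks n v j b y. f ((b, y) # ps))"
    by (subst sum.cartesian_product) (simp add: split_def)
  finally show ?thesis .
qed

lemma ust_walks:
  assumes X: "\<forall>x<n. \<forall>y<n. Xa (x * n + y) = X x y"
    and Y: "\<forall>x<n. \<forall>y<n. Ya (x * n + y) = Y x y" and x: "x < n"
  shows "ust n lam mu rho Xa Ya A v j x a =
    (\<Sum>ps\<in>walks n v j a x. xiw lam mu rho a (map fst ps) * zprod X Y x ps * (\<Prod>(b, y)\<leftarrow>ps. A y))"
  using x
proof (induction j arbitrary: x a)
  case 0
  have "walks n v 0 a x = (if x = v \<and> a = Bullet then {[]} else {})" by (auto simp: walks_def)
  then show ?case by simp
next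
  case (Suc j)
  let ?g = "\<lambda>y b. \<Sum>ps\<in>walks n v j b y. xiw lam mu rho b (map fst ps) * zprod X Y y ps * (\<Prod>(b, y)\<leftarrow>ps. A y)"
  have "(\<Sum>ps\<in>walks n v (Suc j) a x. xiw lam mu rho a (map fst ps) * zprod X Y x ps * (\<Prod>(b, y)\<leftarrow>ps. A y)) =
    (\<Sum>y<n. \<Sum>b\<in>UNIV. (if a = b then 1 else rho) * dweight lam mu b *
       (case b of Bullet \<Rightarrow> X x y | Circ \<Rightarrow> Y x y) * A y * ?g y b)"
    unfolding sum_walks_Suc by (intro sum.cong refl) (simp add: sum_distrib_left mult_ac)
  also have "\<dots> = (\<Sum>y<n. \<Sum>b\<in>UNIV. (if a = b then 1 else rho) * dweight lam mu b *
       (case b of Bullet \<Rightarrow> X x y | Circ \<Rightarrow> Y x y) * A y * ust n lam mu rho Xa Ya A v j y b)"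
    by (intro sum.cong refl) (simp add: Suc.IH)
  also have "\<dots> = ust n lam mu rho Xa Ya A v (Suc j) x a"
    unfolding ust.simps
  proof (intro sum.cong refl)
    fix y assume "y \<in> {..<n}"
    then have XY: "Xa (x * n + y) = X x y" "Ya (x * n + y) = Y x y" using X Y Suc.prems by auto
    show "(\<Sum>b\<in>UNIV. (if a = b then 1 else rho) * dweight lam mu b *
        (case b of Bullet \<Rightarrow> X x y | Circ \<Rightarrow> Y x y) * A y * ust n lam mu rho Xa Ya A v j y b) =
      (if a = Bullet then 1 else rho) * (lam * Xa (x * n + y) * ust n lam mu rho Xa Ya A v j y Bullet * A y) +
      (if a = Circ then 1 else rho) * (mu * Ya (x * n + y) * ust n lam mu rho Xa Ya A v j y Circ * A y)"
      unfolding XY by (cases a) (simp_all add: UNIV_decoration dweight_def)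
  qed
  finally show ?case ..
qed

text \<open>Subtracting \<open>rho\<close> times the sum with virtual previous letter \<open>Circ\<close> cancels the walks that
  start with \<open>Circ\<close>.\<close>

lemma ust_first_letter:
  assumes X: "\<forall>x<n. \<forall>y<n. Xa (x * n + y) = X x y"
    and Y: "\<forall>x<n. \<forall>y<n. Ya (x * n + y) = Y x y" and x: "x < n" and l: "l \<ge> 1"
  shows "ust n lam mu rho Xa Ya A v l x Bullet - rho * ust n lam mu rho Xa Ya A v l x Circ =
    (1 - rho\<^sup>2) * (\<Sum>ps\<in>{ps \<in> walks n v l Bullet x. map fst ps \<in> words l}.
       xiw lam mu rho Bullet (map fst ps) * zprod X Y x ps * (\<Prod>(b, y)\<leftarrow>ps. A y))"
proof -
  let ?W = "walks n v l Bullet x"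
  let ?g = "\<lambda>ps. zprod X Y x ps * (\<Prod>(b, y)\<leftarrow>ps. A y)"
  have same: "walks n v l Circ x = ?W" using l by (auto simp: walks_def)
  have eq: "xiw lam mu rho Bullet (map fst ps) - rho * xiw lam mu rho Circ (map fst ps) =
      (if map fst ps \<in> words l then (1 - rho\<^sup>2) * xiw lam mu rho Bullet (map fst ps) else 0)"
    if ps: "ps \<in> ?W" for ps
  proof -
    obtain b y qs where e: "ps = (b, y) # qs" using ps l by (cases ps) (auto simp: walks_def)
    have "map fst ps \<in> words l \<longleftrightarrow> b = Bullet"
      using ps unfolding e by (auto simp: walks_def words_def)
    then show ?thesis by (cases b) (auto simp: e power2_eq_square algebra_simps)
  qed
  have "ust n lam mu rho Xa Ya A v l x Bullet - rho * ust n lam mu rho Xa Ya A v l x Circ =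
    (\<Sum>ps\<in>?W. (xiw lam mu rho Bullet (map fst ps) - rho * xiw lam mu rho Circ (map fst ps)) * ?g ps)"
    unfolding ust_walks[OF X Y x] same by (simp add: sum_distrib_left sum_subtractf[symmetric] algebra_simps)
  also have "\<dots> = (\<Sum>ps\<in>?W. if map fst ps \<in> words l then (1 - rho\<^sup>2) * (xiw lam mu rho Bullet (map fst ps) * ?g ps) else 0)"
    by (intro sum.cong refl) (simp add: eq)
  also have "\<dots> = (\<Sum>ps\<in>{ps \<in> ?W. map fst ps \<in> words l}. (1 - rho\<^sup>2) * (xiw lam mu rho Bullet (map fst ps) * ?g ps))"
    by (rule sum.inter_filter[symmetric]) simp
  finally show ?thesis by (simp add: sum_distrib_left mult.assoc)
qed

text \<open>Summing a product over all bit patterns independently in each bit gives a product of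
  sums; the induction splits off the top bit.\<close>

lemma sum_bits:
  fixes f :: "nat \<Rightarrow> bool \<Rightarrow> real"
  shows "(\<Sum>m<(2::nat) ^ L. \<Prod>d<L. f d (odd (m div 2 ^ d))) = (\<Prod>d<L. f d True + f d False)"
proof (induction L)
  case (Suc L)
  let ?g = "\<lambda>m :: nat. \<Prod>d<Suc L. f d (odd (m div 2 ^ d))"
  have split: "{..<2 ^ Suc L :: nat} = {..<2 ^ L} \<union> (\<lambda>m. m + 2 ^ L) ` {..<2 ^ L}"
  proof (intro set_eqI iffI)
    fix m :: nat assume m: "m \<in> {..<2 ^ Suc L}"
    show "m \<in> {..<2 ^ L} \<union> (\<lambda>m. m + 2 ^ L) ` {..<2 ^ L}"
    proof (cases "m < 2 ^ L")
      case False
      then have "m = (m - 2 ^ L) + 2 ^ L" "m - 2 ^ L < 2 ^ L" using m by auto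
      then show ?thesis by blast
    qed simp
  qed auto
  have low: "?g m = (\<Prod>d<L. f d (odd (m div 2 ^ d))) * f L False" if "m < 2 ^ L" for m :: nat
    using that by simp
  have high: "?g (m + 2 ^ L) = (\<Prod>d<L. f d (odd (m div 2 ^ d))) * f L True" if m: "m < 2 ^ L" for m :: nat
  proof -
    have "odd ((m + 2 ^ L) div 2 ^ d) = odd (m div 2 ^ d)" if "d < L" for d
    proof -
      have "(2::nat) ^ L = 2 ^ (L - d) * 2 ^ d" using that by (simp add: power_add[symmetric])
      then have "(m + 2 ^ L) div 2 ^ d = m div 2 ^ d + 2 ^ (L - d)" by simp
      then show ?thesis using that by simp
    qed
    moreover have "(m + 2 ^ L) div 2 ^ L = 1" using m by simp
    ultimately show ?thesis by simp
  qed
  have "(\<Sum>m<(2::nat) ^ Suc L. ?g m) = (\<Sum>m<2 ^ L. ?g m) + (\<Sum>m\<in>(\<lambda>m. m + 2 ^ L) ` {..<2 ^ L}. ?g m)"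
    unfolding split by (rule sum.union_disjoint) auto
  also have "(\<Sum>m\<in>(\<lambda>m. m + 2 ^ L) ` {..<2 ^ L}. ?g m) = (\<Sum>m<2 ^ L. ?g (m + 2 ^ L))"
    by (subst sum.reindex) (auto simp: inj_on_def)
  also have "(\<Sum>m<2 ^ L. ?g m) + (\<Sum>m<2 ^ L. ?g (m + 2 ^ L)) =
      (\<Sum>m<(2::nat) ^ L. \<Prod>d<L. f d (odd (m div 2 ^ d))) * f L False + (\<Sum>m<(2::nat) ^ L. \<Prod>d<L. f d (odd (m div 2 ^ d))) * f L True"
    unfolding sum_distrib_right
    by (intro arg_cong2[where f = "(+)"] sum.cong refl) (simp_all only: low high lessThan_iff)
  also have "\<dots> = (\<Prod>d<Suc L. f d True + f d False)"
    unfolding Suc.IH by (simp add: algebra_simps)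
  finally show ?case .
qed simp

text \<open>Inclusion-exclusion over colour subsets: only the walks meeting all \<open>l + 1\<close> colours survive.\<close>

lemma sum_bits_colors:
  assumes c: "\<And>y. y \<in> set ys \<Longrightarrow> c y < L"
  shows "(\<Sum>m<(2::nat) ^ L. (\<Prod>y\<leftarrow>ys. bitr m (c y)) * (\<Prod>d<L. signr m d)) = of_bool ({..<L} \<subseteq> c ` set ys)"
proof -
  \<comment> \<open>A colour that occurs contributes \<open>1 + 0\<close> to the product of sums, a
    colour that does not occur \<open>1 - 1\<close>.\<close>
  define f where "f d b = (if d \<in> c ` set ys then of_bool b else 1) * (if b then 1 else -1 :: real)" for d b
  have "(\<Prod>y\<leftarrow>ys. bitr m (c y)) = (\<Prod>d<L. if d \<in> c ` set ys then of_bool (odd (m div 2 ^ d)) else 1)" for m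
    using c
  proof (induction ys)
    case (Cons y ys)
    have "(\<Prod>d<L. if d \<in> c ` set (y # ys) then of_bool (odd (m div 2 ^ d)) else 1) =
        (\<Prod>d<L. (if d = c y then of_bool (odd (m div 2 ^ d)) else 1) *
           (if d \<in> c ` set ys then of_bool (odd (m div 2 ^ d)) else 1 :: real))"
      by (intro prod.cong refl) auto
    also have "\<dots> = bitr m (c y) * (\<Prod>y\<leftarrow>ys. bitr m (c y))"
      using Cons by (simp add: prod.distrib prod.delta bitr_def)
    finally show ?case by simp
  qed simp
  then have "(\<Sum>m<(2::nat) ^ L. (\<Prod>y\<leftarrow>ys. bitr m (c y)) * (\<Prod>d<L. signr m d)) =
      (\<Sum>m<(2::nat) ^ L. \<Prod>d<L. f d (odd (m div 2 ^ d)))"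
    by (simp add: f_def signr_def prod.distrib[symmetric])
  also have "\<dots> = (\<Prod>d<L. of_bool (d \<in> c ` set ys))"
    unfolding sum_bits by (intro prod.cong refl) (simp add: f_def)
  also have "\<dots> = of_bool ({..<L} \<subseteq> c ` set ys)"
  proof (cases "{..<L} \<subseteq> c ` set ys")
    case False
    then show ?thesis by (auto intro!: prod_zero)
  qed (auto intro!: prod.neutral)
  finally show ?thesis .
qed

text \<open>With as many colours as positions, a surjective colouring has to be injective on
  positions. So a walk meeting every colour is a path, and self-avoidance need not be
  tracked.\<close>

lemma colorful_iff:
  assumes len: "length ys = L" and c: "\<And>y. y \<in> set ys \<Longrightarrow> c y < L"
  shows "{..<L} \<subseteq> c ` set ys \<longleftrightarrow> distinct ys \<and> inj_on c (set ys)"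
proof
  assume s: "{..<L} \<subseteq> c ` set ys"
  have "L \<le> card (c ` set ys)" using card_mono[OF _ s] by simp
  moreover have "card (c ` set ys) \<le> card (set ys)" by (rule card_image_le) simp
  moreover have "card (set ys) \<le> L" using card_length[of ys] len by simp
  ultimately have "card (set ys) = length ys" "card (c ` set ys) = card (set ys)" using len by auto
  then show "distinct ys \<and> inj_on c (set ys)" by (simp add: card_distinct eq_card_imp_inj_on)
next
  assume "distinct ys \<and> inj_on c (set ys)"
  then have "card (c ` set ys) = L" using len by (simp add: card_image distinct_card)
  moreover have "c ` set ys \<subseteq> {..<L}" using c by auto
  ultimately have "c ` set ys = {..<L}" by (intro card_subset_eq) auto
  then show "{..<L} \<subseteq> c ` set ys" by simp
qed

text \<open>Summation over the colour subsets kills all walks that miss a colour; the surviving ones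
  are the paths on which \<open>c\<close> is injective. The factor \<open>1 - rho^2\<close> stems
  from the removal of the walks starting with \<open>Circ\<close>.\<close>

lemma contrib_sum:
  assumes X: "\<forall>x<n. \<forall>y<n. Xa (x * n + y) = X x y"
    and Y: "\<forall>x<n. \<forall>y<n. Ya (x * n + y) = Y x y"
    and sym: "\<forall>i<n. \<forall>j<n. X i j = X j i \<and> Y i j = Y j i"
    and col: "\<And>y. y < n \<Longrightarrow> col (k * n + y) = c y" "\<And>y. y < n \<Longrightarrow> c y \<le> l"
    and x: "x < n" and l: "l \<ge> 1"
  shows "(\<Sum>m<2 ^ (l + 1). contrib n l lam mu rho Xa Ya col k m x v) =
    (1 - rho\<^sup>2) * (\<Sum>ps\<in>path_steps n l x v. xiw lam mu rho Bullet (map fst ps) *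
       (chi c (set (pverts x ps)) * f_S (pgraph x ps) X Y))"
proof -
  let ?W = "{ps \<in> walks n v l Bullet x. map fst ps \<in> words l}"
  let ?h = "\<lambda>ps. xiw lam mu rho Bullet (map fst ps) * zprod X Y x ps"
  have vs: "set (pverts x ps) \<subseteq> {..<n}" "length (pverts x ps) = l + 1" if "ps \<in> ?W" for ps
    using that x by (auto simp: walks_def pverts_def)
  have one: "contrib n l lam mu rho Xa Ya col k m x v =
     (1 - rho\<^sup>2) * (\<Sum>ps\<in>?W. ?h ps * ((\<Prod>y\<leftarrow>pverts x ps. bitr m (c y)) * (\<Prod>d<l + 1. signr m d)))" for m
  proof -
    \<comment> \<open>The walk sum covers only the vertices reached by steps; the indicator at
      \<open>x\<close> completes the product over all \<open>l + 1\<close> vertices.\<close>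
    have p: "(\<Prod>(b, y)\<leftarrow>ps. bitr m (col (k * n + y))) * bitr m (col (k * n + x)) = (\<Prod>y\<leftarrow>pverts x ps. bitr m (c y))"
      if "ps \<in> ?W" for ps
    proof -
      have "set (map snd ps) \<subseteq> {..<n}" using that by (auto simp: walks_def)
      then have "(\<Prod>(b, y)\<leftarrow>ps. bitr m (col (k * n + y))) = (\<Prod>y\<leftarrow>map snd ps. bitr m (c y))"
        by (induction ps) (auto simp: col)
      then show ?thesis using col(1)[OF x] by (simp add: pverts_def mult.commute)
    qed
    have "contrib n l lam mu rho Xa Ya col k m x v =
      (1 - rho\<^sup>2) * (\<Sum>ps\<in>?W. ?h ps * (\<Prod>(b, y)\<leftarrow>ps. bitr m (col (k * n + y)))) *
        bitr m (col (k * n + x)) * (\<Prod>d<l + 1. signr m d)"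
      unfolding contrib_def ust_first_letter[OF X Y x l] ..
    also have "\<dots> = (1 - rho\<^sup>2) * (\<Sum>ps\<in>?W. ?h ps * (((\<Prod>(b, y)\<leftarrow>ps. bitr m (col (k * n + y))) *
        bitr m (col (k * n + x))) * (\<Prod>d<l + 1. signr m d)))"
      by (simp only: sum_distrib_right mult.assoc)
    also have "\<dots> = (1 - rho\<^sup>2) * (\<Sum>ps\<in>?W. ?h ps * ((\<Prod>y\<leftarrow>pverts x ps. bitr m (c y)) * (\<Prod>d<l + 1. signr m d)))"
      by (intro arg_cong[of _ _ "\<lambda>z. (1 - rho\<^sup>2) * z"] sum.cong refl) (simp only: p)
    finally show ?thesis .
  qed
  have "(\<Sum>m<2 ^ (l + 1). contrib n l lam mu rho Xa Ya col k m x v) =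
     (1 - rho\<^sup>2) * (\<Sum>ps\<in>?W. ?h ps * (\<Sum>m<2 ^ (l + 1). (\<Prod>y\<leftarrow>pverts x ps. bitr m (c y)) * (\<Prod>d<l + 1. signr m d)))"
    unfolding one sum_distrib_left[symmetric] by (subst sum.swap) (simp only: sum_distrib_left)
  also have "\<dots> = (1 - rho\<^sup>2) * (\<Sum>ps\<in>?W. if distinct (pverts x ps) then ?h ps * chi c (set (pverts x ps)) else 0)"
  proof (intro arg_cong[of _ _ "\<lambda>z. (1 - rho\<^sup>2) * z"] sum.cong refl)
    fix ps assume ps: "ps \<in> ?W"
    have cl: "c y < l + 1" if "y \<in> set (pverts x ps)" for y
      using col(2)[of y] vs(1)[OF ps] that by auto
    have "{..<l + 1} \<subseteq> c ` set (pverts x ps) \<longleftrightarrow> distinct (pverts x ps) \<and> inj_on c (set (pverts x ps))"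
      by (rule colorful_iff[OF vs(2)[OF ps]]) (rule cl)
    then have e: "(\<Sum>m<2 ^ (l + 1). (\<Prod>y\<leftarrow>pverts x ps. bitr m (c y)) * (\<Prod>d<l + 1. signr m d)) =
      of_bool (distinct (pverts x ps) \<and> inj_on c (set (pverts x ps)))"
      using sum_bits_colors[of "pverts x ps" c "l + 1"] cl by simp
    show "?h ps * (\<Sum>m<2 ^ (l + 1). (\<Prod>y\<leftarrow>pverts x ps. bitr m (c y)) * (\<Prod>d<l + 1. signr m d)) =
      (if distinct (pverts x ps) then ?h ps * chi c (set (pverts x ps)) else 0)"
      unfolding e by (simp add: chi_def)
  qed
  also have "\<dots> = (1 - rho\<^sup>2) * (\<Sum>ps\<in>{ps \<in> ?W. distinct (pverts x ps)}. ?h ps * chi c (set (pverts x ps)))"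
    by (subst sum.inter_filter) simp_all
  also have "{ps \<in> ?W. distinct (pverts x ps)} = path_steps n l x v"
    using x l by (auto simp: walks_def path_steps_def pverts_def words_def)
  also have "(\<Sum>ps\<in>path_steps n l x v. ?h ps * chi c (set (pverts x ps))) =
     (\<Sum>ps\<in>path_steps n l x v. xiw lam mu rho Bullet (map fst ps) * (chi c (set (pverts x ps)) * f_S (pgraph x ps) X Y))"
    by (intro sum.cong refl) (simp add: path_steps_def f_S_zprod[OF _ _ sym])
  finally show ?thesis .
qed

text \<open>The spurious factor \<open>1 - rho^2\<close> is divided out, which is possible since
  \<open>rho^2\<close> is not 1.\<close>

lemma Phi_contrib:
  assumes X: "\<forall>x<n. \<forall>y<n. Xa (x * n + y) = X x y"
    and Y: "\<forall>x<n. \<forall>y<n. Ya (x * n + y) = Y x y"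
    and sym: "\<forall>i<n. \<forall>j<n. X i j = X j i \<and> Y i j = Y j i"
    and col: "\<And>k y. k < num_colorings l \<Longrightarrow> y < n \<Longrightarrow> col (k * n + y) = xi k y"
      "\<And>k y. k < num_colorings l \<Longrightarrow> y < n \<Longrightarrow> xi k y \<le> l"
    and x: "x < n" and l: "l \<ge> 1" and rho: "rho\<^sup>2 \<noteq> 1"
  shows "2 / (real n powr (real l / 2 - 1) * beta_words lam mu rho l) * (1 / (real (num_colorings l) * kappa l)) / (1 - rho\<^sup>2) *
      (\<Sum>k<num_colorings l. \<Sum>m<2 ^ (l + 1). contrib n l lam mu rho Xa Ya col k m x v) =
    Phi n l lam mu rho X Y xi x v"
proof -
  let ?q = "1 / (real (num_colorings l) * kappa l)"
  have "(\<Sum>k<num_colorings l. \<Sum>m<2 ^ (l + 1). contrib n l lam mu rho Xa Ya col k m x v) =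
    (\<Sum>k<num_colorings l. (1 - rho\<^sup>2) * (\<Sum>ps\<in>path_steps n l x v. xiw lam mu rho Bullet (map fst ps) *
       (chi (xi k) (set (pverts x ps)) * f_S (pgraph x ps) X Y)))"
    by (intro sum.cong refl contrib_sum[OF X Y sym _ _ x l]) (auto simp: col)
  also have "\<dots> = (1 - rho\<^sup>2) * (\<Sum>ps\<in>path_steps n l x v. xiw lam mu rho Bullet (map fst ps) *
       (\<Sum>k<num_colorings l. chi (xi k) (set (pverts x ps)) * f_S (pgraph x ps) X Y))"
    unfolding sum_distrib_left[symmetric] by (subst sum.swap) (simp only: sum_distrib_left)
  finally have main: "(\<Sum>k<num_colorings l. \<Sum>m<2 ^ (l + 1). contrib n l lam mu rho Xa Ya col k m x v) = \<dots>" .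
  have alg: "a * q / r * (r * S) = a * (q * S)" if "r \<noteq> 0" for a q r S :: real using that by simp
  have q: "(\<Sum>ps\<in>P. w ps * (?q * g ps)) = ?q * (\<Sum>ps\<in>P. w ps * g ps)" for P and w g :: "step list \<Rightarrow> real"
    by (simp add: sum_distrib_left mult.left_commute)
  show ?thesis
    unfolding main Phi_eq[OF l] q by (rule alg) (use rho in simp)
qed

section \<open>The normalising constant as a recursion\<close>

text \<open>The sum of squared weights over words of length \<open>r\<close> ending in
  \<open>Bullet\<close>, as a recursion in \<open>r\<close>; like \<open>ust\<close>, it fixes the
  last letter only.\<close>

fun bst :: "real \<Rightarrow> real \<Rightarrow> real \<Rightarrow> nat \<Rightarrow> decoration \<Rightarrow> real" where
  "bst lam mu rho 0 a = (if a = Bullet then 1 else 0)"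
| "bst lam mu rho (Suc r) a = (if a = Bullet then 1 else rho\<^sup>2) * lam\<^sup>2 * bst lam mu rho r Bullet +
     (if a = Circ then 1 else rho\<^sup>2) * mu\<^sup>2 * bst lam mu rho r Circ"

lemma finite_words_from [simp]: "finite {w. length w = r \<and> last (a # w) = (Bullet :: decoration)}"
  by (rule finite_subset[OF _ finite_lists_length_eq[of UNIV r]]) auto

lemma sum_words_from_Suc:
  "(\<Sum>w | length w = Suc r \<and> last (a # w) = Bullet. (xiw lam mu rho a w)\<^sup>2) =
    (\<Sum>b\<in>UNIV. (if a = b then 1 else rho\<^sup>2) * (dweight lam mu b)\<^sup>2 *
       (\<Sum>w | length w = r \<and> last (b # w) = Bullet. (xiw lam mu rho b w)\<^sup>2))"
proof -
  let ?S = "\<lambda>b. {w. length w = r \<and> last (b # w) = Bullet}"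
  have eq: "{w. length w = Suc r \<and> last (a # w) = Bullet} = (\<lambda>(b, w). b # w) ` (SIGMA b:UNIV. ?S b)"
    by (auto simp: image_iff length_Suc_conv)
  have "(\<Sum>w | length w = Suc r \<and> last (a # w) = Bullet. (xiw lam mu rho a w)\<^sup>2) =
      (\<Sum>(b, w)\<in>(SIGMA b:UNIV. ?S b). (xiw lam mu rho a (b # w))\<^sup>2)"
    unfolding eq by (subst sum.reindex) (auto simp: inj_on_def split_def)
  also have "\<dots> = (\<Sum>b\<in>UNIV. \<Sum>w\<in>?S b. (xiw lam mu rho a (b # w))\<^sup>2)"
    by (subst sum.Sigma) (simp_all del: last.simps add: split_def)
  also have "\<dots> = (\<Sum>b\<in>UNIV. (if a = b then 1 else rho\<^sup>2) * (dweight lam mu b)\<^sup>2 * (\<Sum>w\<in>?S b. (xiw lam mu rho b w)\<^sup>2))"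
    by (intro sum.cong refl) (auto simp: sum_distrib_left power_mult_distrib)
  finally show ?thesis .
qed

lemma bst_eq: "bst lam mu rho r a = (\<Sum>w | length w = r \<and> last (a # w) = Bullet. (xiw lam mu rho a w)\<^sup>2)"
proof (induction r arbitrary: a)
  case 0
  have "{w. length w = 0 \<and> last (a # w) = Bullet} = (if a = Bullet then {[]} else {})" by auto
  then show ?case by simp
next
  case (Suc r)
  show ?case
    unfolding sum_words_from_Suc Suc.IH[symmetric] by (cases a) (simp_all add: UNIV_decoration dweight_def)
qed

text \<open>The same cancellation as for walks, with squared weights: subtracting
  \<open>rho^2\<close> times the value for \<open>Circ\<close> removes the words that start with
  \<open>Circ\<close> and leaves the factor \<open>1 - rho^4\<close> on the others.\<close>

lemma bst_beta_words:
  assumes l: "l \<ge> 1"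
  shows "bst lam mu rho l Bullet - rho\<^sup>2 * bst lam mu rho l Circ = (1 - rho\<^sup>2 * rho\<^sup>2) * beta_words lam mu rho l"
proof -
  let ?W = "{w. length w = l \<and> last (Bullet # w) = Bullet}"
  have same: "{w. length w = l \<and> last (Circ # w) = Bullet} = ?W" using l by auto
  have eq: "(xiw lam mu rho Bullet w)\<^sup>2 - rho\<^sup>2 * (xiw lam mu rho Circ w)\<^sup>2 =
      (if w \<in> words l then (1 - rho\<^sup>2 * rho\<^sup>2) * (xiw lam mu rho Bullet w)\<^sup>2 else 0)" if w: "w \<in> ?W" for w
  proof -
    obtain b v where e: "w = b # v" using w l by (cases w) auto
    have "w \<in> words l \<longleftrightarrow> b = Bullet" using w unfolding e by (auto simp: words_def)
    then show ?thesis by (cases b) (auto simp: e power_mult_distrib algebra_simps)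
  qed
  have "bst lam mu rho l Bullet - rho\<^sup>2 * bst lam mu rho l Circ =
      (\<Sum>w\<in>?W. (xiw lam mu rho Bullet w)\<^sup>2 - rho\<^sup>2 * (xiw lam mu rho Circ w)\<^sup>2)"
    unfolding bst_eq same sum_subtractf sum_distrib_left ..
  also have "\<dots> = (\<Sum>w\<in>?W. if w \<in> words l then (1 - rho\<^sup>2 * rho\<^sup>2) * (xiw lam mu rho Bullet w)\<^sup>2 else 0)"
    by (intro sum.cong refl eq)
  also have "\<dots> = (\<Sum>w\<in>{w \<in> ?W. w \<in> words l}. (1 - rho\<^sup>2 * rho\<^sup>2) * (xiw lam mu rho Bullet w)\<^sup>2)"
    by (rule sum.inter_filter[symmetric]) (rule finite_words_from)
  also have "{w \<in> ?W. w \<in> words l} = words l" using l by (auto simp: words_def)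
  finally show ?thesis by (simp add: beta_words_def sum_distrib_left)
qed

lemma ok_While_step:
  assumes "nreg s i < nreg s j" "ok P s T Q" "\<And>s1. Q s1 \<Longrightarrow> ok (WhileLessN i j P) s1 T2 W"
  shows "ok (WhileLessN i j P) s (1 + T + T2) W"
proof -
  obtain t1 s1 where 1: "runs P s t1 s1" "t1 \<le> T" "Q s1" using assms(2) by (auto simp: ok_def)
  obtain t2 s2 where 2: "runs (WhileLessN i j P) s1 t2 s2" "t2 \<le> T2" "W s2"
    using assms(3)[OF 1(3)] by (auto simp: ok_def)
  have "runs (WhileLessN i j P) s (Suc (t1 + t2)) s2" by (rule runs.intros(19)[OF assms(1) 1(1) 2(1)])
  then show ?thesis unfolding ok_def using 1 2 by (intro exI conjI) auto
qed

lemma ok_While_done: "\<not> nreg s i < nreg s j \<Longrightarrow> W s \<Longrightarrow> ok (WhileLessN i j P) s 1 W"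
  unfolding ok_def using runs.intros(20) by blast

section \<open>Computing the constants\<close>

definition "setup_const = seqs [ConstN 2 1, AddN 4 1 2, OfNat 4 2, ConstN 5 1]"

lemma setup_const_ok:
  "ok setup_const s 4 (\<lambda>s'. frame {2, 4, 5} {4} {} {} s s' \<and> nreg s' 2 = 1 \<and> nreg s' 4 = nreg s 1 + 1 \<and>
     nreg s' 5 = 1 \<and> rreg s' 4 = 1)"
  unfolding setup_const_def by (rule ok_seqs) (simp_all add: frame_def)

definition "setup_pow = For 11 4 (seqs [StoreN 1 11 5, AddN 5 5 5])"

lemma setup_pow_ok:
  assumes s: "nreg s 2 = 1" "nreg s 4 = L" "nreg s 5 = 1"
  shows "ok setup_pow s (2 + L * 4) (\<lambda>s'. frame {5, 11} {} {1} {} s s' \<and> nreg s' 5 = 2 ^ L \<and> (\<forall>d<L. narr s' 1 d = 2 ^ d))"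
proof -
  define I where "I j s' \<longleftrightarrow> frame {5, 11} {} {1} {} s s' \<and> nreg s' 5 = 2 ^ j \<and> (\<forall>d<j. narr s' 1 d = 2 ^ d)" for j s'
  have "ok setup_pow s (2 + L * (2 + 2)) (\<lambda>s'. I L s' \<and> nreg s' 4 = L \<and> nreg s' 2 = 1)"
    unfolding setup_pow_def
  proof (rule ok_For)
    fix j s1 assume j: "j < L" "I j s1" "nreg s1 11 = j" "nreg s1 4 = L" "nreg s1 2 = 1"
    then have f: "frame {5, 11} {} {1} {} s s1" by (simp add: I_def)
    show "ok (seqs [StoreN 1 11 5, AddN 5 5 5]) s1 2
        (\<lambda>s'. nreg s' 11 = j \<and> nreg s' 4 = L \<and> nreg s' 2 = 1 \<and> I (Suc j) (set_nreg 11 (Suc j) s'))"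
      by (rule ok_seqs) (use j s frameD[OF f] in \<open>auto simp: I_def frame_def less_Suc_eq\<close>)
  qed (use s in \<open>auto simp: I_def\<close>)
  then show ?thesis by (rule ok_mono) (auto simp: I_def)
qed

text \<open>The quotient of factorial and power is accumulated as the product of
  \<open>(c + 1) / (l + 1)\<close>.\<close>

definition "setup_kappa = Seq (seqs [AddR 13 4 3, OfNat 7 4])
  (For 11 4 (seqs [AddN 13 11 2, OfNat 8 13, DivR 8 8 7, MulR 13 13 8]))"

lemma setup_kappa_ok:
  assumes s: "nreg s 2 = 1" "nreg s 4 = l + 1" "rreg s 3 = 0" "rreg s 4 = 1"
  shows "ok setup_kappa s (4 + (l + 1) * 6) (\<lambda>s'. frame {11, 13} {7, 8, 13} {} {} s s' \<and> rreg s' 13 = kappa l)"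
proof -
  define I where "I j s' \<longleftrightarrow> frame {11, 13} {7, 8, 13} {} {} s s' \<and> rreg s' 7 = real (l + 1) \<and>
    rreg s' 13 = (\<Prod>c<j. real (c + 1) / real (l + 1))" for j s'
  have "ok setup_kappa s (2 + (2 + (l + 1) * (4 + 2))) (\<lambda>s'. I (l + 1) s' \<and> nreg s' 4 = l + 1 \<and> nreg s' 2 = 1)"
    unfolding setup_kappa_def
  proof (rule ok_Seq)
    show "ok (seqs [AddR 13 4 3, OfNat 7 4]) s 2 (\<lambda>s'. s' = set_rreg 7 (real (l + 1)) (set_rreg 13 1 s))"
      by (rule ok_seqs) (use s in simp_all)
    fix s0 assume s0: "s0 = set_rreg 7 (real (l + 1)) (set_rreg 13 1 s)"
    show "ok (For 11 4 (seqs [AddN 13 11 2, OfNat 8 13, DivR 8 8 7, MulR 13 13 8])) s0 (2 + (l + 1) * (4 + 2))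
        (\<lambda>s'. I (l + 1) s' \<and> nreg s' 4 = l + 1 \<and> nreg s' 2 = 1)"
    proof (rule ok_For)
      fix j s1 assume j: "j < l + 1" "I j s1" "nreg s1 11 = j" "nreg s1 4 = l + 1" "nreg s1 2 = 1"
      then have f: "frame {11, 13} {7, 8, 13} {} {} s s1" by (simp add: I_def)
      show "ok (seqs [AddN 13 11 2, OfNat 8 13, DivR 8 8 7, MulR 13 13 8]) s1 4
          (\<lambda>s'. nreg s' 11 = j \<and> nreg s' 4 = l + 1 \<and> nreg s' 2 = 1 \<and> I (Suc j) (set_nreg 11 (Suc j) s'))"
        by (rule ok_seqs) (use j s frameD[OF f] in \<open>auto simp: I_def frame_def\<close>)
    qed (use s s0 in \<open>auto simp: I_def frame_def\<close>)
  qed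
  moreover have "(\<Prod>c<l + 1. real (c + 1) / real (l + 1)) = kappa l"
    unfolding kappa_def prod_dividef by (simp add: fact_prod_Suc atLeast0LessThan del: fact_Suc prod.lessThan_Suc)
  ultimately show ?thesis by (elim ok_mono) (auto simp: I_def)
qed

text \<open>Reals cannot be rounded, so the ceiling is found by counting up until the counter is no
  longer below \<open>1 / kappa\<close>. Register 20 is the flag that ends the loop. The cost is
  linear in the number of colourings, no more than the main loop.\<close>

definition "setup_count = Seq (seqs [DivR 14 4 13, ConstN 6 0, ConstN 20 0])
  (WhileLessN 20 2 (Seq (OfNat 7 6) (IfLessR 7 14 (AddN 6 6 2) (ConstN 20 1))))"

lemma setup_count_ok:
  assumes s: "nreg s 2 = 1" "rreg s 4 = 1" and t: "t = nat \<lceil>1 / rreg s 13\<rceil>"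
  shows "ok setup_count s (8 + 4 * t) (\<lambda>s'. frame {6, 20} {7, 14} {} {} s s' \<and> nreg s' 6 = t)"
proof -
  define q where "q = 1 / rreg s 13"
  have lt: "real j < q \<longleftrightarrow> j < t" for j
    unfolding t q_def[symmetric] by (simp add: zless_nat_eq_int_zless less_ceiling_iff)
  let ?F = "frame {6, 20} {7, 14} {} {}"
  let ?P = "Seq (OfNat 7 6) (IfLessR 7 14 (AddN 6 6 2) (ConstN 20 1))"
  have loop: "ok (WhileLessN 20 2 ?P) s1 (5 + 4 * (t - j)) (\<lambda>s'. ?F s s' \<and> nreg s' 6 = t)"
    if "?F s s1" "nreg s1 6 = j" "j \<le> t" "nreg s1 20 = 0" "rreg s1 14 = q" for s1 j
    using that
  proof (induction "t - j" arbitrary: j s1)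
    case 0
    then have jt: "j = t" by simp
    note f = frameD[OF 0(2)]
    have "ok (WhileLessN 20 2 ?P) s1 (1 + (1 + Suc 1) + 1) (\<lambda>s'. ?F s s' \<and> nreg s' 6 = t)"
    proof (rule ok_While_step)
      show "ok ?P s1 (1 + Suc 1) (\<lambda>s'. ?F s s' \<and> nreg s' 6 = t \<and> nreg s' 20 = 1)"
      proof (rule ok_Seq)
        show "ok (OfNat 7 6) s1 1 (\<lambda>s'. s' = set_rreg 7 (real t) s1)"
          unfolding ok_def using runs.intros(6)[of 7 6 s1] 0 jt by auto
        show "ok (IfLessR 7 14 (AddN 6 6 2) (ConstN 20 1)) s' (Suc 1) (\<lambda>s'. ?F s s' \<and> nreg s' 6 = t \<and> nreg s' 20 = 1)"
          if s': "s' = set_rreg 7 (real t) s1" for s'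
        proof (rule ok_IfLessR)
          show "ok (ConstN 20 1) s' 1 (\<lambda>s'. ?F s s' \<and> nreg s' 6 = t \<and> nreg s' 20 = 1)"
            using ok_seqs[of "[ConstN 20 1]" "\<lambda>s'. ?F s s' \<and> nreg s' 6 = t \<and> nreg s' 20 = 1" s' 1] 0 jt s'
            by (simp add: frame_def)
          assume "rreg s' 7 < rreg s' 14"
          then show "ok (AddN 6 6 2) s' 1 (\<lambda>s'. ?F s s' \<and> nreg s' 6 = t \<and> nreg s' 20 = 1)"
            using lt[of t] 0 s' by simp
        qed
      qed
      show "nreg s1 20 < nreg s1 2" using 0 f s by simp
      fix s2 assume "?F s s2 \<and> nreg s2 6 = t \<and> nreg s2 20 = 1"
      then show "ok (WhileLessN 20 2 ?P) s2 1 (\<lambda>s'. ?F s s' \<and> nreg s' 6 = t)"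
        using s by (intro ok_While_done) (auto simp: frame_def)
    qed
    then show ?case using jt by (elim ok_mono) auto
  next
    case (Suc d)
    then have jt: "j < t" by simp
    note f = frameD[OF Suc(3)]
    let ?Q = "\<lambda>s'. ?F s s' \<and> nreg s' 6 = Suc j \<and> nreg s' 20 = 0 \<and> rreg s' 14 = q"
    have "ok (WhileLessN 20 2 ?P) s1 (1 + (1 + Suc 1) + (5 + 4 * (t - Suc j))) (\<lambda>s'. ?F s s' \<and> nreg s' 6 = t)"
    proof (rule ok_While_step)
      show "ok ?P s1 (1 + Suc 1) ?Q"
      proof (rule ok_Seq)
        show "ok (OfNat 7 6) s1 1 (\<lambda>s'. s' = set_rreg 7 (real j) s1)"
          unfolding ok_def using runs.intros(6)[of 7 6 s1] Suc(4) by auto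
        show "ok (IfLessR 7 14 (AddN 6 6 2) (ConstN 20 1)) s' (Suc 1) ?Q"
          if s': "s' = set_rreg 7 (real j) s1" for s'
        proof (rule ok_IfLessR)
          show "ok (AddN 6 6 2) s' 1 ?Q"
            using ok_seqs[of "[AddN 6 6 2]" ?Q s' 1] Suc(3-7) s s' f by (simp add: frame_def)
          assume "\<not> rreg s' 7 < rreg s' 14"
          then show "ok (ConstN 20 1) s' 1 ?Q"
            using lt[of j] Suc(7) s' jt by simp
        qed
      qed
      show "nreg s1 20 < nreg s1 2" using Suc f s by simp
      show "ok (WhileLessN 20 2 ?P) s2 (5 + 4 * (t - Suc j)) (\<lambda>s'. ?F s s' \<and> nreg s' 6 = t)" if s2: "?Q s2" for s2
        by (rule Suc(1)) (use Suc(2) s2 jt in auto)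
    qed
    moreover have "t - j = Suc (t - Suc j)" using jt by simp
    ultimately show ?case by (elim ok_mono) auto
  qed
  have "ok setup_count s (3 + (5 + 4 * (t - 0))) (\<lambda>s'. ?F s s' \<and> nreg s' 6 = t)"
    unfolding setup_count_def
  proof (rule ok_Seq)
    show "ok (seqs [DivR 14 4 13, ConstN 6 0, ConstN 20 0]) s 3
        (\<lambda>s'. ?F s s' \<and> nreg s' 6 = 0 \<and> nreg s' 20 = 0 \<and> rreg s' 14 = q)"
      by (rule ok_seqs) (use s in \<open>simp_all add: frame_def q_def\<close>)
  qed (intro loop, auto)
  then show ?thesis by simp
qed

text \<open>The real power \<open>n powr (l / 2 - 1)\<close> is obtained as
  \<open>sqrt n ^ l / n\<close>.\<close>

definition "setup_sqrt = Seq (seqs [AddR 15 4 3, OfNat 16 0, SqrtR 16 16])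
  (Seq (For 11 1 (MulR 15 15 16)) (seqs [OfNat 16 0, DivR 15 15 16]))"

lemma setup_sqrt_ok:
  assumes s: "nreg s 0 = n" "nreg s 1 = l" "nreg s 2 = 1" "rreg s 3 = 0" "rreg s 4 = 1"
  shows "ok setup_sqrt s (7 + l * 3) (\<lambda>s'. frame {11} {15, 16} {} {} s s' \<and> rreg s' 15 = sqrt (real n) ^ l / real n)"
proof -
  let ?F = "frame {11} {15, 16} {} {}"
  define I where "I j s' \<longleftrightarrow> ?F s s' \<and> rreg s' 16 = sqrt (real n) \<and> rreg s' 15 = sqrt (real n) ^ j" for j s'
  have "ok setup_sqrt s (3 + ((2 + l * (1 + 2)) + 2)) (\<lambda>s'. ?F s s' \<and> rreg s' 15 = sqrt (real n) ^ l / real n)"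
    unfolding setup_sqrt_def
  proof (rule ok_Seq)
    show "ok (seqs [AddR 15 4 3, OfNat 16 0, SqrtR 16 16]) s 3 (\<lambda>s'. I 0 (set_nreg 11 0 s') \<and> nreg s' 1 = l \<and> nreg s' 2 = 1)"
      by (rule ok_seqs) (use s in \<open>simp_all add: I_def frame_def\<close>)
    fix s0 assume s0: "I 0 (set_nreg 11 0 s0) \<and> nreg s0 1 = l \<and> nreg s0 2 = 1"
    show "ok (Seq (For 11 1 (MulR 15 15 16)) (seqs [OfNat 16 0, DivR 15 15 16])) s0 ((2 + l * (1 + 2)) + 2)
        (\<lambda>s'. ?F s s' \<and> rreg s' 15 = sqrt (real n) ^ l / real n)"
    proof (rule ok_Seq)
      show "ok (For 11 1 (MulR 15 15 16)) s0 (2 + l * (1 + 2)) (\<lambda>s'. I l s' \<and> nreg s' 1 = l \<and> nreg s' 2 = 1)"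
      proof (rule ok_For)
        fix j s1 assume j: "j < l" "I j s1" "nreg s1 11 = j" "nreg s1 1 = l" "nreg s1 2 = 1"
        let ?Q = "\<lambda>s'. nreg s' 11 = j \<and> nreg s' 1 = l \<and> nreg s' 2 = 1 \<and> I (Suc j) (set_nreg 11 (Suc j) s')"
        show "ok (MulR 15 15 16) s1 1 ?Q"
          using ok_seqs[of "[MulR 15 15 16]" ?Q s1 1] j by (simp add: I_def frame_def)
      qed (use s0 in auto)
      fix s1 assume "I l s1 \<and> nreg s1 1 = l \<and> nreg s1 2 = 1"
      then show "ok (seqs [OfNat 16 0, DivR 15 15 16]) s1 2 (\<lambda>s'. ?F s s' \<and> rreg s' 15 = sqrt (real n) ^ l / real n)"
        by (intro ok_seqs) (use s in \<open>auto simp: I_def frame_def\<close>)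
    qed
  qed
  then show ?thesis by (simp add: mult.commute)
qed

definition "setup_beta = Seq (seqs [AddR 17 4 3, AddR 18 3 3])
  (For 11 1 (seqs [MulR 7 0 0, MulR 7 7 17, MulR 8 1 1, MulR 8 8 18, MulR 9 2 2, MulR 10 9 8, AddR 17 7 10,
     MulR 10 9 7, AddR 18 10 8]))"

lemma setup_beta_ok:
  assumes s: "nreg s 1 = l" "nreg s 2 = 1" "rreg s 3 = 0" "rreg s 4 = 1" "rreg s 0 = lam" "rreg s 1 = mu" "rreg s 2 = rho"
  shows "ok setup_beta s (4 + l * 11) (\<lambda>s'. frame {11} {7, 8, 9, 10, 17, 18} {} {} s s' \<and>
    rreg s' 17 = bst lam mu rho l Bullet \<and> rreg s' 18 = bst lam mu rho l Circ)"
proof -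
  let ?F = "frame {11} {7, 8, 9, 10, 17, 18} {} {}"
  define I where "I j s' \<longleftrightarrow> ?F s s' \<and> rreg s' 17 = bst lam mu rho j Bullet \<and> rreg s' 18 = bst lam mu rho j Circ" for j s'
  let ?b = "seqs [MulR 7 0 0, MulR 7 7 17, MulR 8 1 1, MulR 8 8 18, MulR 9 2 2, MulR 10 9 8, AddR 17 7 10,
     MulR 10 9 7, AddR 18 10 8]"
  have "ok setup_beta s (2 + (2 + l * (9 + 2))) (\<lambda>s'. I l s' \<and> nreg s' 1 = l \<and> nreg s' 2 = 1)"
    unfolding setup_beta_def
  proof (rule ok_Seq)
    show "ok (seqs [AddR 17 4 3, AddR 18 3 3]) s 2 (\<lambda>s'. I 0 (set_nreg 11 0 s') \<and> nreg s' 1 = l \<and> nreg s' 2 = 1)"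
      by (rule ok_seqs) (use s in \<open>simp_all add: I_def frame_def\<close>)
    fix s0 assume s0: "I 0 (set_nreg 11 0 s0) \<and> nreg s0 1 = l \<and> nreg s0 2 = 1"
    show "ok (For 11 1 ?b) s0 (2 + l * (9 + 2)) (\<lambda>s'. I l s' \<and> nreg s' 1 = l \<and> nreg s' 2 = 1)"
    proof (rule ok_For)
      fix j s1 assume j: "j < l" "I j s1" "nreg s1 11 = j" "nreg s1 1 = l" "nreg s1 2 = 1"
      then have f: "?F s s1" by (simp add: I_def)
      show "ok ?b s1 9 (\<lambda>s'. nreg s' 11 = j \<and> nreg s' 1 = l \<and> nreg s' 2 = 1 \<and> I (Suc j) (set_nreg 11 (Suc j) s'))"
        by (rule ok_seqs) (use j s frameD[OF f] in \<open>auto simp: I_def frame_def power2_eq_square\<close>)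
    qed (use s0 in auto)
  qed
  then show ?thesis by (rule ok_mono) (auto simp: I_def)
qed

text \<open>Two different divisors occur: \<open>1 - rho^4\<close> recovers the sum over words, and
  \<open>1 - rho^2\<close> corrects the walk sums.\<close>

definition "setup_factor = seqs [MulR 9 2 2, MulR 10 9 18, SubR 17 17 10, MulR 10 9 9, SubR 10 4 10, DivR 17 17 10,
  MulR 15 15 17, AddR 7 4 4, DivR 7 7 15, OfNat 8 6, MulR 8 8 13, DivR 8 4 8, MulR 7 7 8, SubR 10 4 9, DivR 5 7 10]"

lemma setup_factor_ok:
  assumes s: "rreg s 4 = 1" "rreg s 2 = rho"
  shows "ok setup_factor s 15 (\<lambda>s'. frame {} {5, 7, 8, 9, 10, 15, 17} {} {} s s' \<and>
    rreg s' 5 = 2 / (rreg s 15 * ((rreg s 17 - rho\<^sup>2 * rreg s 18) / (1 - rho\<^sup>2 * rho\<^sup>2))) *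
      (1 / (real (nreg s 6) * rreg s 13)) / (1 - rho\<^sup>2))"
  unfolding setup_factor_def
  by (rule ok_seqs) (use s in \<open>simp_all add: frame_def power2_eq_square\<close>)

definition "setup = Seq setup_const (Seq setup_pow (Seq setup_kappa (Seq setup_count (Seq setup_sqrt
  (Seq setup_beta setup_factor)))))"

abbreviation "sframe \<equiv> frame {2, 4, 5, 6, 11, 13, 20} {4, 5, 7, 8, 9, 10, 13, 14, 15, 16, 17, 18} {1} {}"

lemma sframe_mono:
  "frame N R B A s s' \<Longrightarrow> N \<subseteq> {2, 4, 5, 6, 11, 13, 20} \<Longrightarrow> R \<subseteq> {4, 5, 7, 8, 9, 10, 13, 14, 15, 16, 17, 18} \<Longrightarrow>
    B \<subseteq> {1} \<Longrightarrow> A \<subseteq> {} \<Longrightarrow> sframe s s'"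
  by (rule frame_mono)

lemma setup_ok:
  assumes s: "nreg s 0 = n" "nreg s 1 = l" "nreg s 3 = 0" "rreg s 3 = 0" "rreg s 0 = lam" "rreg s 1 = mu" "rreg s 2 = rho"
    and n: "n \<ge> 1" and l: "l \<ge> 1" and rho: "rho\<^sup>2 \<noteq> 1"
  shows "ok setup s (70 + 4 * num_colorings l + 24 * l) (\<lambda>s'. sframe s s' \<and> base n l s' \<and> nreg s' 6 = num_colorings l \<and>
    rreg s' 5 = 2 / (real n powr (real l / 2 - 1) * beta_words lam mu rho l) * (1 / (real (num_colorings l) * kappa l)) / (1 - rho\<^sup>2))"
    (is "ok _ _ _ ?Q")
proof -
  have "ok setup s (4 + ((2 + (l + 1) * 4) + ((4 + (l + 1) * 6) + ((8 + 4 * num_colorings l) + ((7 + l * 3) + ((4 + l * 11) + 15)))))) ?Q"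
    unfolding setup_def
  proof (rule ok_Seq[OF setup_const_ok], elim conjE)
    fix s1
    assume f1: "frame {2, 4, 5} {4} {} {} s s1" and "nreg s1 2 = 1" "nreg s1 4 = nreg s 1 + 1" "nreg s1 5 = 1" "rreg s1 4 = 1"
    then have s1: "nreg s1 2 = 1" "nreg s1 4 = l + 1" "nreg s1 5 = 1" "rreg s1 4 = 1" "rreg s1 3 = 0" "nreg s1 0 = n" "nreg s1 1 = l"
      "nreg s1 3 = 0" "rreg s1 0 = lam" "rreg s1 1 = mu" "rreg s1 2 = rho"
      using s frameD[OF f1] by auto
    show "ok (Seq setup_pow (Seq setup_kappa (Seq setup_count (Seq setup_sqrt (Seq setup_beta setup_factor))))) s1
       ((2 + (l + 1) * 4) + ((4 + (l + 1) * 6) + ((8 + 4 * num_colorings l) + ((7 + l * 3) + ((4 + l * 11) + 15))))) ?Q"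
    proof (rule ok_Seq[OF setup_pow_ok[OF s1(1-3)]], elim conjE)
      fix s2
      assume f2: "frame {5, 11} {} {1} {} s1 s2" and p2: "nreg s2 5 = 2 ^ (l + 1)" "\<forall>d<l + 1. narr s2 1 d = 2 ^ d"
      have s2: "nreg s2 2 = 1" "nreg s2 4 = l + 1" "rreg s2 3 = 0" "rreg s2 4 = 1" "nreg s2 0 = n" "nreg s2 1 = l"
        "nreg s2 3 = 0" "rreg s2 0 = lam" "rreg s2 1 = mu" "rreg s2 2 = rho"
        using s1 frameD[OF f2] by auto
      show "ok (Seq setup_kappa (Seq setup_count (Seq setup_sqrt (Seq setup_beta setup_factor)))) s2
         ((4 + (l + 1) * 6) + ((8 + 4 * num_colorings l) + ((7 + l * 3) + ((4 + l * 11) + 15)))) ?Q"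
      proof (rule ok_Seq[OF setup_kappa_ok[OF s2(1-4)]], elim conjE)
        fix s3
        assume f3: "frame {11, 13} {7, 8, 13} {} {} s2 s3" and k3: "rreg s3 13 = kappa l"
        have s3: "nreg s3 2 = 1" "rreg s3 4 = 1" "num_colorings l = nat \<lceil>1 / rreg s3 13\<rceil>"
          using s2 frameD[OF f3] by (auto simp: k3 num_colorings_def)
        show "ok (Seq setup_count (Seq setup_sqrt (Seq setup_beta setup_factor))) s3
           ((8 + 4 * num_colorings l) + ((7 + l * 3) + ((4 + l * 11) + 15))) ?Q"
        proof (rule ok_Seq[OF setup_count_ok[OF s3]], elim conjE)
          fix s4
          assume f4: "frame {6, 20} {7, 14} {} {} s3 s4" and t4: "nreg s4 6 = num_colorings l"
          have s4: "nreg s4 0 = n" "nreg s4 1 = l" "nreg s4 2 = 1" "rreg s4 3 = 0" "rreg s4 4 = 1"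
            using s2 frameD[OF f3] frameD[OF f4] by auto
          show "ok (Seq setup_sqrt (Seq setup_beta setup_factor)) s4 ((7 + l * 3) + ((4 + l * 11) + 15)) ?Q"
          proof (rule ok_Seq[OF setup_sqrt_ok[OF s4]], elim conjE)
            fix s5
            assume f5: "frame {11} {15, 16} {} {} s4 s5" and r5: "rreg s5 15 = sqrt (real n) ^ l / real n"
            have s5: "nreg s5 1 = l" "nreg s5 2 = 1" "rreg s5 3 = 0" "rreg s5 4 = 1" "rreg s5 0 = lam" "rreg s5 1 = mu" "rreg s5 2 = rho"
              using s2 s4 frameD[OF f3] frameD[OF f4] frameD[OF f5] by auto
            show "ok (Seq setup_beta setup_factor) s5 ((4 + l * 11) + 15) ?Q"
            proof (rule ok_Seq[OF setup_beta_ok[OF s5]], elim conjE)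
              fix s6
              assume f6: "frame {11} {7, 8, 9, 10, 17, 18} {} {} s5 s6"
                and r6: "rreg s6 17 = bst lam mu rho l Bullet" "rreg s6 18 = bst lam mu rho l Circ"
              have s6: "rreg s6 4 = 1" "rreg s6 2 = rho" using s5 frameD[OF f6] by auto
              show "ok setup_factor s6 15 ?Q"
              proof (rule ok_mono[OF setup_factor_ok[OF s6]], simp, elim conjE)
                fix s7
                assume f7: "frame {} {5, 7, 8, 9, 10, 15, 17} {} {} s6 s7"
                  and r7: "rreg s7 5 = 2 / (rreg s6 15 * ((rreg s6 17 - rho\<^sup>2 * rreg s6 18) / (1 - rho\<^sup>2 * rho\<^sup>2))) *
                    (1 / (real (nreg s6 6) * rreg s6 13)) / (1 - rho\<^sup>2)"
                note fs = frameD[OF f3] frameD[OF f4] frameD[OF f5] frameD[OF f6] frameD[OF f7]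
                have F: "sframe s s7"
                  by (intro frame_trans[OF sframe_mono[OF f1] frame_trans[OF sframe_mono[OF f2] frame_trans[OF sframe_mono[OF f3]
                    frame_trans[OF sframe_mono[OF f4] frame_trans[OF sframe_mono[OF f5] frame_trans[OF sframe_mono[OF f6]
                      sframe_mono[OF f7]]]]]]]) auto
                have B: "base n l s7" using fs s2 p2 by (simp add: base_def less_Suc_eq_le)
                have n0: "real n > 0" using n by simp
                have "sqrt (real n) ^ l / real n = real n powr (real l / 2) / real n powr 1"
                  using n0 by (simp add: powr_half_sqrt[symmetric] powr_power)
                then have p: "sqrt (real n) ^ l / real n = real n powr (real l / 2 - 1)"
                  using n0 by (simp only: powr_diff)
                have r0: "1 - rho\<^sup>2 * rho\<^sup>2 \<noteq> 0"
                proof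
                  assume "1 - rho\<^sup>2 * rho\<^sup>2 = 0"
                  then have "(1 - rho\<^sup>2) * (1 + rho\<^sup>2) = 0" by (simp add: algebra_simps)
                  moreover have "1 + rho\<^sup>2 > 0" by (intro add_pos_nonneg) auto
                  ultimately show False using rho by auto
                qed
                have b: "(rreg s6 17 - rho\<^sup>2 * rreg s6 18) / (1 - rho\<^sup>2 * rho\<^sup>2) = beta_words lam mu rho l"
                  unfolding r6 bst_beta_words[OF l] using r0 by simp
                have o: "rreg s6 15 = real n powr (real l / 2 - 1)" "nreg s6 6 = num_colorings l" "rreg s6 13 = kappa l"
                  using fs r5 t4 k3 p by auto
                show "?Q s7" using F B fs t4 unfolding r7 b o by simp
              qed
            qed
          qed
        qed
      qed
    qed
  qed
  then show ?thesis by (rule ok_mono) auto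
qed

definition "program = Seq setup prog_k"

lemma program_ok:
  assumes n: "n \<ge> 1" and l: "l \<ge> 1" and rho: "rho\<^sup>2 \<noteq> 1"
    and sym: "\<forall>i<n. \<forall>j<n. X i j = X j i \<and> Y i j = Y j i"
    and xi: "\<forall>k<num_colorings l. \<forall>i<n. xi k i \<le> l"
  shows "ok program (input_store n l lam mu rho X Y xi)
    ((70 + 4 * num_colorings l + 24 * l) + (3 + num_colorings l * (time_m n l + 3)))
    (\<lambda>s. \<forall>u<n. \<forall>v<n. rarr s 2 (u * n + v) = Phi n l lam mu rho X Y xi u v)"
proof -
  let ?s = "input_store n l lam mu rho X Y xi"
  have r: "nreg ?s 0 = n" "nreg ?s 1 = l" "nreg ?s 3 = 0" "rreg ?s 3 = 0" "rreg ?s 0 = lam" "rreg ?s 1 = mu" "rreg ?s 2 = rho"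
    by (simp_all add: input_store_def)
  have idx: "x * n + y < m * n" if "x < m" "y < n" for x y m
  proof -
    have "x * n + y < Suc x * n" using that by simp
    also have "\<dots> \<le> m * n" using that by (intro mult_right_mono) auto
    finally show ?thesis .
  qed
  have A: "\<forall>x<n. \<forall>y<n. rarr ?s 0 (x * n + y) = X x y" "\<forall>x<n. \<forall>y<n. rarr ?s 1 (x * n + y) = Y x y"
    using idx by (auto simp: input_store_def)
  have C: "narr ?s 0 (k * n + y) = xi k y" if "k < num_colorings l" "y < n" for k y
    using idx[OF that] that by (simp add: input_store_def)
  have Z: "rarr ?s 2 p = 0" for p by (simp add: input_store_def)
  show ?thesis
    unfolding program_def
  proof (rule ok_Seq[OF setup_ok[OF r n l rho]], elim conjE)
    fix s
    assume f: "sframe ?s s" and b: "base n l s" and t: "nreg s 6 = num_colorings l"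
      and p: "rreg s 5 = 2 / (real n powr (real l / 2 - 1) * beta_words lam mu rho l) *
        (1 / (real (num_colorings l) * kappa l)) / (1 - rho\<^sup>2)"
    have same: "nreg s 0 = n" "nreg s 1 = l" "rreg s 0 = lam" "rreg s 1 = mu" "rreg s 2 = rho" "rarr s = rarr ?s" "narr s 0 = narr ?s 0"
      using frameD[OF f] r by (auto intro!: ext)
    have "ok prog_k s (3 + num_colorings l * (time_m n l + 3)) (\<lambda>s'. kframe s s' \<and>
      (\<forall>x<n. \<forall>v<n. rarr s' 2 (x * n + v) = rarr s 2 (x * n + v) +
        rreg s 5 * (\<Sum>k<num_colorings l. \<Sum>m<2 ^ (l + 1). scontrib s k m x v)))"
      by (rule prog_k_ok[OF b t]) (use xi C in \<open>auto simp: same\<close>)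
    moreover have "rarr s 2 (x * n + v) + rreg s 5 * (\<Sum>k<num_colorings l. \<Sum>m<2 ^ (l + 1). scontrib s k m x v) =
        Phi n l lam mu rho X Y xi x v" if "x < n" for x v
      unfolding p same Z add_0
      by (rule Phi_contrib[where col = "narr ?s 0", OF A sym _ _ that l rho]) (use C xi in auto)
    ultimately show "ok prog_k s (3 + num_colorings l * (time_m n l + 3))
        (\<lambda>s. \<forall>u<n. \<forall>v<n. rarr s 2 (u * n + v) = Phi n l lam mu rho X Y xi u v)"
      by (elim ok_mono) auto
  qed
qed

section \<open>The running time\<close>

lemma exp_ge_power_fact: "0 \<le> x \<Longrightarrow> x ^ m / fact m \<le> exp (x :: real)"
proof -
  assume "0 \<le> x"
  then have "(\<Sum>n\<in>{m}. x ^ n /\<^sub>R fact n) \<le> (\<Sum>n. x ^ n /\<^sub>R fact n)"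
    by (intro sum_le_suminf summable_exp_generic) auto
  then show ?thesis by (simp add: exp_def divide_inverse mult.commute)
qed

text \<open>The term of index \<open>l + 1\<close> in the exponential series at \<open>l + 1\<close>
  is \<open>1 / kappa\<close>. So \<open>e ^ (l + 1)\<close> dominates it, and rounding up adds at
  most 1.\<close>

lemma num_colorings_le: "real (num_colorings l) \<le> 4 * exp (real l)"
proof -
  have "1 / kappa l \<le> exp (real (l + 1))"
    using exp_ge_power_fact[of "real (l + 1)" "l + 1"] by (simp add: kappa_def del: fact_Suc)
  also have "\<dots> \<le> 3 * exp (real l)"
    using exp_le by (simp add: exp_add mult_right_mono)
  finally have "1 / kappa l \<le> 3 * exp (real l)" .
  moreover have "1 \<le> exp (real l)" by simp
  moreover have "1 / kappa l \<ge> 0" using kappa_pos[of l] by simp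
  then have "real (num_colorings l) \<le> 1 / kappa l + 1" unfolding num_colorings_def by linarith
  ultimately show ?thesis by linarith
qed

text \<open>The dominant cost: \<open>2 ^ (l + 1)\<close> colour subsets, \<open>n\<close> targets,
  \<open>l\<close> steps, and \<open>n^2\<close> entries in each matrix product.\<close>

lemma time_m_le:
  assumes n: "n \<ge> 1" and l: "l \<ge> 1"
  shows "time_m n l \<le> 93 * (2 ^ (l + 1) * ((l + 1) * n ^ 3))"
proof -
  define q where "q = (l + 1) * n ^ 3"
  have n2: "n \<le> n ^ 2" "n ^ 2 \<le> n ^ 3" using n by (auto intro: self_le_power power_increasing)
  have n3: "1 \<le> n ^ 3" using n by simp
  have q: "n ^ 3 \<le> q" "l * n ^ 3 \<le> q" by (auto simp: q_def)
  have q': "l + 1 \<le> q" using mult_left_mono[OF n3, of "l + 1"] by (simp add: q_def)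
  have j: "time_j n l \<le> 44 * (l * n\<^sup>2)"
  proof -
    have "time_j n l = 2 + l * (7 + 15 * n + 20 * n\<^sup>2)" by (simp add: time_j_def algebra_simps power2_eq_square)
    also have "\<dots> \<le> 2 * (l * n\<^sup>2) + l * (42 * n\<^sup>2)"
      using n l n2 by (intro add_mono mult_left_mono) (auto simp: Suc_le_eq)
    finally show ?thesis by simp
  qed
  have "time_v n l = 2 + n * (8 + 18 * n + time_j n l)" by (simp add: time_v_def algebra_simps)
  also have "\<dots> \<le> 2 + n * (8 * n\<^sup>2 + 18 * n\<^sup>2 + 44 * (l * n\<^sup>2))"
    using n n2 j by (intro add_mono mult_left_mono) auto
  also have "\<dots> = 2 + 26 * n ^ 3 + 44 * (l * n ^ 3)" by (simp add: algebra_simps power2_eq_square power3_eq_cube)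
  also have "\<dots> \<le> 70 * q" using n3 by (simp add: q_def)
  finally have v: "time_v n l \<le> 70 * q" .
  have "time_m n l = 2 + 2 ^ (l + 1) * (8 + 7 * (l + 1) + 6 * n + time_v n l)"
    by (simp add: time_m_def algebra_simps)
  also have "\<dots> \<le> 2 ^ (l + 1) * 2 + 2 ^ (l + 1) * (8 * q + 7 * q + 6 * q + 70 * q)"
    using q q' v n2 one_le_power[of "2::nat" "l + 1"] by (intro add_mono mult_left_mono) linarith+
  also have "\<dots> \<le> 2 ^ (l + 1) * (2 * q) + 2 ^ (l + 1) * (91 * q)"
    using q' by (intro add_mono mult_left_mono) linarith+
  also have "\<dots> = 93 * (2 ^ (l + 1) * q)" by (simp only: algebra_simps)
  finally show ?thesis by (simp only: q_def)
qed

text \<open>As \<open>l <= K * ln n\<close>, both \<open>exp l\<close>, which bounds the number of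
  colourings, and \<open>2 ^ l\<close> are at most \<open>n powr K\<close>. The polynomial part
  \<open>l * n^3\<close> costs \<open>n^4\<close> up to a constant.\<close>

lemma program_time_le:
  assumes d: "0 < delta" "delta < 0.1" and ad: "admissible_length delta K n l" and n: "n \<ge> 2"
  shows "real ((70 + 4 * num_colorings l + 24 * l) + (3 + num_colorings l * (time_m n l + 3))) \<le>
    real n powr (2 * K + 4 + log 2 (1600 * (\<bar>K\<bar> + 1)))"
proof -
  note af = admissible_facts[OF d ad n]
  let ?t = "num_colorings l"
  define q where "q = 2 ^ (l + 1) * ((l + 1) * n ^ 3)"
  have t: "?t \<ge> 1" using num_colorings_kappa(2)[of l] by simp
  have "(1::nat) \<le> n ^ 3" using n by simp
  then have "1 * 1 \<le> (l + 1) * n ^ 3" by (intro mult_le_mono) auto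
  have "(1::nat) * (l * 1) \<le> 2 ^ (l + 1) * ((l + 1) * n ^ 3)" using n by (intro mult_mono) auto
  moreover have "1 \<le> q" using \<open>1 * 1 \<le> (l + 1) * n ^ 3\<close> by (simp add: q_def)
  ultimately have q: "l \<le> q" "1 \<le> q" by (simp_all add: q_def)
  have tq: "?t \<le> ?t * q" "q \<le> ?t * q" using q t by auto
  have "?t * (time_m n l + 3) \<le> ?t * (93 * q + 3 * q)"
    using time_m_le[of n l] n af(1) q by (intro mult_left_mono add_mono) (auto simp: q_def)
  also have "\<dots> = 96 * (?t * q)" by simp
  finally have "(70 + 4 * ?t + 24 * l) + (3 + ?t * (time_m n l + 3)) \<le> 200 * (?t * q)"
    using q tq t by linarith
  then have "real ((70 + 4 * ?t + 24 * l) + (3 + ?t * (time_m n l + 3))) \<le> real (200 * (?t * q))"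
    by (simp only: of_nat_le_iff)
  also have "\<dots> = 200 * (real ?t * (2 ^ (l + 1) * (real (l + 1) * real n ^ 3)))"
    unfolding q_def by (simp only: of_nat_mult of_nat_power of_nat_numeral)
  also have "\<dots> \<le> 200 * (4 * (real n powr K) * ((2 * real n powr K) * (((\<bar>K\<bar> + 1) * real n) * real n ^ 3)))"
  proof -
    have "exp (real l) \<le> exp (K * ln (real n))" using ad by (simp add: admissible_length_def)
    also have "\<dots> = real n powr K" using n by (simp add: powr_def)
    finally have e: "exp (real l) \<le> real n powr K" .
    have "real ?t \<le> 4 * real n powr K" using num_colorings_le[of l] e by linarith
    moreover have "(2::real) ^ (l + 1) \<le> 2 * real n powr K"
    proof -
      have "(2::real) ^ l \<le> exp 1 ^ l" using exp_ge_add_one_self[of 1] by (intro power_mono) auto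
      also have "\<dots> = exp (real l)" by (simp add: exp_of_nat_mult[symmetric])
      finally show ?thesis using e by simp
    qed
    moreover have "real (l + 1) \<le> (\<bar>K\<bar> + 1) * real n" using af(2,4) n by (simp add: algebra_simps)
    ultimately show ?thesis by (intro mult_left_mono mult_mono) auto
  qed
  also have "\<dots> = 1600 * (\<bar>K\<bar> + 1) * (real n powr K * real n powr K * real n ^ 4)"
    by (simp add: algebra_simps power4_eq_xxxx power3_eq_cube)
  also have "real n powr K * real n powr K * real n ^ 4 = real n powr (2 * K + 4)"
    using n powr_realpow[of "real n" 4] by (simp add: powr_add[symmetric] powr_add)
  also have "1600 * (\<bar>K\<bar> + 1) * real n powr (2 * K + 4) \<le>
      real n powr log 2 (1600 * (\<bar>K\<bar> + 1)) * real n powr (2 * K + 4)"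
  proof (rule mult_right_mono)
    \<comment> \<open>For \<open>n >= 2\<close> a constant factor becomes a power of
      \<open>n\<close>, with its logarithm to base 2 as the exponent.\<close>
    have "1600 * (\<bar>K\<bar> + 1) = 2 powr log 2 (1600 * (\<bar>K\<bar> + 1))" by (subst powr_log_cancel) auto
    also have "\<dots> \<le> real n powr log 2 (1600 * (\<bar>K\<bar> + 1))" using n by (intro powr_mono2) auto
    finally show "1600 * (\<bar>K\<bar> + 1) \<le> real n powr log 2 (1600 * (\<bar>K\<bar> + 1))" .
  qed simp
  also have "\<dots> = real n powr (2 * K + 4 + log 2 (1600 * (\<bar>K\<bar> + 1)))" by (simp add: powr_add[symmetric] add.commute)
  finally show ?thesis .
qed

lemma running_time:
  assumes d: "0 < delta" "delta < 0.1" and rho: "0 < rho" "rho < 1"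
  shows "\<exists>T (e :: nat \<Rightarrow> real) P. e \<longlonglongrightarrow> 0 \<and>
    (\<forall>n l. n \<ge> 2 \<and> admissible_length delta K n l \<longrightarrow>
       computes_Phi_within P (real n powr (T + e n)) n l lam mu rho)"
proof (intro exI conjI allI impI)
  \<comment> \<open>All constants have been absorbed into the exponent, so the error sequence may be
    taken to be zero.\<close>
  show "(\<lambda>_. 0 :: real) \<longlonglongrightarrow> 0" by simp
  fix n l assume "n \<ge> 2 \<and> admissible_length delta K n l"
  then have n: "n \<ge> 2" and ad: "admissible_length delta K n l" by auto
  have l: "l \<ge> 1" using admissible_facts(1)[OF d ad n] by simp
  have "rho\<^sup>2 < 1" using rho by (simp add: power_less_one_iff)
  then have r: "rho\<^sup>2 \<noteq> 1" by simp
  show "computes_Phi_within program (real n powr (2 * K + 4 + log 2 (1600 * (\<bar>K\<bar> + 1)) + 0)) n l lam mu rho"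
    unfolding computes_Phi_within_def add_0_right
  proof (intro allI impI)
    fix X Y :: "nat \<Rightarrow> nat \<Rightarrow> real" and xi :: "nat \<Rightarrow> nat \<Rightarrow> nat"
    assume "\<forall>i<n. \<forall>j<n. X i j = X j i \<and> Y i j = Y j i" "\<forall>k<num_colorings l. \<forall>i<n. xi k i \<le> l"
    then obtain t s where ts: "runs program (input_store n l lam mu rho X Y xi) t s"
      "t \<le> (70 + 4 * num_colorings l + 24 * l) + (3 + num_colorings l * (time_m n l + 3))"
      "\<forall>u<n. \<forall>v<n. rarr s 2 (u * n + v) = Phi n l lam mu rho X Y xi u v"
      using program_ok[of n l rho X Y xi lam mu] n l r by (auto simp: ok_def)
    have "real t \<le> real n powr (2 * K + 4 + log 2 (1600 * (\<bar>K\<bar> + 1)))"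
      using program_time_le[OF d ad n] ts(2) by (meson of_nat_mono order_trans)
    then show "\<exists>t s. runs program (input_store n l lam mu rho X Y xi) t s \<and>
        real t \<le> real n powr (2 * K + 4 + log 2 (1600 * (\<bar>K\<bar> + 1))) \<and>
        (\<forall>u<n. \<forall>v<n. rarr s 2 (u * n + v) = Phi n l lam mu rho X Y xi u v)"
      using ts by blast
  qed
qed

theorem theorem2p13:
  fixes lam mu rho eps delta K C :: real
  assumes "lam \<in> {0..1}" "mu \<in> {0..1}" "rho \<in> {0<..<1}"
    and "eps > 0" "F_threshold lam mu rho 1 > 1 + eps"
    and "delta \<in> {0<..<0.1}" "A_plus lam mu rho > 1 + delta"
  shows
    "(\<exists>R>0. \<exists>c>0. \<forall>prior. spike_prior rho C prior \<longrightarrow>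
        (\<forall>n l u v. admissible_length delta K n l \<and> u < n \<and> v < n \<and> u \<noteq> v \<longrightarrow>
           integrable (model_law prior n l)
             (\<lambda>om. Phi_rv n l lam mu rho u v om * x_of om u * x_of om v) \<and>
           integrable (model_law prior n l) (\<lambda>om. (Phi_rv n l lam mu rho u v om)\<^sup>2) \<and>
           (\<integral>om. (Phi_rv n l lam mu rho u v om)\<^sup>2 \<partial>model_law prior n l) \<le> R \<and>
           integrable (model_law prior n l)
             (\<lambda>om. (Phi_rv n l lam mu rho u v om)\<^sup>2 * (x_of om u)\<^sup>2 * (x_of om v)\<^sup>2) \<and>
           (\<integral>om. (Phi_rv n l lam mu rho u v om)\<^sup>2 * (x_of om u)\<^sup>2 * (x_of om v)\<^sup>2
              \<partial>model_law prior n l) \<le> R) \<and>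
        (\<forall>l :: nat \<Rightarrow> nat. (\<forall>\<^sub>F n in sequentially. admissible_length delta K n (l n)) \<longrightarrow>
           (\<forall>\<eta>>0. \<forall>\<^sub>F n in sequentially. \<forall>u<n. \<forall>v<n. u \<noteq> v \<longrightarrow>
              \<bar>(\<integral>om. Phi_rv n (l n) lam mu rho u v om * x_of om u * x_of om v
                  \<partial>model_law prior n (l n)) - 2\<bar> < \<eta>) \<and>
           (\<forall>\<^sub>F n in sequentially. \<forall>w<n.
              (\<integral>om. overlap n (x_hat R n (l n) lam mu rho w om) (x_of om)
                 \<partial>model_law prior n (l n)) \<ge> c)))
     \<and> (\<exists>T (e :: nat \<Rightarrow> real) P. e \<longlonglongrightarrow> 0 \<and>
        (\<forall>n l. n \<ge> 2 \<and> admissible_length delta K n l \<longrightarrow>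
           computes_Phi_within P (real n powr (T + e n)) n l lam mu rho))"
proof -
  have "0 \<le> lam" "lam \<le> 1" "0 \<le> mu" "mu \<le> 1" "0 < rho" "rho < 1" "rho \<le> 1" "0 < delta" "delta < 0.1"
    using assms by auto
  then show ?thesis
    using assms(7) by (intro conjI statistical_part running_time)
qed

end
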